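(* In the setting of the context, given $x\in S$, let $K$ be its residue field $k(x)$. Then, given $\mathcal C$ in $\mathbf H\Lambda_{\mathcal B_K}^{\{\mathbf h^{\rm I}_m\}}$ of $K$-socle type $\mathbf t$, there is an open neighborhood $T$ of $x$ and a $\mathcal C'$ in $\mathbf H\Lambda_{\mathcal B_T}^{\{\mathbf h^{\rm I}_m\}}$ of $T$-socle type $\mathbf t$ with $\mathcal C'_K=\mathcal C$.
   Context: $S$ is a nonempty Noetherian scheme; $\mathcal A=\bigoplus_{p\ge0}\mathcal A_p$ is a finitely generated, graded, quasi-coherent $\mathcal O_S$-algebra with $\mathcal A_0=\mathcal O_S$ and $\mathcal A_p$ locally free of constant rank $\mathbf a(p)$ for all $p$; $\mathcal B=\bigoplus_p\mathcal B_p$ is a graded, locally finitely generated $\mathcal A$-module with $\mathcal B_p$ locally free of constant rank $\mathbf b(p)$, indexed so that $\inf\{p:\mathbf b(p)\ne0\}=0$. A subscript $T$ (or $K$) denotes pullback to an $S$-scheme $T$ (or $\mathrm{Spec}\,K$). For graded $\mathcal C$, $\mathcal C^*:=\mathcal Hom(\mathcal C,\mathcal O_T)$ with $(\mathcal C^* )_q=(\mathcal C_{-q})^*$ and adjoint $\mathcal A_T$-action. Let $\mathcal C$ be a homogeneous quotient of $\mathcal B_T$, locally free of finite rank in each degree and nonzero in finitely many degrees. Put $\mathcal D:=\mathcal C^*$ and let $\Delta^m\mathcal D$ be the $\mathcal A_T$-submodule of $\mathcal D$ generated by $\bigoplus_{j\ge m}\mathcal D_{-j}$. Given functions $\mathbf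 h_m\colon\mathbb Z\to\mathbb Z$ ($m\in\mathbb Z$), $\mathbf H\Lambda_{\mathcal B_T}^{\{\mathbf h_m\}}$ is the set of such $\mathcal C$ with $(\Delta^m\mathcal D)_{-p}$ locally free of rank $\mathbf h_m(p)$ and $\mathcal D/\Delta^m\mathcal D$ flat over $\mathcal O_T$ for all $m,p$. $\mathcal C$ is of $T$-socle type $\mathbf t$ if $(\mathcal C^*\otimes_{\mathcal A_T}\mathcal O_T)_{-p}$ is locally free of rank $\mathbf t(p)$ for all $p$, where $\mathcal O_T=\mathcal A_T/\bigoplus_{p>0}(\mathcal A_p)_T$. $\mathbf t\colon\mathbb Z\to\mathbb Z$ is a fixed nonzero function with finitely many nonzero values and $\mathbf t(p)\ge0$; $s:=\sup\{p:\mathbf t(p)\ne0\}$; $\mathbf g_m(p):=\sum_{q=m}^s\mathbf t(q)\mathbf a(q-p)$; $\mathbf h^{\rm I}_m(p):=\min\{\mathbf g_m(p),\mathbf b(p)\}$. *)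

theory Defs
  imports "HOL-Analysis.Abstract_Topology" "HOL-Algebra.Module" "HOL-Algebra.QuotRing"
    "HOL-Algebra.Ring_Divisibility" "HOL-Library.Poly_Mapping"
begin

section \<open>Presheaves and sheaves\<close>

text \<open>
  Sections over \<open>U\<close> are a HOL-Algebra structure \<open>sec F U\<close> (a ring or a module); only its value on
  open sets is meaningful, so the restriction of \<open>F\<close> to an open subspace is given by the same record.
\<close>

record ('x, 'm, 's) presheaf =
  sec :: "'x set \<Rightarrow> 's"
  res :: "'x set \<Rightarrow> 'x set \<Rightarrow> 'm \<Rightarrow> 'm"

type_synonym ('x, 'r) ring_presheaf = "('x, 'r, 'r ring) presheaf"
type_synonym ('x, 'r, 'm) mod_presheaf = "('x, 'm, ('r, 'm) module) presheaf"

definition is_sheaf ::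
  "'x topology \<Rightarrow> ('x, 'm, ('m, 'z) partial_object_scheme) presheaf \<Rightarrow> bool" where
  "is_sheaf X F \<longleftrightarrow>
    (\<forall>U V. openin X U \<and> openin X V \<and> V \<subseteq> U \<longrightarrow>
       res F U V \<in> carrier (sec F U) \<rightarrow> carrier (sec F V)) \<and>
    (\<forall>U. openin X U \<longrightarrow> (\<forall>s\<in>carrier (sec F U). res F U U s = s)) \<and>
    (\<forall>U V W. openin X U \<and> openin X V \<and> openin X W \<and> W \<subseteq> V \<and> V \<subseteq> U \<longrightarrow>
       (\<forall>s\<in>carrier (sec F U). res F V W (res F U V s) = res F U W s)) \<and>
    (\<forall>\<U>. (\<forall>U\<in>\<U>. openin X U) \<longrightarrow>
       (\<forall>s\<in>carrier (sec F (\<Union>\<U>)). \<forall>t\<in>carrier (sec F (\<Union>\<U>)).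
          (\<forall>U\<in>\<U>. res F (\<Union>\<U>) U s = res F (\<Union>\<U>) U t) \<longrightarrow> s = t)) \<and>
    (\<forall>\<U> s. (\<forall>U\<in>\<U>. openin X U \<and> s U \<in> carrier (sec F U)) \<and>
       (\<forall>U\<in>\<U>. \<forall>V\<in>\<U>. res F U (U \<inter> V) (s U) = res F V (U \<inter> V) (s V)) \<longrightarrow>
       (\<exists>t\<in>carrier (sec F (\<Union>\<U>)). \<forall>U\<in>\<U>. res F (\<Union>\<U>) U t = s U))"

record ('x, 'r) ringed_space =
  pts :: "'x topology"
  str :: "('x, 'r) ring_presheaf"

abbreviation Osec :: "('x, 'r) ringed_space \<Rightarrow> 'x set \<Rightarrow> 'r ring" where
  "Osec X U \<equiv> sec (str X) U"

definition is_ringed_space :: "('x, 'r) ringed_space \<Rightarrow> bool" where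
  "is_ringed_space X \<longleftrightarrow>
    is_sheaf (pts X) (str X) \<and>
    (\<forall>U. openin (pts X) U \<longrightarrow> cring (Osec X U)) \<and>
    (\<forall>U V. openin (pts X) U \<and> openin (pts X) V \<and> V \<subseteq> U \<longrightarrow>
       res (str X) U V \<in> ring_hom (Osec X U) (Osec X V))"

definition is_module_sheaf :: "('x, 'r) ringed_space \<Rightarrow> ('x, 'r, 'm) mod_presheaf \<Rightarrow> bool" where
  "is_module_sheaf X F \<longleftrightarrow>
    is_sheaf (pts X) F \<and>
    (\<forall>U. openin (pts X) U \<longrightarrow> module (Osec X U) (sec F U)) \<and>
    (\<forall>U V. openin (pts X) U \<and> openin (pts X) V \<and> V \<subseteq> U \<longrightarrow>
       (\<forall>s\<in>carrier (sec F U). \<forall>t\<in>carrier (sec F U).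
          res F U V (s \<oplus>\<^bsub>sec F U\<^esub> t) = res F U V s \<oplus>\<^bsub>sec F V\<^esub> res F U V t) \<and>
       (\<forall>r\<in>carrier (Osec X U). \<forall>s\<in>carrier (sec F U).
          res F U V (r \<odot>\<^bsub>sec F U\<^esub> s) = res (str X) U V r \<odot>\<^bsub>sec F V\<^esub> res F U V s))"

definition open_subspace :: "('x, 'r) ringed_space \<Rightarrow> 'x set \<Rightarrow> ('x, 'r) ringed_space" where
  "open_subspace X T = X\<lparr>pts := subtopology (pts X) T\<rparr>"


section \<open>Stalks\<close>

definition germ ::
  "'x topology \<Rightarrow> ('x, 'm, ('m, 'z) partial_object_scheme) presheaf \<Rightarrow> 'x \<Rightarrow> 'x set \<Rightarrow> 'm
    \<Rightarrow> ('x set \<times> 'm) set" where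
  "germ X F x U s = {(V, t). openin X V \<and> x \<in> V \<and> t \<in> carrier (sec F V) \<and>
     (\<exists>W. openin X W \<and> x \<in> W \<and> W \<subseteq> U \<inter> V \<and> res F U W s = res F V W t)}"

definition germs ::
  "'x topology \<Rightarrow> ('x, 'm, ('m, 'z) partial_object_scheme) presheaf \<Rightarrow> 'x
    \<Rightarrow> ('x set \<times> 'm) set set" where
  "germs X F x = {germ X F x U s | U s. openin X U \<and> x \<in> U \<and> s \<in> carrier (sec F U)}"

text \<open>
  The operation on germs induced by operations \<open>f U\<close> on sections that commute with restriction; as
  with \<^const>\<open>rcoset_mult\<close>, all sets in the union coincide.
\<close>

definition germ_op ::
  "'x topology \<Rightarrow> ('x, 'a, ('a, 'y) partial_object_scheme) presheaf
    \<Rightarrow> ('x, 'b, ('b, 'z) partial_object_scheme) presheaf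
    \<Rightarrow> ('x, 'c, ('c, 'w) partial_object_scheme) presheaf
    \<Rightarrow> 'x \<Rightarrow> ('x set \<Rightarrow> 'a \<Rightarrow> 'b \<Rightarrow> 'c)
    \<Rightarrow> ('x set \<times> 'a) set \<Rightarrow> ('x set \<times> 'b) set \<Rightarrow> ('x set \<times> 'c) set" where
  "germ_op X F G H x f \<alpha> \<beta> =
    (\<Union>(U, s)\<in>\<alpha>. \<Union>(V, t)\<in>\<beta>. germ X H x (U \<inter> V) (f (U \<inter> V) (res F U (U \<inter> V) s) (res G V (U \<inter> V) t)))"

definition stalk_ring :: "('x, 'r) ringed_space \<Rightarrow> 'x \<Rightarrow> ('x set \<times> 'r) set ring" where
  "stalk_ring X x = (let T = topspace (pts X); F = str X in
    \<lparr>carrier = germs (pts X) F x,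
     mult = germ_op (pts X) F F F x (\<lambda>U. mult (sec F U)),
     one = germ (pts X) F x T \<one>\<^bsub>sec F T\<^esub>,
     zero = germ (pts X) F x T \<zero>\<^bsub>sec F T\<^esub>,
     add = germ_op (pts X) F F F x (\<lambda>U. add (sec F U))\<rparr>)"

definition stalk_module ::
  "('x, 'r) ringed_space \<Rightarrow> ('x, 'r, 'm) mod_presheaf \<Rightarrow> 'x
    \<Rightarrow> (('x set \<times> 'r) set, ('x set \<times> 'm) set) module" where
  "stalk_module X F x = (let T = topspace (pts X) in
    \<lparr>carrier = germs (pts X) F x,
     mult = (\<lambda>_ _. undefined),
     one = undefined,
     zero = germ (pts X) F x T \<zero>\<^bsub>sec F T\<^esub>,
     add = germ_op (pts X) F F F x (\<lambda>U. add (sec F U)),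
     smult = germ_op (pts X) (str X) F F x (\<lambda>U. smult (sec F U))\<rparr>)"

definition max_ideal :: "('a, 'b) ring_scheme \<Rightarrow> 'a set" where
  "max_ideal R = (THE I. maximalideal I R)"

definition residue_field ::
  "('x, 'r) ringed_space \<Rightarrow> 'x \<Rightarrow> ('x set \<times> 'r) set set ring" where
  "residue_field X x = stalk_ring X x Quot max_ideal (stalk_ring X x)"


section \<open>Schemes\<close>

definition is_locally_ringed_space :: "('x, 'r) ringed_space \<Rightarrow> bool" where
  "is_locally_ringed_space X \<longleftrightarrow>
    is_ringed_space X \<and> (\<forall>x\<in>topspace (pts X). \<exists>!I. maximalideal I (stalk_ring X x))"

definition basic_open :: "('a, 'b) ring_scheme \<Rightarrow> 'a \<Rightarrow> 'a set set" where
  "basic_open R f = {P. primeideal P R \<and> f \<notin> P}"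

definition Spec_top :: "('a, 'b) ring_scheme \<Rightarrow> 'a set topology" where
  "Spec_top R = topology_generated_by (basic_open R ` carrier R)"

definition is_localization_away ::
  "('a, 'b) ring_scheme \<Rightarrow> 'a \<Rightarrow> ('c, 'd) ring_scheme \<Rightarrow> ('a \<Rightarrow> 'c) \<Rightarrow> bool" where
  "is_localization_away R f L \<phi> \<longleftrightarrow>
    \<phi> \<in> ring_hom R L \<and> \<phi> f \<in> Units L \<and>
    (\<forall>l\<in>carrier L. \<exists>a\<in>carrier R. \<exists>n::nat. l \<otimes>\<^bsub>L\<^esub> \<phi> f [^]\<^bsub>L\<^esub> n = \<phi> a) \<and>
    (\<forall>a\<in>carrier R. \<phi> a = \<zero>\<^bsub>L\<^esub> \<longrightarrow> (\<exists>n::nat. f [^]\<^bsub>R\<^esub> n \<otimes>\<^bsub>R\<^esub> a = \<zero>\<^bsub>R\<^esub>))"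

text \<open>
  \<open>U\<close> is isomorphic, as a ringed space, to \<open>Spec R\<close>, where \<open>R\<close> may be taken to be the ring of sections
  over \<open>U\<close>. The structure sheaf of \<open>Spec R\<close> is the sheaf whose ring of sections over each basic
  open set \<open>D(f)\<close> is \<open>R\<^sub>f\<close>; as the \<open>D(f)\<close> form a basis, the second condition says precisely that
  \<open>\<phi>\<close> carries the structure sheaf of \<open>U\<close> to that of \<open>Spec R\<close>.
\<close>

definition is_affine_open :: "('x, 'r) ringed_space \<Rightarrow> 'x set \<Rightarrow> bool" where
  "is_affine_open X U \<longleftrightarrow> openin (pts X) U \<and>
    (\<exists>\<phi>. homeomorphic_map (subtopology (pts X) U) (Spec_top (Osec X U)) \<phi> \<and>
       (\<forall>f\<in>carrier (Osec X U). let V = {y\<in>U. \<phi> y \<in> basic_open (Osec X U) f} in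
          is_localization_away (Osec X U) f (Osec X V) (res (str X) U V)))"

definition is_scheme :: "('x, 'r) ringed_space \<Rightarrow> bool" where
  "is_scheme X \<longleftrightarrow> is_locally_ringed_space X \<and>
    (\<forall>x\<in>topspace (pts X). \<exists>U. x \<in> U \<and> is_affine_open X U)"

definition is_noetherian_scheme :: "('x, 'r) ringed_space \<Rightarrow> bool" where
  "is_noetherian_scheme X \<longleftrightarrow> is_scheme X \<and>
    (\<exists>\<U>. finite \<U> \<and> \<Union>\<U> = topspace (pts X) \<and>
       (\<forall>U\<in>\<U>. is_affine_open X U \<and> noetherian_ring (Osec X U)))"


section \<open>Locally free and flat\<close>

text \<open>
  These properties are stated for a presheaf and concern its associated sheaf. Thus \<open>e\<close> is a local
  basis on \<open>U\<close> if the map from \<open>\<O>\<^sub>U\<^sup>n\<close> to \<open>P\<close> restricted to \<open>U\<close> is injective and locally surjective,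
  that is, becomes an isomorphism of sheaves. If \<open>P\<close> is a sheaf, then it is itself an isomorphism.
\<close>

definition is_local_basis ::
  "('x, 'r) ringed_space \<Rightarrow> ('x, 'r, 'm) mod_presheaf \<Rightarrow> 'x set \<Rightarrow> nat \<Rightarrow> (nat \<Rightarrow> 'm) \<Rightarrow> bool" where
  "is_local_basis X P U n e \<longleftrightarrow>
    (\<forall>i<n. e i \<in> carrier (sec P U)) \<and>
    (\<forall>V. openin (pts X) V \<and> V \<subseteq> U \<longrightarrow>
      (\<forall>c. (\<forall>i<n. c i \<in> carrier (Osec X V)) \<and>
         finsum (sec P V) (\<lambda>i. c i \<odot>\<^bsub>sec P V\<^esub> res P U V (e i)) {..<n} = \<zero>\<^bsub>sec P V\<^esub> \<longrightarrow>
         (\<forall>i<n. c i = \<zero>\<^bsub>Osec X V\<^esub>)) \<and>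
      (\<forall>s\<in>carrier (sec P V). \<forall>y\<in>V. \<exists>W c. openin (pts X) W \<and> y \<in> W \<and> W \<subseteq> V \<and>
         (\<forall>i<n. c i \<in> carrier (Osec X W)) \<and>
         res P V W s = finsum (sec P W) (\<lambda>i. c i \<odot>\<^bsub>sec P W\<^esub> res P U W (e i)) {..<n}))"

definition locally_free_finite :: "('x, 'r) ringed_space \<Rightarrow> ('x, 'r, 'm) mod_presheaf \<Rightarrow> bool" where
  "locally_free_finite X P \<longleftrightarrow>
    (\<forall>x\<in>topspace (pts X). \<exists>U n e. openin (pts X) U \<and> x \<in> U \<and> is_local_basis X P U n e)"

definition locally_free_rank ::
  "('x, 'r) ringed_space \<Rightarrow> ('x, 'r, 'm) mod_presheaf \<Rightarrow> int \<Rightarrow> bool" where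
  "locally_free_rank X P r \<longleftrightarrow> r \<ge> 0 \<and>
    (\<forall>x\<in>topspace (pts X). \<exists>U e. openin (pts X) U \<and> x \<in> U \<and> is_local_basis X P U (nat r) e)"

definition linear_maps ::
  "('r, 'b) ring_scheme \<Rightarrow> ('r, 'm) module \<Rightarrow> ('r, 'n) module \<Rightarrow> ('m \<Rightarrow> 'n) set" where
  "linear_maps R M N = {f. f \<in> carrier M \<rightarrow> carrier N \<and>
    (\<forall>x\<in>carrier M. \<forall>y\<in>carrier M. f (x \<oplus>\<^bsub>M\<^esub> y) = f x \<oplus>\<^bsub>N\<^esub> f y) \<and>
    (\<forall>r\<in>carrier R. \<forall>x\<in>carrier M. f (r \<odot>\<^bsub>M\<^esub> x) = r \<odot>\<^bsub>N\<^esub> f x)}"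

text \<open>
  The tensor product of \<open>M\<close> and \<open>N\<close> is the free abelian group on \<open>carrier M \<times> carrier N\<close> modulo the
  following subgroup.
\<close>

inductive_set tensor_relations ::
  "('r, 'b) ring_scheme \<Rightarrow> ('r, 'm) module \<Rightarrow> ('r, 'n) module \<Rightarrow> ('m \<times> 'n \<Rightarrow>\<^sub>0 int) set"
  for R M N where
  zero: "0 \<in> tensor_relations R M N"
| diff: "u \<in> tensor_relations R M N \<Longrightarrow> v \<in> tensor_relations R M N \<Longrightarrow>
    u - v \<in> tensor_relations R M N"
| add_left: "x \<in> carrier M \<Longrightarrow> x' \<in> carrier M \<Longrightarrow> y \<in> carrier N \<Longrightarrow>
    frag_of (x \<oplus>\<^bsub>M\<^esub> x', y) - frag_of (x, y) - frag_of (x', y) \<in> tensor_relations R M N"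
| add_right: "x \<in> carrier M \<Longrightarrow> y \<in> carrier N \<Longrightarrow> y' \<in> carrier N \<Longrightarrow>
    frag_of (x, y \<oplus>\<^bsub>N\<^esub> y') - frag_of (x, y) - frag_of (x, y') \<in> tensor_relations R M N"
| scalar: "r \<in> carrier R \<Longrightarrow> x \<in> carrier M \<Longrightarrow> y \<in> carrier N \<Longrightarrow>
    frag_of (r \<odot>\<^bsub>M\<^esub> x, y) - frag_of (x, r \<odot>\<^bsub>N\<^esub> y) \<in> tensor_relations R M N"

text \<open>
  Flatness: tensoring with \<open>M\<close> preserves injections. A definition cannot quantify over all types; it
  suffices to test finitely generated modules, and each of these is a quotient of some \<open>R\<^sup>n\<close>, hence
  isomorphic to one whose elements (the cosets) have type \<open>(nat \<Rightarrow> 'r) set\<close>.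
\<close>

definition flat_module :: "('r, 'b) ring_scheme \<Rightarrow> ('r, 'm) module \<Rightarrow> bool" where
  "flat_module R M \<longleftrightarrow>
    (\<forall>(N :: ('r, (nat \<Rightarrow> 'r) set) module) (N' :: ('r, (nat \<Rightarrow> 'r) set) module) f.
       module R N \<and> module R N' \<and> f \<in> linear_maps R N N' \<and> inj_on f (carrier N) \<longrightarrow>
       (\<forall>z. Poly_Mapping.keys z \<subseteq> carrier N \<times> carrier M \<and>
          frag_extend (\<lambda>(n, m). frag_of (f n, m)) z \<in> tensor_relations R N' M \<longrightarrow>
          z \<in> tensor_relations R N M))"

definition flat_over :: "('x, 'r) ringed_space \<Rightarrow> ('x, 'r, 'm) mod_presheaf \<Rightarrow> bool" where
  "flat_over X P \<longleftrightarrow>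
    (\<forall>x\<in>topspace (pts X). flat_module (stalk_ring X x) (stalk_module X P x))"


section \<open>Subsheaves, quotients and duals\<close>

definition sub_presheaf ::
  "('x, 'r, 'm) mod_presheaf \<Rightarrow> ('x set \<Rightarrow> 'm set) \<Rightarrow> ('x, 'r, 'm) mod_presheaf" where
  "sub_presheaf P N = P\<lparr>sec := (\<lambda>U. (sec P U)\<lparr>carrier := N U\<rparr>)\<rparr>"

definition quot_module :: "('r, 'm) module \<Rightarrow> 'm set \<Rightarrow> ('r, 'm set) module" where
  "quot_module M N =
    \<lparr>carrier = a_rcosets\<^bsub>M\<^esub> N, mult = (\<lambda>_ _. undefined), one = undefined,
     zero = N, add = set_add M, smult = (\<lambda>r X. \<Union>s\<in>X. N +>\<^bsub>M\<^esub> (r \<odot>\<^bsub>M\<^esub> s))\<rparr>"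

text \<open>Not sheafified: the properties imposed on it below concern the associated sheaf.\<close>

definition quot_presheaf ::
  "('x, 'r, 'm) mod_presheaf \<Rightarrow> ('x set \<Rightarrow> 'm set) \<Rightarrow> ('x, 'r, 'm set) mod_presheaf" where
  "quot_presheaf P N =
    \<lparr>sec = (\<lambda>U. quot_module (sec P U) (N U)),
     res = (\<lambda>U V X. \<Union>s\<in>X. N V +>\<^bsub>sec P V\<^esub> res P U V s)\<rparr>"

text \<open>
  \<open>Hom(P, \<O>)\<close>: a section over \<open>U\<close> is a morphism from \<open>P\<close> to the structure sheaf, both restricted to
  \<open>U\<close>, that is, a compatible family of linear maps \<open>\<phi> V\<close> for \<open>V \<subseteq> U\<close> open. For a presheaf \<open>P\<close> it is
  the same as \<open>Hom\<close> from the associated sheaf. \<open>hom_fun\<close> fixes the irrelevant values.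
\<close>

definition hom_fun ::
  "('x, 'r) ringed_space \<Rightarrow> ('x, 'r, 'm) mod_presheaf \<Rightarrow> 'x set \<Rightarrow> ('x set \<Rightarrow> 'm \<Rightarrow> 'r)
    \<Rightarrow> 'x set \<Rightarrow> 'm \<Rightarrow> 'r" where
  "hom_fun X P U \<phi> = (\<lambda>V c. if openin (pts X) V \<and> V \<subseteq> U \<and> c \<in> carrier (sec P V)
     then \<phi> V c else undefined)"

definition dual_sections ::
  "('x, 'r) ringed_space \<Rightarrow> ('x, 'r, 'm) mod_presheaf \<Rightarrow> 'x set \<Rightarrow> ('x set \<Rightarrow> 'm \<Rightarrow> 'r) set" where
  "dual_sections X P U = {\<phi>. hom_fun X P U \<phi> = \<phi> \<and>
    (\<forall>V. openin (pts X) V \<and> V \<subseteq> U \<longrightarrow>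
       (\<forall>c\<in>carrier (sec P V). \<phi> V c \<in> carrier (Osec X V)) \<and>
       (\<forall>c\<in>carrier (sec P V). \<forall>c'\<in>carrier (sec P V).
          \<phi> V (c \<oplus>\<^bsub>sec P V\<^esub> c') = \<phi> V c \<oplus>\<^bsub>Osec X V\<^esub> \<phi> V c') \<and>
       (\<forall>r\<in>carrier (Osec X V). \<forall>c\<in>carrier (sec P V).
          \<phi> V (r \<odot>\<^bsub>sec P V\<^esub> c) = r \<otimes>\<^bsub>Osec X V\<^esub> \<phi> V c) \<and>
       (\<forall>W. openin (pts X) W \<and> W \<subseteq> V \<longrightarrow>
          (\<forall>c\<in>carrier (sec P V). \<phi> W (res P V W c) = res (str X) V W (\<phi> V c))))}"

definition dual_presheaf ::
  "('x, 'r) ringed_space \<Rightarrow> ('x, 'r, 'm) mod_presheaf \<Rightarrow> ('x, 'r, 'x set \<Rightarrow> 'm \<Rightarrow> 'r) mod_presheaf"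
  where
  "dual_presheaf X P =
    \<lparr>sec = (\<lambda>U.
       \<lparr>carrier = dual_sections X P U, mult = (\<lambda>_ _. undefined), one = undefined,
        zero = hom_fun X P U (\<lambda>V c. \<zero>\<^bsub>Osec X V\<^esub>),
        add = (\<lambda>\<phi> \<psi>. hom_fun X P U (\<lambda>V c. \<phi> V c \<oplus>\<^bsub>Osec X V\<^esub> \<psi> V c)),
        smult = (\<lambda>r \<phi>. hom_fun X P U (\<lambda>V c. res (str X) U V r \<otimes>\<^bsub>Osec X V\<^esub> \<phi> V c))\<rparr>),
     res = (\<lambda>U V \<phi>. hom_fun X P V \<phi>)\<rparr>"


section \<open>Graded algebras and graded modules\<close>

text \<open>
  A graded object is the family of its homogeneous components, and \<open>act M U p q\<close> is the pairing of
  degree-\<open>p\<close> sections of the algebra with degree-\<open>q\<close> sections of \<open>M\<close>. A graded algebra is in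
  particular a module over itself; \<open>act\<close> is then its multiplication.
\<close>

record ('x, 'r, 'a, 'm) grmod =
  piece :: "int \<Rightarrow> ('x, 'r, 'm) mod_presheaf"
  act :: "'x set \<Rightarrow> int \<Rightarrow> int \<Rightarrow> 'a \<Rightarrow> 'm \<Rightarrow> 'm"

record ('x, 'r, 'a) gralg = "('x, 'r, 'a, 'a) grmod" +
  unit :: "'x set \<Rightarrow> 'a"

abbreviation gsec :: "('x, 'r, 'a, 'm, 'z) grmod_scheme \<Rightarrow> int \<Rightarrow> 'x set \<Rightarrow> ('r, 'm) module" where
  "gsec M p U \<equiv> sec (piece M p) U"

definition is_graded_module ::
  "('x, 'r) ringed_space \<Rightarrow> ('x, 'r, 'a) gralg \<Rightarrow> ('x, 'r, 'a, 'm, 'z) grmod_scheme \<Rightarrow> bool" where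
  "is_graded_module X A M \<longleftrightarrow>
    (\<forall>p. is_module_sheaf X (piece M p)) \<and>
    (\<forall>U. openin (pts X) U \<longrightarrow>
      (\<forall>p q. \<forall>a\<in>carrier (gsec A p U). \<forall>s\<in>carrier (gsec M q U).
         act M U p q a s \<in> carrier (gsec M (p + q) U) \<and>
         (\<forall>a'\<in>carrier (gsec A p U).
            act M U p q (a \<oplus>\<^bsub>gsec A p U\<^esub> a') s =
            act M U p q a s \<oplus>\<^bsub>gsec M (p + q) U\<^esub> act M U p q a' s) \<and>
         (\<forall>s'\<in>carrier (gsec M q U).
            act M U p q a (s \<oplus>\<^bsub>gsec M q U\<^esub> s') =
            act M U p q a s \<oplus>\<^bsub>gsec M (p + q) U\<^esub> act M U p q a s') \<and>
         (\<forall>r\<in>carrier (Osec X U).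
            act M U p q (r \<odot>\<^bsub>gsec A p U\<^esub> a) s = r \<odot>\<^bsub>gsec M (p + q) U\<^esub> act M U p q a s \<and>
            act M U p q a (r \<odot>\<^bsub>gsec M q U\<^esub> s) = r \<odot>\<^bsub>gsec M (p + q) U\<^esub> act M U p q a s) \<and>
         (\<forall>V. openin (pts X) V \<and> V \<subseteq> U \<longrightarrow>
            res (piece M (p + q)) U V (act M U p q a s) =
            act M V p q (res (piece A p) U V a) (res (piece M q) U V s))) \<and>
      (\<forall>p p' q. \<forall>a\<in>carrier (gsec A p U). \<forall>a'\<in>carrier (gsec A p' U). \<forall>s\<in>carrier (gsec M q U).
         act M U (p + p') q (act A U p p' a a') s = act M U p (p' + q) a (act M U p' q a' s)) \<and>
      (\<forall>q. \<forall>s\<in>carrier (gsec M q U). act M U 0 q (unit A U) s = s))"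

text \<open>
  Commutative graded algebras, zero in negative degrees and with degree-zero component the structure
  sheaf (through the structure map).
\<close>

definition is_graded_algebra :: "('x, 'r) ringed_space \<Rightarrow> ('x, 'r, 'a) gralg \<Rightarrow> bool" where
  "is_graded_algebra X A \<longleftrightarrow> is_graded_module X A A \<and>
    (\<forall>U. openin (pts X) U \<longrightarrow>
      unit A U \<in> carrier (gsec A 0 U) \<and>
      (\<forall>V. openin (pts X) V \<and> V \<subseteq> U \<longrightarrow> res (piece A 0) U V (unit A U) = unit A V) \<and>
      (\<forall>p q. \<forall>a\<in>carrier (gsec A p U). \<forall>b\<in>carrier (gsec A q U). act A U p q a b = act A U q p b a) \<and>
      (\<forall>p<0. carrier (gsec A p U) = {\<zero>\<^bsub>gsec A p U\<^esub>}) \<and>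
      bij_betw (\<lambda>r. r \<odot>\<^bsub>gsec A 0 U\<^esub> unit A U) (carrier (Osec X U)) (carrier (gsec A 0 U)))"

text \<open>Homogeneous subsheaves of \<open>A\<close>-modules.\<close>

definition is_graded_submodule ::
  "('x, 'r) ringed_space \<Rightarrow> ('x, 'r, 'a) gralg \<Rightarrow> ('x, 'r, 'a, 'm) grmod \<Rightarrow> (int \<Rightarrow> 'x set \<Rightarrow> 'm set)
    \<Rightarrow> bool" where
  "is_graded_submodule X A M N \<longleftrightarrow>
    (\<forall>U. openin (pts X) U \<longrightarrow>
      (\<forall>p. submodule (N p U) (Osec X U) (gsec M p U)) \<and>
      (\<forall>p V. openin (pts X) V \<and> V \<subseteq> U \<longrightarrow> res (piece M p) U V \<in> N p U \<rightarrow> N p V) \<and>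
      (\<forall>p. \<forall>s\<in>carrier (gsec M p U).
         (\<forall>y\<in>U. \<exists>V. openin (pts X) V \<and> y \<in> V \<and> V \<subseteq> U \<and> res (piece M p) U V s \<in> N p V) \<longrightarrow>
         s \<in> N p U) \<and>
      (\<forall>p q. \<forall>a\<in>carrier (gsec A p U). \<forall>s\<in>N q U. act M U p q a s \<in> N (p + q) U))"

definition generated_submodule ::
  "('x, 'r) ringed_space \<Rightarrow> ('x, 'r, 'a) gralg \<Rightarrow> ('x, 'r, 'a, 'm) grmod \<Rightarrow> (int \<Rightarrow> 'x set \<Rightarrow> 'm set)
    \<Rightarrow> int \<Rightarrow> 'x set \<Rightarrow> 'm set" where
  "generated_submodule X A M G = (\<lambda>p U. \<Inter>{N p U | N. is_graded_submodule X A M N \<and>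
     (\<forall>q V. openin (pts X) V \<longrightarrow> G q V \<subseteq> N q V)})"

text \<open>
  Finite generation. A finitely generated graded algebra or module has finitely many homogeneous
  generators, so homogeneous ones are used; \<open>(p, g)\<close> is a generator \<open>g\<close> of degree \<open>p\<close>.
\<close>

definition locally_fg_module ::
  "('x, 'r) ringed_space \<Rightarrow> ('x, 'r, 'a) gralg \<Rightarrow> ('x, 'r, 'a, 'm) grmod \<Rightarrow> bool" where
  "locally_fg_module X A M \<longleftrightarrow>
    (\<forall>x\<in>topspace (pts X). \<exists>U G. openin (pts X) U \<and> x \<in> U \<and> finite G \<and>
       (\<forall>(p, g)\<in>G. g \<in> carrier (gsec M p U)) \<and>
       (\<forall>N. is_graded_submodule (open_subspace X U) A M N \<and> (\<forall>(p, g)\<in>G. g \<in> N p U) \<longrightarrow>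
          (\<forall>p V. openin (pts X) V \<and> V \<subseteq> U \<longrightarrow> N p V = carrier (gsec M p V))))"

definition is_graded_subalgebra ::
  "('x, 'r) ringed_space \<Rightarrow> ('x, 'r, 'a) gralg \<Rightarrow> (int \<Rightarrow> 'x set \<Rightarrow> 'a set) \<Rightarrow> bool" where
  "is_graded_subalgebra X A E \<longleftrightarrow>
    (\<forall>U. openin (pts X) U \<longrightarrow>
      unit A U \<in> E 0 U \<and>
      (\<forall>p. submodule (E p U) (Osec X U) (gsec A p U)) \<and>
      (\<forall>p V. openin (pts X) V \<and> V \<subseteq> U \<longrightarrow> res (piece A p) U V \<in> E p U \<rightarrow> E p V) \<and>
      (\<forall>p. \<forall>s\<in>carrier (gsec A p U).
         (\<forall>y\<in>U. \<exists>V. openin (pts X) V \<and> y \<in> V \<and> V \<subseteq> U \<and> res (piece A p) U V s \<in> E p V) \<longrightarrow>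
         s \<in> E p U) \<and>
      (\<forall>p q. \<forall>a\<in>E p U. \<forall>b\<in>E q U. act A U p q a b \<in> E (p + q) U))"

definition fg_algebra :: "('x, 'r) ringed_space \<Rightarrow> ('x, 'r, 'a) gralg \<Rightarrow> bool" where
  "fg_algebra X A \<longleftrightarrow>
    (\<forall>x\<in>topspace (pts X). \<exists>U G. openin (pts X) U \<and> x \<in> U \<and> finite G \<and>
       (\<forall>(p, g)\<in>G. g \<in> carrier (gsec A p U)) \<and>
       (\<forall>E. is_graded_subalgebra (open_subspace X U) A E \<and> (\<forall>(p, g)\<in>G. g \<in> E p U) \<longrightarrow>
          (\<forall>p V. openin (pts X) V \<and> V \<subseteq> U \<longrightarrow> E p V = carrier (gsec A p V))))"

definition gr_quot ::
  "('x, 'r, 'a, 'm) grmod \<Rightarrow> (int \<Rightarrow> 'x set \<Rightarrow> 'm set) \<Rightarrow> ('x, 'r, 'a, 'm set) grmod" where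
  "gr_quot M N =
    \<lparr>piece = (\<lambda>p. quot_presheaf (piece M p) (N p)),
     act = (\<lambda>U p q a Y. \<Union>s\<in>Y. N (p + q) U +>\<^bsub>gsec M (p + q) U\<^esub> act M U p q a s)\<rparr>"

text \<open>
  The dual, with components \<open>(M\<^sup>*)\<^sub>q = (M\<^sub>-\<^sub>q)\<^sup>*\<close> and the adjoint action \<open>(a \<phi>)(c) = \<phi> (a c)\<close>: here
  \<open>a\<close> has degree \<open>p\<close>, \<open>\<phi>\<close> has degree \<open>q\<close>, and \<open>c\<close> has degree \<open>-(p + q)\<close>.
\<close>

definition gr_dual ::
  "('x, 'r) ringed_space \<Rightarrow> ('x, 'r, 'a) gralg \<Rightarrow> ('x, 'r, 'a, 'm) grmod
    \<Rightarrow> ('x, 'r, 'a, 'x set \<Rightarrow> 'm \<Rightarrow> 'r) grmod" where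
  "gr_dual X A M =
    \<lparr>piece = (\<lambda>q. dual_presheaf X (piece M (- q))),
     act = (\<lambda>U p q a \<phi>. hom_fun X (piece M (- (p + q))) U
       (\<lambda>V c. \<phi> V (act M V p (- (p + q)) (res (piece A p) U V a) c)))\<rparr>"


section \<open>The fibre over a point\<close>

text \<open>
  Pullback along \<open>Spec k(x) \<rightarrow> X\<close>. The one-point scheme is modelled on the type \<^typ>\<open>unit\<close>, and a
  sheaf on it is a value over the point together with a zero object over the empty set. The pullback
  of \<open>F\<close>, that is, the tensor product of the stalk \<open>F\<^sub>x\<close> with \<open>k(x) = \<O>\<^sub>x / m\<close>, is
  \<open>F\<^sub>x / m F\<^sub>x\<close>.
\<close>

definition point_presheaf ::
  "('m, 'z) ring_scheme \<Rightarrow> (unit, 'm, ('m, 'z) ring_scheme) presheaf" where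
  "point_presheaf M =
    \<lparr>sec = (\<lambda>U. if U = {} then M\<lparr>carrier := {\<zero>\<^bsub>M\<^esub>}, one := \<zero>\<^bsub>M\<^esub>\<rparr> else M),
     res = (\<lambda>U V s. if V = {} then \<zero>\<^bsub>M\<^esub> else s)\<rparr>"

definition Spec_field :: "'k ring \<Rightarrow> (unit, 'k) ringed_space" where
  "Spec_field K = \<lparr>pts = discrete_topology UNIV, str = point_presheaf K\<rparr>"

definition max_ideal_times_stalk ::
  "('x, 'r) ringed_space \<Rightarrow> 'x \<Rightarrow> ('x, 'r, 'm) mod_presheaf \<Rightarrow> ('x set \<times> 'm) set set" where
  "max_ideal_times_stalk X x F = (let R = stalk_ring X x; M = stalk_module X F x in
    \<Inter>{N. submodule N R M \<and> (\<forall>r\<in>max_ideal R. \<forall>s\<in>carrier M. r \<odot>\<^bsub>M\<^esub> s \<in> N)})"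

definition fibre_class ::
  "('x, 'r) ringed_space \<Rightarrow> 'x \<Rightarrow> ('x, 'r, 'm) mod_presheaf \<Rightarrow> ('x set \<times> 'm) set
    \<Rightarrow> ('x set \<times> 'm) set set" where
  "fibre_class X x F \<alpha> = max_ideal_times_stalk X x F +>\<^bsub>stalk_module X F x\<^esub> \<alpha>"

definition fibre_module ::
  "('x, 'r) ringed_space \<Rightarrow> 'x \<Rightarrow> ('x, 'r, 'm) mod_presheaf
    \<Rightarrow> (('x set \<times> 'r) set set, ('x set \<times> 'm) set set) module" where
  "fibre_module X x F = (let M = stalk_module X F x; N = max_ideal_times_stalk X x F in
    \<lparr>carrier = a_rcosets\<^bsub>M\<^esub> N, mult = (\<lambda>_ _. undefined), one = undefined,
     zero = N, add = set_add M,
     smult = (\<lambda>\<kappa> Y. \<Union>r\<in>\<kappa>. \<Union>s\<in>Y. fibre_class X x F (r \<odot>\<^bsub>M\<^esub> s))\<rparr>)"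

definition fibre_act ::
  "('x, 'r) ringed_space \<Rightarrow> 'x \<Rightarrow> ('x, 'r, 'a) gralg \<Rightarrow> ('x, 'r, 'a, 'm, 'z) grmod_scheme
    \<Rightarrow> unit set \<Rightarrow> int \<Rightarrow> int \<Rightarrow> ('x set \<times> 'a) set set \<Rightarrow> ('x set \<times> 'm) set set
    \<Rightarrow> ('x set \<times> 'm) set set" where
  "fibre_act X x A M = (\<lambda>_ p q Y Z. \<Union>\<alpha>\<in>Y. \<Union>\<beta>\<in>Z. fibre_class X x (piece M (p + q))
     (germ_op (pts X) (piece A p) (piece M q) (piece M (p + q)) x (\<lambda>U. act M U p q) \<alpha> \<beta>))"

definition fibre_grmod ::
  "('x, 'r) ringed_space \<Rightarrow> 'x \<Rightarrow> ('x, 'r, 'a) gralg \<Rightarrow> ('x, 'r, 'a, 'm) grmod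
    \<Rightarrow> (unit, ('x set \<times> 'r) set set, ('x set \<times> 'a) set set, ('x set \<times> 'm) set set) grmod" where
  "fibre_grmod X x A M =
    \<lparr>piece = (\<lambda>p. point_presheaf (fibre_module X x (piece M p))), act = fibre_act X x A M\<rparr>"

definition fibre_gralg ::
  "('x, 'r) ringed_space \<Rightarrow> 'x \<Rightarrow> ('x, 'r, 'a) gralg
    \<Rightarrow> (unit, ('x set \<times> 'r) set set, ('x set \<times> 'a) set set) gralg" where
  "fibre_gralg X x A =
    \<lparr>piece = (\<lambda>p. point_presheaf (fibre_module X x (piece A p))), act = fibre_act X x A A,
     unit = (\<lambda>U. if U = {} then \<zero>\<^bsub>fibre_module X x (piece A 0)\<^esub>
       else fibre_class X x (piece A 0)
         (germ (pts X) (piece A 0) x (topspace (pts X)) (unit A (topspace (pts X)))))\<rparr>"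

text \<open>
  A quotient of \<open>B\<close> is given by its kernel. By right exactness, the kernel of the pullback of the
  quotient is the image of the kernel, which need only be defined on a neighbourhood \<open>T\<close> of \<open>x\<close>.
\<close>

definition fibre_quotient ::
  "('x, 'r) ringed_space \<Rightarrow> 'x \<Rightarrow> 'x set \<Rightarrow> ('x, 'r, 'a, 'm) grmod \<Rightarrow> (int \<Rightarrow> 'x set \<Rightarrow> 'm set)
    \<Rightarrow> int \<Rightarrow> unit set \<Rightarrow> ('x set \<times> 'm) set set set" where
  "fibre_quotient X x T B N = (\<lambda>p U.
     if U = {} then {\<zero>\<^bsub>fibre_module X x (piece B p)\<^esub>}
     else {fibre_class X x (piece B p) (germ (pts X) (piece B p) x V s) | V s.
             openin (pts X) V \<and> x \<in> V \<and> V \<subseteq> T \<and> s \<in> N p V})"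


section \<open>Quotients with prescribed ranks, and socle type\<close>

text \<open>Throughout, \<open>N\<close> is the kernel of the homogeneous quotient \<open>C\<close> of \<open>B\<close>, and \<open>D = C\<^sup>*\<close>.\<close>

definition quot_dual ::
  "('x, 'r) ringed_space \<Rightarrow> ('x, 'r, 'a) gralg \<Rightarrow> ('x, 'r, 'a, 'm) grmod \<Rightarrow> (int \<Rightarrow> 'x set \<Rightarrow> 'm set)
    \<Rightarrow> ('x, 'r, 'a, 'x set \<Rightarrow> 'm set \<Rightarrow> 'r) grmod" where
  "quot_dual X A B N = gr_dual X A (gr_quot B N)"

definition is_finite_lf_quotient ::
  "('x, 'r) ringed_space \<Rightarrow> ('x, 'r, 'a) gralg \<Rightarrow> ('x, 'r, 'a, 'm) grmod \<Rightarrow> (int \<Rightarrow> 'x set \<Rightarrow> 'm set)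
    \<Rightarrow> bool" where
  "is_finite_lf_quotient X A B N \<longleftrightarrow>
    is_graded_submodule X A B N \<and>
    (\<forall>p. locally_free_finite X (piece (gr_quot B N) p)) \<and>
    finite {p. \<exists>U. openin (pts X) U \<and> carrier (gsec (gr_quot B N) p U) \<noteq> {\<zero>\<^bsub>gsec (gr_quot B N) p U\<^esub>}}"

definition Delta ::
  "('x, 'r) ringed_space \<Rightarrow> ('x, 'r, 'a) gralg \<Rightarrow> int \<Rightarrow> ('x, 'r, 'a, 'm) grmod
    \<Rightarrow> int \<Rightarrow> 'x set \<Rightarrow> 'm set" where
  "Delta X A m D = generated_submodule X A D
     (\<lambda>q U. if \<exists>j\<ge>m. q = - j then carrier (gsec D q U) else {})"

definition HLambda ::
  "('x, 'r) ringed_space \<Rightarrow> ('x, 'r, 'a) gralg \<Rightarrow> ('x, 'r, 'a, 'm) grmod \<Rightarrow> (int \<Rightarrow> int \<Rightarrow> int)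
    \<Rightarrow> (int \<Rightarrow> 'x set \<Rightarrow> 'm set) set" where
  "HLambda X A B h = {N. is_finite_lf_quotient X A B N \<and>
    (let D = quot_dual X A B N in \<forall>m p.
       locally_free_rank X (sub_presheaf (piece D (- p)) (Delta X A m D (- p))) (h m p) \<and>
       flat_over X (piece (gr_quot D (Delta X A m D)) (- p)))}"

text \<open>The augmentation submodule, so that \<open>D \<otimes>\<^sub>A (A/A\<^sub>+) = D / A\<^sub>+ D\<close>.\<close>

definition Aplus_times ::
  "('x, 'r) ringed_space \<Rightarrow> ('x, 'r, 'a) gralg \<Rightarrow> ('x, 'r, 'a, 'm) grmod \<Rightarrow> int \<Rightarrow> 'x set \<Rightarrow> 'm set"
  where
  "Aplus_times X A D = generated_submodule X A D
     (\<lambda>k U. {act D U p q a d | p q a d.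
        p > 0 \<and> p + q = k \<and> a \<in> carrier (gsec A p U) \<and> d \<in> carrier (gsec D q U)})"

definition has_socle_type ::
  "('x, 'r) ringed_space \<Rightarrow> ('x, 'r, 'a) gralg \<Rightarrow> ('x, 'r, 'a, 'm) grmod \<Rightarrow> (int \<Rightarrow> 'x set \<Rightarrow> 'm set)
    \<Rightarrow> (int \<Rightarrow> int) \<Rightarrow> bool" where
  "has_socle_type X A B N t \<longleftrightarrow>
    (let D = quot_dual X A B N in
     \<forall>p. locally_free_rank X (piece (gr_quot D (Aplus_times X A D)) (- p)) (t p))"

definition g_fun :: "(int \<Rightarrow> int) \<Rightarrow> (int \<Rightarrow> int) \<Rightarrow> int \<Rightarrow> int \<Rightarrow> int" where
  "g_fun a t m p = (\<Sum>q = m..Max {q. t q \<noteq> 0}. t q * a (q - p))"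

definition hI :: "(int \<Rightarrow> int) \<Rightarrow> (int \<Rightarrow> int) \<Rightarrow> (int \<Rightarrow> int) \<Rightarrow> int \<Rightarrow> int \<Rightarrow> int" where
  "hI a b t m p = min (g_fun a t m p) (b p)"

end

theory Submission
  imports Defs "HOL-Algebra.Free_Abelian_Groups"
begin

text \<open>
  Over the one-point space, Macaulay duality describes \<open>C\<close> by its inverse system: lifting local
  bases of the socle pieces gives functionals \<open>f\<close> on the fibre of \<open>B\<close> such that \<open>C\<close> is the largest
  homogeneous submodule on which all of them vanish. These functionals extend to a neighbourhood of
  \<open>x\<close>, and the same recipe defines \<open>C'\<close>. In degree \<open>p\<close> the dual of the quotient is spanned by the
  contractions \<open>f (a \<cdot> _)\<close>, with \<open>a\<close> running through a local basis of the relevant piece of \<open>A\<close>.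
  Eliminating these in order of decreasing level \<open>q\<close> makes every step of the filtration spanned by
  those chosen so far. The rank \<open>min (g m p) (b p)\<close> on the fibre says that the chosen ones of level at
  least \<open>m\<close> are either all contractions or a full basis of the dual of \<open>B\<^sub>p\<close>; both persist near \<open>x\<close>.
\<close>

text \<open>A functional skipped during elimination is known to be redundant only at
  \<open>x\<close>: independence of functionals persists on a neighbourhood, dependence does not, so
  the recipe by itself could give a quotient whose rank jumps away from \<open>x\<close>. The
  minimum in \<open>hI\<close> excludes the harmful case of partial dependence. At each level either
  nothing was skipped, or every basis vector of the piece of \<open>B\<close> is the pivot of a
  chosen functional, and then the chosen ones already cut out zero. One choice has to serve all
  levels \<open>m\<close> at once, hence the order of elimination.

  The generated submodules in the definitions are infinite intersections. They are replaced by
  annihilators with explicit bases, in a setting that assumes only a dual basis adapted to the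
  levels. That setting occurs twice: over the one-point space it turns the hypotheses on
  \<open>C\<close> into cardinalities, over the neighbourhood it turns the same cardinalities into
  the conclusion. Shrinking is finite because only degrees from 0 to the largest socle degree
  matter: above it contractions use negative degrees of \<open>A\<close>, and below 0 the module
  \<open>B\<close> vanishes.\<close>

abbreviation opn :: "('x, 'r) ringed_space \<Rightarrow> 'x set \<Rightarrow> bool" where "opn X \<equiv> openin (pts X)"
abbreviation "csec M p U \<equiv> carrier (gsec M p U)"
abbreviation "cO X U \<equiv> carrier (Osec X U)"

section \<open>Modules\<close>

text \<open>Restriction, passage to germs, evaluation at \<open>x\<close> and application of a
  functional are all additive; this one statement carries finite linear combinations through each of
  them.\<close>

lemma finsum_additive_map:
 assumes M: "abelian_group M" and N: "abelian_group N" and fin: "finite I"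
 and cl: "!!x. x : carrier M ==> h x : carrier N"
 and add: "!!x y. x : carrier M ==> y : carrier M ==> h (x \<oplus>\<^bsub>M\<^esub> y) = h x \<oplus>\<^bsub>N\<^esub> h y"
 and f: "!!i. i : I ==> f i : carrier M"
 shows "h (finsum M f I) = finsum N (%i. h (f i)) I"
proof -
 interpret M: abelian_group M by fact
 interpret N: abelian_group N by fact
 have z: "h \<zero>\<^bsub>M\<^esub> = \<zero>\<^bsub>N\<^esub>"
 using add[of "\<zero>\<^bsub>M\<^esub>" "\<zero>\<^bsub>M\<^esub>"] cl[of "\<zero>\<^bsub>M\<^esub>"] by (simp add: N.add.l_cancel_one)
 show ?thesis using fin f
 proof (induction I)
 case empty then show ?case by (simp add: z)
 next
 case (insert i I)
 then show ?case
 by (subst M.finsum_insert; (subst N.finsum_insert)?)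
  (auto simp: add cl Pi_def intro!: M.finsum_closed)
 qed
qed

lemma (in abelian_group) minus_add_cancel:
 "x : carrier G ==> y : carrier G ==> (x \<ominus> y) \<oplus> y = x"
 by (simp add: a_minus_def a_assoc l_neg)

lemma (in abelian_group) minus_eq_zero_iff:
 "x : carrier G ==> y : carrier G ==> x \<ominus> y = \<zero> \<longleftrightarrow> x = y"
 by (metis minus_add_cancel l_zero a_minus_def r_neg)

lemma additive_map_zero:
 assumes "abelian_group M" "abelian_group N"
 and "!!x. x : carrier M ==> h x : carrier N"
 and "!!x y. x : carrier M ==> y : carrier M ==> h (x \<oplus>\<^bsub>M\<^esub> y) = h x \<oplus>\<^bsub>N\<^esub> h y"
 shows "h \<zero>\<^bsub>M\<^esub> = \<zero>\<^bsub>N\<^esub>"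
 using finsum_additive_map[OF assms(1,2), of "{}" h] assms(3,4)
 by (simp add: abelian_monoid.finsum_empty abelian_group.axioms(1) assms(1,2))

lemma additive_map_minus:
 assumes M: "abelian_group M" and N: "abelian_group N"
 and cl: "!!x. x : carrier M ==> h x : carrier N"
 and add: "!!x y. x : carrier M ==> y : carrier M ==> h (x \<oplus>\<^bsub>M\<^esub> y) = h x \<oplus>\<^bsub>N\<^esub> h y"
 and x: "x : carrier M" and y: "y : carrier M"
 shows "h (x \<ominus>\<^bsub>M\<^esub> y) = h x \<ominus>\<^bsub>N\<^esub> h y"
proof -
 interpret M: abelian_group M by fact
 interpret N: abelian_group N by fact
 have "h (x \<ominus>\<^bsub>M\<^esub> y) \<oplus>\<^bsub>N\<^esub> h y = h x"
 using add[of "x \<ominus>\<^bsub>M\<^esub> y" y] x y by (simp add: M.minus_add_cancel)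
 then show ?thesis
 using x y cl N.add.inv_solve_right'[of "h (x \<ominus>\<^bsub>M\<^esub> y)" "h x" "h y"]
 by (simp add: a_minus_def)
qed

lemma submodule_abelian_subgroup:
 assumes "module R M" "submodule N R M"
 shows "abelian_subgroup N M"
proof -
 interpret module R M by fact
 show ?thesis
 using submodule.axioms(1)[OF assms(2)]
 by (intro abelian_subgroupI3 M.abelian_group_axioms) (simp add: additive_subgroup_def)
qed

lemma submodule_zero_closed:
 "submodule N R M ==> \<zero>\<^bsub>M\<^esub> : N"
 using submodule.axioms(1) subgroup.one_closed by fastforce

lemma submodule_finsum_closed:
 assumes M: "module R M" and N: "submodule N R M" and fin: "finite I" and f: "!!i. i : I ==> f i : N"
 shows "finsum M f I : N"
 using fin f
proof (induction I)
 interpret module R M by fact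
 case empty
 then show ?case using submodule_zero_closed[OF N] by simp
next
 interpret module R M by fact
 case (insert i I)
 then have "f : I \<rightarrow> carrier M" "f i : carrier M" using submoduleE(1)[OF N] by auto
 then show ?case using insert submoduleE(5)[OF N] by simp
qed

lemma a_rcoset_eq_iff:
 assumes "module R M" "submodule N R M" "x : carrier M" "y : carrier M"
 shows "N +>\<^bsub>M\<^esub> x = N +>\<^bsub>M\<^esub> y \<longleftrightarrow> x \<ominus>\<^bsub>M\<^esub> y : N"
proof -
 interpret module R M by fact
 interpret N: abelian_subgroup N M using submodule_abelian_subgroup[OF assms(1,2)] .
 show ?thesis
 using assms N.a_rcos_module[of y x] N.a_repr_independence'[of x y] N.a_rcos_self[of x]
 by (auto simp: a_minus_def)
qed

lemma a_rcoset_mem_iff: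
 assumes "module R M" "submodule N R M" "x : carrier M"
 shows "y : N +>\<^bsub>M\<^esub> x \<longleftrightarrow> y : carrier M & N +>\<^bsub>M\<^esub> y = N +>\<^bsub>M\<^esub> x"
proof -
 interpret module R M by fact
 interpret N: abelian_subgroup N M using submodule_abelian_subgroup[OF assms(1,2)] .
 show ?thesis
 using assms(3) N.a_repr_independence' N.a_rcos_self N.a_elemrcos_carrier by metis
qed

context
 fixes R :: "('r, 'z) ring_scheme" and M :: "('r, 'm) module" and N
 assumes M: "module R M" and N: "submodule N R M"
begin

interpretation module R M by (fact M)
interpretation N: abelian_subgroup N M using submodule_abelian_subgroup[OF M N] .

lemma quot_module_carrier: "carrier (quot_module M N) = (%s. N +>\<^bsub>M\<^esub> s) ` carrier M"
 unfolding quot_module_def A_RCOSETS_defs a_r_coset_defs by auto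

lemma quot_module_add:
 "s : carrier M ==> t : carrier M ==>
 (N +>\<^bsub>M\<^esub> s) \<oplus>\<^bsub>quot_module M N\<^esub> (N +>\<^bsub>M\<^esub> t) = N +>\<^bsub>M\<^esub> (s \<oplus>\<^bsub>M\<^esub> t)"
 unfolding quot_module_def by (simp add: N.a_rcos_sum)

lemma quot_module_zero: "\<zero>\<^bsub>quot_module M N\<^esub> = N +>\<^bsub>M\<^esub> \<zero>\<^bsub>M\<^esub>"
 unfolding quot_module_def using N.a_subset by simp

text \<open>The product is defined as a union over all representatives of the coset. Scaling keeps
  differences inside \<open>N\<close>, so all members of the union coincide and
  \<open>UN_constant_eq\<close> collapses it; the unions in quotient restrictions, germ operations
  and fibres are treated in the same way.\<close>

lemma quot_module_smult:
 assumes r: "r : carrier R" and s: "s : carrier M"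
 shows "r \<odot>\<^bsub>quot_module M N\<^esub> (N +>\<^bsub>M\<^esub> s) = N +>\<^bsub>M\<^esub> (r \<odot>\<^bsub>M\<^esub> s)"
proof -
 have "N +>\<^bsub>M\<^esub> (r \<odot>\<^bsub>M\<^esub> s') = N +>\<^bsub>M\<^esub> (r \<odot>\<^bsub>M\<^esub> s)" if "s' : N +>\<^bsub>M\<^esub> s" for s'
 proof -
 have s': "s' : carrier M" "s' \<ominus>\<^bsub>M\<^esub> s : N"
 using that a_rcoset_mem_iff[OF M N s] a_rcoset_eq_iff[OF M N _ s] by auto
 have "r \<odot>\<^bsub>M\<^esub> s' \<ominus>\<^bsub>M\<^esub> r \<odot>\<^bsub>M\<^esub> s = r \<odot>\<^bsub>M\<^esub> (s' \<ominus>\<^bsub>M\<^esub> s)"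
 using r s s' by (simp add: a_minus_def smult_r_distr smult_r_minus)
 then show ?thesis
 using a_rcoset_eq_iff[OF M N] r s s' submodule.smult_closed[OF N] by simp
 qed
 moreover have "s : N +>\<^bsub>M\<^esub> s" using N.a_rcos_self s by blast
 ultimately have "(\<Union>s'\<in>N +>\<^bsub>M\<^esub> s. N +>\<^bsub>M\<^esub> (r \<odot>\<^bsub>M\<^esub> s')) = N +>\<^bsub>M\<^esub> (r \<odot>\<^bsub>M\<^esub> s)"
 by (intro UN_constant_eq ballI)
 then show ?thesis unfolding quot_module_def by simp
qed

lemma quot_module_module: "module R (quot_module M N)"
proof (intro moduleI abelian_groupI)
 let ?Q = "quot_module M N"
 note qs = quot_module_carrier quot_module_add quot_module_zero quot_module_smult
 show "cring R" by (rule R.is_cring)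
 fix x y z assume x: "x : carrier ?Q"
 then obtain s where s: "s : carrier M" "x = N +>\<^bsub>M\<^esub> s" by (auto simp: qs)
 show "\<zero>\<^bsub>?Q\<^esub> \<oplus>\<^bsub>?Q\<^esub> x = x" using s by (simp add: qs)
 have "(\<ominus>\<^bsub>M\<^esub> s) : carrier M" "(N +>\<^bsub>M\<^esub> (\<ominus>\<^bsub>M\<^esub> s)) \<oplus>\<^bsub>?Q\<^esub> x = \<zero>\<^bsub>?Q\<^esub>"
 using s by (simp_all add: qs M.l_neg)
 then show "EX y:carrier ?Q. y \<oplus>\<^bsub>?Q\<^esub> x = \<zero>\<^bsub>?Q\<^esub>" by (auto simp: quot_module_carrier)
 show "\<one>\<^bsub>R\<^esub> \<odot>\<^bsub>?Q\<^esub> x = x" using s by (simp add: qs)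
 {
 fix a assume a: "a : carrier R"
 show "a \<odot>\<^bsub>?Q\<^esub> x : carrier ?Q" using s a by (auto simp: qs)
 {
 fix b assume b: "b : carrier R"
 show "(a \<oplus>\<^bsub>R\<^esub> b) \<odot>\<^bsub>?Q\<^esub> x = a \<odot>\<^bsub>?Q\<^esub> x \<oplus>\<^bsub>?Q\<^esub> b \<odot>\<^bsub>?Q\<^esub> x"
  using s a b by (simp add: qs smult_l_distr)
 show "(a \<otimes>\<^bsub>R\<^esub> b) \<odot>\<^bsub>?Q\<^esub> x = a \<odot>\<^bsub>?Q\<^esub> (b \<odot>\<^bsub>?Q\<^esub> x)"
  using s a b by (simp add: qs smult_assoc1)
 }
 }
 assume y: "y : carrier ?Q"
 then obtain t where t: "t : carrier M" "y = N +>\<^bsub>M\<^esub> t" by (auto simp: qs)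
 show "x \<oplus>\<^bsub>?Q\<^esub> y : carrier ?Q" using s t by (auto simp: qs)
 show "x \<oplus>\<^bsub>?Q\<^esub> y = y \<oplus>\<^bsub>?Q\<^esub> x" using s t by (simp add: qs M.a_comm)
 {
 fix a assume a: "a : carrier R"
 show "a \<odot>\<^bsub>?Q\<^esub> (x \<oplus>\<^bsub>?Q\<^esub> y) = a \<odot>\<^bsub>?Q\<^esub> x \<oplus>\<^bsub>?Q\<^esub> a \<odot>\<^bsub>?Q\<^esub> y"
 using s t a by (simp add: qs smult_r_distr)
 }
 assume "z : carrier ?Q"
 then obtain u where u: "u : carrier M" "z = N +>\<^bsub>M\<^esub> u" by (auto simp: qs)
 show "(x \<oplus>\<^bsub>?Q\<^esub> y) \<oplus>\<^bsub>?Q\<^esub> z = x \<oplus>\<^bsub>?Q\<^esub> (y \<oplus>\<^bsub>?Q\<^esub> z)"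
 using s t u by (simp add: qs M.a_assoc)
next
 show "\<zero>\<^bsub>quot_module M N\<^esub> : carrier (quot_module M N)"
 by (auto simp: quot_module_carrier quot_module_zero)
qed

end

section \<open>Presheaves of modules\<close>

definition module_presheaf :: "('x, 'r) ringed_space => ('x, 'r, 'm) mod_presheaf => bool" where
 "module_presheaf X P \<longleftrightarrow>
 (ALL U. opn X U --> module (Osec X U) (sec P U)) &
 (ALL U V. opn X U & opn X V & V \<subseteq> U -->
 (ALL s:carrier (sec P U). res P U V s : carrier (sec P V)) &
 (ALL s:carrier (sec P U). ALL t:carrier (sec P U).
  res P U V (s \<oplus>\<^bsub>sec P U\<^esub> t) = res P U V s \<oplus>\<^bsub>sec P V\<^esub> res P U V t) &
 (ALL r:(cO X U). ALL s:carrier (sec P U).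
  res P U V (r \<odot>\<^bsub>sec P U\<^esub> s) = res (str X) U V r \<odot>\<^bsub>sec P V\<^esub> res P U V s)) &
 (ALL U. opn X U --> (ALL s:carrier (sec P U). res P U U s = s)) &
 (ALL U V W. opn X U & opn X V & opn X W & W \<subseteq> V & V \<subseteq> U -->
 (ALL s:carrier (sec P U). res P V W (res P U V s) = res P U W s))"

definition submodule_presheaf ::
 "('x, 'r) ringed_space => ('x, 'r, 'm) mod_presheaf => ('x set => 'm set) => bool" where
 "submodule_presheaf X P N \<longleftrightarrow>
 (ALL U. opn X U --> submodule (N U) (Osec X U) (sec P U)) &
 (ALL U V. opn X U & opn X V & V \<subseteq> U --> (ALL s:N U. res P U V s : N V))"

lemma presheafD:
 assumes "module_presheaf X P"
 shows "opn X U ==> module (Osec X U) (sec P U)"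
 and "opn X U ==> opn X V ==> V \<subseteq> U ==> s : carrier (sec P U) ==>
 res P U V s : carrier (sec P V)"
 and "opn X U ==> opn X V ==> V \<subseteq> U ==> s : carrier (sec P U) ==>
 t : carrier (sec P U) ==> res P U V (s \<oplus>\<^bsub>sec P U\<^esub> t) = res P U V s \<oplus>\<^bsub>sec P V\<^esub> res P U V t"
 and "opn X U ==> opn X V ==> V \<subseteq> U ==> r : (cO X U) ==>
 s : carrier (sec P U) ==> res P U V (r \<odot>\<^bsub>sec P U\<^esub> s) = res (str X) U V r \<odot>\<^bsub>sec P V\<^esub> res P U V s"
 and "opn X U ==> s : carrier (sec P U) ==> res P U U s = s"
 and "opn X U ==> opn X V ==> opn X W ==> W \<subseteq> V ==> V \<subseteq> U ==>
 s : carrier (sec P U) ==> res P V W (res P U V s) = res P U W s"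
 and "opn X U ==> abelian_group (sec P U)"
proof -
 show m: "opn X U ==> module (Osec X U) (sec P U)" using assms by (simp add: module_presheaf_def)
 show "opn X U ==> abelian_group (sec P U)" using m by (rule module.axioms(2))
qed (use assms in \<open>simp_all add: module_presheaf_def\<close>)

lemma module_presheaf_res_map:
 assumes P: "module_presheaf X P"
 and U: "opn X U" and V: "opn X V" and VU: "V \<subseteq> U"
 shows "res P U V \<zero>\<^bsub>sec P U\<^esub> = \<zero>\<^bsub>sec P V\<^esub>"
 and "s : carrier (sec P U) ==> t : carrier (sec P U) ==>
 res P U V (s \<ominus>\<^bsub>sec P U\<^esub> t) = res P U V s \<ominus>\<^bsub>sec P V\<^esub> res P U V t"
 and "finite I ==> (!!i. i : I ==> f i : carrier (sec P U)) ==>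
 res P U V (finsum (sec P U) f I) = finsum (sec P V) (%i. res P U V (f i)) I"
 by (rule additive_map_zero additive_map_minus finsum_additive_map;
 use presheafD[OF P] U V VU in simp)+

lemma is_sheafD:
 assumes "is_sheaf X F"
 shows "openin X U ==> openin X V ==> V \<subseteq> U ==> s : carrier (sec F U) ==> res F U V s : carrier (sec F V)"
 and "openin X U ==> s : carrier (sec F U) ==> res F U U s = s"
 and "openin X U ==> openin X V ==> openin X W ==> W \<subseteq> V ==> V \<subseteq> U ==> s : carrier (sec F U) ==>
 res F V W (res F U V s) = res F U W s"
 and "(!!U. U : \<U> ==> openin X U & s' U : carrier (sec F U)) ==>
 (!!U V. U\<in>\<U> ==> V\<in>\<U> ==> res F U (U \<inter> V) (s' U) = res F V (U \<inter> V) (s' V)) ==>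
 (EX t:carrier (sec F (\<Union>\<U>)). ALL U:\<U>. res F (\<Union>\<U>) U t = s' U)"
proof -
 show "openin X U ==> openin X V ==> V \<subseteq> U ==> s : carrier (sec F U) ==> res F U V s : carrier (sec F V)"
 using assms by (simp add: is_sheaf_def Pi_def)
 show "openin X U ==> s : carrier (sec F U) ==> res F U U s = s"
 using assms by (simp add: is_sheaf_def)
 show "openin X U ==> openin X V ==> openin X W ==> W \<subseteq> V ==> V \<subseteq> U ==> s : carrier (sec F U) ==>
 res F V W (res F U V s) = res F U W s"
 using assms by (simp add: is_sheaf_def)
 show "(!!U. U : \<U> ==> openin X U & s' U : carrier (sec F U)) ==>
 (!!U V. U\<in>\<U> ==> V\<in>\<U> ==> res F U (U \<inter> V) (s' U) = res F V (U \<inter> V) (s' V)) ==>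
 (EX t:carrier (sec F (\<Union>\<U>)). ALL U:\<U>. res F (\<Union>\<U>) U t = s' U)"
 using assms unfolding is_sheaf_def by (elim conjE) metis
qed

text \<open>The open sets on which the two sections agree form a cover, so equality may be tested
  near each point.\<close>

lemma is_sheaf_separated:
 assumes F: "is_sheaf X F" and V: "openin X V"
 and s: "s : carrier (sec F V)" and t: "t : carrier (sec F V)"
 and loc: "!!y. y : V ==> EX W. openin X W & y : W & W \<subseteq> V & res F V W s = res F V W t"
 shows "s = t"
proof -
 define \<U> where "\<U> = {W. openin X W & W \<subseteq> V & res F V W s = res F V W t}"
 have "\<Union>\<U> = V" using loc unfolding \<U>_def by blast
 moreover have "ALL U:\<U>. openin X U" "ALL U:\<U>. res F V U s = res F V U t" by (auto simp: \<U>_def)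
 moreover have "(ALL U:\<U>. openin X U) -->
 (ALL s:carrier (sec F (\<Union>\<U>)). ALL t:carrier (sec F (\<Union>\<U>)).
  (ALL U:\<U>. res F (\<Union>\<U>) U s = res F (\<Union>\<U>) U t) --> s = t)"
 using F unfolding is_sheaf_def by (elim conjE) (erule spec)
 ultimately show ?thesis using s t by metis
qed

lemma is_module_sheaf_presheaf:
 assumes "is_module_sheaf X P"
 shows "module_presheaf X P" "is_sheaf (pts X) P"
proof -
 show s: "is_sheaf (pts X) P" using assms by (simp add: is_module_sheaf_def)
 show "module_presheaf X P"
 using assms is_sheafD(1-3)[OF s] by (simp add: module_presheaf_def is_module_sheaf_def)
qed

lemma ringedD:
 assumes "is_ringed_space X"
 shows "is_sheaf (pts X) (str X)"
 and "opn X U ==> cring (Osec X U)"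
 and "opn X U ==> opn X V ==> V \<subseteq> U ==> r : (cO X U) ==>
 res (str X) U V r : (cO X V)"
 and "opn X U ==> opn X V ==> V \<subseteq> U ==> r : (cO X U) ==>
 r' : (cO X U) ==> res (str X) U V (r \<oplus>\<^bsub>Osec X U\<^esub> r') = res (str X) U V r \<oplus>\<^bsub>Osec X V\<^esub> res (str X) U V r'"
 and "opn X U ==> opn X V ==> V \<subseteq> U ==> r : (cO X U) ==>
 r' : (cO X U) ==> res (str X) U V (r \<otimes>\<^bsub>Osec X U\<^esub> r') = res (str X) U V r \<otimes>\<^bsub>Osec X V\<^esub> res (str X) U V r'"
 and "opn X U ==> opn X V ==> V \<subseteq> U ==> res (str X) U V \<one>\<^bsub>Osec X U\<^esub> = \<one>\<^bsub>Osec X V\<^esub>"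
 and "opn X U ==> opn X V ==> V \<subseteq> U ==> res (str X) U V \<zero>\<^bsub>Osec X U\<^esub> = \<zero>\<^bsub>Osec X V\<^esub>"
 and "opn X U ==> opn X V ==> V \<subseteq> U ==> r : (cO X U) ==>
 r' : (cO X U) ==> res (str X) U V (r \<ominus>\<^bsub>Osec X U\<^esub> r') = res (str X) U V r \<ominus>\<^bsub>Osec X V\<^esub> res (str X) U V r'"
 and "opn X U ==> r : (cO X U) ==> res (str X) U U r = r"
 and "opn X U ==> opn X V ==> opn X W ==> W \<subseteq> V ==> V \<subseteq> U ==>
 r : (cO X U) ==> res (str X) V W (res (str X) U V r) = res (str X) U W r"
 and "opn X U ==> abelian_group (Osec X U)"
proof -
 show sh: "is_sheaf (pts X) (str X)" and cr: "opn X U ==> cring (Osec X U)" for U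
 using assms unfolding is_ringed_space_def by auto
 show ab: "opn X U ==> abelian_group (Osec X U)" for U
 using cr by (simp add: cring_def ring_def)
 have h: "res (str X) U V : ring_hom (Osec X U) (Osec X V)"
 if "opn X U" "opn X V" "V \<subseteq> U" for U V
 using assms that unfolding is_ringed_space_def by auto
 show c: "opn X U ==> opn X V ==> V \<subseteq> U ==> r : (cO X U) ==>
 res (str X) U V r : (cO X V)" for r
 using h ring_hom_closed by metis
 show a: "opn X U ==> opn X V ==> V \<subseteq> U ==> r : (cO X U) ==>
 r' : (cO X U) ==> res (str X) U V (r \<oplus>\<^bsub>Osec X U\<^esub> r') = res (str X) U V r \<oplus>\<^bsub>Osec X V\<^esub> res (str X) U V r'" for r r'
 using h ring_hom_add by metis
 show "opn X U ==> opn X V ==> V \<subseteq> U ==> r : (cO X U) ==>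
 r' : (cO X U) ==> res (str X) U V (r \<otimes>\<^bsub>Osec X U\<^esub> r') = res (str X) U V r \<otimes>\<^bsub>Osec X V\<^esub> res (str X) U V r'"
 using h ring_hom_mult by metis
 show "opn X U ==> opn X V ==> V \<subseteq> U ==> res (str X) U V \<one>\<^bsub>Osec X U\<^esub> = \<one>\<^bsub>Osec X V\<^esub>"
 using h ring_hom_one by metis
 show "opn X U ==> opn X V ==> V \<subseteq> U ==> res (str X) U V \<zero>\<^bsub>Osec X U\<^esub> = \<zero>\<^bsub>Osec X V\<^esub>"
 by (rule additive_map_zero) (use ab c a in simp)+
 show "opn X U ==> opn X V ==> V \<subseteq> U ==> r : (cO X U) ==>
 r' : (cO X U) ==> res (str X) U V (r \<ominus>\<^bsub>Osec X U\<^esub> r') = res (str X) U V r \<ominus>\<^bsub>Osec X V\<^esub> res (str X) U V r'"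
 by (rule additive_map_minus) (use ab c a in simp)+
 show "opn X U ==> r : (cO X U) ==> res (str X) U U r = r"
 by (rule is_sheafD(2)[OF sh])
 show "opn X U ==> opn X V ==> opn X W ==> W \<subseteq> V ==> V \<subseteq> U ==>
 r : (cO X U) ==> res (str X) V W (res (str X) U V r) = res (str X) U W r"
 by (rule is_sheafD(3)[OF sh])
qed

subsection \<open>Quotients and submodules\<close>

lemma subpresheafD:
 assumes "submodule_presheaf X P N"
 shows "opn X U ==> submodule (N U) (Osec X U) (sec P U)"
 and "opn X U ==> opn X V ==> V \<subseteq> U ==> s : N U ==> res P U V s : N V"
 using assms unfolding submodule_presheaf_def by auto

context
 fixes X :: "('x, 'r) ringed_space" and P :: "('x, 'r, 'm) mod_presheaf" and N
 assumes X: "is_ringed_space X" and P: "module_presheaf X P" and N: "submodule_presheaf X P N"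
begin

lemma quot_presheaf_carrier:
 "opn X U ==> carrier (sec (quot_presheaf P N) U) = (%s. N U +>\<^bsub>sec P U\<^esub> s) ` carrier (sec P U)"
 by (simp add: quot_presheaf_def quot_module_carrier[OF presheafD(1)[OF P] subpresheafD(1)[OF N]])

lemma quot_presheaf_add:
 "opn X U ==> s : carrier (sec P U) ==> t : carrier (sec P U) ==>
 (N U +>\<^bsub>sec P U\<^esub> s) \<oplus>\<^bsub>sec (quot_presheaf P N) U\<^esub> (N U +>\<^bsub>sec P U\<^esub> t) = N U +>\<^bsub>sec P U\<^esub> (s \<oplus>\<^bsub>sec P U\<^esub> t)"
 by (simp add: quot_presheaf_def quot_module_add[OF presheafD(1)[OF P] subpresheafD(1)[OF N]])

lemma quot_presheaf_smult:
 "opn X U ==> r : (cO X U) ==> s : carrier (sec P U) ==>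
 r \<odot>\<^bsub>sec (quot_presheaf P N) U\<^esub> (N U +>\<^bsub>sec P U\<^esub> s) = N U +>\<^bsub>sec P U\<^esub> (r \<odot>\<^bsub>sec P U\<^esub> s)"
 by (simp add: quot_presheaf_def quot_module_smult[OF presheafD(1)[OF P] subpresheafD(1)[OF N]])

lemma quot_presheaf_zero:
 "opn X U ==> \<zero>\<^bsub>sec (quot_presheaf P N) U\<^esub> = N U +>\<^bsub>sec P U\<^esub> \<zero>\<^bsub>sec P U\<^esub>"
 by (simp add: quot_presheaf_def quot_module_zero[OF presheafD(1)[OF P] subpresheafD(1)[OF N]])

lemma quot_presheaf_eq_iff:
 "opn X U ==> s : carrier (sec P U) ==> t : carrier (sec P U) ==>
 N U +>\<^bsub>sec P U\<^esub> s = N U +>\<^bsub>sec P U\<^esub> t \<longleftrightarrow> s \<ominus>\<^bsub>sec P U\<^esub> t : N U"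
 by (rule a_rcoset_eq_iff[OF presheafD(1)[OF P] subpresheafD(1)[OF N]])

lemma quot_presheaf_zero_iff:
 assumes U: "opn X U" and s: "s : carrier (sec P U)"
 shows "N U +>\<^bsub>sec P U\<^esub> s = \<zero>\<^bsub>sec (quot_presheaf P N) U\<^esub> \<longleftrightarrow> s : N U"
proof -
 interpret module "Osec X U" "sec P U" by (rule presheafD(1)[OF P U])
 show ?thesis using quot_presheaf_eq_iff[OF U s] s by (simp add: quot_presheaf_zero[OF U] a_minus_def M.add.inv_one[folded a_inv_def])
qed

lemma quot_presheaf_res:
 assumes U: "opn X U" and V: "opn X V" and VU: "V \<subseteq> U" and s: "s : carrier (sec P U)"
 shows "res (quot_presheaf P N) U V (N U +>\<^bsub>sec P U\<^esub> s) = N V +>\<^bsub>sec P V\<^esub> res P U V s"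
proof -
 have "N V +>\<^bsub>sec P V\<^esub> res P U V s' = N V +>\<^bsub>sec P V\<^esub> res P U V s" if "s' : N U +>\<^bsub>sec P U\<^esub> s" for s'
 proof -
 have s': "s' : carrier (sec P U)" "s' \<ominus>\<^bsub>sec P U\<^esub> s : N U"
 using that a_rcoset_mem_iff[OF presheafD(1)[OF P U] subpresheafD(1)[OF N U] s]
  quot_presheaf_eq_iff[OF U _ s] by auto
 then show ?thesis
 using subpresheafD(2)[OF N U V VU s'(2)] quot_presheaf_eq_iff[OF V]
  module_presheaf_res_map(2)[OF P U V VU s'(1) s] presheafD(2)[OF P U V VU] s by simp
 qed
 moreover have "s : N U +>\<^bsub>sec P U\<^esub> s"
 using a_rcoset_mem_iff[OF presheafD(1)[OF P U] subpresheafD(1)[OF N U] s] s by auto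
 ultimately have "(\<Union>s'\<in>N U +>\<^bsub>sec P U\<^esub> s. N V +>\<^bsub>sec P V\<^esub> res P U V s') = N V +>\<^bsub>sec P V\<^esub> res P U V s"
 by (intro UN_constant_eq ballI)
 then show ?thesis unfolding quot_presheaf_def by simp
qed

lemma quot_presheaf_module: "module_presheaf X (quot_presheaf P N)"
 unfolding module_presheaf_def
proof (intro conjI allI impI)
 fix U assume U: "opn X U"
 show "module (Osec X U) (sec (quot_presheaf P N) U)"
 using quot_module_module[OF presheafD(1)[OF P U] subpresheafD(1)[OF N U]]
 by (simp add: quot_presheaf_def)
next
 have cl: "s \<oplus>\<^bsub>sec P U\<^esub> t : carrier (sec P U)" "r : (cO X U) ==> r \<odot>\<^bsub>sec P U\<^esub> s : carrier (sec P U)"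
 if "opn X U" "s : carrier (sec P U)" "t : carrier (sec P U)" for U r s t
 using module.smult_closed[OF presheafD(1)[OF P that(1)]] that
 abelian_monoid.a_closed[OF abelian_group.axioms(1)[OF presheafD(7)[OF P that(1)]]] by auto
 fix U V assume UV: "opn X U & opn X V & V \<subseteq> U"
 show "ALL s:carrier (sec (quot_presheaf P N) U). res (quot_presheaf P N) U V s : carrier (sec (quot_presheaf P N) V)"
 using UV by (auto simp: quot_presheaf_carrier quot_presheaf_res presheafD(2)[OF P])
 show "ALL s:carrier (sec (quot_presheaf P N) U). ALL t:carrier (sec (quot_presheaf P N) U).
 res (quot_presheaf P N) U V (s \<oplus>\<^bsub>sec (quot_presheaf P N) U\<^esub> t) =
 res (quot_presheaf P N) U V s \<oplus>\<^bsub>sec (quot_presheaf P N) V\<^esub> res (quot_presheaf P N) U V t"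
 using UV by (auto simp: quot_presheaf_carrier quot_presheaf_res quot_presheaf_add cl presheafD(2,3)[OF P])
 show "ALL r:(cO X U). ALL s:carrier (sec (quot_presheaf P N) U).
 res (quot_presheaf P N) U V (r \<odot>\<^bsub>sec (quot_presheaf P N) U\<^esub> s) =
 res (str X) U V r \<odot>\<^bsub>sec (quot_presheaf P N) V\<^esub> res (quot_presheaf P N) U V s"
 proof (intro ballI)
 fix r s assume r: "r : (cO X U)" and "s : carrier (sec (quot_presheaf P N) U)"
 then obtain s' where s': "s' : carrier (sec P U)" "s = N U +>\<^bsub>sec P U\<^esub> s'"
 using UV by (auto simp: quot_presheaf_carrier)
 have "res (str X) U V r : (cO X V)"
 using X UV r by (auto simp: ringedD(3))
 then show "res (quot_presheaf P N) U V (r \<odot>\<^bsub>sec (quot_presheaf P N) U\<^esub> s) =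
 res (str X) U V r \<odot>\<^bsub>sec (quot_presheaf P N) V\<^esub> res (quot_presheaf P N) U V s"
 using UV r s' by (auto simp: quot_presheaf_smult quot_presheaf_res cl presheafD(2,4)[OF P])
 qed
qed (auto simp: quot_presheaf_carrier quot_presheaf_res presheafD(2,5,6)[OF P])

lemma quot_presheaf_finsum:
 assumes U: "opn X U" and I: "finite I" and f: "!!i. i : I ==> f i : carrier (sec P U)"
 shows "finsum (sec (quot_presheaf P N) U) (%i. N U +>\<^bsub>sec P U\<^esub> f i) I = N U +>\<^bsub>sec P U\<^esub> finsum (sec P U) f I"
 by (rule sym, rule finsum_additive_map)
 (use U I f in \<open>auto simp: quot_presheaf_carrier quot_presheaf_add presheafD(7)[OF P]
 presheafD(7)[OF quot_presheaf_module]\<close>)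

lemma sub_presheaf_module_presheaf: "module_presheaf X (sub_presheaf P N)"
proof -
 have s: "N U \<subseteq> carrier (sec P U)" if "opn X U" for U
 using module.submoduleE(1)[OF presheafD(1)[OF P that] subpresheafD(1)[OF N that]] .
 show ?thesis
 unfolding module_presheaf_def
 by (intro conjI allI impI ballI)
 (simp_all add: sub_presheaf_def submodule.submodule_is_module[OF subpresheafD(1)[OF N] presheafD(1)[OF P]]
  subpresheafD(2)[OF N] presheafD(3-6)[OF P] subsetD[OF s])
qed

end

text \<open>\<open>finsum\<close> refers to the carrier, so a sum in \<open>sub_presheaf\<close>,
  which shrinks the carriers, is not literally the sum in the ambient module. The inclusion is
  additive, which identifies the two.\<close>

lemma finsum_carrier_update:
 assumes M: "module R M" and N: "submodule N R M" and I: "finite I" and f: "!!i. i : I ==> f i : N"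
 shows "finsum (M\<lparr>carrier := N\<rparr>) f I = finsum M f I"
 using finsum_additive_map[of "M\<lparr>carrier := N\<rparr>" M I "%x. x" f, OF _ _ I]  f
 module.axioms(2)[OF submodule.submodule_is_module[OF N M]] module.axioms(2)[OF M]
 module.submoduleE(1)[OF M N] by auto

subsection \<open>Duals\<close>

lemma hom_fun_apply [simp]:
 "opn X V ==> V \<subseteq> U ==> c : carrier (sec P V) ==> hom_fun X P U \<phi> V c = \<phi> V c"
 by (simp add: hom_fun_def)

text \<open>\<open>hom_fun\<close> fixes the irrelevant values of a functional; the rule allows the
  conditions to be checked for a raw family \<open>\<phi>\<close> whose other values are
  arbitrary.\<close>

lemma dual_sectionsI:
 assumes "module_presheaf X P" "opn X U"
 and "!!V c. opn X V ==> V \<subseteq> U ==> c : carrier (sec P V) ==> \<phi> V c : (cO X V)"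
 and "!!V c c'. opn X V ==> V \<subseteq> U ==> c : carrier (sec P V) ==> c' : carrier (sec P V) ==>
 \<phi> V (c \<oplus>\<^bsub>sec P V\<^esub> c') = \<phi> V c \<oplus>\<^bsub>Osec X V\<^esub> \<phi> V c'"
 and "!!V r c. opn X V ==> V \<subseteq> U ==> r : (cO X V) ==> c : carrier (sec P V) ==>
 \<phi> V (r \<odot>\<^bsub>sec P V\<^esub> c) = r \<otimes>\<^bsub>Osec X V\<^esub> \<phi> V c"
 and "!!V W c. opn X V ==> V \<subseteq> U ==> opn X W ==> W \<subseteq> V ==> c : carrier (sec P V) ==>
 \<phi> W (res P V W c) = res (str X) V W (\<phi> V c)"
 shows "hom_fun X P U \<phi> : dual_sections X P U"
proof -
 have "hom_fun X P U (hom_fun X P U \<phi>) = hom_fun X P U \<phi>"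
 by (auto simp: hom_fun_def fun_eq_iff)
 moreover have "s \<oplus>\<^bsub>sec P V\<^esub> t : carrier (sec P V)" "r : (cO X V) ==> r \<odot>\<^bsub>sec P V\<^esub> s : carrier (sec P V)"
 if "opn X V" "s : carrier (sec P V)" "t : carrier (sec P V)" for V r s t
 using module.smult_closed[OF presheafD(1)[OF assms(1) that(1)]] that
 abelian_monoid.a_closed[OF abelian_group.axioms(1)[OF presheafD(7)[OF assms(1) that(1)]]] by auto
 ultimately show ?thesis
 unfolding dual_sections_def
 by (intro CollectI conjI allI impI ballI)
 (simp_all add: assms presheafD(2)[OF assms(1)], auto simp: hom_fun_def assms presheafD(2)[OF assms(1)])
qed

context
 fixes X :: "('x, 'r) ringed_space" and P :: "('x, 'r, 'm) mod_presheaf"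
 assumes X: "is_ringed_space X" and P: "module_presheaf X P"
begin

text \<open>The normalisation by \<open>hom_fun\<close> makes functionals equal as HOL functions
  once they agree on the relevant arguments.\<close>

lemma dual_sections_ext:
 assumes "\<phi> : dual_sections X P U" "\<psi> : dual_sections X P U"
 and "!!V c. opn X V ==> V \<subseteq> U ==> c : carrier (sec P V) ==> \<phi> V c = \<psi> V c"
 shows "\<phi> = \<psi>"
proof -
 have e: "hom_fun X P U \<phi> = \<phi>" "hom_fun X P U \<psi> = \<psi>" using assms(1,2) by (auto simp: dual_sections_def)
 have "hom_fun X P U \<phi> = hom_fun X P U \<psi>" using assms(3) by (auto simp: hom_fun_def fun_eq_iff)
 then show ?thesis using e by simp
qed

lemma dualD:
 assumes \<phi>: "\<phi> : dual_sections X P U" and V: "opn X V" "V \<subseteq> U"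
 shows "c : carrier (sec P V) ==> \<phi> V c : (cO X V)"
 and "c : carrier (sec P V) ==> c' : carrier (sec P V) ==>
 \<phi> V (c \<oplus>\<^bsub>sec P V\<^esub> c') = \<phi> V c \<oplus>\<^bsub>Osec X V\<^esub> \<phi> V c'"
 and "r : (cO X V) ==> c : carrier (sec P V) ==>
 \<phi> V (r \<odot>\<^bsub>sec P V\<^esub> c) = r \<otimes>\<^bsub>Osec X V\<^esub> \<phi> V c"
 and "opn X W ==> W \<subseteq> V ==> c : carrier (sec P V) ==>
 \<phi> W (res P V W c) = res (str X) V W (\<phi> V c)"
 and "\<phi> V \<zero>\<^bsub>sec P V\<^esub> = \<zero>\<^bsub>Osec X V\<^esub>"
 and "c : carrier (sec P V) ==> c' : carrier (sec P V) ==>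
 \<phi> V (c \<ominus>\<^bsub>sec P V\<^esub> c') = \<phi> V c \<ominus>\<^bsub>Osec X V\<^esub> \<phi> V c'"
 and "finite I ==> (!!i. i : I ==> f i : carrier (sec P V)) ==>
 \<phi> V (finsum (sec P V) f I) = finsum (Osec X V) (%i. \<phi> V (f i)) I"
proof -
 show a: "c : carrier (sec P V) ==> \<phi> V c : (cO X V)" for c
 using \<phi> V by (simp add: dual_sections_def)
 show b: "c : carrier (sec P V) ==> c' : carrier (sec P V) ==>
 \<phi> V (c \<oplus>\<^bsub>sec P V\<^esub> c') = \<phi> V c \<oplus>\<^bsub>Osec X V\<^esub> \<phi> V c'" for c c'
 using \<phi> V by (simp add: dual_sections_def)
 show "r : (cO X V) ==> c : carrier (sec P V) ==>
 \<phi> V (r \<odot>\<^bsub>sec P V\<^esub> c) = r \<otimes>\<^bsub>Osec X V\<^esub> \<phi> V c"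
 using \<phi> V by (simp add: dual_sections_def)
 show "opn X W ==> W \<subseteq> V ==> c : carrier (sec P V) ==>
 \<phi> W (res P V W c) = res (str X) V W (\<phi> V c)"
 using \<phi> V by (simp add: dual_sections_def)
 note g = presheafD(7)[OF P V(1)] ringedD(11)[OF X V(1)]
 show "\<phi> V \<zero>\<^bsub>sec P V\<^esub> = \<zero>\<^bsub>Osec X V\<^esub>"
 by (rule additive_map_zero[OF g a b])
 show "c : carrier (sec P V) ==> c' : carrier (sec P V) ==>
 \<phi> V (c \<ominus>\<^bsub>sec P V\<^esub> c') = \<phi> V c \<ominus>\<^bsub>Osec X V\<^esub> \<phi> V c'"
 by (rule additive_map_minus[OF g a b])
 show "finite I ==> (!!i. i : I ==> f i : carrier (sec P V)) ==>
 \<phi> V (finsum (sec P V) f I) = finsum (Osec X V) (%i. \<phi> V (f i)) I"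
 by (rule finsum_additive_map[OF g _ a b])
qed

lemma dual_presheaf_simps:
 "carrier (sec (dual_presheaf X P) U) = dual_sections X P U"
 "\<zero>\<^bsub>sec (dual_presheaf X P) U\<^esub> = hom_fun X P U (%V c. \<zero>\<^bsub>Osec X V\<^esub>)"
 "\<phi> \<oplus>\<^bsub>sec (dual_presheaf X P) U\<^esub> \<psi> = hom_fun X P U (%V c. \<phi> V c \<oplus>\<^bsub>Osec X V\<^esub> \<psi> V c)"
 "r \<odot>\<^bsub>sec (dual_presheaf X P) U\<^esub> \<phi> = hom_fun X P U (%V c. res (str X) U V r \<otimes>\<^bsub>Osec X V\<^esub> \<phi> V c)"
 "res (dual_presheaf X P) U V \<phi> = hom_fun X P V \<phi>"
 by (simp_all add: dual_presheaf_def)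

lemma dual_sections_zero:
 assumes U: "opn X U"
 shows "hom_fun X P U (%V c. \<zero>\<^bsub>Osec X V\<^esub>) : dual_sections X P U"
proof (rule dual_sectionsI[OF P U])
 fix V assume V: "opn X V"
 interpret O: cring "Osec X V" by (rule ringedD(2)[OF X V])
 show "\<zero>\<^bsub>Osec X V\<^esub> : (cO X V)" "\<zero>\<^bsub>Osec X V\<^esub> = \<zero>\<^bsub>Osec X V\<^esub> \<oplus>\<^bsub>Osec X V\<^esub> \<zero>\<^bsub>Osec X V\<^esub>"
 by simp_all
 show "r : (cO X V) ==> \<zero>\<^bsub>Osec X V\<^esub> = r \<otimes>\<^bsub>Osec X V\<^esub> \<zero>\<^bsub>Osec X V\<^esub>" for r by simp
qed (simp add: ringedD(7)[OF X])

lemma dual_sections_add: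
 assumes U: "opn X U" and \<phi>: "\<phi> : dual_sections X P U" and \<psi>: "\<psi> : dual_sections X P U"
 shows "hom_fun X P U (%V c. \<phi> V c \<oplus>\<^bsub>Osec X V\<^esub> \<psi> V c) : dual_sections X P U"
proof (rule dual_sectionsI[OF P U])
 fix V assume V: "opn X V" "V \<subseteq> U"
 interpret O: cring "Osec X V" by (rule ringedD(2)[OF X V(1)])
 note D = dualD[OF \<phi> V] dualD[OF \<psi> V]
 show "c : carrier (sec P V) ==> \<phi> V c \<oplus>\<^bsub>Osec X V\<^esub> \<psi> V c : (cO X V)" for c by (simp add: D)
 show "c : carrier (sec P V) ==> c' : carrier (sec P V) ==>
 \<phi> V (c \<oplus>\<^bsub>sec P V\<^esub> c') \<oplus>\<^bsub>Osec X V\<^esub> \<psi> V (c \<oplus>\<^bsub>sec P V\<^esub> c') =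
 \<phi> V c \<oplus>\<^bsub>Osec X V\<^esub> \<psi> V c \<oplus>\<^bsub>Osec X V\<^esub> (\<phi> V c' \<oplus>\<^bsub>Osec X V\<^esub> \<psi> V c')" for c c'
 by (simp add: D O.a_ac)
 show "r : (cO X V) ==> c : carrier (sec P V) ==>
 \<phi> V (r \<odot>\<^bsub>sec P V\<^esub> c) \<oplus>\<^bsub>Osec X V\<^esub> \<psi> V (r \<odot>\<^bsub>sec P V\<^esub> c) =
 r \<otimes>\<^bsub>Osec X V\<^esub> (\<phi> V c \<oplus>\<^bsub>Osec X V\<^esub> \<psi> V c)" for r c
 by (simp add: D O.r_distr)
 show "opn X W ==> W \<subseteq> V ==> c : carrier (sec P V) ==>
 \<phi> W (res P V W c) \<oplus>\<^bsub>Osec X W\<^esub> \<psi> W (res P V W c) = res (str X) V W (\<phi> V c \<oplus>\<^bsub>Osec X V\<^esub> \<psi> V c)" for W c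
 by (simp add: D ringedD(4)[OF X V(1)])
qed

lemma dual_sections_smult:
 assumes U: "opn X U" and \<phi>: "\<phi> : dual_sections X P U" and a: "a : (cO X U)"
 shows "hom_fun X P U (%V c. res (str X) U V a \<otimes>\<^bsub>Osec X V\<^esub> \<phi> V c) : dual_sections X P U"
proof (rule dual_sectionsI[OF P U])
 fix V assume V: "opn X V" "V \<subseteq> U"
 interpret O: cring "Osec X V" by (rule ringedD(2)[OF X V(1)])
 note D = dualD[OF \<phi> V]
 have a': "res (str X) U V a : (cO X V)" by (rule ringedD(3)[OF X U V a])
 show "c : carrier (sec P V) ==> res (str X) U V a \<otimes>\<^bsub>Osec X V\<^esub> \<phi> V c : (cO X V)" for c by (simp add: D a')
 show "c : carrier (sec P V) ==> c' : carrier (sec P V) ==>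
 res (str X) U V a \<otimes>\<^bsub>Osec X V\<^esub> \<phi> V (c \<oplus>\<^bsub>sec P V\<^esub> c') =
 res (str X) U V a \<otimes>\<^bsub>Osec X V\<^esub> \<phi> V c \<oplus>\<^bsub>Osec X V\<^esub> res (str X) U V a \<otimes>\<^bsub>Osec X V\<^esub> \<phi> V c'" for c c'
 by (simp add: D O.r_distr a')
 show "r : (cO X V) ==> c : carrier (sec P V) ==>
 res (str X) U V a \<otimes>\<^bsub>Osec X V\<^esub> \<phi> V (r \<odot>\<^bsub>sec P V\<^esub> c) =
 r \<otimes>\<^bsub>Osec X V\<^esub> (res (str X) U V a \<otimes>\<^bsub>Osec X V\<^esub> \<phi> V c)" for r c
 by (simp add: D O.m_lcomm a')
 show "opn X W ==> W \<subseteq> V ==> c : carrier (sec P V) ==>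
 res (str X) U W a \<otimes>\<^bsub>Osec X W\<^esub> \<phi> W (res P V W c) = res (str X) V W (res (str X) U V a \<otimes>\<^bsub>Osec X V\<^esub> \<phi> V c)" for W c
 by (simp add: D ringedD(5)[OF X V(1)] ringedD(10)[OF X U V(1) _ _ V(2)] a a')
qed

lemma dual_sections_res:
 assumes U: "opn X U" and V: "opn X V" "V \<subseteq> U" and \<phi>: "\<phi> : dual_sections X P U"
 shows "hom_fun X P V \<phi> : dual_sections X P V"
 by (rule dual_sectionsI[OF P V(1)])
 (use V(2) in \<open>auto intro!: dualD(1-3)[OF \<phi>] dualD(4)[OF \<phi>]\<close>)

lemma dual_presheaf_apply:
 assumes V: "opn X V" "V \<subseteq> U" and c: "c : carrier (sec P V)"
 shows "\<zero>\<^bsub>sec (dual_presheaf X P) U\<^esub> V c = \<zero>\<^bsub>Osec X V\<^esub>"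
 and "(\<phi> \<oplus>\<^bsub>sec (dual_presheaf X P) U\<^esub> \<psi>) V c = \<phi> V c \<oplus>\<^bsub>Osec X V\<^esub> \<psi> V c"
 and "(r \<odot>\<^bsub>sec (dual_presheaf X P) U\<^esub> \<phi>) V c = res (str X) U V r \<otimes>\<^bsub>Osec X V\<^esub> \<phi> V c"
 and "res (dual_presheaf X P) U' U \<phi> V c = \<phi> V c"
 using V c by (simp_all add: dual_presheaf_simps)

lemma dual_presheaf_closed:
 assumes U: "opn X U"
 shows "\<zero>\<^bsub>sec (dual_presheaf X P) U\<^esub> : dual_sections X P U"
 and "\<phi> : dual_sections X P U ==> \<psi> : dual_sections X P U ==> \<phi> \<oplus>\<^bsub>sec (dual_presheaf X P) U\<^esub> \<psi> : dual_sections X P U"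
 and "r : (cO X U) ==> \<phi> : dual_sections X P U ==> r \<odot>\<^bsub>sec (dual_presheaf X P) U\<^esub> \<phi> : dual_sections X P U"
 and "opn X V ==> V \<subseteq> U ==> \<phi> : dual_sections X P U ==> res (dual_presheaf X P) U V \<phi> : dual_sections X P V"
 using dual_sections_zero[OF U] dual_sections_add[OF U] dual_sections_smult[OF U] dual_sections_res[OF U]
 by (simp_all add: dual_presheaf_simps)

lemma dual_presheaf_module: "module_presheaf X (dual_presheaf X P)"
 unfolding module_presheaf_def
proof (intro conjI allI impI ballI)
 let ?D = "dual_presheaf X P"
 fix U assume U: "opn X U"
 interpret OU: cring "Osec X U" by (rule ringedD(2)[OF X U])
 note cl = dual_presheaf_closed[OF U]
 have ext: "\<phi> = \<psi>" if "\<phi> : dual_sections X P U" "\<psi> : dual_sections X P U"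
 "!!V c. opn X V ==> V \<subseteq> U ==> c : carrier (sec P V) ==> cring (Osec X V) ==> \<phi> V c = \<psi> V c" for \<phi> \<psi>
 by (rule dual_sections_ext[OF that(1,2)]) (use that(3) ringedD(2)[OF X] in simp)
 show "module (Osec X U) (sec ?D U)"
 proof (intro moduleI abelian_groupI, unfold dual_presheaf_simps(1))
 show "cring (Osec X U)" by (rule ringedD(2)[OF X U])
 show "\<zero>\<^bsub>sec ?D U\<^esub> : dual_sections X P U" by (rule cl)
 fix \<phi> assume \<phi>: "\<phi> : dual_sections X P U"
 show "\<zero>\<^bsub>sec ?D U\<^esub> \<oplus>\<^bsub>sec ?D U\<^esub> \<phi> = \<phi>"
 by (rule ext) (auto simp: cl \<phi> dual_presheaf_apply dualD[OF \<phi>] cring.cring_simprules)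
 show "\<one>\<^bsub>Osec X U\<^esub> \<odot>\<^bsub>sec ?D U\<^esub> \<phi> = \<phi>"
 by (rule ext) (auto simp: cl \<phi> U dual_presheaf_apply dualD[OF \<phi>] ringedD(6)[OF X U] cring.cring_simprules(12))
 \<comment> \<open>The inverse of \<open>\<phi>\<close> is \<open>\<phi>\<close> scaled by minus
   one; for this the restriction of minus one to \<open>V\<close> has to be recognised as minus one
   again.\<close>
 show "EX y:dual_sections X P U. y \<oplus>\<^bsub>sec ?D U\<^esub> \<phi> = \<zero>\<^bsub>sec ?D U\<^esub>"
 proof (intro bexI ext)
 show m: "(\<ominus>\<^bsub>Osec X U\<^esub> \<one>\<^bsub>Osec X U\<^esub>) \<odot>\<^bsub>sec ?D U\<^esub> \<phi> : dual_sections X P U" by (simp add: cl \<phi>)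
 fix V c assume V: "opn X V" "V \<subseteq> U" and c: "c : carrier (sec P V)"
 interpret OV: cring "Osec X V" by (rule ringedD(2)[OF X V(1)])
 have "\<ominus>\<^bsub>Osec X U\<^esub> \<one>\<^bsub>Osec X U\<^esub> = \<zero>\<^bsub>Osec X U\<^esub> \<ominus>\<^bsub>Osec X U\<^esub> \<one>\<^bsub>Osec X U\<^esub>" by (simp add: OU.minus_eq)
 then have "res (str X) U V (\<ominus>\<^bsub>Osec X U\<^esub> \<one>\<^bsub>Osec X U\<^esub>) = \<ominus>\<^bsub>Osec X V\<^esub> \<one>\<^bsub>Osec X V\<^esub>"
  by (simp add: ringedD(6-8)[OF X U V] OV.minus_eq)
 then show "((\<ominus>\<^bsub>Osec X U\<^esub> \<one>\<^bsub>Osec X U\<^esub>) \<odot>\<^bsub>sec ?D U\<^esub> \<phi> \<oplus>\<^bsub>sec ?D U\<^esub> \<phi>) V c = \<zero>\<^bsub>sec ?D U\<^esub> V c"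
  using V c by (simp add: dual_presheaf_apply dualD[OF \<phi>] OV.l_minus OV.l_neg)
 qed (auto simp: cl \<phi>)
 {
 fix a b assume a: "a : (cO X U)" and b: "b : (cO X U)"
 show "(a \<oplus>\<^bsub>Osec X U\<^esub> b) \<odot>\<^bsub>sec ?D U\<^esub> \<phi> = a \<odot>\<^bsub>sec ?D U\<^esub> \<phi> \<oplus>\<^bsub>sec ?D U\<^esub> b \<odot>\<^bsub>sec ?D U\<^esub> \<phi>"
  by (rule ext) (auto simp: cl \<phi> a b U dual_presheaf_apply dualD[OF \<phi>]
  ringedD(3,4)[OF X U] cring.cring_simprules)
 show "(a \<otimes>\<^bsub>Osec X U\<^esub> b) \<odot>\<^bsub>sec ?D U\<^esub> \<phi> = a \<odot>\<^bsub>sec ?D U\<^esub> (b \<odot>\<^bsub>sec ?D U\<^esub> \<phi>)"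
  by (rule ext) (auto simp: cl \<phi> a b U dual_presheaf_apply dualD[OF \<phi>]
  ringedD(3,5)[OF X U] cring.cring_simprules)
 }
 fix \<psi> assume \<psi>: "\<psi> : dual_sections X P U"
 show "\<phi> \<oplus>\<^bsub>sec ?D U\<^esub> \<psi> = \<psi> \<oplus>\<^bsub>sec ?D U\<^esub> \<phi>"
 by (rule ext) (auto simp: cl \<phi> \<psi> dual_presheaf_apply dualD[OF \<phi>] dualD[OF \<psi>] cring.cring_simprules)
 {
 fix a assume a: "a : (cO X U)"
 show "a \<odot>\<^bsub>sec ?D U\<^esub> (\<phi> \<oplus>\<^bsub>sec ?D U\<^esub> \<psi>) = a \<odot>\<^bsub>sec ?D U\<^esub> \<phi> \<oplus>\<^bsub>sec ?D U\<^esub> a \<odot>\<^bsub>sec ?D U\<^esub> \<psi>"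
  by (rule ext) (auto simp: cl \<phi> \<psi> a U dual_presheaf_apply dualD[OF \<phi>] dualD[OF \<psi>]
  ringedD(3)[OF X U] cring.cring_simprules)
 }
 fix \<theta> assume \<theta>: "\<theta> : dual_sections X P U"
 show "\<phi> \<oplus>\<^bsub>sec ?D U\<^esub> \<psi> \<oplus>\<^bsub>sec ?D U\<^esub> \<theta> = \<phi> \<oplus>\<^bsub>sec ?D U\<^esub> (\<psi> \<oplus>\<^bsub>sec ?D U\<^esub> \<theta>)"
 by (rule ext) (auto simp: cl \<phi> \<psi> \<theta> dual_presheaf_apply dualD[OF \<phi>] dualD[OF \<psi>]
  dualD[OF \<theta>] cring.cring_simprules)
 qed (simp_all add: cl)
next
 let ?D = "dual_presheaf X P"
 fix U V assume UV: "opn X U & opn X V & V \<subseteq> U"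
 then have U: "opn X U" and V: "opn X V" "V \<subseteq> U" by auto
 note cl = dual_presheaf_closed[OF U] dual_presheaf_closed[OF V(1)]
 have ext: "\<phi> = \<psi>" if "\<phi> : dual_sections X P V" "\<psi> : dual_sections X P V"
 "!!W c. opn X W ==> W \<subseteq> V ==> W \<subseteq> U ==> c : carrier (sec P W) ==> \<phi> W c = \<psi> W c" for \<phi> \<psi>
 by (rule dual_sections_ext[OF that(1,2)]) (use that(3) V in auto)
 fix \<phi> assume "\<phi> : carrier (sec ?D U)"
 then have \<phi>: "\<phi> : dual_sections X P U" by (simp add: dual_presheaf_simps)
 show "res ?D U V \<phi> : carrier (sec ?D V)" using cl(4)[OF V \<phi>] by (simp add: dual_presheaf_simps)
 {
 fix \<psi> assume "\<psi> : carrier (sec ?D U)"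
 then have \<psi>: "\<psi> : dual_sections X P U" by (simp add: dual_presheaf_simps)
 show "res ?D U V (\<phi> \<oplus>\<^bsub>sec ?D U\<^esub> \<psi>) = res ?D U V \<phi> \<oplus>\<^bsub>sec ?D V\<^esub> res ?D U V \<psi>"
 by (rule ext) (auto simp: cl \<phi> \<psi> V dual_presheaf_apply)
 }
next
 let ?D = "dual_presheaf X P"
 fix U V r \<phi> assume UV: "opn X U & opn X V & V \<subseteq> U" and r: "r : (cO X U)" and "\<phi> : carrier (sec ?D U)"
 then have U: "opn X U" and V: "opn X V" "V \<subseteq> U" and \<phi>: "\<phi> : dual_sections X P U" by (auto simp: dual_presheaf_simps)
 note cl = dual_presheaf_closed[OF U] dual_presheaf_closed[OF V(1)]
 have r': "res (str X) U V r : (cO X V)" by (rule ringedD(3)[OF X U V r])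
 show "res ?D U V (r \<odot>\<^bsub>sec ?D U\<^esub> \<phi>) = res (str X) U V r \<odot>\<^bsub>sec ?D V\<^esub> res ?D U V \<phi>"
 proof (rule dual_sections_ext[where U = V])
 fix W c assume W: "opn X W" "W \<subseteq> V" "c : carrier (sec P W)"
 then show "res ?D U V (r \<odot>\<^bsub>sec ?D U\<^esub> \<phi>) W c = (res (str X) U V r \<odot>\<^bsub>sec ?D V\<^esub> res ?D U V \<phi>) W c"
 using V ringedD(10)[OF X U V(1) W(1,2) V(2) r] by (simp add: dual_presheaf_apply)
 qed (simp_all add: cl \<phi> r r' V)
next
 let ?D = "dual_presheaf X P"
 fix U \<phi> assume U: "opn X U" and "\<phi> : carrier (sec ?D U)"
 then show "res ?D U U \<phi> = \<phi>" by (simp add: dual_presheaf_simps dual_sections_def)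
next
 let ?D = "dual_presheaf X P"
 fix U V W \<phi> assume "opn X U & opn X V & opn X W & W \<subseteq> V & V \<subseteq> U" and "\<phi> : carrier (sec ?D U)"
 then show "res ?D V W (res ?D U V \<phi>) = res ?D U W \<phi>" by (auto simp: dual_presheaf_simps hom_fun_def fun_eq_iff)
qed

lemma dual_presheaf_finsum:
 assumes U: "opn X U" and V: "opn X V" "V \<subseteq> U" and c: "c : carrier (sec P V)"
 and I: "finite I" and f: "!!i. i : I ==> f i : dual_sections X P U"
 shows "finsum (sec (dual_presheaf X P) U) f I V c = finsum (Osec X V) (%i. f i V c) I"
 by (rule finsum_additive_map[where h = "%\<phi>. \<phi> V c"])
 (use V c I f in \<open>simp_all add: presheafD(7)[OF dual_presheaf_module] U ringedD(11)[OF X]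
 dual_presheaf_simps(1) dual_presheaf_apply dualD(1)\<close>)

lemma dual_presheaf_minus:
 assumes U: "opn X U" and V: "opn X V" "V \<subseteq> U" and c: "c : carrier (sec P V)"
 and \<phi>: "\<phi> : dual_sections X P U" and \<psi>: "\<psi> : dual_sections X P U"
 shows "(\<phi> \<ominus>\<^bsub>sec (dual_presheaf X P) U\<^esub> \<psi>) V c = \<phi> V c \<ominus>\<^bsub>Osec X V\<^esub> \<psi> V c"
 by (rule additive_map_minus[where h = "%\<phi>. \<phi> V c"])
 (use V c \<phi> \<psi> in \<open>simp_all add: presheafD(7)[OF dual_presheaf_module] U ringedD(11)[OF X]
 dual_presheaf_simps(1) dual_presheaf_apply dualD(1)\<close>)

end

subsection \<open>Local bases\<close>

text \<open>The bases constructed below are indexed by sets of chosen contractions, which carry no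
  natural numbering. This is \<open>is_local_basis\<close> over an arbitrary index set;
  \<open>is_basis_on_reindex\<close> leads back to numbers.\<close>

definition is_basis_on ::
 "('x, 'r) ringed_space => ('x, 'r, 'm) mod_presheaf => 'x set => 'j set => ('j => 'm) => bool" where
 "is_basis_on X P U J e \<longleftrightarrow>
 (ALL j:J. e j : carrier (sec P U)) &
 (ALL V. opn X V & V \<subseteq> U -->
 (ALL c. (ALL j:J. c j : (cO X V)) &
  finsum (sec P V) (%j. c j \<odot>\<^bsub>sec P V\<^esub> res P U V (e j)) J = \<zero>\<^bsub>sec P V\<^esub> -->
  (ALL j:J. c j = \<zero>\<^bsub>Osec X V\<^esub>)) &
 (ALL s:carrier (sec P V). ALL y:V. EX W c. opn X W & y : W & W \<subseteq> V &
  (ALL j:J. c j : (cO X W)) &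
  res P V W s = finsum (sec P W) (%j. c j \<odot>\<^bsub>sec P W\<^esub> res P U W (e j)) J))"

lemma is_local_basis_iff_on: "is_local_basis X P U n e \<longleftrightarrow> is_basis_on X P U {..<n} e"
 by (simp add: is_local_basis_def is_basis_on_def Ball_def)

lemma is_basis_onD:
 assumes e: "is_basis_on X P U J e" and V: "opn X V" "V \<subseteq> U"
 shows "(ALL i:J. c i : (cO X V)) ==>
 finsum (sec P V) (%i. c i \<odot>\<^bsub>sec P V\<^esub> res P U V (e i)) J = \<zero>\<^bsub>sec P V\<^esub> ==> i : J ==>
 c i = \<zero>\<^bsub>Osec X V\<^esub>"
 and "s : carrier (sec P V) ==> y : V ==> EX W c. opn X W & y : W & W \<subseteq> V &
  (ALL i:J. c i : (cO X W)) &
  res P V W s = finsum (sec P W) (%i. c i \<odot>\<^bsub>sec P W\<^esub> res P U W (e i)) J"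
proof -
 let ?I = "%V c. (ALL i:J. c i : (cO X V)) &
  finsum (sec P V) (%i. c i \<odot>\<^bsub>sec P V\<^esub> res P U V (e i)) J = \<zero>\<^bsub>sec P V\<^esub> -->
  (ALL i:J. c i = \<zero>\<^bsub>Osec X V\<^esub>)"
 let ?S = "%V s y. EX W c. opn X W & y : W & W \<subseteq> V &
  (ALL i:J. c i : (cO X W)) &
  res P V W s = finsum (sec P W) (%i. c i \<odot>\<^bsub>sec P W\<^esub> res P U W (e i)) J"
 have "ALL V. opn X V & V \<subseteq> U --> (ALL c. ?I V c) & (ALL s:carrier (sec P V). ALL y:V. ?S V s y)"
 using e unfolding is_basis_on_def by (rule conjunct2)
 then have "opn X V & V \<subseteq> U --> (ALL c. ?I V c) & (ALL s:carrier (sec P V). ALL y:V. ?S V s y)"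
 by (rule spec)
 then have E: "(ALL c. ?I V c) & (ALL s:carrier (sec P V). ALL y:V. ?S V s y)"
 using V by iprover
 from E have "ALL c. ?I V c" by (rule conjunct1)
 then have I: "?I V c" by (rule spec)
 show "c i = \<zero>\<^bsub>Osec X V\<^esub>" if "ALL i:J. c i : (cO X V)"
 "finsum (sec P V) (%i. c i \<odot>\<^bsub>sec P V\<^esub> res P U V (e i)) J = \<zero>\<^bsub>sec P V\<^esub>" "i : J"
 by (rule bspec[OF mp[OF I conjI[OF that(1,2)]] that(3)])
 from E have S: "ALL s:carrier (sec P V). ALL y:V. ?S V s y" by (rule conjunct2)
 assume "s : carrier (sec P V)" "y : V"
 then show "?S V s y" by (rule bspec[OF bspec[OF S]])
qed

lemma is_local_basisD:
 assumes e: "is_local_basis X P U n e" and V: "opn X V" "V \<subseteq> U"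
 shows "(ALL i<n. c i : (cO X V)) ==>
 finsum (sec P V) (%i. c i \<odot>\<^bsub>sec P V\<^esub> res P U V (e i)) {..<n} = \<zero>\<^bsub>sec P V\<^esub> ==> i < n ==>
 c i = \<zero>\<^bsub>Osec X V\<^esub>"
 and "s : carrier (sec P V) ==> y : V ==> EX W c. opn X W & y : W & W \<subseteq> V &
  (ALL i<n. c i : (cO X W)) &
  res P V W s = finsum (sec P W) (%i. c i \<odot>\<^bsub>sec P W\<^esub> res P U W (e i)) {..<n}"
 using is_basis_onD(1)[OF e[unfolded is_local_basis_iff_on] V, of c i] is_basis_onD(2)[OF e[unfolded is_local_basis_iff_on] V, of s y]
 by (simp_all add: Ball_def)

lemma is_basis_on_reindex:
 assumes P: "module_presheaf X P" and U: "opn X U"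
 and J: "bij_betw h I J" and e: "is_basis_on X P U J e"
 shows "is_basis_on X P U I (e \<circ> h)"
proof -
 have eJ: "!!j. j : J ==> e j : carrier (sec P U)" using e by (simp add: is_basis_on_def)
 have inj: "inj_on h I" and im: "h ` I = J" using J by (auto simp: bij_betw_def)
 have sum: "finsum (sec P V) (%i. c (h i) \<odot>\<^bsub>sec P V\<^esub> res P U V ((e \<circ> h) i)) I =
 finsum (sec P V) (%j. c j \<odot>\<^bsub>sec P V\<^esub> res P U V (e j)) J"
 if V: "opn X V" "V \<subseteq> U" and c: "!!j. j : J ==> c j : (cO X V)" for V c
 proof -
 interpret module "Osec X V" "sec P V" by (rule presheafD(1)[OF P V(1)])
 have "(%j. c j \<odot>\<^bsub>sec P V\<^esub> res P U V (e j)) : h ` I \<rightarrow> carrier (sec P V)"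
 using c eJ im by (auto intro!: smult_closed presheafD(2)[OF P U V])
 from finsum_reindex[OF this inj] show ?thesis by (simp add: im)
 qed
 show ?thesis
 unfolding is_basis_on_def
 proof (intro conjI allI impI ballI)
 show "!!i. i : I ==> (e \<circ> h) i : carrier (sec P U)" using eJ im by auto
 fix V assume V: "opn X V & V \<subseteq> U"
 {
 fix c i assume c: "(ALL i:I. c i : (cO X V)) &
  finsum (sec P V) (%i. c i \<odot>\<^bsub>sec P V\<^esub> res P U V ((e \<circ> h) i)) I = \<zero>\<^bsub>sec P V\<^esub>" and i: "i : I"
 define c' where "c' = c \<circ> the_inv_into I h"
 have c'h: "c' (h i) = c i" if "i : I" for i using that by (simp add: c'_def the_inv_into_f_f[OF inj])
 have c'J: "c' j : (cO X V)" if "j : J" for j using that c c'h im by auto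
 have "finsum (sec P V) (%i. c' (h i) \<odot>\<^bsub>sec P V\<^esub> res P U V ((e \<circ> h) i)) I =
  finsum (sec P V) (%i. c i \<odot>\<^bsub>sec P V\<^esub> res P U V ((e \<circ> h) i)) I"
 proof -
  interpret module "Osec X V" "sec P V" using presheafD(1)[OF P] V by auto
  show ?thesis
  using c V eJ im by (intro finsum_cong') (auto simp: c'h intro!: smult_closed presheafD(2)[OF P U])
 qed
 then have "finsum (sec P V) (%j. c' j \<odot>\<^bsub>sec P V\<^esub> res P U V (e j)) J = \<zero>\<^bsub>sec P V\<^esub>"
  using sum[of V c'] c c'J V by simp
 then have "c' (h i) = \<zero>\<^bsub>Osec X V\<^esub>"
  using is_basis_onD(1)[OF e, of V c' "h i"] V c'J i im by auto
 then show "c i = \<zero>\<^bsub>Osec X V\<^esub>" using c'h[OF i] by simp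
 }
 fix s y assume "s : carrier (sec P V)" "y : V"
 then obtain W c where W: "opn X W" "y : W" "W \<subseteq> V" "ALL j:J. c j : (cO X W)"
  "res P V W s = finsum (sec P W) (%j. c j \<odot>\<^bsub>sec P W\<^esub> res P U W (e j)) J"
 using is_basis_onD(2)[OF e, of V s y] V by blast
 then show "EX W c. opn X W & y : W & W \<subseteq> V &
  (ALL i:I. c i : (cO X W)) &
  res P V W s = finsum (sec P W) (%i. c i \<odot>\<^bsub>sec P W\<^esub> res P U W ((e \<circ> h) i)) I"
 using sum[of W c] V im by (intro exI[of _ W] exI[of _ "%i. c (h i)"]) auto
 qed
qed

lemma is_basis_on_locally_free_rank:
 assumes P: "module_presheaf X P" and J: "finite J" and e: "is_basis_on X P (topspace (pts X)) J e"
 shows "locally_free_rank X P (int (card J))"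
proof -
 obtain h where h: "bij_betw h {..<card J} J" using J by (metis bij_betw_from_nat_into_finite)
 have "is_local_basis X P (topspace (pts X)) (nat (int (card J))) (e \<circ> h)"
 using is_basis_on_reindex[OF P openin_topspace h e] by (simp add: is_local_basis_iff_on)
 then show ?thesis unfolding locally_free_rank_def by (auto intro!: exI[of _ "topspace (pts X)"])
qed

lemma locally_free_rank_imp_finite: "locally_free_rank X P r ==> locally_free_finite X P"
 unfolding locally_free_rank_def locally_free_finite_def by blast

lemma is_local_basis_restrict:
 assumes P: "module_presheaf X P" and U: "opn X U" and V: "opn X V" "V \<subseteq> U"
 and e: "is_local_basis X P U n e"
 shows "is_local_basis X P V n (%i. res P U V (e i))"
proof -
 have ei: "e i : carrier (sec P U)" if "i < n" for i using e that by (simp add: is_local_basis_def)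
 have sum: "finsum (sec P W) (%i. c i \<odot>\<^bsub>sec P W\<^esub> res P V W (res P U V (e i))) {..<n} =
 finsum (sec P W) (%i. c i \<odot>\<^bsub>sec P W\<^esub> res P U W (e i)) {..<n}"
 if W: "opn X W" "W \<subseteq> V" and c: "ALL i<n. c i : (cO X W)" for W c
 proof -
 interpret module "Osec X W" "sec P W" by (rule presheafD(1)[OF P W(1)])
 show ?thesis
 using c ei W V by (intro finsum_cong')
 (auto simp: presheafD(6)[OF P U V(1) W(1,2) V(2)] intro!: smult_closed presheafD(2)[OF P U])
 qed
 show ?thesis
 unfolding is_local_basis_def
 proof (intro conjI allI impI ballI)
 show "!!i. i < n ==> res P U V (e i) : carrier (sec P V)" using ei presheafD(2)[OF P U V] by simp
 fix W assume W: "opn X W & W \<subseteq> V"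
 {
 fix c i assume c: "(ALL i<n. c i : (cO X W)) &
  finsum (sec P W) (%i. c i \<odot>\<^bsub>sec P W\<^esub> res P V W (res P U V (e i))) {..<n} = \<zero>\<^bsub>sec P W\<^esub>" and i: "i < n"
 then have "finsum (sec P W) (%i. c i \<odot>\<^bsub>sec P W\<^esub> res P U W (e i)) {..<n} = \<zero>\<^bsub>sec P W\<^esub>"
  using sum[of W c] W by metis
 moreover have "W \<subseteq> U" using W V by auto
 ultimately show "c i = \<zero>\<^bsub>Osec X W\<^esub>" using is_local_basisD(1)[OF e, of W c i] c i W by auto
 }
 fix s y assume s: "s : carrier (sec P W)" "y : W"
 have "W \<subseteq> U" using W V by auto
 then obtain W' c where W': "opn X W'" "y : W'" "W' \<subseteq> W" "ALL i<n. c i : (cO X W')"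
  "res P W W' s = finsum (sec P W') (%i. c i \<odot>\<^bsub>sec P W'\<^esub> res P U W' (e i)) {..<n}"
 using is_local_basisD(2)[OF e _ _ s] W by blast
 then show "EX W' c. opn X W' & y : W' & W' \<subseteq> W &
  (ALL i<n. c i : (cO X W')) &
  res P W W' s = finsum (sec P W') (%i. c i \<odot>\<^bsub>sec P W'\<^esub> res P V W' (res P U V (e i))) {..<n}"
 using sum[of W' c] W by (intro exI[of _ W'] exI[of _ c]) auto
 qed
qed

section \<open>Coordinate functionals of a local basis\<close>

context
 fixes X :: "('x, 'r) ringed_space" and P :: "('x, 'r, 'm) mod_presheaf"
 and U :: "'x set" and n :: nat and e :: "nat => 'm"
 assumes X: "is_ringed_space X" and P: "module_presheaf X P" and U: "opn X U"
 and e: "is_local_basis X P U n e"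
begin

private definition lin :: "'x set => (nat => 'r) => 'm" where
 "lin V c = finsum (sec P V) (%i. c i \<odot>\<^bsub>sec P V\<^esub> res P U V (e i)) {..<n}"

private definition coefs :: "'x set => (nat => 'r) => bool" where
 "coefs V c \<longleftrightarrow> (ALL i<n. c i : (cO X V))"

text \<open>Spanning is a local property, so \<open>s\<close> need not be a combination of the basis
  on all of \<open>V\<close>. Its coordinates are nevertheless sections of the structure sheaf on
  all of \<open>V\<close>, required to represent \<open>s\<close> near each point.\<close>

private definition coords :: "'x set => 'm => (nat => 'r) => bool" where
 "coords V s c \<longleftrightarrow> coefs V c & (ALL y:V. EX W. opn X W & y : W & W \<subseteq> V &
 res P V W s = lin W (%i. res (str X) V W (c i)))"

private lemma basis_closed: "opn X V ==> V \<subseteq> U ==> i < n ==> res P U V (e i) : carrier (sec P V)"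
 using e presheafD(2)[OF P U] by (simp add: is_local_basis_def)

private lemma lin_closed:
 assumes "opn X V" "V \<subseteq> U" "coefs V c"
 shows "lin V c : carrier (sec P V)"
proof -
 interpret module "Osec X V" "sec P V" by (rule presheafD(1)[OF P assms(1)])
 show ?thesis unfolding lin_def using assms by (auto simp: coefs_def intro!: M.finsum_closed smult_closed basis_closed)
qed

private lemma coefs_res:
 "opn X V ==> opn X W ==> W \<subseteq> V ==> coefs V c ==> coefs W (%i. res (str X) V W (c i))"
 by (simp add: coefs_def ringedD(3)[OF X])

private lemma lin_res:
 assumes V: "opn X V" "V \<subseteq> U" and W: "opn X W" "W \<subseteq> V" and c: "coefs V c"
 shows "res P V W (lin V c) = lin W (%i. res (str X) V W (c i))"
proof -
 interpret V: module "Osec X V" "sec P V" by (rule presheafD(1)[OF P V(1)])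
 interpret W: module "Osec X W" "sec P W" by (rule presheafD(1)[OF P W(1)])
 have cl: "!!i. i : {..<n} ==> c i \<odot>\<^bsub>sec P V\<^esub> res P U V (e i) : carrier (sec P V)"
 using c by (auto simp: coefs_def intro!: V.smult_closed basis_closed V)
 show ?thesis
 unfolding lin_def
 proof (subst module_presheaf_res_map(3)[OF P V(1) W finite_lessThan cl], assumption, rule W.finsum_cong')
 show "(%i. res (str X) V W (c i) \<odot>\<^bsub>sec P W\<^esub> res P U W (e i)) : {..<n} \<rightarrow> carrier (sec P W)"
 using c V W by (auto simp: coefs_def ringedD(3)[OF X] intro!: W.smult_closed basis_closed)
 fix i assume "i : {..<n}"
 then show "res P V W (c i \<odot>\<^bsub>sec P V\<^esub> res P U V (e i)) = res (str X) V W (c i) \<odot>\<^bsub>sec P W\<^esub> res P U W (e i)"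
 using c V W e basis_closed[OF V]
 by (simp add: coefs_def presheafD(4)[OF P] presheafD(6)[OF P U V(1) W V(2)] is_local_basis_def)
 qed simp
qed

private lemma lin_add:
 assumes V: "opn X V" "V \<subseteq> U" and c: "coefs V c" and d: "coefs V d"
 shows "lin V (%i. c i \<oplus>\<^bsub>Osec X V\<^esub> d i) = lin V c \<oplus>\<^bsub>sec P V\<^esub> lin V d"
proof -
 interpret V: module "Osec X V" "sec P V" by (rule presheafD(1)[OF P V(1)])
 have cl: "(%i. c i \<odot>\<^bsub>sec P V\<^esub> res P U V (e i)) : {..<n} \<rightarrow> carrier (sec P V)"
 "(%i. d i \<odot>\<^bsub>sec P V\<^esub> res P U V (e i)) : {..<n} \<rightarrow> carrier (sec P V)"
 using c d by (auto simp: coefs_def intro!: V.smult_closed basis_closed V)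
 show ?thesis
 unfolding lin_def V.finsum_addf[OF cl, symmetric]
 using cl c d by (intro V.finsum_cong') (auto simp: coefs_def V.smult_l_distr basis_closed V)
qed

private lemma lin_smult:
 assumes V: "opn X V" "V \<subseteq> U" and c: "coefs V c" and r: "r : (cO X V)"
 shows "lin V (%i. r \<otimes>\<^bsub>Osec X V\<^esub> c i) = r \<odot>\<^bsub>sec P V\<^esub> lin V c"
proof -
 interpret V: module "Osec X V" "sec P V" by (rule presheafD(1)[OF P V(1)])
 have cl: "(%i. c i \<odot>\<^bsub>sec P V\<^esub> res P U V (e i)) : {..<n} \<rightarrow> carrier (sec P V)"
 using c by (auto simp: coefs_def intro!: V.smult_closed basis_closed V)
 show ?thesis
 unfolding lin_def V.finsum_smult_ldistr[OF finite_lessThan r cl]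
 using cl c r by (intro V.finsum_cong') (auto simp: coefs_def V.smult_assoc1 basis_closed V)
qed

private lemma lin_inj:
 assumes V: "opn X V" "V \<subseteq> U" and c: "coefs V c" and d: "coefs V d" and eq: "lin V c = lin V d" and i: "i < n"
 shows "c i = d i"
proof -
 interpret V: module "Osec X V" "sec P V" by (rule presheafD(1)[OF P V(1)])
 let ?m = "%i. c i \<ominus>\<^bsub>Osec X V\<^esub> d i"
 have m: "coefs V ?m" using c d by (simp add: coefs_def)
 have "lin V (%i. ?m i \<oplus>\<^bsub>Osec X V\<^esub> d i) = lin V c"
 unfolding lin_def using c d
 by (intro V.finsum_cong') (auto simp: coefs_def V.R.minus_add_cancel basis_closed V)
 then have "lin V ?m \<oplus>\<^bsub>sec P V\<^esub> lin V d = lin V d"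
 using lin_add[OF V m d] eq by simp
 then have "lin V ?m = \<zero>\<^bsub>sec P V\<^esub>"
 using lin_closed[OF V m] lin_closed[OF V d] by (metis V.M.add.r_cancel_one')
 then have "ALL i<n. ?m i = \<zero>\<^bsub>Osec X V\<^esub>"
 using is_local_basisD(1)[OF e V, of ?m] m unfolding coefs_def lin_def by blast
 then show ?thesis using V.R.minus_eq_zero_iff c d i by (simp add: coefs_def)
qed

private lemma coords_local:
 assumes V: "opn X V" "V \<subseteq> U" and s: "s : carrier (sec P V)" and c: "coords V s c"
 and y: "y : V" "opn X W0" "y : W0"
 shows "EX W. opn X W & y : W & W \<subseteq> V \<inter> W0 & res P V W s = lin W (%i. res (str X) V W (c i))"
proof -
 obtain W where W: "opn X W" "y : W" "W \<subseteq> V" "res P V W s = lin W (%i. res (str X) V W (c i))"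
 using c y by (auto simp: coords_def)
 have O: "opn X (W \<inter> W0)" using W y by auto
 have cW: "coefs W (%i. res (str X) V W (c i))" "coefs V c" using c coefs_res[OF V(1) W(1,3)] by (auto simp: coords_def)
 have "res P V (W \<inter> W0) s = res P W (W \<inter> W0) (res P V W s)"
 using presheafD(6)[OF P V(1) W(1) O _ W(3) s] by simp
 also have "\<dots> = lin (W \<inter> W0) (%i. res (str X) W (W \<inter> W0) (res (str X) V W (c i)))"
 using lin_res[OF W(1) _ O _ cW(1)] W V by auto
 also have "\<dots> = lin (W \<inter> W0) (%i. res (str X) V (W \<inter> W0) (c i))"
 proof -
 interpret M: module "Osec X (W \<inter> W0)" "sec P (W \<inter> W0)" by (rule presheafD(1)[OF P O])
 have "W \<inter> W0 \<subseteq> U" "W \<inter> W0 \<subseteq> V" using W V by auto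
 then show ?thesis
 unfolding lin_def using cW(2)
 by (intro M.finsum_cong')
  (auto simp: coefs_def ringedD(10)[OF X V(1) W(1) O _ W(3)] ringedD(3)[OF X V(1) O]
  intro!: M.smult_closed basis_closed[OF O])
 qed
 finally show ?thesis using O W y by (intro exI[of _ "W \<inter> W0"]) auto
qed

text \<open>Independence of the basis compares the two families on small open sets, and
  separatedness of the structure sheaf does the rest.\<close>

private lemma coords_unique:
 assumes V: "opn X V" "V \<subseteq> U" and s: "s : carrier (sec P V)" and c: "coords V s c" and d: "coords V s d"
 and i: "i < n"
 shows "c i = d i"
proof (rule is_sheaf_separated[OF ringedD(1)[OF X] V(1)])
 show ci: "c i : (cO X V)" "d i : (cO X V)" using c d i by (auto simp: coords_def coefs_def)
 fix y assume y: "y : V"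
 obtain W where W: "opn X W" "y : W" "W \<subseteq> V" "res P V W s = lin W (%i. res (str X) V W (c i))"
 using c y by (auto simp: coords_def)
 obtain W' where W': "opn X W'" "y : W'" "W' \<subseteq> V \<inter> W" "res P V W' s = lin W' (%i. res (str X) V W' (d i))"
 using coords_local[OF V s d y W(1,2)] by auto
 have cW: "coefs W (%i. res (str X) V W (c i))" "coefs V c" "coefs V d" using c d coefs_res[OF V(1) W(1,3)] by (auto simp: coords_def)
 have sub: "W' \<subseteq> W" "W' \<subseteq> V" "W' \<subseteq> U" "W \<subseteq> U" using W' W V by auto
 have "lin W' (%i. res (str X) V W' (d i)) = res P W W' (res P V W s)"
 using presheafD(6)[OF P V(1) W(1) W'(1) sub(1) W(3) s] W' by simp
 also have "\<dots> = lin W' (%i. res (str X) W W' (res (str X) V W (c i)))"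
 using lin_res[OF W(1) sub(4) W'(1) sub(1) cW(1)] W by simp
 finally have "res (str X) V W' (d i) = res (str X) W W' (res (str X) V W (c i))"
 using lin_inj[OF W'(1) sub(3) coefs_res[OF V(1) W'(1) sub(2) cW(3)] coefs_res[OF W(1) W'(1) sub(1) cW(1)] _ i] by simp
 then have "res (str X) V W' (c i) = res (str X) V W' (d i)"
 using ringedD(10)[OF X V(1) W(1) W'(1) sub(1) W(3) ci(1)] by simp
 then show "EX W. opn X W & y : W & W \<subseteq> V & res (str X) V W (c i) = res (str X) V W (d i)"
 using W' sub by blast
qed

text \<open>Local coefficients agree on overlaps by independence of the basis, hence glue. The
  gluing takes place in the structure sheaf, so \<open>P\<close> itself may be a presheaf.\<close>

private lemma coords_exist:
 assumes V: "opn X V" "V \<subseteq> U" and s: "s : carrier (sec P V)"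
 shows "EX c. coords V s c"
proof -
 define good where "good W c \<longleftrightarrow> opn X W & W \<subseteq> V & coefs W c & res P V W s = lin W c" for W c
 define \<U> where "\<U> = {W. EX c. good W c}"
 define cc where "cc W = (SOME c. good W c)" for W
 have cc: "good W (cc W)" if "W : \<U>" for W
 using that unfolding \<U>_def cc_def mem_Collect_eq by (rule someI_ex)
 have cov: "\<Union>\<U> = V"
 proof
 show "V \<subseteq> \<Union>\<U>"
 proof
 fix y assume "y : V"
 then obtain W c where "opn X W" "y : W" "W \<subseteq> V" "ALL i<n. c i : (cO X W)"
  "res P V W s = finsum (sec P W) (%i. c i \<odot>\<^bsub>sec P W\<^esub> res P U W (e i)) {..<n}"
  using is_local_basisD(2)[OF e V s] by blast
 then show "y : \<Union>\<U>" by (auto simp: \<U>_def good_def coefs_def lin_def)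
 qed
 qed (auto simp: \<U>_def good_def)
 have ov: "res (str X) W (W \<inter> W') (cc W i) = res (str X) W' (W \<inter> W') (cc W' i)"
 if W: "W : \<U>" "W' : \<U>" and i: "i < n" for W W' i
 proof -
 note g = cc[OF W(1), unfolded good_def] cc[OF W(2), unfolded good_def]
 have O: "opn X (W \<inter> W')" using g by auto
 have sub: "W \<inter> W' \<subseteq> W" "W \<inter> W' \<subseteq> W'" "W \<subseteq> U" "W' \<subseteq> U" "W \<inter> W' \<subseteq> U" using g V by auto
 have "res P V (W \<inter> W') s = lin (W \<inter> W') (%i. res (str X) W (W \<inter> W') (cc W i))"
 using lin_res[OF _ sub(3) O sub(1)] presheafD(6)[OF P V(1) _ O sub(1) _ s] g by metis
 moreover have "res P V (W \<inter> W') s = lin (W \<inter> W') (%i. res (str X) W' (W \<inter> W') (cc W' i))"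
 using lin_res[OF _ sub(4) O sub(2)] presheafD(6)[OF P V(1) _ O sub(2) _ s] g by metis
 ultimately show ?thesis
 using lin_inj[OF O sub(5) coefs_res[OF _ O sub(1)] coefs_res[OF _ O sub(2)] _ i] g by metis
 qed
 have "EX t:(cO X V). ALL W:\<U>. res (str X) V W t = cc W i" if i: "i < n" for i
 proof -
 have "EX t:(cO X (\<Union>\<U>)). ALL W:\<U>. res (str X) (\<Union>\<U>) W t = cc W i"
 proof (rule is_sheafD(4)[OF ringedD(1)[OF X]])
 show "opn X W & cc W i : (cO X W)" if "W : \<U>" for W
  using cc[OF that] i by (simp add: good_def coefs_def)
 qed (rule ov[OF _ _ i])
 then show ?thesis unfolding cov .
 qed
 then obtain c where c: "!!i. i < n ==> c i : (cO X V)" "!!i W. i < n ==> W : \<U> ==> res (str X) V W (c i) = cc W i"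
 by metis
 have "coords V s c"
 unfolding coords_def
 proof (intro conjI ballI)
 show "coefs V c" using c(1) by (simp add: coefs_def)
 fix y assume "y : V"
 then obtain W where W: "W : \<U>" "y : W" using cov by auto
 note g = cc[OF W(1), unfolded good_def]
 have "lin W (%i. res (str X) V W (c i)) = lin W (cc W)"
 proof -
 interpret M: module "Osec X W" "sec P W" using presheafD(1)[OF P] g by auto
 have "W \<subseteq> U" using g V by auto
 then show ?thesis
  unfolding lin_def using g V c(2) W by (intro M.finsum_cong') (auto simp: coefs_def basis_closed)
 qed
 then show "EX W. opn X W & y : W & W \<subseteq> V & res P V W s = lin W (%i. res (str X) V W (c i))"
 using g W(2) by (intro exI[of _ W]) auto
 qed
 then show ?thesis by blast
qed

text \<open>The dual basis, as sections of the dual over all of \<open>U\<close>. It is the raw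
  material for lifting functionals from the fibre, for separating sections of a free piece by
  functionals, and for the flatness of stalks.\<close>

lemma local_coordinates:
 obtains \<gamma> where "!!l. l < n ==> \<gamma> l : dual_sections X P U"
 and "!!V l i. opn X V ==> V \<subseteq> U ==> l < n ==> i < n ==>
 \<gamma> l V (res P U V (e i)) = (if i = l then \<one>\<^bsub>Osec X V\<^esub> else \<zero>\<^bsub>Osec X V\<^esub>)"
 and "!!V s y. opn X V ==> V \<subseteq> U ==> s : carrier (sec P V) ==> y : V ==>
 EX W. opn X W & y : W & W \<subseteq> V &
  res P V W s = finsum (sec P W) (%i. res (str X) V W (\<gamma> i V s) \<odot>\<^bsub>sec P W\<^esub> res P U W (e i)) {..<n}"
proof -
 define cc where "cc V s = (SOME c. coords V s c)" for V s
 have cc: "coords V s (cc V s)" if "opn X V" "V \<subseteq> U" "s : carrier (sec P V)" for V s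
 using coords_exist[OF that] unfolding cc_def by (rule someI_ex)
 have ccI: "cc V s i = c i" if "opn X V" "V \<subseteq> U" "s : carrier (sec P V)" "i < n" "coords V s c" for V s c i
 using coords_unique[OF that(1-3) cc[OF that(1-3)] that(5,4)] .
 have coordsI: "coords V s c" if "opn X V" "coefs V c" "res P V V s = lin V (%i. res (str X) V V (c i))" for V s c
 using that by (auto simp: coords_def)
 define \<gamma> where "\<gamma> l = hom_fun X P U (%V s. cc V s l)" for l
 show ?thesis
 proof (rule that[of \<gamma>])
 fix l assume l: "l < n"
 show "\<gamma> l : dual_sections X P U"
 unfolding \<gamma>_def
 proof (rule dual_sectionsI[OF P U])
 fix V assume V: "opn X V" "V \<subseteq> U"
 interpret M: module "Osec X V" "sec P V" by (rule presheafD(1)[OF P V(1)])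
 fix s assume s: "s : carrier (sec P V)"
 note cs = cc[OF V s]
 show "cc V s l : (cO X V)" using cs l by (simp add: coords_def coefs_def)
 {
  fix t assume t: "t : carrier (sec P V)"
  note ct = cc[OF V t]
  have "coords V (s \<oplus>\<^bsub>sec P V\<^esub> t) (%i. cc V s i \<oplus>\<^bsub>Osec X V\<^esub> cc V t i)"
  unfolding coords_def
  proof (intro conjI ballI)
  show "coefs V (%i. cc V s i \<oplus>\<^bsub>Osec X V\<^esub> cc V t i)" using cs ct by (simp add: coords_def coefs_def)
  fix y assume y: "y : V"
  obtain W where W: "opn X W" "y : W" "W \<subseteq> V" "res P V W s = lin W (%i. res (str X) V W (cc V s i))"
   using cs y by (auto simp: coords_def)
  obtain W' where W': "opn X W'" "y : W'" "W' \<subseteq> V \<inter> W" "res P V W' t = lin W' (%i. res (str X) V W' (cc V t i))"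
   using coords_local[OF V t ct y W(1,2)] by auto
  have sub: "W' \<subseteq> W" "W' \<subseteq> V" "W' \<subseteq> U" "W \<subseteq> U" using W' W V by auto
  interpret M': module "Osec X W'" "sec P W'" by (rule presheafD(1)[OF P W'(1)])
  have cf: "coefs V (cc V s)" "coefs V (cc V t)" using cs ct by (auto simp: coords_def)
  have s': "res P V W' s = lin W' (%i. res (str X) V W' (cc V s i))"
  proof -
   have "res P V W' s = lin W' (%i. res (str X) W W' (res (str X) V W (cc V s i)))"
   using lin_res[OF W(1) sub(4) W'(1) sub(1) coefs_res[OF V(1) W(1,3) cf(1)]]
    presheafD(6)[OF P V(1) W(1) W'(1) sub(1) W(3) s] W(4) by simp
   also have "\<dots> = lin W' (%i. res (str X) V W' (cc V s i))"
   unfolding lin_def using cf sub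
   by (intro M'.finsum_cong') (auto simp: coefs_def ringedD(10)[OF X V(1) W(1) W'(1) sub(1) W(3)]
    ringedD(3)[OF X V(1) W'(1)] intro!: M'.smult_closed basis_closed[OF W'(1)])
   finally show ?thesis .
  qed
  have "lin W' (%i. res (str X) V W' (cc V s i \<oplus>\<^bsub>Osec X V\<^esub> cc V t i)) =
   lin W' (%i. res (str X) V W' (cc V s i) \<oplus>\<^bsub>Osec X W'\<^esub> res (str X) V W' (cc V t i))"
   unfolding lin_def using cf sub
   by (intro M'.finsum_cong') (auto simp: coefs_def ringedD(4)[OF X V(1) W'(1)]
    ringedD(3)[OF X V(1) W'(1)] intro!: M'.smult_closed basis_closed[OF W'(1)])
  then have "res P V W' (s \<oplus>\<^bsub>sec P V\<^esub> t) = lin W' (%i. res (str X) V W' (cc V s i \<oplus>\<^bsub>Osec X V\<^esub> cc V t i))"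
   using lin_add[OF W'(1) sub(3) coefs_res[OF V(1) W'(1) sub(2) cf(1)] coefs_res[OF V(1) W'(1) sub(2) cf(2)]]
   s' W'(4) presheafD(3)[OF P V(1) W'(1) sub(2) s t] by simp
  then show "EX W. opn X W & y : W & W \<subseteq> V &
   res P V W (s \<oplus>\<^bsub>sec P V\<^esub> t) = lin W (%i. res (str X) V W (cc V s i \<oplus>\<^bsub>Osec X V\<^esub> cc V t i))"
   using W' sub by blast
  qed
  then show "cc V (s \<oplus>\<^bsub>sec P V\<^esub> t) l = cc V s l \<oplus>\<^bsub>Osec X V\<^esub> cc V t l"
  using ccI[OF V _ l] s t by simp
 }
 {
  fix r assume r: "r : (cO X V)"
  have "coords V (r \<odot>\<^bsub>sec P V\<^esub> s) (%i. r \<otimes>\<^bsub>Osec X V\<^esub> cc V s i)"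
  unfolding coords_def
  proof (intro conjI ballI)
  show "coefs V (%i. r \<otimes>\<^bsub>Osec X V\<^esub> cc V s i)" using cs r by (simp add: coords_def coefs_def)
  fix y assume y: "y : V"
  obtain W where W: "opn X W" "y : W" "W \<subseteq> V" "res P V W s = lin W (%i. res (str X) V W (cc V s i))"
   using cs y by (auto simp: coords_def)
  interpret M': module "Osec X W" "sec P W" by (rule presheafD(1)[OF P W(1)])
  have cf: "coefs V (cc V s)" using cs by (auto simp: coords_def)
  have sub: "W \<subseteq> U" using W V by auto
  have r': "res (str X) V W r : (cO X W)" by (rule ringedD(3)[OF X V(1) W(1,3) r])
  have "lin W (%i. res (str X) V W (r \<otimes>\<^bsub>Osec X V\<^esub> cc V s i)) =
   lin W (%i. res (str X) V W r \<otimes>\<^bsub>Osec X W\<^esub> res (str X) V W (cc V s i))"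
   unfolding lin_def using cf sub r r' W(3)
   by (intro M'.finsum_cong') (auto simp: coefs_def ringedD(5)[OF X V(1) W(1)]
    ringedD(3)[OF X V(1) W(1)] intro!: M'.smult_closed basis_closed[OF W(1)])
  then have "res P V W (r \<odot>\<^bsub>sec P V\<^esub> s) = lin W (%i. res (str X) V W (r \<otimes>\<^bsub>Osec X V\<^esub> cc V s i))"
   using lin_smult[OF W(1) sub coefs_res[OF V(1) W(1,3) cf] r']
   W(4) presheafD(4)[OF P V(1) W(1,3) r s] by simp
  then show "EX W. opn X W & y : W & W \<subseteq> V &
   res P V W (r \<odot>\<^bsub>sec P V\<^esub> s) = lin W (%i. res (str X) V W (r \<otimes>\<^bsub>Osec X V\<^esub> cc V s i))"
   using W by blast
  qed
  then show "cc V (r \<odot>\<^bsub>sec P V\<^esub> s) l = r \<otimes>\<^bsub>Osec X V\<^esub> cc V s l"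
  using ccI[OF V _ l] s r by simp
 }
 fix W assume W: "opn X W" "W \<subseteq> V"
 have sub: "W \<subseteq> U" using W V by auto
 have sW: "res P V W s : carrier (sec P W)" by (rule presheafD(2)[OF P V(1) W s])
 have cf: "coefs V (cc V s)" using cs by (auto simp: coords_def)
 have "coords W (res P V W s) (%i. res (str X) V W (cc V s i))"
  unfolding coords_def
 proof (intro conjI ballI)
  show "coefs W (%i. res (str X) V W (cc V s i))" by (rule coefs_res[OF V(1) W cf])
  fix y assume y: "y : W"
  then obtain W' where W': "opn X W'" "y : W'" "W' \<subseteq> V \<inter> W" "res P V W' s = lin W' (%i. res (str X) V W' (cc V s i))"
  using coords_local[OF V s cs _ W(1)] W(2) by blast
  interpret M': module "Osec X W'" "sec P W'" by (rule presheafD(1)[OF P W'(1)])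
  have sub: "W' \<subseteq> W" "W' \<subseteq> V" "W' \<subseteq> U" using W' W V by auto
  have "lin W' (%i. res (str X) W W' (res (str X) V W (cc V s i))) = lin W' (%i. res (str X) V W' (cc V s i))"
  unfolding lin_def using cf sub
  by (intro M'.finsum_cong') (auto simp: coefs_def ringedD(10)[OF X V(1) W(1) W'(1) sub(1) W(2)]
    ringedD(3)[OF X V(1) W'(1)] intro!: M'.smult_closed basis_closed[OF W'(1)])
  then have "res P W W' (res P V W s) = lin W' (%i. res (str X) W W' (res (str X) V W (cc V s i)))"
  using W'(4) presheafD(6)[OF P V(1) W(1) W'(1) sub(1) W(2) s] by simp
  then show "EX W'. opn X W' & y : W' & W' \<subseteq> W &
   res P W W' (res P V W s) = lin W' (%i. res (str X) W W' (res (str X) V W (cc V s i)))"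
  using W' sub by blast
 qed
 then show "cc W (res P V W s) l = res (str X) V W (cc V s l)"
  using ccI[OF W(1) sub sW l] by simp
 qed
 next
 fix V l i assume V: "opn X V" "V \<subseteq> U" and l: "l < n" and i: "i < n"
 interpret M: module "Osec X V" "sec P V" by (rule presheafD(1)[OF P V(1)])
 let ?c = "%l. if i = l then \<one>\<^bsub>Osec X V\<^esub> else \<zero>\<^bsub>Osec X V\<^esub>"
 have ei: "res P U V (e i) : carrier (sec P V)" by (rule basis_closed[OF V i])
 have cf: "coefs V ?c" by (simp add: coefs_def)
 have "lin V (%l. res (str X) V V (?c l)) = finsum (sec P V) (%l. if i = l then res P U V (e l) else \<zero>\<^bsub>sec P V\<^esub>) {..<n}"
 unfolding lin_def by (rule M.finsum_cong') (auto simp: ringedD(9)[OF X V(1)] basis_closed[OF V])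
 also have "\<dots> = res P U V (e i)"
 using i by (subst M.finsum_singleton) (auto simp: basis_closed[OF V])
 finally have "coords V (res P U V (e i)) ?c"
 using coordsI[OF V(1) cf] presheafD(5)[OF P V(1) ei] by simp
 then show "\<gamma> l V (res P U V (e i)) = ?c l"
 using V ei ccI[OF V ei l] by (simp add: \<gamma>_def)
 next
 fix V s y assume V: "opn X V" "V \<subseteq> U" and s: "s : carrier (sec P V)" and y: "y : V"
 then show "EX W. opn X W & y : W & W \<subseteq> V &
  res P V W s = finsum (sec P W) (%i. res (str X) V W (\<gamma> i V s) \<odot>\<^bsub>sec P W\<^esub> res P U W (e i)) {..<n}"
 using cc[OF V s] unfolding coords_def lin_def by (auto simp: \<gamma>_def)
 qed
qed

end

section \<open>Fields and local rings\<close>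

text \<open>Induction on the equations: a nonzero entry of one equation eliminates its variable from
  the others, and a solution of the reduced system extends to that variable.\<close>

lemma (in field) underdetermined_system:
 assumes "finite I" "finite J" "card I < card J" "!!i j. i : I ==> j : J ==> M i j : carrier R"
 shows "EX c. (ALL j:J. c j : carrier R) & (EX j:J. c j ~= \<zero>) & (ALL i:I. (\<Oplus>j\<in>J. M i j \<otimes> c j) = \<zero>)"
 using assms
proof (induction I arbitrary: J M)
 case empty
 then obtain j where "j : J" by (metis card.empty card_gt_0_iff ex_in_conv)
 then show ?case by (intro exI[of _ "%_. \<one>"]) auto
next
 case (insert i I)
 show ?case
 proof (cases "ALL j:J. M i j = \<zero>")
 case True
 obtain c where c: "ALL j:J. c j : carrier R" "EX j:J. c j ~= \<zero>" "ALL i:I. (\<Oplus>j\<in>J. M i j \<otimes> c j) = \<zero>"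
 using insert.IH[of J M] insert.prems insert.hyps by auto
 moreover have "(\<Oplus>j\<in>J. M i j \<otimes> c j) = (\<Oplus>j\<in>J. \<zero>)"
 using True c by (intro add.finprod_cong') auto
 ultimately show ?thesis by (intro exI[of _ c]) simp
 next
 case False
 then obtain j0 where j0: "j0 : J" "M i j0 ~= \<zero>" by auto
 define J' where "J' = J - {j0}"
 have J: "J = insert j0 J'" "j0 \<notin> J'" "finite J'" using j0 insert.prems by (auto simp: J'_def)
 have Mc: "M k j : carrier R" if "k : insert i I" "j : J" for k j using insert.prems that by auto
 have u: "inv (M i j0) : carrier R" "M i j0 \<otimes> inv (M i j0) = \<one>"
 using j0 Mc[of i j0] by (auto simp: field_Units)
 \<comment> \<open>The reduced system: from equation \<open>k\<close> the multiple of equation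
   \<open>i\<close> that clears column \<open>j0\<close> is subtracted.\<close>
 define M' where "M' k j = M k j \<ominus> M k j0 \<otimes> inv (M i j0) \<otimes> M i j" for k j
 have "card I < card J'" using insert J by simp
 moreover have "M' k j : carrier R" if "k : I" "j : J'" for k j
 using that Mc u J j0(1) by (auto simp: M'_def)
 ultimately obtain c where c: "ALL j:J'. c j : carrier R" "EX j:J'. c j ~= \<zero>" "ALL k:I. (\<Oplus>j\<in>J'. M' k j \<otimes> c j) = \<zero>"
 using insert.IH[of J' M'] J(3) by auto
 define S where "S = (\<Oplus>j\<in>J'. M i j \<otimes> c j)"
 have Sc: "S : carrier R" using c(1) Mc J unfolding S_def by (intro finsum_closed) auto
 \<comment> \<open>Back substitution: equation \<open>i\<close> forces the value at
   \<open>j0\<close>.\<close>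
 define c' where "c' = c(j0 := \<ominus> (inv (M i j0) \<otimes> S))"
 have c'0: "c' j0 = \<ominus> (inv (M i j0) \<otimes> S)" and c'J: "!!j. j : J' ==> c' j = c j" using J by (auto simp: c'_def)
 have c'c: "c' j : carrier R" if "j : J" for j
 using that J c(1) Sc u by (cases "j = j0") (auto simp: c'_def)
 have split: "(\<Oplus>j\<in>J. M k j \<otimes> c' j) = M k j0 \<otimes> c' j0 \<oplus> (\<Oplus>j\<in>J'. M k j \<otimes> c j)" if k: "k : insert i I" for k
 proof -
 have "(\<Oplus>j\<in>J. M k j \<otimes> c' j) = M k j0 \<otimes> c' j0 \<oplus> (\<Oplus>j\<in>J'. M k j \<otimes> c' j)"
  unfolding J(1) using J c'c Mc k by (intro finsum_insert) auto
 also have "(\<Oplus>j\<in>J'. M k j \<otimes> c' j) = (\<Oplus>j\<in>J'. M k j \<otimes> c j)"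
  using c(1) Mc k J by (intro add.finprod_cong') (auto simp: c'J)
 finally show ?thesis .
 qed
 have "M i j0 \<otimes> (inv (M i j0) \<otimes> S) = S" using u Sc Mc[of i j0] j0 by (simp add: m_assoc[symmetric])
 then have "(\<Oplus>j\<in>J. M i j \<otimes> c' j) = \<zero>"
 using split[of i] Mc[of i j0] j0 u Sc by (simp add: c'0 S_def[symmetric] r_minus l_neg)
 moreover have "(\<Oplus>j\<in>J. M k j \<otimes> c' j) = \<zero>" if k: "k : I" for k
 proof -
 let ?a = "M k j0 \<otimes> inv (M i j0)"
 have a: "?a : carrier R" "M k j0 : carrier R" using Mc k j0 u by auto
 have "(\<Oplus>j\<in>J'. M k j \<otimes> c j) = (\<Oplus>j\<in>J'. M' k j \<otimes> c j \<oplus> ?a \<otimes> (M i j \<otimes> c j))"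
 proof (rule add.finprod_cong')
  fix j assume j: "j : J'"
  then have m: "M k j : carrier R" "M i j : carrier R" "c j : carrier R" using Mc k J c by auto
  have "M k j \<otimes> c j = (M' k j \<oplus> ?a \<otimes> M i j) \<otimes> c j"
  unfolding M'_def using m a by (simp add: minus_add_cancel)
  also have "\<dots> = M' k j \<otimes> c j \<oplus> ?a \<otimes> (M i j \<otimes> c j)"
  using m a by (simp add: M'_def l_distr m_assoc)
  finally show "M k j \<otimes> c j = M' k j \<otimes> c j \<oplus> ?a \<otimes> (M i j \<otimes> c j)" .
 qed (use c Mc k J a in \<open>auto simp: M'_def\<close>)
 also have "\<dots> = (\<Oplus>j\<in>J'. M' k j \<otimes> c j) \<oplus> (\<Oplus>j\<in>J'. ?a \<otimes> (M i j \<otimes> c j))"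
  using c Mc k J a by (intro finsum_addf) (auto simp: M'_def)
 also have "(\<Oplus>j\<in>J'. ?a \<otimes> (M i j \<otimes> c j)) = ?a \<otimes> S"
  unfolding S_def using c Mc k J a by (intro finsum_rdistr[symmetric]) auto
 finally have "(\<Oplus>j\<in>J'. M k j \<otimes> c j) = ?a \<otimes> S" using c(3) k a Sc by simp
 then show ?thesis
  using split[of k] k a u Sc by (simp add: c'0 r_minus m_assoc[symmetric] l_neg)
 qed
 moreover have "EX j:J. c' j ~= \<zero>" using c(2) c'J J by auto
 ultimately show ?thesis using c'c by (intro exI[of _ c']) auto
 qed
qed

text \<open>A non-unit lies in an ideal that is largest among those containing it and avoiding one,
  by Zorn's lemma. Such an ideal is maximal, so by uniqueness it is
  \<open>max_ideal R\<close>.\<close>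

lemma local_ring_unit:
 assumes R: "cring R" and loc: "EX! I. maximalideal I R" and r: "r : carrier R" "r \<notin> max_ideal R"
 shows "r : Units R"
proof (rule ccontr)
 interpret cring R by fact
 assume nu: "r \<notin> Units R"
 define A where "A = {I. ideal I R & r : I & \<one>\<^bsub>R\<^esub> \<notin> I}"
 have "PIdl\<^bsub>R\<^esub> r : A"
 using cgenideal_ideal[OF r(1)] cgenideal_self[OF r(1)] nu r(1) m_comm
 by (force simp: A_def cgenideal_def Units_def)
 then have "EX M:A. ALL I:A. M \<subseteq> I --> I = M"
 proof (intro subset_Zorn_nonempty)
 fix C assume C: "C ~= {}" "subset.chain A C"
 then have "subset.chain {I. ideal I R} C" by (auto simp: A_def subset_chain_def)
 then have "ideal (\<Union>C) R" using chain_Union_is_ideal[of C] C by simp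
 then show "\<Union>C : A" using C by (auto simp: A_def subset_chain_def)
 qed auto
 then obtain M where M: "M : A" "!!I. I : A ==> M \<subseteq> I ==> I = M" by auto
 have "maximalideal M R"
 proof (rule maximalidealI)
 show "ideal M R" "carrier R ~= M" using M(1) by (auto simp: A_def)
 fix J assume J: "ideal J R" "M \<subseteq> J" "J \<subseteq> carrier R"
 show "J = M \<or> J = carrier R"
 using M(2)[of J] J M(1) ideal.one_imp_carrier[OF J(1)] by (auto simp: A_def)
 qed
 then have "max_ideal R = M" unfolding max_ideal_def using loc by (metis the1_equality)
 then show False using M(1) r by (simp add: A_def)
qed

lemma max_ideal_maximal: "EX! I. maximalideal I R ==> maximalideal (max_ideal R) R"
 unfolding max_ideal_def by (rule theI')

text \<open>If \<open>m\<close> exceeded \<open>n\<close>, the coordinates of the second basis with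
  respect to the first would be the matrix of an underdetermined system, and a nonzero solution is a
  relation within the second basis. Since \<open>T\<close> is the only neighbourhood of
  \<open>x\<close>, local spanning holds on \<open>T\<close> itself.\<close>

lemma single_point_basis_card_le:
 assumes X: "is_ringed_space X" and P: "module_presheaf X P" and T: "opn X T"
 and x: "x : T" and only: "!!W. opn X W ==> x : W ==> W = T"
 and K: "field (Osec X T)" and e: "is_local_basis X P T n e" and e': "is_local_basis X P T m e'"
 shows "m \<le> n"
proof (rule ccontr)
 assume "\<not> m \<le> n"
 interpret K: field "Osec X T" by fact
 interpret M: module "Osec X T" "sec P T" by (rule presheafD(1)[OF P T])
 obtain \<gamma> where \<gamma>: "!!l. l < n ==> \<gamma> l : dual_sections X P T"
 and "!!V l i. opn X V ==> V \<subseteq> T ==> l < n ==> i < n ==>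
 \<gamma> l V (res P T V (e i)) = (if i = l then \<one>\<^bsub>Osec X V\<^esub> else \<zero>\<^bsub>Osec X V\<^esub>)"
 and span0: "!!V s y. opn X V ==> V \<subseteq> T ==> s : carrier (sec P V) ==> y : V ==>
 EX W. opn X W & y : W & W \<subseteq> V &
  res P V W s = finsum (sec P W) (%i. res (str X) V W (\<gamma> i V s) \<odot>\<^bsub>sec P W\<^esub> res P T W (e i)) {..<n}"
 by (rule local_coordinates[OF X P T e]) (rule that)
 note span = span0[OF T subset_refl _ x]
 have ei: "e i : carrier (sec P T)" if "i < n" for i using e that by (simp add: is_local_basis_def)
 have ej: "e' i : carrier (sec P T)" if "i < m" for i using e' that by (simp add: is_local_basis_def)
 have re: "res P T T (e i) = e i" if "i < n" for i using presheafD(5)[OF P T ei[OF that]] .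
 have re': "res P T T (e' i) = e' i" if "i < m" for i using presheafD(5)[OF P T ej[OF that]] .
 note D = dualD[OF X P \<gamma> T subset_refl]
 have "EX c. (ALL j:{..<m}. c j : (cO X T)) & (EX j:{..<m}. c j ~= \<zero>\<^bsub>Osec X T\<^esub>) &
 (ALL i:{..<n}. finsum (Osec X T) (%j. \<gamma> i T (e' j) \<otimes>\<^bsub>Osec X T\<^esub> c j) {..<m} = \<zero>\<^bsub>Osec X T\<^esub>)"
 using \<open>\<not> m \<le> n\<close> by (intro K.underdetermined_system) (auto simp: D ej)
 then obtain c where c: "!!j. j < m ==> c j : (cO X T)" "EX j<m. c j ~= \<zero>\<^bsub>Osec X T\<^esub>"
 "!!i. i < n ==> finsum (Osec X T) (%j. \<gamma> i T (e' j) \<otimes>\<^bsub>Osec X T\<^esub> c j) {..<m} = \<zero>\<^bsub>Osec X T\<^esub>"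
 by (auto simp: Bex_def)
 define s where "s = finsum (sec P T) (%j. c j \<odot>\<^bsub>sec P T\<^esub> e' j) {..<m}"
 have s: "s : carrier (sec P T)" unfolding s_def using c ej by (intro M.finsum_closed) auto
 have \<gamma>s: "\<gamma> i T s = \<zero>\<^bsub>Osec X T\<^esub>" if i: "i < n" for i
 proof -
 have "\<gamma> i T s = finsum (Osec X T) (%j. \<gamma> i T (c j \<odot>\<^bsub>sec P T\<^esub> e' j)) {..<m}"
 unfolding s_def using c ej by (intro D(7)[OF i]) auto
 also have "\<dots> = finsum (Osec X T) (%j. \<gamma> i T (e' j) \<otimes>\<^bsub>Osec X T\<^esub> c j) {..<m}"
 using c ej i by (intro K.add.finprod_cong') (auto simp: D K.m_comm)
 finally show ?thesis using c(3)[OF i] by simp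
 qed
 obtain W where W: "opn X W" "x : W" "W \<subseteq> T"
 "res P T W s = finsum (sec P W) (%i. res (str X) T W (\<gamma> i T s) \<odot>\<^bsub>sec P W\<^esub> res P T W (e i)) {..<n}"
 using span[OF s] by blast
 have "W = T" using only W by blast
 then have "s = finsum (sec P T) (%i. res (str X) T T (\<gamma> i T s) \<odot>\<^bsub>sec P T\<^esub> res P T T (e i)) {..<n}"
 using W(4) presheafD(5)[OF P T s] by simp
 also have "\<dots> = finsum (sec P T) (%i. \<zero>\<^bsub>sec P T\<^esub>) {..<n}"
 by (intro M.finsum_cong') (auto simp: \<gamma>s ringedD(7)[OF X T T] re ei)
 finally have "s = \<zero>\<^bsub>sec P T\<^esub>" by simp
 moreover have "finsum (sec P T) (%j. c j \<odot>\<^bsub>sec P T\<^esub> res P T T (e' j)) {..<m} = s"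
 unfolding s_def using c ej by (intro M.finsum_cong') (auto simp: re')
 ultimately have "c j = \<zero>\<^bsub>Osec X T\<^esub>" if "j < m" for j
 using is_local_basisD(1)[OF e' T subset_refl, of c j] c(1) that by simp
 then show False using c(2) by blast
qed

section \<open>Flatness\<close>

lemma (in abelian_group) add_minus_minus:
 "x : carrier G ==> y : carrier G ==> (x \<oplus> y) \<ominus> x \<ominus> y = \<zero>"
 by (simp add: a_minus_def a_comm[of x y] a_assoc r_neg)

lemma tensor_relations_uminus: "u : tensor_relations R M N ==> - u : tensor_relations R M N"
 using tensor_relations.diff[OF tensor_relations.zero] by fastforce

lemma tensor_relations_add:
 "u : tensor_relations R M N ==> v : tensor_relations R M N ==> u + v : tensor_relations R M N"
 using tensor_relations.diff[of u R M N "- v"] tensor_relations_uminus by fastforce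

lemma tensor_relations_sum:
 "(!!i. i : I ==> u i : tensor_relations R M N) ==> sum u I : tensor_relations R M N"
 by (induction I rule: infinite_finite_induct) (auto intro: tensor_relations.zero tensor_relations_add)

text \<open>Contraction with the linear form \<open>lam\<close>: the tensor of \<open>n\<close> and
  \<open>m\<close> goes to \<open>lam m\<close> times \<open>n\<close>. It is defined on the free
  abelian group by its universal property and kills the relations, so the tensor product is handled
  without forming a quotient.\<close>

lemma tensor_hom:
 assumes R: "cring R" and M: "module R M" and N: "module R N"
 and cl: "!!m. m : carrier M ==> lam m : carrier R"
 and add: "!!m m'. m : carrier M ==> m' : carrier M ==> lam (m \<oplus>\<^bsub>M\<^esub> m') = lam m \<oplus>\<^bsub>R\<^esub> lam m'"
 and smult: "!!r m. r : carrier R ==> m : carrier M ==> lam (r \<odot>\<^bsub>M\<^esub> m) = r \<otimes>\<^bsub>R\<^esub> lam m"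
 obtains h where "!!n m. n : carrier N ==> m : carrier M ==> h (frag_of (n, m)) = lam m \<odot>\<^bsub>N\<^esub> n"
 and "!!z. Poly_Mapping.keys z \<subseteq> carrier N \<times> carrier M ==> h z : carrier N"
 and "h 0 = \<zero>\<^bsub>N\<^esub>"
 and "!!z w. Poly_Mapping.keys z \<subseteq> carrier N \<times> carrier M ==> Poly_Mapping.keys w \<subseteq> carrier N \<times> carrier M ==>
 h (z - w) = h z \<ominus>\<^bsub>N\<^esub> h w"
 and "!!z. z : tensor_relations R N M ==> h z = \<zero>\<^bsub>N\<^esub>"
proof -
 interpret M: module R M by fact
 interpret N: module R N by fact
 let ?S = "carrier N \<times> carrier M"
 have cg: "comm_group (add_monoid N)" by (rule N.M.a_comm_group)
 have "(%(n, m). lam m \<odot>\<^bsub>N\<^esub> n) ` ?S \<subseteq> carrier (add_monoid N)" using cl by auto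
 then obtain h where h: "h : hom (free_Abelian_group ?S) (add_monoid N)"
 and hx: "!!x. x : ?S ==> h (frag_of x) = (case x of (n, m) => lam m \<odot>\<^bsub>N\<^esub> n)"
 using comm_group.free_Abelian_group_universal[OF cg] by blast
 have 1: "h (frag_of (n, m)) = lam m \<odot>\<^bsub>N\<^esub> n" if "n : carrier N" "m : carrier M" for n m using hx that by auto
 have 2: "h z : carrier N" if "Poly_Mapping.keys z \<subseteq> ?S" for z
 using hom_in_carrier[OF h] that by auto
 have 3: "h 0 = \<zero>\<^bsub>N\<^esub>"
 using hom_one[OF h] cg by (simp add: comm_group_def)
 have pl: "h (z + w) = h z \<oplus>\<^bsub>N\<^esub> h w" if "Poly_Mapping.keys z \<subseteq> ?S" "Poly_Mapping.keys w \<subseteq> ?S" for z w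
 using hom_mult[OF h, of z w] that by simp
 have 4: "h (z - w) = h z \<ominus>\<^bsub>N\<^esub> h w" if z: "Poly_Mapping.keys z \<subseteq> ?S" and w: "Poly_Mapping.keys w \<subseteq> ?S" for z w
 proof -
 have zw: "Poly_Mapping.keys (z - w) \<subseteq> ?S" using z w keys_diff[of z w] by blast
 have "h z = h (z - w) \<oplus>\<^bsub>N\<^esub> h w" using pl[OF zw w] by simp
 then show ?thesis using 2[OF zw] 2[OF w] by (simp add: a_minus_def N.M.a_assoc N.M.r_neg)
 qed
 have kd: "Poly_Mapping.keys (z - w) \<subseteq> ?S" if "Poly_Mapping.keys z \<subseteq> ?S" "Poly_Mapping.keys w \<subseteq> ?S" for z w :: "_ \<Rightarrow>\<^sub>0 int"
 using that keys_diff[of z w] by blast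
 have three: "Poly_Mapping.keys (frag_of a - frag_of b - frag_of c) \<subseteq> ?S &
 h (frag_of a - frag_of b - frag_of c) = h (frag_of a) \<ominus>\<^bsub>N\<^esub> h (frag_of b) \<ominus>\<^bsub>N\<^esub> h (frag_of c)"
 if "a : ?S" "b : ?S" "c : ?S" for a b c
 proof -
 have k: "Poly_Mapping.keys (frag_of a) \<subseteq> ?S" "Poly_Mapping.keys (frag_of b) \<subseteq> ?S" "Poly_Mapping.keys (frag_of c) \<subseteq> ?S"
 using that by auto
 show ?thesis using 4[OF kd[OF k(1,2)] k(3)] 4[OF k(1,2)] kd[OF kd[OF k(1,2)] k(3)] by simp
 qed
 have "Poly_Mapping.keys z \<subseteq> ?S & h z = \<zero>\<^bsub>N\<^esub>" if "z : tensor_relations R N M" for z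
 using that
 proof induction
 case zero
 then show ?case by (simp add: 3)
 next
 case (diff u v)
 then show ?case using 4[of u v] kd[of u v] by (simp add: a_minus_def N.M.r_neg)
 next
 case (add_left x x' y)
 then show ?case
 using three[of "(x \<oplus>\<^bsub>N\<^esub> x', y)" "(x, y)" "(x', y)"] cl[of y]
 by (simp add: 1 N.smult_r_distr N.M.add_minus_minus)
 next
 case (add_right x y y')
 then show ?case
 using three[of "(x, y \<oplus>\<^bsub>M\<^esub> y')" "(x, y)" "(x, y')"] cl[of y] cl[of y']
 by (simp add: 1 add N.smult_l_distr N.M.add_minus_minus)
 next
 case (scalar r x y)
 then have k: "Poly_Mapping.keys (frag_of (r \<odot>\<^bsub>N\<^esub> x, y)) \<subseteq> ?S" "Poly_Mapping.keys (frag_of (x, r \<odot>\<^bsub>M\<^esub> y)) \<subseteq> ?S"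
 by auto
 show ?case
 using 4[OF k] kd[OF k] scalar cl[of y]
 by (simp add: 1 smult N.smult_assoc1[symmetric] M.R.m_comm a_minus_def N.M.r_neg)
 qed
 then show ?thesis using that[of h] 1 2 3 4 by blast
qed

text \<open>A finite dual basis writes every tensor \<open>w\<close>, modulo relations, as the sum
  of the tensors of \<open>g j w\<close> and \<open>e j\<close>, where \<open>g j\<close> is
  contraction with \<open>lam j\<close>. Contraction commutes with the injection \<open>f\<close>.
  So if the image of \<open>z\<close> is a relation, then \<open>f (g j z)\<close> is zero, hence
  \<open>g j z\<close> is zero for every \<open>j\<close>.\<close>

lemma flat_module_dual_basis:
 fixes R :: "('r, 'b) ring_scheme" and M :: "('r, 'm) module" and n :: nat
 assumes R: "cring R" and M: "module R M"
 and e: "!!j. j < n ==> e j : carrier M"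
 and cl: "!!j m. j < n ==> m : carrier M ==> lam j m : carrier R"
 and add: "!!j m m'. j < n ==> m : carrier M ==> m' : carrier M ==> lam j (m \<oplus>\<^bsub>M\<^esub> m') = lam j m \<oplus>\<^bsub>R\<^esub> lam j m'"
 and smult: "!!j r m. j < n ==> r : carrier R ==> m : carrier M ==> lam j (r \<odot>\<^bsub>M\<^esub> m) = r \<otimes>\<^bsub>R\<^esub> lam j m"
 and dual: "!!m. m : carrier M ==> m = finsum M (%j. lam j m \<odot>\<^bsub>M\<^esub> e j) {..<n}"
 shows "flat_module R M"
 unfolding flat_module_def
proof (intro allI impI)
 fix N N' :: "('r, (nat => 'r) set) module" and f z
 assume A: "module R N & module R N' & f : linear_maps R N N' & inj_on f (carrier N)"
 and Z: "Poly_Mapping.keys z \<subseteq> carrier N \<times> carrier M &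
  frag_extend (%(n, m). frag_of (f n, m)) z : tensor_relations R N' M"
 let ?S = "carrier N \<times> carrier M"
 let ?S' = "carrier N' \<times> carrier M"
 let ?F = "frag_extend (%(n, m). frag_of (f n, m))"
 interpret M: module R M by fact
 interpret N: module R N using A by simp
 interpret N': module R N' using A by simp
 have f: "f : linear_maps R N N'" "inj_on f (carrier N)" using A by auto
 have fc: "!!x. x : carrier N ==> f x : carrier N'" and fa: "!!x y. x : carrier N ==> y : carrier N ==> f (x \<oplus>\<^bsub>N\<^esub> y) = f x \<oplus>\<^bsub>N'\<^esub> f y"
 and fs: "!!r x. r : carrier R ==> x : carrier N ==> f (r \<odot>\<^bsub>N\<^esub> x) = r \<odot>\<^bsub>N'\<^esub> f x"
 using f(1) by (auto simp: linear_maps_def)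
 have f0: "f \<zero>\<^bsub>N\<^esub> = \<zero>\<^bsub>N'\<^esub>" by (rule additive_map_zero[OF N.M.abelian_group_axioms N'.M.abelian_group_axioms fc fa])
 have fm: "f (x \<ominus>\<^bsub>N\<^esub> y) = f x \<ominus>\<^bsub>N'\<^esub> f y" if "x : carrier N" "y : carrier N" for x y
 by (rule additive_map_minus[OF N.M.abelian_group_axioms N'.M.abelian_group_axioms fc fa that])
 have left0: "frag_of (\<zero>\<^bsub>N\<^esub>, y) : tensor_relations R N M" if "y : carrier M" for y
 using tensor_relations_uminus[OF tensor_relations.add_left[of "\<zero>\<^bsub>N\<^esub>" N "\<zero>\<^bsub>N\<^esub>" y M R]] that by simp
 have left_diff: "frag_of (x \<ominus>\<^bsub>N\<^esub> x', y) - (frag_of (x, y) - frag_of (x', y)) : tensor_relations R N M"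
 if "x : carrier N" "x' : carrier N" "y : carrier M" for x x' y
 proof -
 have "frag_of ((x \<ominus>\<^bsub>N\<^esub> x') \<oplus>\<^bsub>N\<^esub> x', y) - frag_of (x \<ominus>\<^bsub>N\<^esub> x', y) - frag_of (x', y) : tensor_relations R N M"
 using that by (intro tensor_relations.add_left) auto
 from tensor_relations_uminus[OF this] that show ?thesis
 by (simp add: N.M.minus_add_cancel algebra_simps)
 qed
 have right_sum: "frag_of (x, finsum M g I) - (\<Sum>i\<in>I. frag_of (x, g i)) : tensor_relations R N M"
 if x: "x : carrier N" and "finite I" "!!i. i : I ==> g i : carrier M" for x g and I :: "nat set"
 using that(2,3)
 proof (induction I)
 case empty
 have "frag_of (x, \<zero>\<^bsub>M\<^esub> \<oplus>\<^bsub>M\<^esub> \<zero>\<^bsub>M\<^esub>) - frag_of (x, \<zero>\<^bsub>M\<^esub>) - frag_of (x, \<zero>\<^bsub>M\<^esub>) : tensor_relations R N M"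
 using x by (intro tensor_relations.add_right) auto
 from tensor_relations_uminus[OF this] show ?case by simp
 next
 case (insert i I)
 have g: "g : I \<rightarrow> carrier M" "g i : carrier M" using insert by auto
 have "frag_of (x, g i \<oplus>\<^bsub>M\<^esub> finsum M g I) - frag_of (x, g i) - frag_of (x, finsum M g I) : tensor_relations R N M"
 using g x by (intro tensor_relations.add_right) auto
 from tensor_relations_add[OF this insert.IH] insert g show ?case
 by (simp add: algebra_simps)
 qed
 \<comment> \<open>The properties of a contraction are packed into one predicate so that all
   \<open>g j\<close> can be chosen at once.\<close>
 define Q where "Q j g \<longleftrightarrow> (ALL x:carrier N. ALL m:carrier M. g (frag_of (x, m)) = lam j m \<odot>\<^bsub>N\<^esub> x) &
 (ALL z. Poly_Mapping.keys z \<subseteq> ?S --> g z : carrier N) & g 0 = \<zero>\<^bsub>N\<^esub> &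
 (ALL z w. Poly_Mapping.keys z \<subseteq> ?S --> Poly_Mapping.keys w \<subseteq> ?S --> g (z - w) = g z \<ominus>\<^bsub>N\<^esub> g w)"
 for j and g :: "((nat => 'r) set \<times> 'm \<Rightarrow>\<^sub>0 int) => (nat => 'r) set"
 define g where "g j = (SOME h. Q j h)" for j
 have "Q j (g j)" if j: "j < n" for j
 proof -
 obtain h where "Q j h"
 proof (rule tensor_hom[OF R M N.module_axioms cl[OF j] add[OF j] smult[OF j]], goal_cases)
 case (6 h)
 from this(1)[of h] this(2-) show ?case by (simp add: Q_def)
 qed
 then show ?thesis unfolding g_def by (rule someI[of "Q j"])
 qed
 then have g1: "!!j x m. j < n ==> x : carrier N ==> m : carrier M ==> g j (frag_of (x, m)) = lam j m \<odot>\<^bsub>N\<^esub> x"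
 and g2: "!!j z. j < n ==> Poly_Mapping.keys z \<subseteq> ?S ==> g j z : carrier N"
 and g3: "!!j. j < n ==> g j 0 = \<zero>\<^bsub>N\<^esub>"
 and g4: "!!j z w. j < n ==> Poly_Mapping.keys z \<subseteq> ?S ==> Poly_Mapping.keys w \<subseteq> ?S ==> g j (z - w) = g j z \<ominus>\<^bsub>N\<^esub> g j w"
 by (simp_all add: Q_def)
 \<comment> \<open>On a generator \<open>(x, m)\<close> expand \<open>m\<close> in the dual basis
   and move the coefficients across the tensor sign; both sides are compatible with differences, so
   induction over the free abelian group applies.\<close>
 have reduce: "w - (\<Sum>j<n. frag_of (g j w, e j)) : tensor_relations R N M" if "Poly_Mapping.keys w \<subseteq> ?S" for w
 using that
 proof (induction rule: free_Abelian_group_induct[consumes 1])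
 case 1
 show ?case by (auto simp: g3 e left0 intro!: tensor_relations_uminus tensor_relations_sum)
 next
 case (2 u v)
 have "(\<Sum>j<n. frag_of (g j (u - v), e j) - (frag_of (g j u, e j) - frag_of (g j v, e j))) : tensor_relations R N M"
 using 2 by (intro tensor_relations_sum) (auto simp: g4 g2 e intro!: left_diff)
 from tensor_relations_uminus[OF this]
 have "(\<Sum>j<n. frag_of (g j u, e j)) - (\<Sum>j<n. frag_of (g j v, e j)) - (\<Sum>j<n. frag_of (g j (u - v), e j)) : tensor_relations R N M"
 by (simp add: sum_subtractf sum.distrib algebra_simps)
 from tensor_relations_add[OF tensor_relations.diff[OF 2(3,4)] this] show ?case by (simp add: algebra_simps)
 next
 case (3 p)
 obtain x m where p: "p = (x, m)" "x : carrier N" "m : carrier M" using 3 by auto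
 have "frag_of (x, m) - (\<Sum>j<n. frag_of (x, lam j m \<odot>\<^bsub>M\<^esub> e j)) : tensor_relations R N M"
 using right_sum[OF p(2) finite_lessThan[of n], of "%j. lam j m \<odot>\<^bsub>M\<^esub> e j"] p dual[OF p(3)] cl e by simp
 moreover have "(\<Sum>j<n. frag_of (lam j m \<odot>\<^bsub>N\<^esub> x, e j) - frag_of (x, lam j m \<odot>\<^bsub>M\<^esub> e j)) : tensor_relations R N M"
 using p cl e by (intro tensor_relations_sum tensor_relations.scalar) auto
 ultimately have "frag_of (x, m) - (\<Sum>j<n. frag_of (lam j m \<odot>\<^bsub>N\<^esub> x, e j)) : tensor_relations R N M"
 by (auto simp: sum_subtractf dest: tensor_relations.diff)
 then show ?case using p by (simp add: g1)
 qed
 \<comment> \<open>Contraction over \<open>N'\<close>, applied to the image under \<open>f\<close>,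
   agrees with \<open>f\<close> after contraction over \<open>N\<close>; the former kills relations
   and \<open>f\<close> is injective.\<close>
 have "g j z = \<zero>\<^bsub>N\<^esub>" if j: "j < n" for j
 proof -
 obtain h where h1: "!!x m. x : carrier N' ==> m : carrier M ==> h (frag_of (x, m)) = lam j m \<odot>\<^bsub>N'\<^esub> x"
 and h2: "!!z. Poly_Mapping.keys z \<subseteq> ?S' ==> h z : carrier N'"
 and h3: "h 0 = \<zero>\<^bsub>N'\<^esub>"
 and h4: "!!z w. Poly_Mapping.keys z \<subseteq> ?S' ==> Poly_Mapping.keys w \<subseteq> ?S' ==> h (z - w) = h z \<ominus>\<^bsub>N'\<^esub> h w"
 and h5: "!!z. z : tensor_relations R N' M ==> h z = \<zero>\<^bsub>N'\<^esub>"
 proof (rule tensor_hom[OF R M N'.module_axioms cl[OF j] add[OF j] smult[OF j]], goal_cases)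
 case (6 h)
 show ?case by (rule 6(1)[of h]) (simp_all add: 6(2-))
 qed
 have "Poly_Mapping.keys (?F w) \<subseteq> ?S' & h (?F w) = f (g j w)" if "Poly_Mapping.keys w \<subseteq> ?S" for w
 using that
 proof (induction rule: free_Abelian_group_induct[consumes 1])
 case 1
 show ?case by (simp add: h3 g3[OF j] f0)
 next
 case (2 u v)
 have "Poly_Mapping.keys (?F u - ?F v) \<subseteq> ?S'" using 2(3,4) keys_diff[of "?F u" "?F v"] by blast
 then show ?case using 2 by (simp add: frag_extend_diff h4 g4[OF j] fm g2[OF j])
 next
 case (3 p)
 then show ?case using fc cl[OF j] by (auto simp: h1 g1[OF j] fs)
 qed
 then have "f (g j z) = \<zero>\<^bsub>N'\<^esub>" using Z h5 by metis
 then show ?thesis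
 using f(2) f0 g2[OF j] Z by (metis N.M.zero_closed inj_onD)
 qed
 then have "(\<Sum>j<n. frag_of (g j z, e j)) : tensor_relations R N M"
 using e left0 by (intro tensor_relations_sum) auto
 from tensor_relations_add[OF reduce[OF Z[THEN conjunct1]] this] show "z : tensor_relations R N M" by simp
qed

section \<open>Stalks\<close>

text \<open>Functoriality alone, without operations, so that one treatment of germs serves both the
  structure sheaf and the module presheaves.\<close>

definition is_presheaf ::
 "'x topology => ('x, 'm, ('m, 'z) partial_object_scheme) presheaf => bool" where
 "is_presheaf X F \<longleftrightarrow>
 (ALL U V. openin X U & openin X V & V \<subseteq> U --> (ALL s:carrier (sec F U). res F U V s : carrier (sec F V))) &
 (ALL U. openin X U --> (ALL s:carrier (sec F U). res F U U s = s)) &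
 (ALL U V W. openin X U & openin X V & openin X W & W \<subseteq> V & V \<subseteq> U -->
 (ALL s:carrier (sec F U). res F V W (res F U V s) = res F U W s))"

lemma is_presheafD:
 assumes "is_presheaf X F"
 shows "openin X U ==> openin X V ==> V \<subseteq> U ==> s : carrier (sec F U) ==> res F U V s : carrier (sec F V)"
 and "openin X U ==> s : carrier (sec F U) ==> res F U U s = s"
 and "openin X U ==> openin X V ==> openin X W ==> W \<subseteq> V ==> V \<subseteq> U ==> s : carrier (sec F U) ==>
 res F V W (res F U V s) = res F U W s"
 using assms by (simp_all add: is_presheaf_def)

lemma module_presheaf_is_presheaf: "module_presheaf X P ==> is_presheaf (pts X) P"
 by (simp add: module_presheaf_def is_presheaf_def)

lemma ringed_space_is_presheaf: "is_ringed_space X ==> is_presheaf (pts X) (str X)"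
 using ringedD(3,9,10)[of X] by (simp add: is_presheaf_def)

context
 fixes X :: "'x topology" and F :: "('x, 'm, ('m, 'z) partial_object_scheme) presheaf" and x :: 'x
 assumes F: "is_presheaf X F"
begin

lemma germ_self:
 "openin X U ==> x : U ==> s : carrier (sec F U) ==> (U, s) : germ X F x U s"
 unfolding germ_def by auto

lemma germ_eqI:
 assumes U: "openin X U" "x : U" "s : carrier (sec F U)" and V: "openin X V" "x : V" "t : carrier (sec F V)"
 and W: "openin X W" "x : W" "W \<subseteq> U" "W \<subseteq> V" "res F U W s = res F V W t"
 shows "germ X F x U s = germ X F x V t"
proof -
 have sub: "germ X F x U s \<subseteq> germ X F x V t"
 if U: "openin X U" "x : U" "s : carrier (sec F U)" and V: "openin X V" "x : V" "t : carrier (sec F V)"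
 and W: "W \<subseteq> U" "W \<subseteq> V" "res F U W s = res F V W t" for U V s t
 proof clarify
 fix V' u assume "(V', u) : germ X F x U s"
 then obtain W' where W': "openin X V'" "x : V'" "u : carrier (sec F V')" "openin X W'" "x : W'" "W' \<subseteq> U" "W' \<subseteq> V'"
 "res F U W' s = res F V' W' u" by (auto simp: germ_def)
 let ?W = "W \<inter> W'"
 have O: "openin X ?W" using W' assms(7) by auto
 have "res F V ?W t = res F W ?W (res F V W t)"
 using is_presheafD(3)[OF F V(1) assms(7) O _ W(2) V(3)] by simp
 also have "\<dots> = res F U ?W s"
 using is_presheafD(3)[OF F U(1) assms(7) O _ W(1) U(3)] W(3) by simp
 also have "\<dots> = res F W' ?W (res F U W' s)"
 using is_presheafD(3)[OF F U(1) W'(4) O _ W'(6) U(3)] by simp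
 also have "\<dots> = res F V' ?W u"
 using is_presheafD(3)[OF F W'(1) W'(4) O _ W'(7) W'(3)] W'(8) by simp
 finally show "(V', u) : germ X F x V t"
 using W' W O assms(8) by (auto simp: germ_def intro!: exI[of _ ?W])
 qed
 show ?thesis
 using sub[OF U V W(3-5)] sub[OF V U W(4,3) W(5)[symmetric]] by auto
qed

lemma germ_eqE:
 assumes "openin X U" "x : U" "s : carrier (sec F U)" and "germ X F x U s = germ X F x V t"
 obtains W where "openin X W" "x : W" "W \<subseteq> U" "W \<subseteq> V" "res F U W s = res F V W t"
proof -
 have "(U, s) : germ X F x V t" using germ_self[OF assms(1-3)] assms(4) by simp
 then show ?thesis using that by (auto simp: germ_def)
qed

lemma germ_res:
 assumes "openin X U" "openin X V" "x : V" "V \<subseteq> U" "s : carrier (sec F U)"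
 shows "germ X F x V (res F U V s) = germ X F x U s"
 using assms by (intro germ_eqI[where W = V]) (auto simp: is_presheafD[OF F])

lemma germ_mem:
 assumes "openin X U" "x : U" "s : carrier (sec F U)" "(V, t) : germ X F x U s"
 shows "openin X V" "x : V" "t : carrier (sec F V)" "germ X F x V t = germ X F x U s"
proof -
 show V: "openin X V" "x : V" "t : carrier (sec F V)" using assms(4) by (auto simp: germ_def)
 obtain W where "openin X W" "x : W" "W \<subseteq> U \<inter> V" "res F U W s = res F V W t"
 using assms(4) by (auto simp: germ_def)
 then show "germ X F x V t = germ X F x U s"
 by (intro germ_eqI[OF V assms(1-3), of W]) auto
qed

lemma germ_in_germs: "openin X U ==> x : U ==> s : carrier (sec F U) ==> germ X F x U s : germs X F x"
 by (auto simp: germs_def)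

lemma germs_within:
 assumes "\<alpha> : germs X F x" "openin X W" "x : W"
 obtains V s where "openin X V" "x : V" "V \<subseteq> W" "s : carrier (sec F V)" "\<alpha> = germ X F x V s"
proof -
 obtain U s where U: "openin X U" "x : U" "s : carrier (sec F U)" "\<alpha> = germ X F x U s"
 using assms(1) by (auto simp: germs_def)
 have O: "openin X (U \<inter> W)" using U assms by auto
 have "germ X F x (U \<inter> W) (res F U (U \<inter> W) s) = \<alpha>"
 using germ_res[OF U(1) O] U assms by auto
 then show ?thesis
 using that[OF O, of "res F U (U \<inter> W) s"] is_presheafD(1)[OF F U(1) O _ U(3)] U assms by auto
qed

end

lemma germs_common:
 assumes F: "is_presheaf X F" and G: "is_presheaf X G"
 and a: "\<alpha> : germs X F x" and b: "\<beta> : germs X G x"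
 obtains W s t where "openin X W" "x : W" "s : carrier (sec F W)" "t : carrier (sec G W)"
 "\<alpha> = germ X F x W s" "\<beta> = germ X G x W t"
proof -
 obtain U s where U: "openin X U" "x : U" "s : carrier (sec F U)" "\<alpha> = germ X F x U s"
 using a by (auto simp: germs_def)
 obtain V t where V: "openin X V" "x : V" "V \<subseteq> U" "t : carrier (sec G V)" "\<beta> = germ X G x V t"
 using germs_within[OF G b U(1,2)] .
 show ?thesis
 using that[OF V(1,2) is_presheafD(1)[OF F U(1) V(1,3) U(3)] V(4) _ V(5)] germ_res[OF F U(1) V(1-3) U(3)] U(4) by simp
qed

lemma germs_common3:
 assumes F: "is_presheaf X F" and G: "is_presheaf X G" and H: "is_presheaf X H"
 and a: "\<alpha> : germs X F x" and b: "\<beta> : germs X G x" and c: "\<gamma> : germs X H x"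
 obtains W s t u where "openin X W" "x : W" "s : carrier (sec F W)" "t : carrier (sec G W)" "u : carrier (sec H W)"
 "\<alpha> = germ X F x W s" "\<beta> = germ X G x W t" "\<gamma> = germ X H x W u"
proof -
 obtain U s t where U: "openin X U" "x : U" "s : carrier (sec F U)" "t : carrier (sec G U)" "\<alpha> = germ X F x U s" "\<beta> = germ X G x U t"
 by (rule germs_common[OF F G a b])
 obtain V u where V: "openin X V" "x : V" "V \<subseteq> U" "u : carrier (sec H V)" "\<gamma> = germ X H x V u"
 using germs_within[OF H c U(1,2)] .
 show ?thesis
 using that[OF V(1,2) is_presheafD(1)[OF F U(1) V(1,3) U(3)] is_presheafD(1)[OF G U(1) V(1,3) U(4)] V(4) _ _ V(5)]
 germ_res[OF F U(1) V(1-3) U(3)] germ_res[OF G U(1) V(1-3) U(4)] U(5,6) by simp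
qed

text \<open>\<open>germ_op\<close> is a union over all pairs of representatives. Two choices agree
  on a smaller neighbourhood because \<open>f\<close> commutes with restriction, so all germs in the
  union coincide.\<close>

lemma germ_op_germ:
 assumes F: "is_presheaf X F" and G: "is_presheaf X G" and H: "is_presheaf X H"
 and f: "!!W s t. openin X W ==> s : carrier (sec F W) ==> t : carrier (sec G W) ==> f W s t : carrier (sec H W)"
 and fr: "!!W V s t. openin X W ==> openin X V ==> V \<subseteq> W ==> s : carrier (sec F W) ==> t : carrier (sec G W) ==>
 res H W V (f W s t) = f V (res F W V s) (res G W V t)"
 and U: "openin X U" "x : U" and s: "s : carrier (sec F U)" and t: "t : carrier (sec G U)"
 shows "germ_op X F G H x f (germ X F x U s) (germ X G x U t) = germ X H x U (f U s t)"
proof -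
 have eq: "germ X H x (V \<inter> V') (f (V \<inter> V') (res F V (V \<inter> V') s') (res G V' (V \<inter> V') t')) = germ X H x U (f U s t)"
 if s': "(V, s') : germ X F x U s" and t': "(V', t') : germ X G x U t" for V V' s' t'
 proof -
 note S = germ_mem[OF F U s s'] and T = germ_mem[OF G U t t']
 obtain W1 where W1: "openin X W1" "x : W1" "W1 \<subseteq> V" "W1 \<subseteq> U" "res F V W1 s' = res F U W1 s"
 using germ_eqE[OF F S(1-4)] .
 obtain W2 where W2: "openin X W2" "x : W2" "W2 \<subseteq> V'" "W2 \<subseteq> U" "res G V' W2 t' = res G U W2 t"
 using germ_eqE[OF G T(1-4)] .
 let ?V = "V \<inter> V'" and ?W = "W1 \<inter> W2"
 have O: "openin X ?V" "openin X ?W" using S T W1 W2 by auto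
 have sV: "res F V ?V s' : carrier (sec F ?V)" "res G V' ?V t' : carrier (sec G ?V)"
 using is_presheafD(1)[OF F S(1) O(1) _ S(3)] is_presheafD(1)[OF G T(1) O(1) _ T(3)] by auto
 have sub: "?W \<subseteq> ?V" "?W \<subseteq> U" "?W \<subseteq> V" "?W \<subseteq> V'" "?V \<subseteq> V" "?V \<subseteq> V'" using W1 W2 by auto
 have "res F ?V ?W (res F V ?V s') = res F V ?W s'" by (rule is_presheafD(3)[OF F S(1) O sub(1,5) S(3)])
 also have "\<dots> = res F U ?W s"
 using is_presheafD(3)[OF F S(1) W1(1) O(2) _ W1(3) S(3)] is_presheafD(3)[OF F U(1) W1(1) O(2) _ W1(4) s] W1(5) by simp
 finally have a: "res F ?V ?W (res F V ?V s') = res F U ?W s" .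
 have "res G ?V ?W (res G V' ?V t') = res G V' ?W t'" by (rule is_presheafD(3)[OF G T(1) O sub(1,6) T(3)])
 also have "\<dots> = res G U ?W t"
 using is_presheafD(3)[OF G T(1) W2(1) O(2) _ W2(3) T(3)] is_presheafD(3)[OF G U(1) W2(1) O(2) _ W2(4) t] W2(5) by simp
 finally have b: "res G ?V ?W (res G V' ?V t') = res G U ?W t" .
 show ?thesis
 proof (rule germ_eqI[OF H O(1) _ f[OF O(1) sV] U f[OF U(1) s t] O(2) _ sub(1,2)])
 show "res H ?V ?W (f ?V (res F V ?V s') (res G V' ?V t')) = res H U ?W (f U s t)"
  by (simp add: fr[OF O sub(1) sV] fr[OF U(1) O(2) sub(2) s t] a b)
 qed (use S T W1 W2 in auto)
 qed
 have ne: "(U, s) : germ X F x U s" "(U, t) : germ X G x U t"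
 using germ_self[OF F U s] germ_self[OF G U t] by auto
 let ?c = "germ X H x U (f U s t)"
 have "(\<Union>(V', t')\<in>germ X G x U t. germ X H x (V \<inter> V') (f (V \<inter> V') (res F V (V \<inter> V') s') (res G V' (V \<inter> V') t'))) = ?c"
 if "(V, s') : germ X F x U s" for V s'
 by (rule UN_constant_eq[OF ne(2)]) (use eq[OF that] in auto)
 then show ?thesis
 unfolding germ_op_def by (intro UN_constant_eq[OF ne(1)]) auto
qed

context
 fixes X :: "('x, 'r) ringed_space" and x :: 'x
 assumes X: "is_ringed_space X" and x: "x : topspace (pts X)"
begin

lemma stalk_ring_simps:
 shows "carrier (stalk_ring X x) = germs (pts X) (str X) x"
 and "opn X U ==> x : U ==> \<zero>\<^bsub>stalk_ring X x\<^esub> = germ (pts X) (str X) x U \<zero>\<^bsub>Osec X U\<^esub>"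
 and "opn X U ==> x : U ==> \<one>\<^bsub>stalk_ring X x\<^esub> = germ (pts X) (str X) x U \<one>\<^bsub>Osec X U\<^esub>"
 and "opn X U ==> x : U ==> r : (cO X U) ==> r' : (cO X U) ==>
 germ (pts X) (str X) x U r \<oplus>\<^bsub>stalk_ring X x\<^esub> germ (pts X) (str X) x U r' = germ (pts X) (str X) x U (r \<oplus>\<^bsub>Osec X U\<^esub> r')"
 and "opn X U ==> x : U ==> r : (cO X U) ==> r' : (cO X U) ==>
 germ (pts X) (str X) x U r \<otimes>\<^bsub>stalk_ring X x\<^esub> germ (pts X) (str X) x U r' = germ (pts X) (str X) x U (r \<otimes>\<^bsub>Osec X U\<^esub> r')"
proof -
 note P = ringed_space_is_presheaf[OF X]
 show "carrier (stalk_ring X x) = germs (pts X) (str X) x" by (simp add: stalk_ring_def Let_def)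
 have T: "opn X (topspace (pts X))" by simp
 interpret OT: cring "Osec X (topspace (pts X))" by (rule ringedD(2)[OF X T])
 {
 assume U: "opn X U" "x : U"
 have UT: "U \<subseteq> topspace (pts X)" using U openin_subset by auto
 show "\<zero>\<^bsub>stalk_ring X x\<^esub> = germ (pts X) (str X) x U \<zero>\<^bsub>Osec X U\<^esub>"
 using germ_res[OF P T U UT, of "\<zero>\<^bsub>Osec X (topspace (pts X))\<^esub>"] ringedD(7)[OF X T U(1) UT]
 by (simp add: stalk_ring_def Let_def OT.zero_closed)
 show "\<one>\<^bsub>stalk_ring X x\<^esub> = germ (pts X) (str X) x U \<one>\<^bsub>Osec X U\<^esub>"
 using germ_res[OF P T U UT, of "\<one>\<^bsub>Osec X (topspace (pts X))\<^esub>"] ringedD(6)[OF X T U(1) UT]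
 by (simp add: stalk_ring_def Let_def OT.one_closed)
 assume r: "r : (cO X U)" "r' : (cO X U)"
 show "germ (pts X) (str X) x U r \<oplus>\<^bsub>stalk_ring X x\<^esub> germ (pts X) (str X) x U r' = germ (pts X) (str X) x U (r \<oplus>\<^bsub>Osec X U\<^esub> r')"
 using germ_op_germ[OF P P P _ _ U r, of "%U. add (Osec X U)"]
 by (simp add: stalk_ring_def Let_def ringedD(4)[OF X] cring.cring_simprules(1)[OF ringedD(2)[OF X]])
 show "germ (pts X) (str X) x U r \<otimes>\<^bsub>stalk_ring X x\<^esub> germ (pts X) (str X) x U r' = germ (pts X) (str X) x U (r \<otimes>\<^bsub>Osec X U\<^esub> r')"
 using germ_op_germ[OF P P P _ _ U r, of "%U. mult (Osec X U)"]
 by (simp add: stalk_ring_def Let_def ringedD(5)[OF X] cring.cring_simprules(5)[OF ringedD(2)[OF X]])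
 }
qed

lemma stalk_ring_cring: "cring (stalk_ring X x)"
proof -
 note P = ringed_space_is_presheaf[OF X]
 note S = stalk_ring_simps
 let ?R = "stalk_ring X x"
 note in_germs = germ_in_germs[OF P]
 have T: "opn X (topspace (pts X))" by simp
 interpret OT: cring "Osec X (topspace (pts X))" by (rule ringedD(2)[OF X T])
 show ?thesis
 proof (intro cringI abelian_groupI Group.comm_monoidI, unfold S(1))
 show "\<zero>\<^bsub>?R\<^esub> : germs (pts X) (str X) x" "\<one>\<^bsub>?R\<^esub> : germs (pts X) (str X) x"
 by (auto simp: S(2)[OF T x] S(3)[OF T x] intro!: in_germs x)
 fix \<alpha> \<beta> assume "\<alpha> : germs (pts X) (str X) x" "\<beta> : germs (pts X) (str X) x"
 then obtain W r r' where W: "opn X W" "x : W" "r : (cO X W)" "r' : (cO X W)"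
 "\<alpha> = germ (pts X) (str X) x W r" "\<beta> = germ (pts X) (str X) x W r'"
 using germs_common[OF P P] by metis
 interpret O: cring "Osec X W" by (rule ringedD(2)[OF X W(1)])
 show "\<alpha> \<oplus>\<^bsub>?R\<^esub> \<beta> : germs (pts X) (str X) x" "\<alpha> \<otimes>\<^bsub>?R\<^esub> \<beta> : germs (pts X) (str X) x"
 using W by (auto simp: S intro!: in_germs)
 show "\<alpha> \<oplus>\<^bsub>?R\<^esub> \<beta> = \<beta> \<oplus>\<^bsub>?R\<^esub> \<alpha>" "\<alpha> \<otimes>\<^bsub>?R\<^esub> \<beta> = \<beta> \<otimes>\<^bsub>?R\<^esub> \<alpha>"
 using W by (auto simp: S O.a_comm O.m_comm)
 next
 fix \<alpha> assume "\<alpha> : germs (pts X) (str X) x"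
 then obtain W r where W: "opn X W" "x : W" "r : (cO X W)"
 "\<alpha> = germ (pts X) (str X) x W r" by (auto simp: germs_def)
 interpret O: cring "Osec X W" by (rule ringedD(2)[OF X W(1)])
 show "\<zero>\<^bsub>?R\<^esub> \<oplus>\<^bsub>?R\<^esub> \<alpha> = \<alpha>" "\<one>\<^bsub>?R\<^esub> \<otimes>\<^bsub>?R\<^esub> \<alpha> = \<alpha>"
 using W by (simp_all add: S(2)[OF W(1,2)] S(3)[OF W(1,2)] S(4,5))
 show "EX \<beta>:germs (pts X) (str X) x. \<beta> \<oplus>\<^bsub>?R\<^esub> \<alpha> = \<zero>\<^bsub>?R\<^esub>"
 using W by (intro bexI[of _ "germ (pts X) (str X) x W (\<ominus>\<^bsub>Osec X W\<^esub> r)"])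
  (auto simp: S(2)[OF W(1,2)] S(4) O.l_neg intro!: in_germs)
 next
 fix \<alpha> \<beta> \<gamma> assume "\<alpha> : germs (pts X) (str X) x" "\<beta> : germs (pts X) (str X) x" "\<gamma> : germs (pts X) (str X) x"
 then obtain W r r' r'' where W: "opn X W" "x : W" "r : (cO X W)" "r' : (cO X W)" "r'' : (cO X W)"
 "\<alpha> = germ (pts X) (str X) x W r" "\<beta> = germ (pts X) (str X) x W r'" "\<gamma> = germ (pts X) (str X) x W r''"
 using germs_common3[OF P P P] by metis
 interpret O: cring "Osec X W" by (rule ringedD(2)[OF X W(1)])
 show "\<alpha> \<oplus>\<^bsub>?R\<^esub> \<beta> \<oplus>\<^bsub>?R\<^esub> \<gamma> = \<alpha> \<oplus>\<^bsub>?R\<^esub> (\<beta> \<oplus>\<^bsub>?R\<^esub> \<gamma>)" "\<alpha> \<otimes>\<^bsub>?R\<^esub> \<beta> \<otimes>\<^bsub>?R\<^esub> \<gamma> = \<alpha> \<otimes>\<^bsub>?R\<^esub> (\<beta> \<otimes>\<^bsub>?R\<^esub> \<gamma>)"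
 "(\<alpha> \<oplus>\<^bsub>?R\<^esub> \<beta>) \<otimes>\<^bsub>?R\<^esub> \<gamma> = \<alpha> \<otimes>\<^bsub>?R\<^esub> \<gamma> \<oplus>\<^bsub>?R\<^esub> \<beta> \<otimes>\<^bsub>?R\<^esub> \<gamma>"
 using W by (simp_all add: S O.a_assoc O.m_assoc O.l_distr)
 qed
qed

context
 fixes P :: "('x, 'r, 'm) mod_presheaf"
 assumes P: "module_presheaf X P"
begin

lemma stalk_module_simps:
 shows "carrier (stalk_module X P x) = germs (pts X) P x"
 and "opn X U ==> x : U ==> \<zero>\<^bsub>stalk_module X P x\<^esub> = germ (pts X) P x U \<zero>\<^bsub>sec P U\<^esub>"
 and "opn X U ==> x : U ==> s : carrier (sec P U) ==> s' : carrier (sec P U) ==>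
 germ (pts X) P x U s \<oplus>\<^bsub>stalk_module X P x\<^esub> germ (pts X) P x U s' = germ (pts X) P x U (s \<oplus>\<^bsub>sec P U\<^esub> s')"
 and "opn X U ==> x : U ==> r : (cO X U) ==> s : carrier (sec P U) ==>
 germ (pts X) (str X) x U r \<odot>\<^bsub>stalk_module X P x\<^esub> germ (pts X) P x U s = germ (pts X) P x U (r \<odot>\<^bsub>sec P U\<^esub> s)"
proof -
 note PP = module_presheaf_is_presheaf[OF P] and PO = ringed_space_is_presheaf[OF X]
 show "carrier (stalk_module X P x) = germs (pts X) P x" by (simp add: stalk_module_def Let_def)
 have T: "opn X (topspace (pts X))" by simp
 interpret PT: module "Osec X (topspace (pts X))" "sec P (topspace (pts X))" by (rule presheafD(1)[OF P T])
 {
 assume U: "opn X U" "x : U"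
 have UT: "U \<subseteq> topspace (pts X)" using U openin_subset by auto
 show "\<zero>\<^bsub>stalk_module X P x\<^esub> = germ (pts X) P x U \<zero>\<^bsub>sec P U\<^esub>"
 using germ_res[OF PP T U UT, of "\<zero>\<^bsub>sec P (topspace (pts X))\<^esub>"] module_presheaf_res_map(1)[OF P T U(1) UT]
 by (simp add: stalk_module_def Let_def PT.M.zero_closed)
 {
 assume s: "s : carrier (sec P U)" "s' : carrier (sec P U)"
 show "germ (pts X) P x U s \<oplus>\<^bsub>stalk_module X P x\<^esub> germ (pts X) P x U s' = germ (pts X) P x U (s \<oplus>\<^bsub>sec P U\<^esub> s')"
  using germ_op_germ[OF PP PP PP _ _ U s, of "%U. add (sec P U)"]
  by (simp add: stalk_module_def Let_def presheafD(3)[OF P] abelian_monoid.a_closed[OF abelian_group.axioms(1)[OF presheafD(7)[OF P]]])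
 }
 assume s: "r : (cO X U)" "s : carrier (sec P U)"
 show "germ (pts X) (str X) x U r \<odot>\<^bsub>stalk_module X P x\<^esub> germ (pts X) P x U s = germ (pts X) P x U (r \<odot>\<^bsub>sec P U\<^esub> s)"
 using germ_op_germ[OF PO PP PP _ _ U s, of "%U. smult (sec P U)"]
 by (simp add: stalk_module_def Let_def presheafD(4)[OF P] module.smult_closed[OF presheafD(1)[OF P]])
 }
qed

lemma stalk_module_module: "module (stalk_ring X x) (stalk_module X P x)"
proof -
 note PP = module_presheaf_is_presheaf[OF P] and PO = ringed_space_is_presheaf[OF X]
 note S = stalk_module_simps and SR = stalk_ring_simps
 let ?R = "stalk_ring X x" and ?M = "stalk_module X P x"
 note in_germs = germ_in_germs[OF PP]
 have T: "opn X (topspace (pts X))" by simp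
 interpret PT: module "Osec X (topspace (pts X))" "sec P (topspace (pts X))" by (rule presheafD(1)[OF P T])
 show ?thesis
 proof (intro moduleI abelian_groupI, unfold S(1) SR(1))
 show "cring ?R" by (rule stalk_ring_cring)
 show "\<zero>\<^bsub>?M\<^esub> : germs (pts X) P x"
 by (auto simp: S(2)[OF T x] intro!: in_germs x)
 {
 fix \<alpha> \<beta> assume "\<alpha> : germs (pts X) P x" "\<beta> : germs (pts X) P x"
 then obtain W r r' where W: "opn X W" "x : W" "r : carrier (sec P W)" "r' : carrier (sec P W)"
  "\<alpha> = germ (pts X) P x W r" "\<beta> = germ (pts X) P x W r'"
  using germs_common[OF PP PP] by metis
 interpret P: module "Osec X W" "sec P W" by (rule presheafD(1)[OF P W(1)])
 show "\<alpha> \<oplus>\<^bsub>?M\<^esub> \<beta> : germs (pts X) P x"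
  using W by (auto simp: S intro!: in_germs)
 show "\<alpha> \<oplus>\<^bsub>?M\<^esub> \<beta> = \<beta> \<oplus>\<^bsub>?M\<^esub> \<alpha>"
  using W by (auto simp: S P.M.a_comm)
 }
 {
 fix \<alpha> assume "\<alpha> : germs (pts X) P x"
 then obtain W r where W: "opn X W" "x : W" "r : carrier (sec P W)"
  "\<alpha> = germ (pts X) P x W r" by (auto simp: germs_def)
 interpret P: module "Osec X W" "sec P W" by (rule presheafD(1)[OF P W(1)])
 show "\<zero>\<^bsub>?M\<^esub> \<oplus>\<^bsub>?M\<^esub> \<alpha> = \<alpha>" "\<one>\<^bsub>?R\<^esub> \<odot>\<^bsub>?M\<^esub> \<alpha> = \<alpha>"
  using W by (simp_all add: S(2)[OF W(1,2)] SR(3)[OF W(1,2)] S(3,4))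
 show "EX \<beta>:germs (pts X) P x. \<beta> \<oplus>\<^bsub>?M\<^esub> \<alpha> = \<zero>\<^bsub>?M\<^esub>"
  using W by (intro bexI[of _ "germ (pts X) P x W (\<ominus>\<^bsub>sec P W\<^esub> r)"])
  (auto simp: S(2)[OF W(1,2)] S(3) P.M.l_neg intro!: in_germs)
 }
 {
 fix \<alpha> \<beta> \<gamma> assume "\<alpha> : germs (pts X) P x" "\<beta> : germs (pts X) P x" "\<gamma> : germs (pts X) P x"
 then obtain W r r' r'' where W: "opn X W" "x : W" "r : carrier (sec P W)" "r' : carrier (sec P W)" "r'' : carrier (sec P W)"
  "\<alpha> = germ (pts X) P x W r" "\<beta> = germ (pts X) P x W r'" "\<gamma> = germ (pts X) P x W r''"
  using germs_common3[OF PP PP PP] by metis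
 interpret P: module "Osec X W" "sec P W" by (rule presheafD(1)[OF P W(1)])
 show "\<alpha> \<oplus>\<^bsub>?M\<^esub> \<beta> \<oplus>\<^bsub>?M\<^esub> \<gamma> = \<alpha> \<oplus>\<^bsub>?M\<^esub> (\<beta> \<oplus>\<^bsub>?M\<^esub> \<gamma>)"
  using W by (simp_all add: S P.M.a_assoc)
 }
 {
 fix \<rho> \<alpha> assume "\<rho> : germs (pts X) (str X) x" "\<alpha> : germs (pts X) P x"
 then obtain W r s where W: "opn X W" "x : W" "r : (cO X W)" "s : carrier (sec P W)"
  "\<rho> = germ (pts X) (str X) x W r" "\<alpha> = germ (pts X) P x W s"
  using germs_common[OF PO PP] by metis
 interpret P: module "Osec X W" "sec P W" by (rule presheafD(1)[OF P W(1)])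
 show "\<rho> \<odot>\<^bsub>?M\<^esub> \<alpha> : germs (pts X) P x"
  using W by (auto simp: S intro!: in_germs)
 }
 {
 fix \<rho> \<sigma> \<alpha> assume "\<rho> : germs (pts X) (str X) x" "\<sigma> : germs (pts X) (str X) x" "\<alpha> : germs (pts X) P x"
 then obtain W r r' s where W: "opn X W" "x : W" "r : (cO X W)" "r' : (cO X W)" "s : carrier (sec P W)"
  "\<rho> = germ (pts X) (str X) x W r" "\<sigma> = germ (pts X) (str X) x W r'" "\<alpha> = germ (pts X) P x W s"
  using germs_common3[OF PO PO PP] by metis
 interpret P: module "Osec X W" "sec P W" by (rule presheafD(1)[OF P W(1)])
 show "(\<rho> \<oplus>\<^bsub>?R\<^esub> \<sigma>) \<odot>\<^bsub>?M\<^esub> \<alpha> = \<rho> \<odot>\<^bsub>?M\<^esub> \<alpha> \<oplus>\<^bsub>?M\<^esub> \<sigma> \<odot>\<^bsub>?M\<^esub> \<alpha>"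
  "(\<rho> \<otimes>\<^bsub>?R\<^esub> \<sigma>) \<odot>\<^bsub>?M\<^esub> \<alpha> = \<rho> \<odot>\<^bsub>?M\<^esub> (\<sigma> \<odot>\<^bsub>?M\<^esub> \<alpha>)"
  using W by (simp_all add: S(3,4) SR(4,5) P.smult_l_distr P.smult_assoc1 P.R.a_closed P.R.m_closed)
 }
 {
 fix \<rho> \<alpha> \<beta> assume "\<rho> : germs (pts X) (str X) x" "\<alpha> : germs (pts X) P x" "\<beta> : germs (pts X) P x"
 then obtain W r s s' where W: "opn X W" "x : W" "r : (cO X W)" "s : carrier (sec P W)" "s' : carrier (sec P W)"
  "\<rho> = germ (pts X) (str X) x W r" "\<alpha> = germ (pts X) P x W s" "\<beta> = germ (pts X) P x W s'"
  using germs_common3[OF PO PP PP] by metis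
 interpret P: module "Osec X W" "sec P W" by (rule presheafD(1)[OF P W(1)])
 show "\<rho> \<odot>\<^bsub>?M\<^esub> (\<alpha> \<oplus>\<^bsub>?M\<^esub> \<beta>) = \<rho> \<odot>\<^bsub>?M\<^esub> \<alpha> \<oplus>\<^bsub>?M\<^esub> \<rho> \<odot>\<^bsub>?M\<^esub> \<beta>"
  using W by (simp_all add: S(3,4) P.smult_r_distr)
 }
 qed
qed

definition stalk_functional where
 "stalk_functional U \<phi> \<alpha> = (SOME \<beta>. EX V s. opn X V & x : V & V \<subseteq> U & s : carrier (sec P V) &
 \<alpha> = germ (pts X) P x V s & \<beta> = germ (pts X) (str X) x V (\<phi> V s))"

lemma stalk_functional_germ:
 assumes \<phi>: "\<phi> : dual_sections X P U" and V: "opn X V" "x : V" "V \<subseteq> U" and s: "s : carrier (sec P V)"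
 shows "stalk_functional U \<phi> (germ (pts X) P x V s) = germ (pts X) (str X) x V (\<phi> V s)"
 unfolding stalk_functional_def
proof (rule some_equality)
 note PP = module_presheaf_is_presheaf[OF P] and PO = ringed_space_is_presheaf[OF X]
 show "EX V' s'. opn X V' & x : V' & V' \<subseteq> U & s' : carrier (sec P V') &
 germ (pts X) P x V s = germ (pts X) P x V' s' & germ (pts X) (str X) x V (\<phi> V s) = germ (pts X) (str X) x V' (\<phi> V' s')"
 using V s by blast
 fix \<beta> assume "EX V' s'. opn X V' & x : V' & V' \<subseteq> U & s' : carrier (sec P V') &
 germ (pts X) P x V s = germ (pts X) P x V' s' & \<beta> = germ (pts X) (str X) x V' (\<phi> V' s')"
 then obtain V' s' where V': "opn X V'" "x : V'" "V' \<subseteq> U" "s' : carrier (sec P V')"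
 "germ (pts X) P x V s = germ (pts X) P x V' s'" "\<beta> = germ (pts X) (str X) x V' (\<phi> V' s')" by blast
 obtain W where W: "opn X W" "x : W" "W \<subseteq> V" "W \<subseteq> V'" "res P V W s = res P V' W s'"
 using germ_eqE[OF PP V(1,2) s V'(5)] .
 have "germ (pts X) (str X) x V (\<phi> V s) = germ (pts X) (str X) x V' (\<phi> V' s')"
 proof (rule germ_eqI[OF PO V(1,2) _ V'(1,2) _ W(1-4)])
 show "\<phi> V s : (cO X V)" "\<phi> V' s' : (cO X V')"
 using dualD(1)[OF X P \<phi>] V V' s by auto
 show "res (str X) V W (\<phi> V s) = res (str X) V' W (\<phi> V' s')"
 using dualD(4)[OF X P \<phi> V(1,3) W(1,3) s] dualD(4)[OF X P \<phi> V'(1,3) W(1,4) V'(4)] W(5) by simp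
 qed
 then show "\<beta> = germ (pts X) (str X) x V (\<phi> V s)" using V'(6) by simp
qed

lemma germ_finsum:
 assumes U: "opn X U" "x : U" and I: "finite I" and f: "!!i. i : I ==> f i : carrier (sec P U)"
 shows "germ (pts X) P x U (finsum (sec P U) f I) = finsum (stalk_module X P x) (%i. germ (pts X) P x U (f i)) I"
 by (rule finsum_additive_map)
 (use U I f in \<open>auto simp: stalk_module_simps presheafD(7)[OF P] module.axioms(2)[OF stalk_module_module]
 intro: germ_in_germs[OF module_presheaf_is_presheaf[OF P]]\<close>)

text \<open>The coordinate functionals induce linear forms on the stalk, and together with the germs
  of the basis they form a finite dual basis there.\<close>

lemma flat_stalk:
 assumes U: "opn X U" "x : U" and e: "is_local_basis X P U n e"
 shows "flat_module (stalk_ring X x) (stalk_module X P x)"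
proof -
 note PP = module_presheaf_is_presheaf[OF P] and PO = ringed_space_is_presheaf[OF X]
 obtain \<gamma> where \<gamma>: "!!l. l < n ==> \<gamma> l : dual_sections X P U"
 and "!!V l i. opn X V ==> V \<subseteq> U ==> l < n ==> i < n ==>
 \<gamma> l V (res P U V (e i)) = (if i = l then \<one>\<^bsub>Osec X V\<^esub> else \<zero>\<^bsub>Osec X V\<^esub>)"
 and span: "!!V s y. opn X V ==> V \<subseteq> U ==> s : carrier (sec P V) ==> y : V ==>
 EX W. opn X W & y : W & W \<subseteq> V &
  res P V W s = finsum (sec P W) (%i. res (str X) V W (\<gamma> i V s) \<odot>\<^bsub>sec P W\<^esub> res P U W (e i)) {..<n}"
 by (rule local_coordinates[OF X P U(1) e]) (rule that)
 have ei: "e i : carrier (sec P U)" if "i < n" for i using e that by (simp add: is_local_basis_def)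
 note D = dualD[OF X P \<gamma>]
 show ?thesis
 proof (rule flat_module_dual_basis[OF stalk_ring_cring stalk_module_module,
  where n = n and e = "%j. germ (pts X) P x U (e j)" and lam = "%j. stalk_functional U (\<gamma> j)"])
 show "germ (pts X) P x U (e j) : carrier (stalk_module X P x)" if "j < n" for j
 using that ei U by (auto simp: stalk_module_simps intro: germ_in_germs[OF PP])
 next
 fix j m assume j: "j < n" and m: "m : carrier (stalk_module X P x)"
 obtain V s where V: "opn X V" "x : V" "V \<subseteq> U" "s : carrier (sec P V)" "m = germ (pts X) P x V s"
 using germs_within[OF PP _ U] m by (auto simp: stalk_module_simps)
 show "stalk_functional U (\<gamma> j) m : carrier (stalk_ring X x)"
 using V j by (auto simp: stalk_functional_germ[OF \<gamma>] stalk_ring_simps(1) D intro!: germ_in_germs[OF PO])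
 next
 fix j m m' assume j: "j < n" and m: "m : carrier (stalk_module X P x)" "m' : carrier (stalk_module X P x)"
 then obtain V0 s0 s0' where V0: "opn X V0" "x : V0" "s0 : carrier (sec P V0)" "s0' : carrier (sec P V0)"
 "m = germ (pts X) P x V0 s0" "m' = germ (pts X) P x V0 s0'"
 using germs_common[OF PP PP] unfolding stalk_module_simps(1) by metis
 define V where "V = V0 \<inter> U"
 have V: "opn X V" "x : V" "V \<subseteq> U" "V \<subseteq> V0" using V0 U by (auto simp: V_def)
 define s s' where "s = res P V0 V s0" and "s' = res P V0 V s0'"
 have s: "s : carrier (sec P V)" "s' : carrier (sec P V)" "m = germ (pts X) P x V s" "m' = germ (pts X) P x V s'"
 using V0 V by (auto simp: s_def s'_def presheafD(2)[OF P] germ_res[OF PP])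
 interpret P: module "Osec X V" "sec P V" by (rule presheafD(1)[OF P V(1)])
 show "stalk_functional U (\<gamma> j) (m \<oplus>\<^bsub>stalk_module X P x\<^esub> m') =
 stalk_functional U (\<gamma> j) m \<oplus>\<^bsub>stalk_ring X x\<^esub> stalk_functional U (\<gamma> j) m'"
 using V s j by (simp add: stalk_module_simps stalk_functional_germ[OF \<gamma>] stalk_ring_simps D)
 next
 fix j \<rho> m assume j: "j < n" and m: "\<rho> : carrier (stalk_ring X x)" "m : carrier (stalk_module X P x)"
 then obtain V0 s0 s0' where V0: "opn X V0" "x : V0" "s0 : (cO X V0)" "s0' : carrier (sec P V0)"
 "\<rho> = germ (pts X) (str X) x V0 s0" "m = germ (pts X) P x V0 s0'"
 using germs_common[OF PO PP] unfolding stalk_module_simps(1) stalk_ring_simps(1) by metis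
 define V where "V = V0 \<inter> U"
 have V: "opn X V" "x : V" "V \<subseteq> U" "V \<subseteq> V0" using V0 U by (auto simp: V_def)
 define s s' where "s = res (str X) V0 V s0" and "s' = res P V0 V s0'"
 have s: "s : (cO X V)" "s' : carrier (sec P V)" "\<rho> = germ (pts X) (str X) x V s" "m = germ (pts X) P x V s'"
 using V0 V by (auto simp: s_def s'_def presheafD(2)[OF P] ringedD(3)[OF X] germ_res[OF PP] germ_res[OF PO])
 interpret P: module "Osec X V" "sec P V" by (rule presheafD(1)[OF P V(1)])
 show "stalk_functional U (\<gamma> j) (\<rho> \<odot>\<^bsub>stalk_module X P x\<^esub> m) = \<rho> \<otimes>\<^bsub>stalk_ring X x\<^esub> stalk_functional U (\<gamma> j) m"
 using V s j by (simp add: stalk_module_simps stalk_functional_germ[OF \<gamma>] stalk_ring_simps D)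
 next
 fix m assume m: "m : carrier (stalk_module X P x)"
 obtain V s where V: "opn X V" "x : V" "V \<subseteq> U" "s : carrier (sec P V)" "m = germ (pts X) P x V s"
 using germs_within[OF PP _ U] m by (auto simp: stalk_module_simps)
 obtain W where W: "opn X W" "x : W" "W \<subseteq> V"
  "res P V W s = finsum (sec P W) (%i. res (str X) V W (\<gamma> i V s) \<odot>\<^bsub>sec P W\<^esub> res P U W (e i)) {..<n}"
 using span[OF V(1,3,4,2)] by blast
 have WU: "W \<subseteq> U" using W V by auto
 have c: "res (str X) V W (\<gamma> i V s) : (cO X W)" "res P U W (e i) : carrier (sec P W)" if "i < n" for i
 using that V W WU ei U by (auto simp: ringedD(3)[OF X] presheafD(2)[OF P] D)
 have "m = germ (pts X) P x W (res P V W s)"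
 using germ_res[OF PP V(1) W(1-3) V(4)] V(5) by simp
 also have "\<dots> = finsum (stalk_module X P x) (%i. germ (pts X) P x W (res (str X) V W (\<gamma> i V s) \<odot>\<^bsub>sec P W\<^esub> res P U W (e i))) {..<n}"
 unfolding W(4) using c W module.smult_closed[OF presheafD(1)[OF P W(1)]] by (intro germ_finsum) auto
 also have "\<dots> = finsum (stalk_module X P x) (%j. stalk_functional U (\<gamma> j) m \<odot>\<^bsub>stalk_module X P x\<^esub> germ (pts X) P x U (e j)) {..<n}"
 proof -
 interpret M: module "stalk_ring X x" "stalk_module X P x" by (rule stalk_module_module)
 have "stalk_functional U (\<gamma> j) m \<odot>\<^bsub>stalk_module X P x\<^esub> germ (pts X) P x U (e j) =
  germ (pts X) P x W (res (str X) V W (\<gamma> j V s) \<odot>\<^bsub>sec P W\<^esub> res P U W (e j))" if j: "j < n" for j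
 proof -
  have "stalk_functional U (\<gamma> j) m = germ (pts X) (str X) x W (res (str X) V W (\<gamma> j V s))"
  using V W j by (simp add: stalk_functional_germ[OF \<gamma>] germ_res[OF PO] D)
  moreover have "germ (pts X) P x U (e j) = germ (pts X) P x W (res P U W (e j))"
  using U W WU ei j by (simp add: germ_res[OF PP])
  ultimately show ?thesis using c[OF j] W by (simp add: stalk_module_simps)
 qed
 then show ?thesis
  using c W module.smult_closed[OF presheafD(1)[OF P W(1)]]
  by (intro M.finsum_cong') (auto simp: stalk_module_simps(1) intro!: germ_in_germs[OF PP])
 qed
 finally show "m = finsum (stalk_module X P x) (%j. stalk_functional U (\<gamma> j) m \<odot>\<^bsub>stalk_module X P x\<^esub> germ (pts X) P x U (e j)) {..<n}" .
 qed
qed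

end

end

lemma locally_free_finite_imp_flat:
 assumes X: "is_ringed_space X" and P: "module_presheaf X P" and lf: "locally_free_finite X P"
 shows "flat_over X P"
 unfolding flat_over_def
proof
 fix x assume "x : topspace (pts X)"
 then show "flat_module (stalk_ring X x) (stalk_module X P x)"
 using lf flat_stalk[OF X _ P] unfolding locally_free_finite_def by blast
qed

lemma dual_presheaf_carrier [simp]: "carrier (sec (dual_presheaf X P) U) = dual_sections X P U"
 by (simp add: dual_presheaf_def)

lemma quot_functional_descend:
 assumes X: "is_ringed_space X" and P: "module_presheaf X P" and N: "submodule_presheaf X P N" and U: "opn X U"
 and g: "g : dual_sections X P U" and van: "!!V s. opn X V ==> V \<subseteq> U ==> s : N V ==> g V s = \<zero>\<^bsub>Osec X V\<^esub>"
 obtains \<phi> where "\<phi> : dual_sections X (quot_presheaf P N) U"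
 and "!!V s. opn X V ==> V \<subseteq> U ==> s : carrier (sec P V) ==> \<phi> V (N V +>\<^bsub>sec P V\<^esub> s) = g V s"
proof -
 note Q = quot_presheaf_carrier[OF X P N] quot_presheaf_add[OF X P N] quot_presheaf_smult[OF X P N] quot_presheaf_res[OF X P N]
 note D = dualD[OF X P g]
 \<comment> \<open>An arbitrary representative is chosen; the vanishing of \<open>g\<close> on
   \<open>N\<close> makes the value independent of it.\<close>
 define \<psi> where "\<psi> V Y = g V (SOME s. s : carrier (sec P V) & Y = N V +>\<^bsub>sec P V\<^esub> s)" for V Y
 have \<psi>: "\<psi> V (N V +>\<^bsub>sec P V\<^esub> s) = g V s" if V: "opn X V" "V \<subseteq> U" and s: "s : carrier (sec P V)" for V s
 proof -
 let ?s = "SOME s'. s' : carrier (sec P V) & N V +>\<^bsub>sec P V\<^esub> s = N V +>\<^bsub>sec P V\<^esub> s'"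
 have s': "?s : carrier (sec P V) & N V +>\<^bsub>sec P V\<^esub> s = N V +>\<^bsub>sec P V\<^esub> ?s"
 by (rule someI[of _ s]) (use s in simp)
 then have "s \<ominus>\<^bsub>sec P V\<^esub> ?s : N V" using quot_presheaf_eq_iff[OF X P N V(1) s] by auto
 then have "g V s \<ominus>\<^bsub>Osec X V\<^esub> g V ?s = \<zero>\<^bsub>Osec X V\<^esub>" using van[OF V] D(6)[OF V s s'[THEN conjunct1]] by simp
 then show ?thesis unfolding \<psi>_def
 using abelian_group.minus_eq_zero_iff[OF ringedD(11)[OF X V(1)]] D(1)[OF V s] D(1)[OF V s'[THEN conjunct1]] by simp
 qed
 note cl = module.smult_closed[OF presheafD(1)[OF P]]
 abelian_monoid.a_closed[OF abelian_group.axioms(1)[OF presheafD(7)[OF P]]]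
 have "hom_fun X (quot_presheaf P N) U \<psi> : dual_sections X (quot_presheaf P N) U"
 by (rule dual_sectionsI[OF quot_presheaf_module[OF X P N] U])
 (auto simp: Q \<psi> D cl presheafD(2)[OF P] subset_trans)
 then show ?thesis
 using that \<psi> by (auto simp: Q)
qed

lemma quot_functional_lift:
 assumes X: "is_ringed_space X" and P: "module_presheaf X P" and N: "submodule_presheaf X P N" and U: "opn X U"
 and \<phi>: "\<phi> : dual_sections X (quot_presheaf P N) U"
 shows "hom_fun X P U (%V s. \<phi> V (N V +>\<^bsub>sec P V\<^esub> s)) : dual_sections X P U"
proof (rule dual_sectionsI[OF P U])
 note Q = quot_presheaf_carrier[OF X P N] quot_presheaf_add[OF X P N] quot_presheaf_smult[OF X P N] quot_presheaf_res[OF X P N]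
 fix V assume V: "opn X V" "V \<subseteq> U"
 note D = dualD[OF X quot_presheaf_module[OF X P N] \<phi> V]
 fix s assume s: "s : carrier (sec P V)"
 have c: "N V +>\<^bsub>sec P V\<^esub> s' : carrier (sec (quot_presheaf P N) V)" if "s' : carrier (sec P V)" for s'
 using that V by (auto simp: Q)
 show "\<phi> V (N V +>\<^bsub>sec P V\<^esub> s) : (cO X V)" by (rule D(1)[OF c[OF s]])
 show "\<phi> V (N V +>\<^bsub>sec P V\<^esub> (s \<oplus>\<^bsub>sec P V\<^esub> t)) = \<phi> V (N V +>\<^bsub>sec P V\<^esub> s) \<oplus>\<^bsub>Osec X V\<^esub> \<phi> V (N V +>\<^bsub>sec P V\<^esub> t)"
 if "t : carrier (sec P V)" for t using D(2)[OF c[OF s] c[OF that]] s that V by (simp add: Q)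
 show "\<phi> V (N V +>\<^bsub>sec P V\<^esub> (r \<odot>\<^bsub>sec P V\<^esub> s)) = r \<otimes>\<^bsub>Osec X V\<^esub> \<phi> V (N V +>\<^bsub>sec P V\<^esub> s)"
 if "r : (cO X V)" for r using D(3)[OF that c[OF s]] s that V by (simp add: Q)
 show "\<phi> W (N W +>\<^bsub>sec P W\<^esub> res P V W s) = res (str X) V W (\<phi> V (N V +>\<^bsub>sec P V\<^esub> s))"
 if "opn X W" "W \<subseteq> V" for W using D(4)[OF that c[OF s]] s that V by (simp add: Q)
qed

section \<open>Graded modules and their duals\<close>

text \<open>The algebraic laws of a graded algebra and a graded module, free of sheaf conditions on
  the pieces. Thus the presheaf quotient \<open>gr_quot\<close>, the restriction to an open subspace
  and the fibre over the point are instances as well.\<close>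

locale graded_system =
 fixes X :: "('x, 'r) ringed_space" and A :: "('x, 'r, 'a) gralg" and M :: "('x, 'r, 'a, 'm) grmod"
 assumes X: "is_ringed_space X"
 and A: "module_presheaf X (piece A p)"
 and M: "module_presheaf X (piece M p)"
 and unit_closed: "opn X U ==> unit A U : (csec A 0 U)"
 and A_negative: "opn X U ==> p < 0 ==> (csec A p U) = {\<zero>\<^bsub>gsec A p U\<^esub>}"
 and A_act_closed: "opn X U ==> a : (csec A p U) ==> a' : (csec A q U) ==>
 act A U p q a a' : (csec A (p + q) U)"
 and act_closed: "opn X U ==> a : (csec A p U) ==> s : (csec M q U) ==>
 act M U p q a s : (csec M (p + q) U)"
 and act_add_left: "opn X U ==> a : (csec A p U) ==> a' : (csec A p U) ==> s : (csec M q U) ==>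
 act M U p q (a \<oplus>\<^bsub>gsec A p U\<^esub> a') s = act M U p q a s \<oplus>\<^bsub>gsec M (p + q) U\<^esub> act M U p q a' s"
 and act_add_right: "opn X U ==> a : (csec A p U) ==> s : (csec M q U) ==> s' : (csec M q U) ==>
 act M U p q a (s \<oplus>\<^bsub>gsec M q U\<^esub> s') = act M U p q a s \<oplus>\<^bsub>gsec M (p + q) U\<^esub> act M U p q a s'"
 and act_smult_left: "opn X U ==> r : (cO X U) ==> a : (csec A p U) ==> s : (csec M q U) ==>
 act M U p q (r \<odot>\<^bsub>gsec A p U\<^esub> a) s = r \<odot>\<^bsub>gsec M (p + q) U\<^esub> act M U p q a s"
 and act_smult_right: "opn X U ==> r : (cO X U) ==> a : (csec A p U) ==> s : (csec M q U) ==>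
 act M U p q a (r \<odot>\<^bsub>gsec M q U\<^esub> s) = r \<odot>\<^bsub>gsec M (p + q) U\<^esub> act M U p q a s"
 and act_res: "opn X U ==> opn X V ==> V \<subseteq> U ==> a : (csec A p U) ==> s : (csec M q U) ==>
 res (piece M (p + q)) U V (act M U p q a s) = act M V p q (res (piece A p) U V a) (res (piece M q) U V s)"
 and act_assoc: "opn X U ==> a : (csec A p U) ==> a' : (csec A p' U) ==> s : (csec M q U) ==>
 act M U (p + p') q (act A U p p' a a') s = act M U p (p' + q) a (act M U p' q a' s)"
 and act_unit: "opn X U ==> s : (csec M q U) ==> act M U 0 q (unit A U) s = s"
begin

lemma act_zero_left:
 assumes U: "opn X U" and s: "s : (csec M q U)"
 shows "act M U p q \<zero>\<^bsub>gsec A p U\<^esub> s = \<zero>\<^bsub>gsec M (p + q) U\<^esub>"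
 by (rule additive_map_zero[where h = "%a. act M U p q a s"])
 (use U s in \<open>simp_all add: presheafD(7)[OF A] presheafD(7)[OF M] act_closed act_add_left\<close>)

lemma act_negative:
 assumes U: "opn X U" and "p < 0" "a : (csec A p U)" and s: "s : (csec M q U)"
 shows "act M U p q a s = \<zero>\<^bsub>gsec M (p + q) U\<^esub>"
 using A_negative[OF U assms(2)] assms(3) act_zero_left[OF U s, of p] by simp

text \<open>Contraction by an algebra section of degree \<open>k\<close> moves a functional from
  degree \<open>k + p\<close> to degree \<open>p\<close>. Such contractions are the spanning
  elements of every inverse system below.\<close>

lemma contract:
 assumes U: "opn X U" and f: "f : dual_sections X (piece M (k + p)) U" and a: "a : (csec A k U)"
 shows "hom_fun X (piece M p) U (%V c. f V (act M V k p (res (piece A k) U V a) c)) : dual_sections X (piece M p) U"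
proof (rule dual_sectionsI[OF M U])
 fix V assume V: "opn X V" "V \<subseteq> U"
 note D = dualD[OF X M f V]
 have a': "res (piece A k) U V a : (csec A k V)" by (rule presheafD(2)[OF A U V a])
 fix c assume c: "c : (csec M p V)"
 have ac: "act M V k p (res (piece A k) U V a) c : (csec M (k + p) V)" by (rule act_closed[OF V(1) a' c])
 show "f V (act M V k p (res (piece A k) U V a) c) : (cO X V)" by (rule D(1)[OF ac])
 show "f V (act M V k p (res (piece A k) U V a) (c \<oplus>\<^bsub>gsec M p V\<^esub> c')) =
 f V (act M V k p (res (piece A k) U V a) c) \<oplus>\<^bsub>Osec X V\<^esub> f V (act M V k p (res (piece A k) U V a) c')"
 if "c' : (csec M p V)" for c'
 using that by (simp add: act_add_right[OF V(1) a' c] D(2)[OF ac] act_closed[OF V(1) a'])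
 show "f V (act M V k p (res (piece A k) U V a) (r \<odot>\<^bsub>gsec M p V\<^esub> c)) = r \<otimes>\<^bsub>Osec X V\<^esub> f V (act M V k p (res (piece A k) U V a) c)"
 if "r : (cO X V)" for r
 using that by (simp add: act_smult_right[OF V(1) _ a' c] D(3)[OF _ ac])
 show "f W (act M W k p (res (piece A k) U W a) (res (piece M p) V W c)) =
 res (str X) V W (f V (act M V k p (res (piece A k) U V a) c))"
 if W: "opn X W" "W \<subseteq> V" for W
 using D(4)[OF W ac] by (simp add: act_res[OF V(1) W a' c] presheafD(6)[OF A U V(1) W V(2) a])
qed

abbreviation "D \<equiv> gr_dual X A M"

lemma gr_dual_simps:
 "piece D q = dual_presheaf X (piece M (- q))"
 "(csec D q U) = dual_sections X (piece M (- q)) U"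
 by (simp_all add: gr_dual_def dual_presheaf_def)

lemma D_module_presheaf: "module_presheaf X (piece D q)"
 unfolding gr_dual_simps by (rule dual_presheaf_module[OF X M])

lemma gr_dual_act_closed:
 assumes U: "opn X U" and a: "a : (csec A p U)" and f: "\<phi> : (csec D q U)"
 shows "act D U p q a \<phi> : (csec D (p + q) U)"
 using contract[OF U _ a, of \<phi> "- (p + q)"] f by (simp add: gr_dual_def dual_presheaf_def)

lemma gr_dual_act_apply:
 assumes V: "opn X V" "V \<subseteq> U" and c: "c : (csec M (- (p + q)) V)"
 shows "act D U p q a \<phi> V c = \<phi> V (act M V p (- (p + q)) (res (piece A p) U V a) c)"
 using V c by (simp add: gr_dual_def)

text \<open>Annihilators do not see sums or local conditions, so only closure under restriction and
  under the action is recorded. The families to which this is applied are images of kernels in a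
  quotient.\<close>

definition stable :: "(int => 'x set => 'm set) => bool" where
 "stable L \<longleftrightarrow> (ALL U. opn X U -->
 (ALL p. L p U \<subseteq> (csec M p U)) &
 (ALL p V. opn X V & V \<subseteq> U --> (ALL s:L p U. res (piece M p) U V s : L p V)) &
 (ALL p q. ALL a:(csec A p U). ALL s:L q U. act M U p q a s : L (p + q) U))"

definition ann :: "(int => 'x set => 'm set) => int => 'x set => ('x set => 'm => 'r) set" where
 "ann L q U = {\<phi>\<in>(csec D q U). ALL V. opn X V & V \<subseteq> U --> (ALL c:L (- q) V. \<phi> V c = \<zero>\<^bsub>Osec X V\<^esub>)}"

text \<open>Linear closure is immediate from linear evaluation. The action on the dual is adjoint,
  so it is absorbed by the stability of \<open>L\<close>. The local condition concerns values in the
  structure sheaf and follows from separatedness there.\<close>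

lemma ann_graded_submodule:
 assumes L: "stable L"
 shows "is_graded_submodule X A D (ann L)"
 unfolding is_graded_submodule_def
proof (intro allI impI conjI ballI)
 have Lc: "c : (csec M p V)" if "opn X V" "c : L p V" for c p V
 using L that by (simp add: stable_def subset_iff)
 have Lr: "res (piece M p) U V s : L p V" if "opn X U" "opn X V" "V \<subseteq> U" "s : L p U" for p U V s
 using L that by (auto simp: stable_def)
 have La: "act M U p q a s : L (p + q) U" if "opn X U" "a : (csec A p U)" "s : L q U" for p q U a s
 using L that by (auto simp: stable_def)
 fix U assume U: "opn X U"
 {
 fix q
 interpret Dm: module "Osec X U" "gsec D q U" by (rule presheafD(1)[OF D_module_presheaf U])
 note ap = dual_presheaf_apply[OF X M]
 show "submodule (ann L q U) (Osec X U) (gsec D q U)"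
 proof (rule Dm.submoduleI)
 show "ann L q U \<subseteq> (csec D q U)" by (auto simp: ann_def)
 show "\<zero>\<^bsub>gsec D q U\<^esub> : ann L q U"
  using Lc Dm.M.zero_closed by (auto simp: ann_def gr_dual_simps(1) ap)
 next
 fix \<phi> assume \<phi>: "\<phi> : ann L q U"
 show "\<ominus>\<^bsub>gsec D q U\<^esub> \<phi> : ann L q U"
  unfolding ann_def
 proof (intro CollectI conjI allI impI ballI)
  have \<phi>c: "\<phi> : (csec D q U)" using \<phi> by (simp add: ann_def)
  then show "\<ominus>\<^bsub>gsec D q U\<^esub> \<phi> : (csec D q U)" by simp
  have \<phi>': "\<phi> : dual_sections X (piece M (- q)) U" using \<phi>c by (simp add: gr_dual_simps(2))
  fix V c assume V: "opn X V & V \<subseteq> U" and c: "c : L (- q) V"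
  have V': "opn X V" "V \<subseteq> U" using V by auto
  interpret O: cring "Osec X V" using ringedD(2)[OF X] V by auto
  have "\<ominus>\<^bsub>gsec D q U\<^esub> \<phi> = \<zero>\<^bsub>gsec D q U\<^esub> \<ominus>\<^bsub>gsec D q U\<^esub> \<phi>" using \<phi>c by (simp add: a_minus_def)
  then have "(\<ominus>\<^bsub>gsec D q U\<^esub> \<phi>) V c = (\<zero>\<^bsub>gsec D q U\<^esub>) V c \<ominus>\<^bsub>Osec X V\<^esub> \<phi> V c"
  using dual_presheaf_minus[OF X M U V' Lc[OF V'(1) c] dual_presheaf_closed(1)[OF X M U] \<phi>']
  by (simp add: gr_dual_simps(1))
  also have "\<dots> = \<zero>\<^bsub>Osec X V\<^esub>"
  using \<phi> V c Lc[OF _ c] by (simp add: ann_def gr_dual_simps ap a_minus_def)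
  finally show "(\<ominus>\<^bsub>gsec D q U\<^esub> \<phi>) V c = \<zero>\<^bsub>Osec X V\<^esub>" .
 qed
 next
 fix \<phi> \<psi> assume \<phi>: "\<phi> : ann L q U" "\<psi> : ann L q U"
 then have "\<phi> \<oplus>\<^bsub>gsec D q U\<^esub> \<psi> : (csec D q U)" by (auto simp: ann_def)
 moreover have "(\<phi> \<oplus>\<^bsub>gsec D q U\<^esub> \<psi>) V c = \<zero>\<^bsub>Osec X V\<^esub>" if V: "opn X V" "V \<subseteq> U" and c: "c : L (- q) V" for V c
 proof -
  interpret O: cring "Osec X V" using ringedD(2)[OF X] V by auto
  show ?thesis using \<phi> V c Lc[OF V(1) c] by (simp add: ann_def gr_dual_simps(1) ap)
 qed
 ultimately show "\<phi> \<oplus>\<^bsub>gsec D q U\<^esub> \<psi> : ann L q U" by (simp add: ann_def)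
 next
 fix r \<phi> assume r: "r : (cO X U)" and \<phi>: "\<phi> : ann L q U"
 then have "r \<odot>\<^bsub>gsec D q U\<^esub> \<phi> : (csec D q U)" by (auto simp: ann_def)
 moreover have "(r \<odot>\<^bsub>gsec D q U\<^esub> \<phi>) V c = \<zero>\<^bsub>Osec X V\<^esub>" if V: "opn X V" "V \<subseteq> U" and c: "c : L (- q) V" for V c
 proof -
  interpret O: cring "Osec X V" using ringedD(2)[OF X] V by auto
  show ?thesis using \<phi> r V c Lc[OF V(1) c] ringedD(3)[OF X U V r] by (simp add: ann_def gr_dual_simps(1) ap)
 qed
 ultimately show "r \<odot>\<^bsub>gsec D q U\<^esub> \<phi> : ann L q U" by (simp add: ann_def)
 qed
 fix V assume V: "opn X V & V \<subseteq> U"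
 show "res (piece D q) U V : ann L q U \<rightarrow> ann L q V"
 proof
 fix \<phi> assume \<phi>: "\<phi> : ann L q U"
 then have c: "\<phi> : (csec D q U)" by (simp add: ann_def)
 show "res (piece D q) U V \<phi> : ann L q V"
  unfolding ann_def
 proof (intro CollectI conjI allI impI ballI)
  show "res (piece D q) U V \<phi> : (csec D q V)" using presheafD(2)[OF D_module_presheaf U _ _ c] V by auto
  fix W c assume W: "opn X W & W \<subseteq> V" and c: "c : L (- q) W"
  then show "res (piece D q) U V \<phi> W c = \<zero>\<^bsub>Osec X W\<^esub>"
  using Lc[OF _ c] \<phi> V unfolding gr_dual_simps(1) by (simp add: ap(4)) (auto simp: ann_def)
 qed
 qed
 }
 {
 fix q \<phi> assume \<phi>: "\<phi> : (csec D q U)"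
 and loc: "ALL y:U. EX V. opn X V & y : V & V \<subseteq> U & res (piece D q) U V \<phi> : ann L q V"
 show "\<phi> : ann L q U"
 unfolding ann_def
 proof (intro CollectI conjI allI impI ballI \<phi>)
 fix V c assume V: "opn X V & V \<subseteq> U" and c: "c : L (- q) V"
 have V': "opn X V" "V \<subseteq> U" using V by auto
 have \<phi>': "\<phi> : dual_sections X (piece M (- q)) U" using \<phi> by (simp add: gr_dual_simps)
 interpret O: cring "Osec X V" using ringedD(2)[OF X] V by auto
 show "\<phi> V c = \<zero>\<^bsub>Osec X V\<^esub>"
 proof (rule is_sheaf_separated[OF ringedD(1)[OF X] V'(1)])
  show "\<phi> V c : (cO X V)" by (rule dualD(1)[OF X M \<phi>' V' Lc[OF V'(1) c]])
  fix y assume y: "y : V"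
  then obtain W where W: "opn X W" "y : W" "W \<subseteq> U" "res (piece D q) U W \<phi> : ann L q W"
  using loc V by blast
  have O: "opn X (V \<inter> W)" using V W by auto
  have cW: "res (piece M (- q)) V (V \<inter> W) c : L (- q) (V \<inter> W)" using Lr[OF V'(1) O _ c] by auto
  have "res (str X) V (V \<inter> W) (\<phi> V c) = \<phi> (V \<inter> W) (res (piece M (- q)) V (V \<inter> W) c)"
  using dualD(4)[OF X M \<phi>' V' O _ Lc[OF V'(1) c]] by simp
  also have "\<dots> = res (piece D q) U W \<phi> (V \<inter> W) (res (piece M (- q)) V (V \<inter> W) c)"
  using dual_presheaf_apply(4)[OF X M O _ Lc[OF O cW], of W U \<phi>] by (simp add: gr_dual_simps)
  also have "\<dots> = \<zero>\<^bsub>Osec X (V \<inter> W)\<^esub>" using W(4) O cW by (auto simp: ann_def)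
  finally show "EX W. opn X W & y : W & W \<subseteq> V & res (str X) V W (\<phi> V c) = res (str X) V W \<zero>\<^bsub>Osec X V\<^esub>"
  using O y W V ringedD(7)[OF X V'(1) O] by (intro exI[of _ "V \<inter> W"]) auto
 qed simp
 qed
 }
 fix p q a \<phi> assume a: "a : (csec A p U)" and \<phi>: "\<phi> : ann L q U"
 then have c: "\<phi> : (csec D q U)" by (simp add: ann_def)
 show "act D U p q a \<phi> : ann L (p + q) U"
 unfolding ann_def
 proof (intro CollectI conjI allI impI ballI gr_dual_act_closed[OF U a c])
 fix V c assume V: "opn X V & V \<subseteq> U" and c: "c : L (- (p + q)) V"
 have "act M V p (- (p + q)) (res (piece A p) U V a) c : L (- q) V"
 using La[of V "res (piece A p) U V a" p c "- (p + q)"] V c presheafD(2)[OF A U _ _ a] by simp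
 then show "act D U p q a \<phi> V c = \<zero>\<^bsub>Osec X V\<^esub>"
 using \<phi> V gr_dual_act_apply[of V U c p q a \<phi>] Lc[OF _ c] by (simp add: ann_def)
 qed
qed

lemma graded_submoduleD:
 assumes "is_graded_submodule X A M N"
 shows "submodule_presheaf X (piece M p) (N p)"
 and "opn X U ==> a : (csec A p U) ==> s : N q U ==> act M U p q a s : N (p + q) U"
 and "opn X U ==> s : N p U ==> s : (csec M p U)"
 and "opn X U ==> s : (csec M p U) ==>
 (!!y. y : U ==> EX V. opn X V & y : V & V \<subseteq> U & res (piece M p) U V s : N p V) ==> s : N p U"
proof -
 note G = mp[OF spec[OF assms[unfolded is_graded_submodule_def]]]
 have s: "submodule (N p U) (Osec X U) (gsec M p U)" if U: "opn X U" for U p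
 using G[OF U] by (elim conjE) (erule spec)
 have "res (piece M p) U V s : N p V"
 if U: "opn X U" and V: "opn X V" "V \<subseteq> U" and "s : N p U" for U V s
 proof -
 have "ALL p V. opn X V & V \<subseteq> U --> res (piece M p) U V : N p U \<rightarrow> N p V"
 using G[OF U] by (elim conjE) assumption
 then show ?thesis using V \<open>s : N p U\<close> by (auto simp: Pi_iff)
 qed
 then show "submodule_presheaf X (piece M p) (N p)"
 using s by (simp add: submodule_presheaf_def)
 show "act M U p q a s : N (p + q) U" if U: "opn X U" and "a : (csec A p U)" "s : N q U"
 proof -
 have "ALL p q. ALL a:(csec A p U). ALL s:N q U. act M U p q a s : N (p + q) U"
 using G[OF U] by (elim conjE) assumption
 then show ?thesis using that by blast
 qed
 show "opn X U ==> s : N p U ==> s : (csec M p U)"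
 using module.submoduleE(1)[OF presheafD(1)[OF M] s] by blast
 show "s : N p U" if U: "opn X U" and "s : (csec M p U)"
 "!!y. y : U ==> EX V. opn X V & y : V & V \<subseteq> U & res (piece M p) U V s : N p V"
 proof -
 have "ALL p. ALL s:(csec M p U).
  (ALL y:U. EX V. opn X V & y : V & V \<subseteq> U & res (piece M p) U V s : N p V) --> s : N p U"
 using G[OF U] by (elim conjE) assumption
 then show ?thesis using that(2,3) by blast
 qed
qed

lemma gr_quot_graded_system:
 assumes N: "is_graded_submodule X A M N"
 shows "graded_system X A (gr_quot M N)"
 and "opn X U ==> a : (csec A p U) ==> s : (csec M q U) ==>
 act (gr_quot M N) U p q a (N q U +>\<^bsub>gsec M q U\<^esub> s) = N (p + q) U +>\<^bsub>gsec M (p + q) U\<^esub> act M U p q a s"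
proof -
 note Np = graded_submoduleD(1)[OF N]
 note Q = quot_presheaf_carrier[OF X M Np] quot_presheaf_add[OF X M Np] quot_presheaf_smult[OF X M Np] quot_presheaf_res[OF X M Np]
 have aN: "act (gr_quot M N) U p q a (N q U +>\<^bsub>gsec M q U\<^esub> s) = N (p + q) U +>\<^bsub>gsec M (p + q) U\<^esub> act M U p q a s"
 if U: "opn X U" and a: "a : (csec A p U)" and s: "s : (csec M q U)" for U p q a s
 proof -
 have mem: "s' : N q U +>\<^bsub>gsec M q U\<^esub> s \<longleftrightarrow> s' : (csec M q U) & s' \<ominus>\<^bsub>gsec M q U\<^esub> s : N q U" for s'
 using a_rcoset_mem_iff[OF presheafD(1)[OF M U] subpresheafD(1)[OF Np U] s]
  quot_presheaf_eq_iff[OF X M Np U _ s] by auto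
 have "N (p + q) U +>\<^bsub>gsec M (p + q) U\<^esub> act M U p q a s' = N (p + q) U +>\<^bsub>gsec M (p + q) U\<^esub> act M U p q a s"
 if s': "s' : N q U +>\<^bsub>gsec M q U\<^esub> s" for s'
 proof -
 have s'': "s' : (csec M q U)" "s' \<ominus>\<^bsub>gsec M q U\<^esub> s : N q U" using s' mem by auto
 have "act M U p q a (s' \<ominus>\<^bsub>gsec M q U\<^esub> s) = act M U p q a s' \<ominus>\<^bsub>gsec M (p + q) U\<^esub> act M U p q a s"
  by (rule additive_map_minus) (use U a s s'' in \<open>simp_all add: presheafD(7)[OF M] act_closed act_add_right\<close>)
 then show ?thesis
  using graded_submoduleD(2)[OF N U a s''(2)] quot_presheaf_eq_iff[OF X M Np U] act_closed[OF U a] s s'' by simp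
 qed
 moreover have "s : N q U +>\<^bsub>gsec M q U\<^esub> s"
 using a_rcoset_mem_iff[OF presheafD(1)[OF M U] subpresheafD(1)[OF Np U] s] s by simp
 ultimately have "(\<Union>s'\<in>N q U +>\<^bsub>gsec M q U\<^esub> s. N (p + q) U +>\<^bsub>gsec M (p + q) U\<^esub> act M U p q a s') =
  N (p + q) U +>\<^bsub>gsec M (p + q) U\<^esub> act M U p q a s" by (intro UN_constant_eq ballI)
 then show ?thesis by (simp add: gr_quot_def)
 qed
 then show "opn X U ==> a : (csec A p U) ==> s : (csec M q U) ==>
 act (gr_quot M N) U p q a (N q U +>\<^bsub>gsec M q U\<^esub> s) = N (p + q) U +>\<^bsub>gsec M (p + q) U\<^esub> act M U p q a s" .
 have pc: "piece (gr_quot M N) p = quot_presheaf (piece M p) (N p)" for p by (simp add: gr_quot_def)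
 note cl = module.smult_closed[OF presheafD(1)[OF M]]
 abelian_monoid.a_closed[OF abelian_group.axioms(1)[OF presheafD(7)[OF M]]]
 note clA = module.smult_closed[OF presheafD(1)[OF A]]
 abelian_monoid.a_closed[OF abelian_group.axioms(1)[OF presheafD(7)[OF A]]]
 show "graded_system X A (gr_quot M N)"
 proof (unfold_locales, unfold pc)
 show "is_ringed_space X" by (rule X)
 show "module_presheaf X (piece A p)" for p by (rule A)
 show "module_presheaf X (quot_presheaf (piece M p) (N p))" for p by (rule quot_presheaf_module[OF X M Np])
 fix U assume U: "opn X U"
 show "unit A U : (csec A 0 U)" by (rule unit_closed[OF U])
 show "p < 0 ==> (csec A p U) = {\<zero>\<^bsub>gsec A p U\<^esub>}" for p by (rule A_negative[OF U])
 show "a : (csec A p U) ==> a' : (csec A q U) ==>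
 act A U p q a a' : (csec A (p + q) U)" for a a' p q by (rule A_act_closed[OF U])
 fix q Y assume "Y : carrier (sec (quot_presheaf (piece M q) (N q)) U)"
 then obtain s where s: "s : (csec M q U)" "Y = N q U +>\<^bsub>gsec M q U\<^esub> s" by (auto simp: Q U)
 show "act (gr_quot M N) U 0 q (unit A U) Y = Y"
 using aN[OF U unit_closed[OF U] s(1)] s act_unit[OF U s(1)] by simp
 fix p a assume a: "a : (csec A p U)"
 show "act (gr_quot M N) U p q a Y : carrier (sec (quot_presheaf (piece M (p + q)) (N (p + q))) U)"
 using s act_closed[OF U a s(1)] by (auto simp: aN[OF U a] Q U)
 {
 fix a' assume a': "a' : (csec A p U)"
 show "act (gr_quot M N) U p q (a \<oplus>\<^bsub>gsec A p U\<^esub> a') Y = act (gr_quot M N) U p q a Y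
  \<oplus>\<^bsub>sec (quot_presheaf (piece M (p + q)) (N (p + q))) U\<^esub> act (gr_quot M N) U p q a' Y"
  using s a' by (simp add: aN[OF U] a Q U clA act_closed act_add_left)
 }
 {
 fix Y' assume "Y' : carrier (sec (quot_presheaf (piece M q) (N q)) U)"
 then obtain s' where s': "s' : (csec M q U)" "Y' = N q U +>\<^bsub>gsec M q U\<^esub> s'" by (auto simp: Q U)
 show "act (gr_quot M N) U p q a (Y \<oplus>\<^bsub>sec (quot_presheaf (piece M q) (N q)) U\<^esub> Y') = act (gr_quot M N) U p q a Y
  \<oplus>\<^bsub>sec (quot_presheaf (piece M (p + q)) (N (p + q))) U\<^esub> act (gr_quot M N) U p q a Y'"
  using s s' by (simp add: aN[OF U] a Q U cl act_closed act_add_right)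
 }
 {
 fix r assume r: "r : (cO X U)"
 show "act (gr_quot M N) U p q (r \<odot>\<^bsub>gsec A p U\<^esub> a) Y = r \<odot>\<^bsub>sec (quot_presheaf (piece M (p + q)) (N (p + q))) U\<^esub> act (gr_quot M N) U p q a Y"
  using s r by (simp add: aN[OF U] a Q U clA act_closed act_smult_left)
 show "act (gr_quot M N) U p q a (r \<odot>\<^bsub>sec (quot_presheaf (piece M q) (N q)) U\<^esub> Y) = r \<odot>\<^bsub>sec (quot_presheaf (piece M (p + q)) (N (p + q))) U\<^esub> act (gr_quot M N) U p q a Y"
  using s r by (simp add: aN[OF U] a Q U cl act_closed act_smult_right)
 }
 {
 fix V assume V: "opn X V" "V \<subseteq> U"
 show "res (quot_presheaf (piece M (p + q)) (N (p + q))) U V (act (gr_quot M N) U p q a Y) =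
  act (gr_quot M N) V p q (res (piece A p) U V a) (res (quot_presheaf (piece M q) (N q)) U V Y)"
  using s V by (simp add: aN U a Q presheafD(2)[OF M] presheafD(2)[OF A] act_closed act_res)
 }
 fix p' a' assume a': "a' : (csec A p' U)"
 show "act (gr_quot M N) U (p + p') q (act A U p p' a a') Y = act (gr_quot M N) U p (p' + q) a (act (gr_quot M N) U p' q a' Y)"
 using s by (simp add: aN U a a' A_act_closed act_closed act_assoc) (simp add: add.assoc)
 qed
qed

end

section \<open>Inverse systems generated by finitely many functionals\<close>

lemma (in cring) finsum_indicator:
 assumes J: "finite J" "k : J" and c: "!!j. j : J ==> c j : carrier R"
 shows "(\<Oplus>j\<in>J. c j \<otimes> (if j = k then \<one> else \<zero>)) = c k"
proof -
 have "(\<Oplus>j\<in>J. c j \<otimes> (if j = k then \<one> else \<zero>)) = (\<Oplus>j\<in>J. if k = j then c j else \<zero>)"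
 using c by (intro add.finprod_cong') auto
 also have "\<dots> = c k" using J c by (intro add.finprod_singleton) auto
 finally show ?thesis .
qed

text \<open>Generators of an inverse system in the sense of Macaulay, with \<open>lev i\<close> the
  degree on which \<open>f i\<close> is defined. They are global; the space is later the one-point
  space or a neighbourhood of \<open>x\<close>.\<close>

locale dual_generators = graded_system X A B
 for X :: "('x, 'r) ringed_space" and A :: "('x, 'r, 'a) gralg" and B :: "('x, 'r, 'a, 'b) grmod" +
 fixes I :: "'i set" and lev :: "'i => int" and f :: "'i => 'x set => 'b => 'r"
 assumes f: "i : I ==> f i : dual_sections X (piece B (lev i)) (topspace (pts X))"
 and finite_I: "finite I"
begin

text \<open>Testing against all algebra sections over all smaller open sets gives the largest
  homogeneous submodule on which the functionals indexed by \<open>L\<close> vanish. No negative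
  level is excluded: contractions by negative degrees of \<open>A\<close> are simply zero.\<close>

definition Ker :: "'i set => int => 'x set => 'b set" where
 "Ker L p U = {s\<in>(csec B p U). ALL V i a. opn X V & V \<subseteq> U & i : L & a : (csec A (lev i - p) V) -->
 f i V (act B V (lev i - p) p a (res (piece B p) U V s)) = \<zero>\<^bsub>Osec X V\<^esub>}"

lemma act_lev_closed:
 "opn X V ==> a : (csec A (lev i - p) V) ==> s : (csec B p V) ==>
 act B V (lev i - p) p a s : (csec B (lev i) V)"
 using act_closed[of V a "lev i - p" s p] by simp

lemma fD:
 assumes i: "i : I" and V: "opn X V"
 shows "c : (csec B (lev i) V) ==> f i V c : (cO X V)"
 and "c : (csec B (lev i) V) ==> c' : (csec B (lev i) V) ==>
 f i V (c \<oplus>\<^bsub>gsec B (lev i) V\<^esub> c') = f i V c \<oplus>\<^bsub>Osec X V\<^esub> f i V c'"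
 and "r : (cO X V) ==> c : (csec B (lev i) V) ==>
 f i V (r \<odot>\<^bsub>gsec B (lev i) V\<^esub> c) = r \<otimes>\<^bsub>Osec X V\<^esub> f i V c"
 and "opn X W ==> W \<subseteq> V ==> c : (csec B (lev i) V) ==>
 f i W (res (piece B (lev i)) V W c) = res (str X) V W (f i V c)"
 and "f i V \<zero>\<^bsub>gsec B (lev i) V\<^esub> = \<zero>\<^bsub>Osec X V\<^esub>"
 by (rule dualD[OF X M f[OF i] V openin_subset[OF V]]; assumption)+

lemma Ker_graded_submodule:
 assumes L: "L \<subseteq> I"
 shows "is_graded_submodule X A B (Ker L)"
 unfolding is_graded_submodule_def
proof (intro allI impI conjI ballI)
 fix U assume U: "opn X U"
 note resB = presheafD(2)[OF M U] and resA = presheafD(2)[OF A]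
 have iI: "i : I" if "i : L" for i using that L by auto
 {
 fix p
 interpret Bp: module "Osec X U" "gsec B p U" by (rule presheafD(1)[OF M U])
 have add: "s \<oplus>\<^bsub>gsec B p U\<^esub> t : Ker L p U" if s: "s : Ker L p U" and t: "t : Ker L p U" for s t
 unfolding Ker_def
 proof (intro CollectI conjI allI impI)
 have c: "s : (csec B p U)" "t : (csec B p U)" using s t by (auto simp: Ker_def)
 then show "s \<oplus>\<^bsub>gsec B p U\<^esub> t : (csec B p U)" by simp
 fix V i a assume V: "opn X V & V \<subseteq> U & i : L & a : (csec A (lev i - p) V)"
 interpret O: cring "Osec X V" using ringedD(2)[OF X] V by auto
 have "act B V (lev i - p) p a (res (piece B p) U V s \<oplus>\<^bsub>gsec B p V\<^esub> res (piece B p) U V t) =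
  act B V (lev i - p) p a (res (piece B p) U V s) \<oplus>\<^bsub>gsec B (lev i) V\<^esub> act B V (lev i - p) p a (res (piece B p) U V t)"
  using act_add_right[of V a "lev i - p" "res (piece B p) U V s" p "res (piece B p) U V t"] V c resB by simp
 then show "f i V (act B V (lev i - p) p a (res (piece B p) U V (s \<oplus>\<^bsub>gsec B p U\<^esub> t))) = \<zero>\<^bsub>Osec X V\<^esub>"
  using V c s t fD(2)[OF iI] act_lev_closed resB
  by (simp add: presheafD(3)[OF M U] Ker_def)
 qed
 have sm: "r \<odot>\<^bsub>gsec B p U\<^esub> s : Ker L p U" if s: "s : Ker L p U" and r: "r : (cO X U)" for s r
 unfolding Ker_def
 proof (intro CollectI conjI allI impI)
 have c: "s : (csec B p U)" using s by (auto simp: Ker_def)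
 then show "r \<odot>\<^bsub>gsec B p U\<^esub> s : (csec B p U)" using r by simp
 fix V i a assume V: "opn X V & V \<subseteq> U & i : L & a : (csec A (lev i - p) V)"
 interpret O: cring "Osec X V" using ringedD(2)[OF X] V by auto
 have r': "res (str X) U V r : (cO X V)" using ringedD(3)[OF X U _ _ r] V by auto
 have "act B V (lev i - p) p a (res (str X) U V r \<odot>\<^bsub>gsec B p V\<^esub> res (piece B p) U V s) =
  res (str X) U V r \<odot>\<^bsub>gsec B (lev i) V\<^esub> act B V (lev i - p) p a (res (piece B p) U V s)"
  using act_smult_right[of V "res (str X) U V r" a "lev i - p" "res (piece B p) U V s" p] V c resB r' by simp
 then show "f i V (act B V (lev i - p) p a (res (piece B p) U V (r \<odot>\<^bsub>gsec B p U\<^esub> s))) = \<zero>\<^bsub>Osec X V\<^esub>"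
  using V c s r r' fD(3)[OF iI] act_lev_closed resB
  by (simp add: presheafD(4)[OF M U] Ker_def)
 qed
 have zero: "\<zero>\<^bsub>gsec B p U\<^esub> : Ker L p U"
 unfolding Ker_def
 proof (intro CollectI conjI allI impI)
 fix V i a assume V: "opn X V & V \<subseteq> U & i : L & a : (csec A (lev i - p) V)"
 have "act B V (lev i - p) p a \<zero>\<^bsub>gsec B p V\<^esub> = \<zero>\<^bsub>gsec B (lev i - p + p) V\<^esub>"
  by (rule additive_map_zero) (use V in \<open>simp_all add: presheafD(7)[OF M] act_closed act_lev_closed act_add_right\<close>)
 then show "f i V (act B V (lev i - p) p a (res (piece B p) U V \<zero>\<^bsub>gsec B p U\<^esub>)) = \<zero>\<^bsub>Osec X V\<^esub>"
  using V fD(5)[OF iI] module_presheaf_res_map(1)[OF M U] by simp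
 qed simp
 show "submodule (Ker L p U) (Osec X U) (gsec B p U)"
 proof (rule Bp.submoduleI)
 show "Ker L p U \<subseteq> (csec B p U)" by (auto simp: Ker_def)
 fix s assume s: "s : Ker L p U"
 have "(\<ominus>\<^bsub>Osec X U\<^esub> \<one>\<^bsub>Osec X U\<^esub>) \<odot>\<^bsub>gsec B p U\<^esub> s = \<ominus>\<^bsub>gsec B p U\<^esub> s"
  using s by (subst Bp.smult_l_minus) (auto simp: Ker_def)
 then show "\<ominus>\<^bsub>gsec B p U\<^esub> s : Ker L p U" using sm[OF s, of "\<ominus>\<^bsub>Osec X U\<^esub> \<one>\<^bsub>Osec X U\<^esub>"] by simp
 qed (use zero add sm in auto)
 fix V assume V: "opn X V & V \<subseteq> U"
 show "res (piece B p) U V : Ker L p U \<rightarrow> Ker L p V"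
 proof
 fix s assume s: "s : Ker L p U"
 then have c: "s : (csec B p U)" by (simp add: Ker_def)
 show "res (piece B p) U V s : Ker L p V"
  using V s resB[OF _ _ c] presheafD(6)[OF M U _ _ _ _ c] by (simp add: Ker_def) blast
 qed
 }
 {
 fix p s assume c: "s : (csec B p U)"
 and loc: "ALL y:U. EX V. opn X V & y : V & V \<subseteq> U & res (piece B p) U V s : Ker L p V"
 show "s : Ker L p U"
 unfolding Ker_def
 proof (intro CollectI conjI allI impI c)
 fix V i a assume V: "opn X V & V \<subseteq> U & i : L & a : (csec A (lev i - p) V)"
 then have V': "opn X V" "V \<subseteq> U" "i : I" "a : (csec A (lev i - p) V)" using iI by auto
 interpret O: cring "Osec X V" using ringedD(2)[OF X] V by auto
 have as: "act B V (lev i - p) p a (res (piece B p) U V s) : (csec B (lev i) V)"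
  by (rule act_lev_closed[OF V'(1,4) resB[OF V'(1,2) c]])
 show "f i V (act B V (lev i - p) p a (res (piece B p) U V s)) = \<zero>\<^bsub>Osec X V\<^esub>"
 proof (rule is_sheaf_separated[OF ringedD(1)[OF X] V'(1)])
  show "f i V (act B V (lev i - p) p a (res (piece B p) U V s)) : (cO X V)"
  by (rule fD(1)[OF V'(3,1) as])
  fix y assume y: "y : V"
  then obtain W where W: "opn X W" "y : W" "W \<subseteq> U" "res (piece B p) U W s : Ker L p W"
  using loc V by blast
  let ?W = "V \<inter> W"
  have O: "opn X ?W" using V W by auto
  have "res (str X) V ?W (f i V (act B V (lev i - p) p a (res (piece B p) U V s))) =
   f i ?W (res (piece B (lev i)) V ?W (act B V (lev i - p) p a (res (piece B p) U V s)))"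
  using fD(4)[OF V'(3,1) O _ as] by simp
  also have "res (piece B (lev i)) V ?W (act B V (lev i - p) p a (res (piece B p) U V s)) =
   act B ?W (lev i - p) p (res (piece A (lev i - p)) V ?W a) (res (piece B p) V ?W (res (piece B p) U V s))"
  using act_res[OF V'(1) O _ V'(4) resB[OF V'(1,2) c]] by simp
  also have "res (piece B p) V ?W (res (piece B p) U V s) = res (piece B p) W ?W (res (piece B p) U W s)"
  using presheafD(6)[OF M U V'(1) O _ V'(2) c] presheafD(6)[OF M U W(1) O _ W(3) c] by simp
  also have "f i ?W (act B ?W (lev i - p) p (res (piece A (lev i - p)) V ?W a) (res (piece B p) W ?W (res (piece B p) U W s))) = \<zero>\<^bsub>Osec X ?W\<^esub>"
  using W(4) O V resA[OF V'(1) O _ V'(4)] by (simp add: Ker_def)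
  finally show "EX W. opn X W & y : W & W \<subseteq> V &
   res (str X) V W (f i V (act B V (lev i - p) p a (res (piece B p) U V s))) = res (str X) V W \<zero>\<^bsub>Osec X V\<^esub>"
  using O y W ringedD(7)[OF X V'(1) O] by (intro exI[of _ ?W]) auto
 qed simp
 qed
 }
 fix p q a s assume a: "a : (csec A p U)" and s: "s : Ker L q U"
 then have c: "s : (csec B q U)" by (simp add: Ker_def)
 show "act B U p q a s : Ker L (p + q) U"
 unfolding Ker_def
 proof (intro CollectI conjI allI impI act_closed[OF U a c])
 fix V i a' assume V: "opn X V & V \<subseteq> U & i : L & a' : (csec A (lev i - (p + q)) V)"
 then have V': "opn X V" "V \<subseteq> U" by auto
 have aV: "res (piece A p) U V a : (csec A p V)" using resA[OF U V' a] .
 have e: "lev i - (p + q) + p = lev i - q" by simp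
 \<comment> \<open>Associativity: multiplying \<open>a'\<close> by \<open>a\<close> turns a test of
   the product in degree \<open>p + q\<close> into a test of \<open>s\<close> in degree
   \<open>q\<close>.\<close>
 have aa: "act A V (lev i - (p + q)) p a' (res (piece A p) U V a) : (csec A (lev i - q) V)"
 using A_act_closed[of V a' "lev i - (p + q)" "res (piece A p) U V a" p] V aV unfolding e by simp
 have "act B V (lev i - (p + q)) (p + q) a' (res (piece B (p + q)) U V (act B U p q a s)) =
 act B V (lev i - q) q (act A V (lev i - (p + q)) p a' (res (piece A p) U V a)) (res (piece B q) U V s)"
 using act_assoc[of V a' "lev i - (p + q)" "res (piece A p) U V a" p "res (piece B q) U V s" q] V aV
  act_res[OF U V' a c] resB[OF V' c] unfolding e by simp
 then show "f i V (act B V (lev i - (p + q)) (p + q) a' (res (piece B (p + q)) U V (act B U p q a s))) = \<zero>\<^bsub>Osec X V\<^esub>"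
 using s V aa by (simp add: Ker_def)
 qed
qed

lemma Ker_mono: "L \<subseteq> L' ==> Ker L' p U \<subseteq> Ker L p U"
 by (auto simp: Ker_def)

text \<open>In degree \<open>p\<close> a functional of level below \<open>p\<close> can only be
  contracted by algebra sections of negative degree, which are zero. So the levels below
  \<open>m\<close> impose no condition as soon as \<open>m \<le> p\<close>.\<close>

lemma Ker_ge:
 assumes "m \<le> p" "opn X U"
 shows "Ker {i\<in>I. m \<le> lev i} p U = Ker I p U"
proof
 show "Ker {i\<in>I. m \<le> lev i} p U \<subseteq> Ker I p U"
 unfolding Ker_def
 proof (intro subsetI CollectI conjI allI impI)
 fix s V i a
 assume s: "s : {s\<in>(csec B p U). ALL V i a. opn X V & V \<subseteq> U & i : {i\<in>I. m \<le> lev i} & a : (csec A (lev i - p) V) -->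
  f i V (act B V (lev i - p) p a (res (piece B p) U V s)) = \<zero>\<^bsub>Osec X V\<^esub>}"
 then show "s : (csec B p U)" by simp
 assume V: "opn X V & V \<subseteq> U & i : I & a : (csec A (lev i - p) V)"
 show "f i V (act B V (lev i - p) p a (res (piece B p) U V s)) = \<zero>\<^bsub>Osec X V\<^esub>"
 proof (cases "m \<le> lev i")
 case True
 then show ?thesis using s V by auto
 next
 case False
 then have "lev i - p < 0" using assms by simp
 then show ?thesis
  using act_negative[of V "lev i - p" a "res (piece B p) U V s" p] V s presheafD(2)[OF M assms(2)] fD(5) by simp
 qed
 qed
qed (rule Ker_mono, auto)

lemma KerD:
 "s : Ker L p U ==> opn X V ==> V \<subseteq> U ==> i : L ==> a : (csec A (lev i - p) V) ==>
 f i V (act B V (lev i - p) p a (res (piece B p) U V s)) = \<zero>\<^bsub>Osec X V\<^esub>"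
 by (simp add: Ker_def)

text \<open>The unit is an admissible test element when the degree equals the level.\<close>

lemma Ker_vanish:
 assumes i: "i : I" "i : L" and V: "opn X V" and s: "s : Ker L (lev i) V"
 shows "f i V s = \<zero>\<^bsub>Osec X V\<^esub>"
proof -
 have c: "s : (csec B (lev i) V)" using s by (simp add: Ker_def)
 have "f i V (act B V (lev i - lev i) (lev i) (unit A V) (res (piece B (lev i)) V V s)) = \<zero>\<^bsub>Osec X V\<^esub>"
 using KerD[OF s V subset_refl i(2), of "unit A V"] unit_closed[OF V] by simp
 then show ?thesis using act_unit[OF V c] presheafD(5)[OF M V c] by simp
qed

end

section \<open>Inverse systems with a dual basis of contractions\<close>

lemma grsubD:
 assumes N: "is_graded_submodule X A M N" and U: "opn X U"
 shows "submodule (N p U) (Osec X U) (gsec M p U)"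
 and "opn X V ==> V \<subseteq> U ==> s : N p U ==> res (piece M p) U V s : N p V"
 and "s : (csec M p U) ==>
 (!!y. y : U ==> EX V. opn X V & y : V & V \<subseteq> U & res (piece M p) U V s : N p V) ==> s : N p U"
 and "a : (csec A p U) ==> s : N q U ==> act M U p q a s : N (p + q) U"
proof -
 note G = mp[OF spec[OF N[unfolded is_graded_submodule_def]] U]
 show "submodule (N p U) (Osec X U) (gsec M p U)"
 using G by (elim conjE) (erule spec)
 have "ALL p V. opn X V & V \<subseteq> U --> res (piece M p) U V : N p U \<rightarrow> N p V"
 using G by (elim conjE) assumption
 then show "opn X V ==> V \<subseteq> U ==> s : N p U ==> res (piece M p) U V s : N p V"
 by (auto simp: Pi_iff)
 have "ALL p. ALL s:(csec M p U).
 (ALL y:U. EX V. opn X V & y : V & V \<subseteq> U & res (piece M p) U V s : N p V) --> s : N p U"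
 using G by (elim conjE) assumption
 then show "s : (csec M p U) ==>
 (!!y. y : U ==> EX V. opn X V & y : V & V \<subseteq> U & res (piece M p) U V s : N p V) ==> s : N p U"
 by blast
 have "ALL p q. ALL a:(csec A p U). ALL s:N q U. act M U p q a s : N (p + q) U"
 using G by (elim conjE) assumption
 then show "a : (csec A p U) ==> s : N q U ==> act M U p q a s : N (p + q) U"
 by blast
qed

lemma grsubI:
 assumes "!!U p. opn X U ==> submodule (N p U) (Osec X U) (gsec M p U)"
 and "!!U p V s. opn X U ==> opn X V ==> V \<subseteq> U ==> s : N p U ==> res (piece M p) U V s : N p V"
 and "!!U p s. opn X U ==> s : (csec M p U) ==>
 (!!y. y : U ==> EX V. opn X V & y : V & V \<subseteq> U & res (piece M p) U V s : N p V) ==> s : N p U"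
 and "!!U a s p q. opn X U ==> a : (csec A p U) ==> s : N q U ==> act M U p q a s : N (p + q) U"
 shows "is_graded_submodule X A M N"
 unfolding is_graded_submodule_def
 by (intro allI impI conjI ballI) (use assms in \<open>auto simp: Pi_iff\<close>)

text \<open>In degree \<open>p\<close> the set \<open>J p\<close> selects contractions of
  \<open>f (ix p j)\<close> by \<open>alpha p j\<close>, and \<open>bb p j\<close> are vectors dual
  to them. The decisive axiom is \<open>ker\<close>: the selected contractions of level at least
  \<open>m\<close> cut out everything that all functionals of level at least \<open>m\<close> cut
  out. It is demanded for every \<open>m\<close>, so a single selection is adapted to the whole
  filtration.\<close>

locale dual_bases = dual_generators X A B I lev f
 for X :: "('x, 'r) ringed_space" and A :: "('x, 'r, 'a) gralg" and B :: "('x, 'r, 'a, 'b) grmod"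
 and I :: "'i set" and lev :: "'i => int" and f :: "'i => 'x set => 'b => 'r" +
 fixes J :: "int => 'j set" and ix :: "int => 'j => 'i" and alpha :: "int => 'j => 'a" and bb :: "int => 'j => 'b"
 assumes finite_J: "finite (J p)"
 and ix: "j : J p ==> ix p j : I"
 and alpha: "j : J p ==> alpha p j : (csec A (lev (ix p j) - p) (topspace (pts X)))"
 and bb: "j : J p ==> bb p j : (csec B p (topspace (pts X)))"
 and dual: "j : J p ==> k : J p ==>
 f (ix p j) (topspace (pts X)) (act B (topspace (pts X)) (lev (ix p j) - p) p (alpha p j) (bb p k)) =
 (if j = k then \<one>\<^bsub>Osec X (topspace (pts X))\<^esub> else \<zero>\<^bsub>Osec X (topspace (pts X))\<^esub>)"
 and ker: "opn X V ==> s : (csec B p V) ==>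
 (!!j. j : J p ==> m \<le> lev (ix p j) ==>
  f (ix p j) V (act B V (lev (ix p j) - p) p (res (piece A (lev (ix p j) - p)) (topspace (pts X)) V (alpha p j)) s) = \<zero>\<^bsub>Osec X V\<^esub>) ==>
 s : Ker {i\<in>I. m \<le> lev i} p V"
begin

abbreviation "Tp \<equiv> topspace (pts X)"

lemma Tp: "opn X Tp" "opn X V ==> V \<subseteq> Tp"
 using openin_subset by auto

sublocale Q: graded_system X A "gr_quot B (Ker I)"
 by (rule gr_quot_graded_system(1)[OF Ker_graded_submodule[OF subset_refl]])

abbreviation "KI \<equiv> Ker I"
abbreviation "Km m \<equiv> Ker {i\<in>I. m \<le> lev i}"
abbreviation "Qp p \<equiv> quot_presheaf (piece B p) (KI p)"
abbreviation "cls p V s \<equiv> KI p V +>\<^bsub>gsec B p V\<^esub> s"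

lemma KI_sub: "submodule_presheaf X (piece B p) (KI p)"
 by (rule graded_submoduleD(1)[OF Ker_graded_submodule[OF subset_refl]])

lemma Km_sub: "submodule_presheaf X (piece B p) (Km m p)"
 by (rule graded_submoduleD(1)[OF Ker_graded_submodule]) auto

lemma Qp: "module_presheaf X (Qp p)"
 by (rule quot_presheaf_module[OF X M KI_sub])

lemma gr_quot_piece: "piece (gr_quot B N) p = quot_presheaf (piece B p) (N p)"
 by (simp add: gr_quot_def)

lemma QD_piece: "piece Q.D (- p) = dual_presheaf X (Qp p)"
 by (simp add: gr_dual_def gr_quot_def)

lemmas Qs = quot_presheaf_carrier[OF X M KI_sub] quot_presheaf_add[OF X M KI_sub]
 quot_presheaf_smult[OF X M KI_sub] quot_presheaf_res[OF X M KI_sub] quot_presheaf_zero[OF X M KI_sub]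

lemma cls_closed: "opn X V ==> s : (csec B p V) ==> cls p V s : carrier (sec (Qp p) V)"
 by (auto simp: Qs)

lemma cls_zero_iff: "opn X V ==> s : (csec B p V) ==> cls p V s = \<zero>\<^bsub>sec (Qp p) V\<^esub> \<longleftrightarrow> s : KI p V"
 by (rule quot_presheaf_zero_iff[OF X M KI_sub])

definition d where
 "d p j V s = f (ix p j) V (act B V (lev (ix p j) - p) p (res (piece A (lev (ix p j) - p)) Tp V (alpha p j)) s)"

lemma d_section: "j : J p ==> hom_fun X (piece B p) Tp (d p j) : dual_sections X (piece B p) Tp"
 using contract[OF Tp(1), of "f (ix p j)" "lev (ix p j) - p" p "alpha p j"] f[OF ix] alpha
 unfolding d_def by simp

lemma dD:
 assumes j: "j : J p" and V: "opn X V"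
 shows "s : (csec B p V) ==> d p j V s : (cO X V)"
 and "s : (csec B p V) ==> s' : (csec B p V) ==>
 d p j V (s \<oplus>\<^bsub>gsec B p V\<^esub> s') = d p j V s \<oplus>\<^bsub>Osec X V\<^esub> d p j V s'"
 and "r : (cO X V) ==> s : (csec B p V) ==>
 d p j V (r \<odot>\<^bsub>gsec B p V\<^esub> s) = r \<otimes>\<^bsub>Osec X V\<^esub> d p j V s"
 and "opn X W ==> W \<subseteq> V ==> s : (csec B p V) ==>
 d p j W (res (piece B p) V W s) = res (str X) V W (d p j V s)"
 and "s : (csec B p V) ==> s' : (csec B p V) ==>
 d p j V (s \<ominus>\<^bsub>gsec B p V\<^esub> s') = d p j V s \<ominus>\<^bsub>Osec X V\<^esub> d p j V s'"
 and "finite S ==> (!!i. i : S ==> g i : (csec B p V)) ==>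
 d p j V (finsum (gsec B p V) g S) = finsum (Osec X V) (%i. d p j V (g i)) S"
proof -
 note D = dualD[OF X M d_section[OF j] V Tp(2)[OF V]]
 interpret B: module "Osec X V" "gsec B p V" by (rule presheafD(1)[OF M V])
 have e: "hom_fun X (piece B p) Tp (d p j) V s = d p j V s" if "s : (csec B p V)" for s
 using that V Tp(2)[OF V] by simp
 show c: "s : (csec B p V) ==> d p j V s : (cO X V)" for s using D(1) e by metis
 show "s : (csec B p V) ==> s' : (csec B p V) ==>
 d p j V (s \<oplus>\<^bsub>gsec B p V\<^esub> s') = d p j V s \<oplus>\<^bsub>Osec X V\<^esub> d p j V s'"
 using D(2)[of s s'] by (simp add: e)
 show "r : (cO X V) ==> s : (csec B p V) ==>
 d p j V (r \<odot>\<^bsub>gsec B p V\<^esub> s) = r \<otimes>\<^bsub>Osec X V\<^esub> d p j V s"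
 using D(3)[of r s] by (simp add: e)
 show "opn X W ==> W \<subseteq> V ==> s : (csec B p V) ==>
 d p j W (res (piece B p) V W s) = res (str X) V W (d p j V s)"
 using D(4)[of W s] Tp(2)[of W] by (simp add: e presheafD(2)[OF M V])
 show "s : (csec B p V) ==> s' : (csec B p V) ==>
 d p j V (s \<ominus>\<^bsub>gsec B p V\<^esub> s') = d p j V s \<ominus>\<^bsub>Osec X V\<^esub> d p j V s'"
 using D(6)[of s s'] by (simp add: e)
 show "finite S ==> (!!i. i : S ==> g i : (csec B p V)) ==>
 d p j V (finsum (gsec B p V) g S) = finsum (Osec X V) (%i. d p j V (g i)) S"
 using D(7)[of S g] B.finsum_closed[of g S] ringedD(2)[OF X V]
 by (simp add: e Pi_def cong: abelian_monoid.finsum_cong'[OF abelian_group.axioms(1)[OF ringedD(11)[OF X V]]])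
 (rule abelian_monoid.finsum_cong'[OF abelian_group.axioms(1)[OF ringedD(11)[OF X V]]]; simp add: e c)
qed

definition bV where "bV p j V = res (piece B p) Tp V (bb p j)"

lemma bV:
 assumes "opn X V"
 shows "j : J p ==> bV p j V : (csec B p V)"
 and "j : J p ==> k : J p ==> d p j V (bV p k V) = (if j = k then \<one>\<^bsub>Osec X V\<^esub> else \<zero>\<^bsub>Osec X V\<^esub>)"
 and "j : J p ==> opn X W ==> W \<subseteq> V ==> res (piece B p) V W (bV p j V) = bV p j W"
proof -
 note V = Tp(2)[OF assms]
 show "j : J p ==> bV p j V : (csec B p V)"
 using presheafD(2)[OF M Tp(1) assms V bb] by (simp add: bV_def)
 show "j : J p ==> opn X W ==> W \<subseteq> V ==> res (piece B p) V W (bV p j V) = bV p j W"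
 using presheafD(6)[OF M Tp(1) assms _ _ V bb] by (simp add: bV_def)
 assume j: "j : J p" and k: "k : J p"
 have "d p j Tp (bb p k) = (if j = k then \<one>\<^bsub>Osec X Tp\<^esub> else \<zero>\<^bsub>Osec X Tp\<^esub>)"
 using dual[OF j k] presheafD(5)[OF A Tp(1) alpha[OF j]] by (simp add: d_def)
 then show "d p j V (bV p k V) = (if j = k then \<one>\<^bsub>Osec X V\<^esub> else \<zero>\<^bsub>Osec X V\<^esub>)"
 using dD(4)[OF j Tp(1) assms V bb[OF k]] ringedD(6,7)[OF X Tp(1) assms V] by (simp add: bV_def)
qed

lemma d_kills:
 assumes j: "j : J p" "m \<le> lev (ix p j)" and V: "opn X V" and s: "s : Km m p V"
 shows "d p j V s = \<zero>\<^bsub>Osec X V\<^esub>"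
proof -
 have c: "s : (csec B p V)" using s by (simp add: Ker_def)
 have "res (piece A (lev (ix p j) - p)) Tp V (alpha p j) : (csec A (lev (ix p j) - p) V)"
 by (rule presheafD(2)[OF A Tp(1) V Tp(2)[OF V] alpha[OF j(1)]])
 then show ?thesis
 using KerD[OF s V subset_refl, of "ix p j"] ix[OF j(1)] j(2) presheafD(5)[OF M V c] by (simp add: d_def)
qed

definition Jm where "Jm m p = {j\<in>J p. m \<le> lev (ix p j)}"

lemma finite_Jm: "finite (Jm m p)" by (simp add: Jm_def finite_J)

text \<open>The sum is the projection onto the dual vectors. Subtracting it makes all selected
  contractions of level at least \<open>m\<close> vanish, and axiom \<open>ker\<close> places the
  difference in \<open>Km m\<close>.\<close>

lemma decompose:
 assumes V: "opn X V" and s: "s : (csec B p V)"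
 shows "s \<ominus>\<^bsub>gsec B p V\<^esub> finsum (gsec B p V) (%j. d p j V s \<odot>\<^bsub>gsec B p V\<^esub> bV p j V) (Jm m p) : Km m p V"
 and "finsum (gsec B p V) (%j. d p j V s \<odot>\<^bsub>gsec B p V\<^esub> bV p j V) (Jm m p) : (csec B p V)"
proof -
 interpret B: module "Osec X V" "gsec B p V" by (rule presheafD(1)[OF M V])
 have t: "!!j. j : Jm m p ==> d p j V s \<odot>\<^bsub>gsec B p V\<^esub> bV p j V : (csec B p V)"
 by (simp add: Jm_def dD(1)[OF _ V s] bV(1)[OF V])
 let ?t = "finsum (gsec B p V) (%j. d p j V s \<odot>\<^bsub>gsec B p V\<^esub> bV p j V) (Jm m p)"
 show tc: "?t : (csec B p V)" by (rule B.finsum_closed) (use t in auto)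
 show "s \<ominus>\<^bsub>gsec B p V\<^esub> ?t : Km m p V"
 proof (rule ker[OF V])
 show "s \<ominus>\<^bsub>gsec B p V\<^esub> ?t : (csec B p V)" using s tc by simp
 fix k assume k: "k : J p" "m \<le> lev (ix p k)"
 have "d p k V ?t = finsum (Osec X V) (%j. d p k V (d p j V s \<odot>\<^bsub>gsec B p V\<^esub> bV p j V)) (Jm m p)"
 by (rule dD(6)[OF k(1) V finite_Jm t])
 also have "\<dots> = finsum (Osec X V) (%j. d p j V s \<otimes>\<^bsub>Osec X V\<^esub> (if j = k then \<one>\<^bsub>Osec X V\<^esub> else \<zero>\<^bsub>Osec X V\<^esub>)) (Jm m p)"
 using k by (intro B.R.add.finprod_cong') (auto simp: Jm_def dD(3)[OF k(1) V] dD(1)[OF _ V s] bV[OF V])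
 also have "\<dots> = d p k V s"
 using k by (intro B.finsum_indicator finite_Jm) (auto simp: Jm_def dD(1)[OF _ V s])
 finally have dt: "d p k V ?t = d p k V s" .
 have "d p k V (s \<ominus>\<^bsub>gsec B p V\<^esub> ?t) = \<zero>\<^bsub>Osec X V\<^esub>"
 unfolding dD(5)[OF k(1) V s tc] dt using dD(1)[OF k(1) V s] by (simp add: a_minus_def B.R.r_neg)
 then show "f (ix p k) V (act B V (lev (ix p k) - p) p (res (piece A (lev (ix p k) - p)) Tp V (alpha p k)) (s \<ominus>\<^bsub>gsec B p V\<^esub> ?t)) = \<zero>\<^bsub>Osec X V\<^esub>"
 by (simp add: d_def)
 qed
qed

text \<open>A selected contraction as an element of the dual of the quotient. It descends because it
  vanishes on the kernel belonging to its own level, which contains \<open>KI\<close>.\<close>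

definition \<delta> where
 "\<delta> p j = (SOME \<phi>. \<phi> : dual_sections X (Qp p) Tp &
 (ALL V s. opn X V --> s : (csec B p V) --> \<phi> V (cls p V s) = d p j V s))"

lemma \<delta>:
 assumes j: "j : J p"
 shows "\<delta> p j : dual_sections X (Qp p) Tp"
 and "opn X V ==> s : (csec B p V) ==> \<delta> p j V (cls p V s) = d p j V s"
proof -
 have "hom_fun X (piece B p) Tp (d p j) V s = \<zero>\<^bsub>Osec X V\<^esub>" if V: "opn X V" and s: "s : KI p V" for V s
 proof -
 have "s : Km (lev (ix p j)) p V" using s Ker_mono[of "{i\<in>I. lev (ix p j) \<le> lev i}" I] by auto
 moreover have "s : (csec B p V)" using s by (simp add: Ker_def)
 ultimately show ?thesis using d_kills[OF j order_refl V] V Tp(2) by simp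
 qed
 then obtain \<phi> where \<phi>: "\<phi> : dual_sections X (Qp p) Tp"
 "!!V s. opn X V ==> V \<subseteq> Tp ==> s : (csec B p V) ==> \<phi> V (cls p V s) = hom_fun X (piece B p) Tp (d p j) V s"
 using quot_functional_descend[OF X M KI_sub Tp(1) d_section[OF j]] by metis
 have "EX \<phi>. \<phi> : dual_sections X (Qp p) Tp &
 (ALL V s. opn X V --> s : (csec B p V) --> \<phi> V (cls p V s) = d p j V s)"
 using \<phi> Tp(2) by (intro exI[of _ \<phi>]) simp
 then have "\<delta> p j : dual_sections X (Qp p) Tp &
 (ALL V s. opn X V --> s : (csec B p V) --> \<delta> p j V (cls p V s) = d p j V s)"
 unfolding \<delta>_def by (rule someI_ex)
 then show "\<delta> p j : dual_sections X (Qp p) Tp"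
 and "opn X V ==> s : (csec B p V) ==> \<delta> p j V (cls p V s) = d p j V s" by auto
qed

text \<open>A generator as an element of the dual of the quotient; \<open>Ker_vanish\<close> is what
  makes it descend.\<close>

definition fb where
 "fb i = (SOME \<phi>. \<phi> : dual_sections X (Qp (lev i)) Tp &
 (ALL V s. opn X V --> s : (csec B (lev i) V) --> \<phi> V (cls (lev i) V s) = f i V s))"

lemma fb:
 assumes i: "i : I"
 shows "fb i : dual_sections X (Qp (lev i)) Tp"
 and "opn X V ==> s : (csec B (lev i) V) ==> fb i V (cls (lev i) V s) = f i V s"
proof -
 obtain \<phi> where \<phi>: "\<phi> : dual_sections X (Qp (lev i)) Tp"
 "!!V s. opn X V ==> V \<subseteq> Tp ==> s : (csec B (lev i) V) ==> \<phi> V (cls (lev i) V s) = f i V s"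
 using quot_functional_descend[OF X M KI_sub Tp(1) f[OF i]] Ker_vanish[OF i i] by metis
 have "EX \<phi>. \<phi> : dual_sections X (Qp (lev i)) Tp &
 (ALL V s. opn X V --> s : (csec B (lev i) V) --> \<phi> V (cls (lev i) V s) = f i V s)"
 using \<phi> Tp(2) by (intro exI[of _ \<phi>]) simp
 then have "fb i : dual_sections X (Qp (lev i)) Tp &
 (ALL V s. opn X V --> s : (csec B (lev i) V) --> fb i V (cls (lev i) V s) = f i V s)"
 unfolding fb_def by (rule someI_ex)
 then show "fb i : dual_sections X (Qp (lev i)) Tp"
 and "opn X V ==> s : (csec B (lev i) V) ==> fb i V (cls (lev i) V s) = f i V s" by auto
qed

text \<open>This links the selected basis to the module structure of the dual: a selected
  contraction is an algebra multiple of a generator sitting in degree minus its level. Hence it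
  belongs to every graded submodule that contains that generator.\<close>

lemma \<delta>_eq_act:
 assumes j: "j : J p"
 shows "\<delta> p j = act Q.D Tp (lev (ix p j) - p) (- lev (ix p j)) (alpha p j) (fb (ix p j))"
proof (rule dual_sections_ext[OF X Qp \<delta>(1)[OF j]])
 let ?i = "ix p j"
 have e: "lev ?i - p + - lev ?i = - p" "- (lev ?i - p + - lev ?i) = p" by simp_all
 have fbc: "fb ?i : (csec Q.D (- lev ?i) Tp)"
 using fb(1)[OF ix[OF j]] by (simp add: Q.gr_dual_simps(2) gr_quot_piece)
 show "act Q.D Tp (lev ?i - p) (- lev ?i) (alpha p j) (fb ?i) : dual_sections X (Qp p) Tp"
 using Q.gr_dual_act_closed[OF Tp(1) alpha[OF j] fbc] unfolding e by (simp add: Q.gr_dual_simps(2) gr_quot_piece)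
 fix V c assume V: "opn X V" "V \<subseteq> Tp" and "c : carrier (sec (Qp p) V)"
 then obtain s where s: "s : (csec B p V)" "c = cls p V s" by (auto simp: Qs)
 have al: "res (piece A (lev ?i - p)) Tp V (alpha p j) : (csec A (lev ?i - p) V)"
 by (rule presheafD(2)[OF A Tp(1) V alpha[OF j]])
 have "act Q.D Tp (lev ?i - p) (- lev ?i) (alpha p j) (fb ?i) V c =
 fb ?i V (act (gr_quot B KI) V (lev ?i - p) p (res (piece A (lev ?i - p)) Tp V (alpha p j)) c)"
 using Q.gr_dual_act_apply[OF V, of c "lev ?i - p" "- lev ?i" "alpha p j" "fb ?i"] cls_closed[OF V(1) s(1)] s(2)
 unfolding e gr_quot_piece by simp
 also have "act (gr_quot B KI) V (lev ?i - p) p (res (piece A (lev ?i - p)) Tp V (alpha p j)) c =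
 cls (lev ?i) V (act B V (lev ?i - p) p (res (piece A (lev ?i - p)) Tp V (alpha p j)) s)"
 using gr_quot_graded_system(2)[OF Ker_graded_submodule[OF subset_refl] V(1) al s(1)] s(2) by simp
 also have "fb ?i V \<dots> = d p j V s"
 using fb(2)[OF ix[OF j] V(1) act_lev_closed[OF V(1) al s(1)]] by (simp add: d_def)
 finally show "\<delta> p j V c = act Q.D Tp (lev ?i - p) (- lev ?i) (alpha p j) (fb ?i) V c"
 using \<delta>(2)[OF j V(1) s(1)] s(2) by simp
qed

text \<open>The explicit form of \<open>Delta\<close>: functionals on the quotient that vanish on
  the common kernel of the generators of level at least \<open>m\<close>. Unlike an intersection of
  submodules, it admits an explicit basis.\<close>

definition E where "E m = Q.ann (%p V. (%s. cls p V s) ` Km m p V)"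

lemma E_graded: "is_graded_submodule X A Q.D (E m)"
 unfolding E_def
proof (rule Q.ann_graded_submodule)
 have K: "is_graded_submodule X A B (Km m)" by (rule Ker_graded_submodule) auto
 note G = graded_submoduleD[OF K] subpresheafD(2)[OF Km_sub]
 show "Q.stable (%p V. (%s. cls p V s) ` Km m p V)"
 unfolding Q.stable_def gr_quot_piece
 proof (intro allI impI conjI ballI)
 fix U assume U: "opn X U"
 show "(%s. cls p U s) ` Km m p U \<subseteq> carrier (sec (Qp p) U)" for p
 using cls_closed[OF U G(3)[OF U]] by auto
 show "res (Qp p) U V s : (%s. cls p V s) ` Km m p V"
 if "opn X V & V \<subseteq> U" "s : (%s. cls p U s) ` Km m p U" for p V s
 using that U G(3)[OF U] G(5)[OF U] by (auto simp: Qs)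
 show "act (gr_quot B KI) U p q a s : (%s. cls (p + q) U s) ` Km m (p + q) U"
 if "a : (csec A p U)" "s : (%s. cls q U s) ` Km m q U" for p q a s
 using that U G(3)[OF U] G(2)[OF U that(1)]
 by (auto simp: gr_quot_graded_system(2)[OF Ker_graded_submodule[OF subset_refl] U])
 qed
qed

lemma E_iff:
 "\<phi> : E m (- p) U \<longleftrightarrow> \<phi> : dual_sections X (Qp p) U &
 (ALL V s. opn X V & V \<subseteq> U & s : Km m p V --> \<phi> V (cls p V s) = \<zero>\<^bsub>Osec X V\<^esub>)"
 by (auto simp: E_def Q.ann_def Q.gr_dual_simps(2) gr_quot_piece)

abbreviation "DP p \<equiv> dual_presheaf X (Qp p)"

lemma DP: "module_presheaf X (DP p)" by (rule dual_presheaf_module[OF X Qp])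

definition \<delta>V where "\<delta>V p j U = res (DP p) Tp U (\<delta> p j)"

lemma \<delta>V:
 assumes U: "opn X U" and j: "j : J p"
 shows "\<delta>V p j U : dual_sections X (Qp p) U"
 and "opn X V ==> V \<subseteq> U ==> s : (csec B p V) ==> \<delta>V p j U V (cls p V s) = d p j V s"
 and "opn X V ==> V \<subseteq> U ==> res (DP p) U V (\<delta>V p j U) = \<delta>V p j V"
 and "m \<le> lev (ix p j) ==> \<delta>V p j U : E m (- p) U"
proof -
 show c: "\<delta>V p j U : dual_sections X (Qp p) U"
 using presheafD(2)[OF DP Tp(1) U Tp(2)[OF U]] \<delta>(1)[OF j] by (simp add: \<delta>V_def)
 show ap: "opn X V ==> V \<subseteq> U ==> s : (csec B p V) ==> \<delta>V p j U V (cls p V s) = d p j V s" for V s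
 by (simp add: \<delta>V_def dual_presheaf_apply(4)[OF X Qp] cls_closed \<delta>(2)[OF j])
 show "opn X V ==> V \<subseteq> U ==> res (DP p) U V (\<delta>V p j U) = \<delta>V p j V"
 using presheafD(6)[OF DP Tp(1) U _ _ Tp(2)[OF U]] \<delta>(1)[OF j] by (simp add: \<delta>V_def)
 show "m \<le> lev (ix p j) ==> \<delta>V p j U : E m (- p) U"
 unfolding E_iff using c ap d_kills[OF j] by (auto simp: Ker_def)
qed

definition co where "co p j U \<phi> = \<phi> U (cls p U (bV p j U))"

lemma co_closed:
 "opn X U ==> j : J p ==> \<phi> : dual_sections X (Qp p) U ==> co p j U \<phi> : (cO X U)"
 by (simp add: co_def dualD(1)[OF X Qp] cls_closed bV)

text \<open>A member of \<open>E m\<close> does not see the remainder in \<open>decompose\<close>.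
  So it is determined by its values on the dual vectors of level at least \<open>m\<close>, and
  these values are its coefficients.\<close>

lemma expand:
 assumes U: "opn X U" and \<phi>: "\<phi> : E m (- p) U"
 shows "\<phi> = finsum (sec (DP p) U) (%j. co p j U \<phi> \<odot>\<^bsub>sec (DP p) U\<^esub> \<delta>V p j U) (Jm m p)"
proof -
 have \<phi>c: "\<phi> : dual_sections X (Qp p) U" using \<phi> by (simp add: E_iff)
 interpret DU: module "Osec X U" "sec (DP p) U" by (rule presheafD(1)[OF DP U])
 have t: "!!j. j : Jm m p ==> co p j U \<phi> \<odot>\<^bsub>sec (DP p) U\<^esub> \<delta>V p j U : dual_sections X (Qp p) U"
 using DU.smult_closed co_closed[OF U _ \<phi>c] \<delta>V(1)[OF U] by (auto simp: Jm_def)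
 show ?thesis
 proof (rule dual_sections_ext[OF X Qp \<phi>c])
 show "finsum (sec (DP p) U) (%j. co p j U \<phi> \<odot>\<^bsub>sec (DP p) U\<^esub> \<delta>V p j U) (Jm m p) : dual_sections X (Qp p) U"
 using DU.M.finsum_closed[of "%j. co p j U \<phi> \<odot>\<^bsub>sec (DP p) U\<^esub> \<delta>V p j U" "Jm m p"] t by auto
 fix V c assume V: "opn X V" "V \<subseteq> U" and c: "c : carrier (sec (Qp p) V)"
 then obtain s where s: "s : (csec B p V)" "c = cls p V s" by (auto simp: Qs)
 interpret BV: module "Osec X V" "gsec B p V" by (rule presheafD(1)[OF M V(1)])
 interpret QV: module "Osec X V" "sec (Qp p) V" by (rule presheafD(1)[OF Qp V(1)])
 note D = dualD[OF X Qp \<phi>c V]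
 define t where "t = finsum (gsec B p V) (%j. d p j V s \<odot>\<^bsub>gsec B p V\<^esub> bV p j V) (Jm m p)"
 have tc: "t : (csec B p V)" and st: "s \<ominus>\<^bsub>gsec B p V\<^esub> t : Km m p V"
 using decompose[OF V(1) s(1)] by (auto simp: t_def)
 have "\<phi> V (cls p V (s \<ominus>\<^bsub>gsec B p V\<^esub> t)) = \<zero>\<^bsub>Osec X V\<^esub>" using \<phi> st V by (simp add: E_iff)
 moreover have "cls p V s = cls p V (s \<ominus>\<^bsub>gsec B p V\<^esub> t) \<oplus>\<^bsub>sec (Qp p) V\<^esub> cls p V t"
 using s tc V by (simp add: Qs BV.M.minus_add_cancel)
 ultimately have "\<phi> V c = \<phi> V (cls p V t)"
 using D(1,2) s tc V cls_closed by simp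
 also have "cls p V t = finsum (sec (Qp p) V) (%j. cls p V (d p j V s \<odot>\<^bsub>gsec B p V\<^esub> bV p j V)) (Jm m p)"
 unfolding t_def
 by (rule quot_presheaf_finsum[OF X M KI_sub V(1) finite_Jm, symmetric]) (use dD(1)[OF _ V(1) s(1)] bV(1)[OF V(1)] in \<open>auto simp: Jm_def\<close>)
 also have "\<phi> V \<dots> = finsum (Osec X V) (%j. \<phi> V (cls p V (d p j V s \<odot>\<^bsub>gsec B p V\<^esub> bV p j V))) (Jm m p)"
 by (rule D(7)[OF finite_Jm]) (use dD(1)[OF _ V(1) s(1)] bV(1)[OF V(1)] cls_closed[OF V(1)] in \<open>auto simp: Jm_def\<close>)
 also have "\<dots> = finsum (Osec X V) (%j. (co p j U \<phi> \<odot>\<^bsub>sec (DP p) U\<^esub> \<delta>V p j U) V c) (Jm m p)"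
 proof (rule BV.R.add.finprod_cong')
 fix j assume "j : Jm m p"
 then have j: "j : J p" by (simp add: Jm_def)
 have "\<phi> V (cls p V (d p j V s \<odot>\<^bsub>gsec B p V\<^esub> bV p j V)) = d p j V s \<otimes>\<^bsub>Osec X V\<^esub> \<phi> V (cls p V (bV p j V))"
  using D(3)[of "d p j V s" "cls p V (bV p j V)"] dD(1)[OF j V(1) s(1)] bV(1)[OF V(1) j] cls_closed[OF V(1)]
  by (simp add: Qs V)
 also have "\<phi> V (cls p V (bV p j V)) = res (str X) U V (co p j U \<phi>)"
  using dualD(4)[OF X Qp \<phi>c U subset_refl V(1,2) cls_closed[OF U bV(1)[OF U j]]] bV[OF U j]
  by (simp add: Qs U V co_def bV[OF U] j)
 finally show "\<phi> V (cls p V (d p j V s \<odot>\<^bsub>gsec B p V\<^esub> bV p j V)) = (co p j U \<phi> \<odot>\<^bsub>sec (DP p) U\<^esub> \<delta>V p j U) V c"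
  using V s c \<delta>V(2)[OF U j V s(1)] dD(1)[OF j V(1) s(1)] ringedD(3)[OF X U V co_closed[OF U j \<phi>c]]
  by (simp add: dual_presheaf_apply(3)[OF X Qp] BV.R.m_comm)
 qed (use dualD(1)[OF X Qp t V c] in auto)
 also have "\<dots> = finsum (sec (DP p) U) (%j. co p j U \<phi> \<odot>\<^bsub>sec (DP p) U\<^esub> \<delta>V p j U) (Jm m p) V c"
 by (rule dual_presheaf_finsum[OF X Qp U V c finite_Jm t, symmetric])
 finally show "\<phi> V c = finsum (sec (DP p) U) (%j. co p j U \<phi> \<odot>\<^bsub>sec (DP p) U\<^esub> \<delta>V p j U) (Jm m p) V c" .
 qed
qed

text \<open>By \<open>Ker_ge\<close> the kernel that has to be annihilated is just \<open>KI\<close>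
  in degree \<open>p\<close>, which is zero in the quotient.\<close>

lemma E_all:
 assumes mp: "m \<le> p" and U: "opn X U"
 shows "E m (- p) U = dual_sections X (Qp p) U"
proof -
 have "\<phi> V (cls p V s) = \<zero>\<^bsub>Osec X V\<^esub>" if "\<phi> : dual_sections X (Qp p) U" "opn X V" "V \<subseteq> U" "s : Km m p V" for \<phi> V s
 proof -
 have "s : KI p V" using that Ker_ge[OF mp] by auto
 then have "cls p V s = \<zero>\<^bsub>sec (Qp p) V\<^esub>" using cls_zero_iff that by (auto simp: Ker_def)
 then show ?thesis using dualD(5)[OF X Qp] that by simp
 qed
 then show ?thesis by (auto simp: E_iff)
qed

text \<open>As \<open>E m\<close> is spanned by the selected contractions, its inclusion in a graded
  submodule has to be checked on these global elements only. Minimality in \<open>Delta_eq\<close>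
  and \<open>Aplus_eq\<close> rests on this.\<close>

lemma E_expand_mem:
 assumes U: "opn X U" and N: "is_graded_submodule X A Q.D N" and \<phi>: "\<phi> : E m (- p) U"
 and \<delta>N: "!!j. j : Jm m p ==> \<delta> p j : N (- p) Tp"
 shows "\<phi> : N (- p) U"
proof -
 interpret QD: module "Osec X U" "sec (DP p) U" by (rule presheafD(1)[OF DP U])
 have sub: "submodule_presheaf X (DP p) (N (- p))"
 using grsubD(1,2)[OF N, where p = "- p"] unfolding submodule_presheaf_def QD_piece by auto
 have "\<delta>V p j U : N (- p) U" if "j : Jm m p" for j
 using subpresheafD(2)[OF sub Tp(1) U Tp(2)[OF U] \<delta>N[OF that]] by (simp add: \<delta>V_def)
 then have "finsum (sec (DP p) U) (%j. co p j U \<phi> \<odot>\<^bsub>sec (DP p) U\<^esub> \<delta>V p j U) (Jm m p) : N (- p) U"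
 using \<phi> co_closed[OF U]
 by (intro submodule_finsum_closed[OF QD.module_axioms subpresheafD(1)[OF sub U] finite_Jm]
 submodule.smult_closed[OF subpresheafD(1)[OF sub U]]) (auto simp: E_iff Jm_def)
 then show ?thesis using expand[OF U \<phi>] by simp
qed

lemma generated_submodule_eqI:
 assumes "is_graded_submodule X A Q.D N" and "!!q V. opn X V ==> G q V \<subseteq> N q V"
 and "!!N'. is_graded_submodule X A Q.D N' ==> (!!q V. opn X V ==> G q V \<subseteq> N' q V) ==> N p U \<subseteq> N' p U"
 shows "generated_submodule X A Q.D G p U = N p U"
 unfolding generated_submodule_def using assms by blast

text \<open>\<open>E m\<close> contains the whole dual in the generating degrees by
  \<open>E_all\<close>. Conversely it is spanned by contractions of level at least \<open>m\<close>,
  and each of these is an algebra multiple of a generator in one of the generating degrees.\<close>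

lemma Delta_eq:
 assumes U: "opn X U"
 shows "Delta X A m Q.D (- p) U = E m (- p) U"
 unfolding Delta_def
proof (rule generated_submodule_eqI[OF E_graded])
 fix q V assume V: "opn X V"
 show "(if \<exists>j\<ge>m. q = - j then (csec Q.D q V) else {}) \<subseteq> E m q V"
 using E_all[OF _ V] by (auto simp: Q.gr_dual_simps(2) gr_quot_piece)
next
 fix N assume N: "is_graded_submodule X A Q.D N"
 and G: "!!q V. opn X V ==> (if \<exists>j\<ge>m. q = - j then (csec Q.D q V) else {}) \<subseteq> N q V"
 show "E m (- p) U \<subseteq> N (- p) U"
 proof
 fix \<phi> assume \<phi>: "\<phi> : E m (- p) U"
 show "\<phi> : N (- p) U"
 proof (rule E_expand_mem[OF U N \<phi>])
 fix j assume "j : Jm m p"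
 then have j: "j : J p" "m \<le> lev (ix p j)" by (auto simp: Jm_def)
 have "fb (ix p j) : N (- lev (ix p j)) Tp"
  using G[OF Tp(1), of "- lev (ix p j)"] j fb(1)[OF ix[OF j(1)]] by (auto simp: Q.gr_dual_simps(2) gr_quot_piece)
 from grsubD(4)[OF N Tp(1) alpha[OF j(1)] this]
 show "\<delta> p j : N (- p) Tp" using \<delta>_eq_act[OF j(1)] by simp
 qed
 qed
qed

lemma E_antimono:
 assumes "m \<le> m'"
 shows "E m' q U \<subseteq> E m q U"
proof
 obtain p where q: "q = - p" by (metis minus_minus)
 fix \<phi> assume "\<phi> : E m' q U"
 then have \<phi>: "\<phi> : dual_sections X (Qp p) U"
 and van: "!!V s. opn X V ==> V \<subseteq> U ==> s : Km m' p V ==> \<phi> V (cls p V s) = \<zero>\<^bsub>Osec X V\<^esub>"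
 unfolding q E_iff by auto
 have "Km m p V \<subseteq> Km m' p V" for V using assms by (intro Ker_mono) auto
 then show "\<phi> : E m q U" unfolding q E_iff using \<phi> van by blast
qed

text \<open>A contraction in degree \<open>p\<close> is a multiple by an algebra section of positive
  degree exactly when its level is at least \<open>p + 1\<close>. So in degree \<open>- p\<close>
  the products with \<open>A\<^sub>+\<close> generate the step of level \<open>p + 1\<close> of the
  same filtration.\<close>

lemma Aplus_eq:
 assumes U: "opn X U"
 shows "Aplus_times X A Q.D (- p) U = E (p + 1) (- p) U"
proof -
 \<comment> \<open>In terms of the degree \<open>q = - p\<close> the level \<open>p + 1\<close>
   reads \<open>1 - q\<close>. As it varies with the degree, the family is not one of the
   \<open>E m\<close> and has to be shown to be a submodule anew.\<close>
 have "generated_submodule X A Q.D (%k U. {act Q.D U p q a d | p q a d.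
  p > 0 & p + q = k & a : (csec A p U) & d : (csec Q.D q U)}) (- p) U =
 (%q. E (1 - q) q) (- p) U"
 proof (rule generated_submodule_eqI)
 show "is_graded_submodule X A Q.D (%q. E (1 - q) q)"
 proof (rule grsubI)
 fix U assume U: "opn X U"
 show "act Q.D U p q a s : E (1 - (p + q)) (p + q) U" if a: "a : (csec A p U)" and s: "s : E (1 - q) q U" for p q a s
 \<comment> \<open>For \<open>p \<ge> 0\<close> the required level drops when the degree rises, and
   \<open>E\<close> grows as the level drops. For \<open>p < 0\<close> the product is zero.\<close>
 proof (cases "p < 0")
  case True
  have "act Q.D U p q a s : E (1 - q) (p + q) U" by (rule grsubD(4)[OF E_graded U a s])
  moreover have "act Q.D U p q a s = \<zero>\<^bsub>gsec Q.D (p + q) U\<^esub>"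
  proof -
  have sc: "s : dual_sections X (piece (gr_quot B KI) (- q)) U"
   using s by (simp add: E_def Q.ann_def Q.gr_dual_simps(2))
  have c: "act Q.D U p q a s : dual_sections X (piece (gr_quot B KI) (- (p + q))) U"
   using Q.gr_dual_act_closed[OF U a, of s q] sc by (simp add: Q.gr_dual_simps(2))
  show ?thesis
   unfolding Q.gr_dual_simps(1)
  proof (rule dual_sections_ext[OF X Q.M c dual_presheaf_closed(1)[OF X Q.M U]])
   fix V c assume V: "opn X V" "V \<subseteq> U" and c: "c : (csec (gr_quot B KI) (- (p + q)) V)"
   have "res (piece A p) U V a : (csec A p V)" by (rule presheafD(2)[OF A U V a])
   have "act (gr_quot B KI) V p (- (p + q)) (res (piece A p) U V a) c = \<zero>\<^bsub>gsec (gr_quot B KI) (p + - (p + q)) V\<^esub>"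
   by (rule Q.act_negative[OF V(1) True \<open>res (piece A p) U V a : _\<close> c])
   have "act Q.D U p q a s V c = \<zero>\<^bsub>Osec X V\<^esub>"
   using Q.gr_dual_act_apply[OF V c, of a s] dualD(5)[OF X Q.M sc V] \<open>act (gr_quot B KI) V p (- (p + q)) (res (piece A p) U V a) c = _\<close>
   by simp
   then show "act Q.D U p q a s V c = \<zero>\<^bsub>sec (dual_presheaf X (piece (gr_quot B KI) (- (p + q)))) U\<^esub> V c"
   using dual_presheaf_apply(1)[OF X Q.M V c] by (simp only:)
  qed
  qed
  moreover have "\<zero>\<^bsub>gsec Q.D (p + q) U\<^esub> : E (1 - (p + q)) (p + q) U"
  using grsubD(1)[OF E_graded U] by (rule submodule_zero_closed)
  ultimately show ?thesis by simp
 next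
  case False
  have "act Q.D U p q a s : E (1 - q) (p + q) U" by (rule grsubD(4)[OF E_graded U a s])
  then show ?thesis using E_antimono[of "1 - (p + q)" "1 - q"] False by auto
 qed
 qed (fact grsubD(1-3)[OF E_graded])+
 next
 fix k V assume V: "opn X V"
 show "{act Q.D V p q a d | p q a d. p > 0 & p + q = k & a : (csec A p V) & d : (csec Q.D q V)} \<subseteq> E (1 - k) k V"
 proof clarify
 fix p q a d assume a: "(0::int) < p" "a : (csec A p V)" and d: "d : (csec Q.D q V)"
 \<comment> \<open>Every functional of degree \<open>q\<close> has level at least
   \<open>- q\<close>, and \<open>1 - (p + q)\<close> is at most \<open>- q\<close> because
   \<open>p\<close> is positive.\<close>
 have "d : E (- q) q V" using E_all[of "- q" "- q", OF _ V] d by (simp add: Q.gr_dual_simps(2) gr_quot_piece)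
 from grsubD(4)[OF E_graded V a(2) this]
 show "act Q.D V p q a d : E (1 - (p + q)) (p + q) V" using E_antimono[of "1 - (p + q)" "- q"] a by auto
 qed
 next
 fix N assume N: "is_graded_submodule X A Q.D N"
 and G: "!!k V. opn X V ==> {act Q.D V p q a d | p q a d. p > 0 & p + q = k & a : (csec A p V) & d : (csec Q.D q V)} \<subseteq> N k V"
 show "E (1 - - p) (- p) U \<subseteq> N (- p) U"
 proof
 fix \<phi> assume \<phi>: "\<phi> : E (1 - - p) (- p) U"
 show "\<phi> : N (- p) U"
 proof (rule E_expand_mem[OF U N \<phi>])
  fix j assume "j : Jm (1 - - p) p"
  then have j: "j : J p" "p + 1 \<le> lev (ix p j)" by (auto simp: Jm_def)
  have "fb (ix p j) : (csec Q.D (- lev (ix p j)) Tp)"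
  using fb(1)[OF ix[OF j(1)]] by (auto simp: Q.gr_dual_simps(2) gr_quot_piece)
  then have "act Q.D Tp (lev (ix p j) - p) (- lev (ix p j)) (alpha p j) (fb (ix p j)) \<in>
   {act Q.D Tp p' q a d | p' q a d. p' > 0 & p' + q = - p & a : (csec A p' Tp) & d : (csec Q.D q Tp)}"
  using alpha[OF j(1)] j(2)
  by (intro CollectI exI[of _ "lev (ix p j) - p"] exI[of _ "- lev (ix p j)"] exI[of _ "alpha p j"] exI[of _ "fb (ix p j)"]) simp
  then have "act Q.D Tp (lev (ix p j) - p) (- lev (ix p j)) (alpha p j) (fb (ix p j)) : N (- p) Tp"
  by (rule subsetD[OF G[OF Tp(1)]])
  then show "\<delta> p j : N (- p) Tp" using \<delta>_eq_act[OF j(1)] by simp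
 qed
 qed
 qed
 then show ?thesis by (simp add: Aplus_times_def add.commute)
qed

end

section \<open>Local bases of the quotient, of the filtration on its dual, and of the quotients by
  its steps\<close>

context dual_bases
begin

text \<open>At a level below all generators the filtration is exhausted: \<open>Km m\<close> is
  \<open>KI\<close> and \<open>Jm m p\<close> is \<open>J p\<close>. Inserting 0 into the minimum
  covers an empty \<open>I\<close>.\<close>

lemma low_level: "EX m. ALL i:I. m \<le> lev i"
proof
 show "ALL i:I. Min (insert 0 (lev ` I)) \<le> lev i" using finite_I by (auto intro!: Min_le)
qed

lemma Jm_low: "ALL i:I. m \<le> lev i ==> Jm m p = J p"
 using ix by (auto simp: Jm_def)

lemma Km_low: "ALL i:I. m \<le> lev i ==> Km m = KI"
proof -
 assume "ALL i:I. m \<le> lev i"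
 then have "{i\<in>I. m \<le> lev i} = I" by auto
 then show ?thesis by simp
qed

lemma indicator_sum:
 assumes V: "opn X V" and S: "finite S" "S \<subseteq> J p" "k : S" and c: "!!j. j : S ==> c j : (cO X V)"
 shows "finsum (Osec X V) (%j. c j \<otimes>\<^bsub>Osec X V\<^esub> d p j V (bV p k V)) S = c k"
 and "finsum (Osec X V) (%j. c j \<otimes>\<^bsub>Osec X V\<^esub> d p k V (bV p j V)) S = c k"
proof -
 interpret O: cring "Osec X V" by (rule ringedD(2)[OF X V])
 have "finsum (Osec X V) (%j. c j \<otimes>\<^bsub>Osec X V\<^esub> d p j V (bV p k V)) S =
 finsum (Osec X V) (%j. c j \<otimes>\<^bsub>Osec X V\<^esub> (if j = k then \<one>\<^bsub>Osec X V\<^esub> else \<zero>\<^bsub>Osec X V\<^esub>)) S"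
 using S c by (intro O.add.finprod_cong') (auto simp: bV(2)[OF V] subset_iff)
 also have "\<dots> = c k" using S c by (intro O.finsum_indicator) auto
 finally show "finsum (Osec X V) (%j. c j \<otimes>\<^bsub>Osec X V\<^esub> d p j V (bV p k V)) S = c k" .
 have "finsum (Osec X V) (%j. c j \<otimes>\<^bsub>Osec X V\<^esub> d p k V (bV p j V)) S =
 finsum (Osec X V) (%j. c j \<otimes>\<^bsub>Osec X V\<^esub> (if j = k then \<one>\<^bsub>Osec X V\<^esub> else \<zero>\<^bsub>Osec X V\<^esub>)) S"
 using S c by (intro O.add.finprod_cong') (auto simp: bV(2)[OF V] subset_iff)
 also have "\<dots> = c k" using S c by (intro O.finsum_indicator) auto
 finally show "finsum (Osec X V) (%j. c j \<otimes>\<^bsub>Osec X V\<^esub> d p k V (bV p j V)) S = c k" .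
qed

text \<open>Independence is read off by applying the functionals \<open>\<delta>V\<close>; spanning
  is \<open>decompose\<close> at a level below all generators.\<close>

lemma quotient_basis: "is_basis_on X (Qp p) Tp (J p) (%j. cls p Tp (bb p j))"
 unfolding is_basis_on_def
proof (intro conjI allI impI ballI)
 show "!!j. j : J p ==> cls p Tp (bb p j) : carrier (sec (Qp p) Tp)" by (rule cls_closed[OF Tp(1) bb])
 fix V assume V: "opn X V & V \<subseteq> Tp"
 then have V': "opn X V" by simp
 interpret O: cring "Osec X V" by (rule ringedD(2)[OF X V'])
 interpret BV: module "Osec X V" "gsec B p V" by (rule presheafD(1)[OF M V'])
 interpret QV: module "Osec X V" "sec (Qp p) V" by (rule presheafD(1)[OF Qp V'])
 have rb: "res (Qp p) Tp V (cls p Tp (bb p j)) = cls p V (bV p j V)" if "j : J p" for j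
 using that V by (simp add: Qs Tp bb bV_def)
 have tm: "c \<odot>\<^bsub>sec (Qp p) V\<^esub> res (Qp p) Tp V (cls p Tp (bb p j)) = cls p V (c \<odot>\<^bsub>gsec B p V\<^esub> bV p j V)"
 if "j : J p" "c : (cO X V)" for c j
 using that by (simp add: rb Qs V' bV(1)[OF V'])
 {
 fix c k assume c: "(ALL j:J p. c j : (cO X V)) &
 finsum (sec (Qp p) V) (%j. c j \<odot>\<^bsub>sec (Qp p) V\<^esub> res (Qp p) Tp V (cls p Tp (bb p j))) (J p) = \<zero>\<^bsub>sec (Qp p) V\<^esub>"
 and k: "k : J p"
 have \<delta>k: "\<delta>V p k V : dual_sections X (Qp p) V" by (rule \<delta>V(1)[OF V' k])
 note D = dualD[OF X Qp \<delta>k V' subset_refl]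
 have cl: "!!j. j : J p ==> c j \<odot>\<^bsub>gsec B p V\<^esub> bV p j V : (csec B p V)"
 using c bV(1)[OF V'] by simp
 have "\<zero>\<^bsub>Osec X V\<^esub> = \<delta>V p k V V (finsum (sec (Qp p) V) (%j. c j \<odot>\<^bsub>sec (Qp p) V\<^esub> res (Qp p) Tp V (cls p Tp (bb p j))) (J p))"
 using c D(5) by simp
 also have "\<dots> = finsum (Osec X V) (%j. \<delta>V p k V V (c j \<odot>\<^bsub>sec (Qp p) V\<^esub> res (Qp p) Tp V (cls p Tp (bb p j)))) (J p)"
 using c cl by (intro D(7) finite_J) (auto simp: tm intro!: cls_closed[OF V'])
 also have "\<dots> = finsum (Osec X V) (%j. c j \<otimes>\<^bsub>Osec X V\<^esub> d p k V (bV p j V)) (J p)"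
 using c cl bV(1)[OF V'] by (intro O.add.finprod_cong')
  (auto simp: tm \<delta>V(2)[OF V' k V' subset_refl] dD(3)[OF k V'] dD(1)[OF k V'])
 also have "\<dots> = c k" using c k by (intro indicator_sum(2)[OF V' finite_J subset_refl k]) auto
 finally show "c k = \<zero>\<^bsub>Osec X V\<^esub>" by simp
 }
 fix Y y assume "Y : carrier (sec (Qp p) V)" and y: "y : V"
 then obtain s where s: "s : (csec B p V)" "Y = cls p V s" using V' by (auto simp: Qs)
 obtain m where m: "ALL i:I. m \<le> lev i" using low_level by blast
 define t where "t = finsum (gsec B p V) (%j. d p j V s \<odot>\<^bsub>gsec B p V\<^esub> bV p j V) (J p)"
 have t: "t : (csec B p V)" "s \<ominus>\<^bsub>gsec B p V\<^esub> t : KI p V"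
 using decompose[OF V' s(1), of m] Jm_low[OF m] Km_low[OF m] by (auto simp: t_def)
 have "Y = cls p V t" using quot_presheaf_eq_iff[OF X M KI_sub V' s(1) t(1)] t(2) s(2) by simp
 also have "\<dots> = finsum (sec (Qp p) V) (%j. cls p V (d p j V s \<odot>\<^bsub>gsec B p V\<^esub> bV p j V)) (J p)"
 unfolding t_def using dD(1)[OF _ V' s(1)] bV(1)[OF V'] by (intro quot_presheaf_finsum[OF X M KI_sub V' finite_J, symmetric]) simp
 also have "\<dots> = finsum (sec (Qp p) V) (%j. d p j V s \<odot>\<^bsub>sec (Qp p) V\<^esub> res (Qp p) Tp V (cls p Tp (bb p j))) (J p)"
 using dD(1)[OF _ V' s(1)] bV(1)[OF V'] by (intro QV.finsum_cong') (auto simp: tm intro!: cls_closed[OF V'])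
 finally have "res (Qp p) V V Y = finsum (sec (Qp p) V) (%j. d p j V s \<odot>\<^bsub>sec (Qp p) V\<^esub> res (Qp p) Tp V (cls p Tp (bb p j))) (J p)"
 using presheafD(5)[OF Qp V'] \<open>Y : carrier (sec (Qp p) V)\<close> by simp
 then show "EX W c. opn X W & y : W & W \<subseteq> V & (ALL j:J p. c j : (cO X W)) &
 res (Qp p) V W Y = finsum (sec (Qp p) W) (%j. c j \<odot>\<^bsub>sec (Qp p) W\<^esub> res (Qp p) Tp W (cls p Tp (bb p j))) (J p)"
 using V' y dD(1)[OF _ V' s(1)] by (intro exI[of _ V] exI[of _ "%j. d p j V s"]) auto
qed

lemma E_sub:
 assumes "!!U. opn X U ==> F U = E m (- p) U"
 shows "submodule_presheaf X (DP p) F"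
 using grsubD(1,2)[OF E_graded, where p = "- p"] unfolding submodule_presheaf_def QD_piece by (auto simp: assms)

lemma \<delta>_combination:
 assumes V: "opn X V" and S: "finite S" "S \<subseteq> J p" and c: "!!j. j : S ==> c j : (cO X V)"
 shows "finsum (sec (DP p) V) (%j. c j \<odot>\<^bsub>sec (DP p) V\<^esub> \<delta>V p j V) S : dual_sections X (Qp p) V"
 and "k : S ==> finsum (sec (DP p) V) (%j. c j \<odot>\<^bsub>sec (DP p) V\<^esub> \<delta>V p j V) S V (cls p V (bV p k V)) = c k"
proof -
 interpret DV: module "Osec X V" "sec (DP p) V" by (rule presheafD(1)[OF DP V])
 have t: "c j \<odot>\<^bsub>sec (DP p) V\<^esub> \<delta>V p j V : dual_sections X (Qp p) V" if "j : S" for j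
 using DV.smult_closed[OF c[OF that], of "\<delta>V p j V"] \<delta>V(1)[OF V] that S by auto
 show "finsum (sec (DP p) V) (%j. c j \<odot>\<^bsub>sec (DP p) V\<^esub> \<delta>V p j V) S : dual_sections X (Qp p) V"
 using DV.M.finsum_closed[of "%j. c j \<odot>\<^bsub>sec (DP p) V\<^esub> \<delta>V p j V" S] t by auto
 assume k: "k : S"
 then have kJ: "k : J p" using S by auto
 have ck: "cls p V (bV p k V) : carrier (sec (Qp p) V)" using cls_closed[OF V bV(1)[OF V kJ]] .
 have "finsum (sec (DP p) V) (%j. c j \<odot>\<^bsub>sec (DP p) V\<^esub> \<delta>V p j V) S V (cls p V (bV p k V)) =
 finsum (Osec X V) (%j. (c j \<odot>\<^bsub>sec (DP p) V\<^esub> \<delta>V p j V) V (cls p V (bV p k V))) S"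
 by (rule dual_presheaf_finsum[OF X Qp V V subset_refl ck S(1) t])
 also have "\<dots> = finsum (Osec X V) (%j. c j \<otimes>\<^bsub>Osec X V\<^esub> d p j V (bV p k V)) S"
 using S c kJ by (intro DV.R.add.finprod_cong')
 (auto simp: dual_presheaf_apply(3)[OF X Qp V subset_refl ck] ringedD(9)[OF X V] subset_iff
  \<delta>V(2)[OF V _ V subset_refl bV(1)[OF V kJ]] dD(1)[OF _ V bV(1)[OF V kJ]])
 also have "\<dots> = c k" by (rule indicator_sum(1)[OF V S k c])
 finally show "finsum (sec (DP p) V) (%j. c j \<odot>\<^bsub>sec (DP p) V\<^esub> \<delta>V p j V) S V (cls p V (bV p k V)) = c k" .
qed

lemma E_combination:
 assumes V: "opn X V" and S: "finite S" "S \<subseteq> Jm m p" and c: "!!j. j : S ==> c j : (cO X V)"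
 shows "finsum (sec (DP p) V) (%j. c j \<odot>\<^bsub>sec (DP p) V\<^esub> \<delta>V p j V) S : E m (- p) V"
proof -
 have sub: "submodule (E m (- p) V) (Osec X V) (sec (DP p) V)"
 using grsubD(1)[OF E_graded V, of m "- p"] unfolding QD_piece .
 show ?thesis
 using S c \<delta>V(4)[OF V] unfolding Jm_def
 by (intro submodule_finsum_closed[OF presheafD(1)[OF DP V] sub] submodule.smult_closed[OF sub]) auto
qed

text \<open>\<open>Delta\<close> and \<open>E\<close> are compared on open sets only, hence the
  formulation for any \<open>F\<close> that agrees with \<open>E\<close> there. Spanning is
  \<open>expand\<close>; independence comes from evaluating at the dual vectors.\<close>

lemma E_basis:
 assumes F: "!!U. opn X U ==> F U = E m (- p) U"
 shows "is_basis_on X (sub_presheaf (DP p) F) Tp (Jm m p) (\<delta> p)"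
 unfolding is_basis_on_def
proof (intro conjI allI impI ballI)
 have FS: "submodule_presheaf X (DP p) F" by (rule E_sub[OF F])
 have \<delta>T: "\<delta>V p j Tp = \<delta> p j" if "j : J p" for j
 using presheafD(5)[OF DP Tp(1)] \<delta>(1)[OF that] by (simp add: \<delta>V_def)
 show "\<delta> p j : carrier (sec (sub_presheaf (DP p) F) Tp)" if "j : Jm m p" for j
 using that \<delta>V(4)[OF Tp(1), of j p m] \<delta>T by (auto simp: sub_presheaf_def F Tp(1) Jm_def)
 fix V assume V: "opn X V & V \<subseteq> Tp"
 then have V': "opn X V" by simp
 have sumeq: "finsum (sec (sub_presheaf (DP p) F) V) (%j. c j \<odot>\<^bsub>sec (sub_presheaf (DP p) F) V\<^esub> res (sub_presheaf (DP p) F) Tp V (\<delta> p j)) (Jm m p) =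
 finsum (sec (DP p) V) (%j. c j \<odot>\<^bsub>sec (DP p) V\<^esub> \<delta>V p j V) (Jm m p)" if c: "ALL j:Jm m p. c j : (cO X V)" for c
 proof -
 have "c j \<odot>\<^bsub>sec (DP p) V\<^esub> \<delta>V p j V : F V" if "j : Jm m p" for j
 using submodule.smult_closed[OF subpresheafD(1)[OF FS V']] c that \<delta>V(4)[OF V', of j p m] by (auto simp: F[OF V'] Jm_def)
 from finsum_carrier_update[OF presheafD(1)[OF DP V'] subpresheafD(1)[OF FS V'] finite_Jm this]
 show ?thesis by (simp add: sub_presheaf_def \<delta>V_def)
 qed
 {
 fix c k assume c: "(ALL j:Jm m p. c j : (cO X V)) &
 finsum (sec (sub_presheaf (DP p) F) V) (%j. c j \<odot>\<^bsub>sec (sub_presheaf (DP p) F) V\<^esub> res (sub_presheaf (DP p) F) Tp V (\<delta> p j)) (Jm m p) = \<zero>\<^bsub>sec (sub_presheaf (DP p) F) V\<^esub>"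
 and k: "k : Jm m p"
 have "\<zero>\<^bsub>sec (sub_presheaf (DP p) F) V\<^esub> = \<zero>\<^bsub>sec (DP p) V\<^esub>" by (simp add: sub_presheaf_def)
 then have "finsum (sec (DP p) V) (%j. c j \<odot>\<^bsub>sec (DP p) V\<^esub> \<delta>V p j V) (Jm m p) = \<zero>\<^bsub>sec (DP p) V\<^esub>"
 using c sumeq[of c] by metis
 moreover have "k : J p" using k by (simp add: Jm_def)
 ultimately show "c k = \<zero>\<^bsub>Osec X V\<^esub>"
 using \<delta>_combination(2)[OF V' finite_Jm _ _ k, of p c] c dual_presheaf_apply(1)[OF X Qp V' subset_refl cls_closed[OF V' bV(1)[OF V']]]
 by (auto simp: Jm_def)
 }
 fix \<phi> y assume "\<phi> : carrier (sec (sub_presheaf (DP p) F) V)" and y: "y : V"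
 then have \<phi>: "\<phi> : E m (- p) V" by (simp add: sub_presheaf_def F[OF V'])
 have c: "ALL j:Jm m p. co p j V \<phi> : (cO X V)" using co_closed[OF V'] \<phi> by (auto simp: Jm_def E_iff)
 have "\<phi> : carrier (sec (DP p) V)" using \<phi> by (simp add: E_iff)
 then have "res (sub_presheaf (DP p) F) V V \<phi> = \<phi>" using presheafD(5)[OF DP V'] by (simp add: sub_presheaf_def)
 then show "EX W c. opn X W & y : W & W \<subseteq> V & (ALL j:Jm m p. c j : (cO X W)) &
 res (sub_presheaf (DP p) F) V W \<phi> = finsum (sec (sub_presheaf (DP p) F) W) (%j. c j \<odot>\<^bsub>sec (sub_presheaf (DP p) F) W\<^esub> res (sub_presheaf (DP p) F) Tp W (\<delta> p j)) (Jm m p)"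
 using V' y c expand[OF V' \<phi>] sumeq[OF c] by (intro exI[of _ V] exI[of _ "%j. co p j V \<phi>"]) auto
qed

text \<open>The remaining contractions are those of level below \<open>m\<close>. Their dual vectors
  are killed by all selected contractions of level at least \<open>m\<close>, hence lie in
  \<open>Km m\<close>. So a combination of the remaining ones that belongs to \<open>E m\<close>
  vanishes on these vectors, where its values are its coefficients.\<close>

lemma E_quotient_basis:
 assumes F: "!!U. opn X U ==> F U = E m (- p) U"
 shows "is_basis_on X (quot_presheaf (DP p) F) Tp (J p - Jm m p) (%j. F Tp +>\<^bsub>sec (DP p) Tp\<^esub> \<delta> p j)"
 unfolding is_basis_on_def
proof (intro conjI allI impI ballI)
 have FS: "submodule_presheaf X (DP p) F" by (rule E_sub[OF F])
 note R = quot_presheaf_carrier[OF X DP FS] quot_presheaf_add[OF X DP FS] quot_presheaf_smult[OF X DP FS] quot_presheaf_res[OF X DP FS]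
 let ?S = "J p - Jm m p"
 have S: "finite ?S" "?S \<subseteq> J p" using finite_J by auto
 show "F Tp +>\<^bsub>sec (DP p) Tp\<^esub> \<delta> p j : carrier (sec (quot_presheaf (DP p) F) Tp)" if "j : ?S" for j
 using that \<delta>(1) by (auto simp: R Tp(1))
 fix V assume V: "opn X V & V \<subseteq> Tp"
 then have V': "opn X V" by simp
 interpret DV: module "Osec X V" "sec (DP p) V" by (rule presheafD(1)[OF DP V'])
 interpret QV: module "Osec X V" "sec (quot_presheaf (DP p) F) V"
 by (rule presheafD(1)[OF quot_presheaf_module[OF X DP FS] V'])
 have sumeq: "finsum (sec (quot_presheaf (DP p) F) V) (%j. c j \<odot>\<^bsub>sec (quot_presheaf (DP p) F) V\<^esub> res (quot_presheaf (DP p) F) Tp V (F Tp +>\<^bsub>sec (DP p) Tp\<^esub> \<delta> p j)) ?S =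
 F V +>\<^bsub>sec (DP p) V\<^esub> finsum (sec (DP p) V) (%j. c j \<odot>\<^bsub>sec (DP p) V\<^esub> \<delta>V p j V) ?S" if c: "ALL j:?S. c j : (cO X V)" for c
 proof -
 have t: "c j \<odot>\<^bsub>sec (DP p) V\<^esub> \<delta>V p j V : carrier (sec (DP p) V)" "\<delta>V p j V : carrier (sec (DP p) V)" if "j : ?S" for j
 using DV.smult_closed[of "c j" "\<delta>V p j V"] \<delta>V(1)[OF V'] c that by auto
 have "c j \<odot>\<^bsub>sec (quot_presheaf (DP p) F) V\<^esub> res (quot_presheaf (DP p) F) Tp V (F Tp +>\<^bsub>sec (DP p) Tp\<^esub> \<delta> p j) =
  F V +>\<^bsub>sec (DP p) V\<^esub> (c j \<odot>\<^bsub>sec (DP p) V\<^esub> \<delta>V p j V)" if j: "j : ?S" for j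
 proof -
 have "res (quot_presheaf (DP p) F) Tp V (F Tp +>\<^bsub>sec (DP p) Tp\<^esub> \<delta> p j) = F V +>\<^bsub>sec (DP p) V\<^esub> \<delta>V p j V"
  using quot_presheaf_res[OF X DP FS Tp(1) V'] V \<delta>(1) j by (simp add: \<delta>V_def)
 then show ?thesis using quot_presheaf_smult[OF X DP FS V' _ t(2)[OF j]] c j by simp
 qed
 then have "finsum (sec (quot_presheaf (DP p) F) V) (%j. c j \<odot>\<^bsub>sec (quot_presheaf (DP p) F) V\<^esub> res (quot_presheaf (DP p) F) Tp V (F Tp +>\<^bsub>sec (DP p) Tp\<^esub> \<delta> p j)) ?S =
  finsum (sec (quot_presheaf (DP p) F) V) (%j. F V +>\<^bsub>sec (DP p) V\<^esub> (c j \<odot>\<^bsub>sec (DP p) V\<^esub> \<delta>V p j V)) ?S"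
 using t by (intro QV.finsum_cong') (auto simp: quot_presheaf_carrier[OF X DP FS V'] simp del: dual_presheaf_carrier)
 also have "\<dots> = F V +>\<^bsub>sec (DP p) V\<^esub> finsum (sec (DP p) V) (%j. c j \<odot>\<^bsub>sec (DP p) V\<^esub> \<delta>V p j V) ?S"
 by (rule quot_presheaf_finsum[OF X DP FS V' S(1) t(1)])
 finally show ?thesis .
 qed
 {
 fix c k assume c: "(ALL j:?S. c j : (cO X V)) &
 finsum (sec (quot_presheaf (DP p) F) V) (%j. c j \<odot>\<^bsub>sec (quot_presheaf (DP p) F) V\<^esub> res (quot_presheaf (DP p) F) Tp V (F Tp +>\<^bsub>sec (DP p) Tp\<^esub> \<delta> p j)) ?S = \<zero>\<^bsub>sec (quot_presheaf (DP p) F) V\<^esub>"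
 and k: "k : ?S"
 define \<phi> where "\<phi> = finsum (sec (DP p) V) (%j. c j \<odot>\<^bsub>sec (DP p) V\<^esub> \<delta>V p j V) ?S"
 have \<phi>c: "\<phi> : carrier (sec (DP p) V)" unfolding \<phi>_def using \<delta>_combination(1)[OF V' S, of c] c by simp
 have "F V +>\<^bsub>sec (DP p) V\<^esub> \<phi> = \<zero>\<^bsub>sec (quot_presheaf (DP p) F) V\<^esub>"
 using c sumeq[of c] unfolding \<phi>_def by metis
 then have "\<phi> : E m (- p) V" using quot_presheaf_zero_iff[OF X DP FS V' \<phi>c] F[OF V'] by simp
 moreover have "bV p k V : Km m p V"
 proof (rule ker[OF V'])
 show "bV p k V : (csec B p V)" using bV(1)[OF V'] k by simp
 fix j assume j: "j : J p" "m \<le> lev (ix p j)"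
 then have "j ~= k" using k by (auto simp: Jm_def)
 then show "f (ix p j) V (act B V (lev (ix p j) - p) p (res (piece A (lev (ix p j) - p)) Tp V (alpha p j)) (bV p k V)) = \<zero>\<^bsub>Osec X V\<^esub>"
  using bV(2)[OF V' j(1), of k] k by (simp add: d_def)
 qed
 ultimately have "\<phi> V (cls p V (bV p k V)) = \<zero>\<^bsub>Osec X V\<^esub>" using V' by (simp add: E_iff)
 then show "c k = \<zero>\<^bsub>Osec X V\<^esub>"
 using \<delta>_combination(2)[OF V' S _ k, of c] c unfolding \<phi>_def by simp
 }
 fix Y y assume "Y : carrier (sec (quot_presheaf (DP p) F) V)" and y: "y : V"
 then obtain \<phi> where \<phi>: "\<phi> : dual_sections X (Qp p) V" "Y = F V +>\<^bsub>sec (DP p) V\<^esub> \<phi>" using V' by (auto simp: R)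
 \<comment> \<open>At the level \<open>m0\<close> every functional on the quotient belongs to
   \<open>E\<close>, so its expansion runs over all of \<open>J p\<close>; this sum is then split at
   level \<open>m\<close>.\<close>
 obtain m0 where m0: "ALL i:I. m0 \<le> lev i" using low_level by blast
 have \<phi>E: "\<phi> : E m0 (- p) V"
 using \<phi>(1) Km_low[OF m0] cls_zero_iff dualD(5)[OF X Qp \<phi>(1)]
 by (auto simp: E_iff) (metis (no_types, lifting) Ker_def mem_Collect_eq)
 have c: "!!j. j : J p ==> co p j V \<phi> : (cO X V)" using co_closed[OF V' _ \<phi>(1)] .
 let ?g = "%j. co p j V \<phi> \<odot>\<^bsub>sec (DP p) V\<^esub> \<delta>V p j V"
 have gc: "!!j. j : J p ==> ?g j : carrier (sec (DP p) V)"
 using DV.smult_closed[OF c] \<delta>V(1)[OF V'] by auto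
 have a: "finsum (sec (DP p) V) ?g (Jm m p) : E m (- p) V"
 using c by (intro E_combination[OF V' finite_Jm subset_refl]) (auto simp: Jm_def)
 have ac: "finsum (sec (DP p) V) ?g (Jm m p) : carrier (sec (DP p) V)" "finsum (sec (DP p) V) ?g ?S : carrier (sec (DP p) V)"
 using gc by (auto intro!: DV.M.finsum_closed simp: Jm_def simp del: dual_presheaf_carrier)
 have "\<phi> = finsum (sec (DP p) V) ?g (J p)" using expand[OF V' \<phi>E] Jm_low[OF m0] by simp
 also have "J p = Jm m p \<union> ?S" by (auto simp: Jm_def)
 also have "finsum (sec (DP p) V) ?g (Jm m p \<union> ?S) = finsum (sec (DP p) V) ?g (Jm m p) \<oplus>\<^bsub>sec (DP p) V\<^esub> finsum (sec (DP p) V) ?g ?S"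
 using gc by (intro DV.M.finsum_Un_disjoint finite_Jm S(1)) (auto simp: Jm_def simp del: dual_presheaf_carrier)
 finally have \<phi>eq: "\<phi> = finsum (sec (DP p) V) ?g (Jm m p) \<oplus>\<^bsub>sec (DP p) V\<^esub> finsum (sec (DP p) V) ?g ?S" .
 have "\<phi> \<ominus>\<^bsub>sec (DP p) V\<^esub> finsum (sec (DP p) V) ?g ?S = finsum (sec (DP p) V) ?g (Jm m p)"
 using ac by (subst \<phi>eq) (simp add: a_minus_def DV.M.a_assoc DV.M.r_neg del: dual_presheaf_carrier)
 then have "Y = F V +>\<^bsub>sec (DP p) V\<^esub> finsum (sec (DP p) V) ?g ?S"
 using quot_presheaf_eq_iff[OF X DP FS V' _ ac(2), of \<phi>] \<phi> a F[OF V'] by simp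
 moreover have "res (quot_presheaf (DP p) F) V V Y = Y"
 by (rule presheafD(5)[OF quot_presheaf_module[OF X DP FS] V']) fact
 ultimately show "EX W c. opn X W & y : W & W \<subseteq> V & (ALL j:?S. c j : (cO X W)) &
 res (quot_presheaf (DP p) F) V W Y = finsum (sec (quot_presheaf (DP p) F) W) (%j. c j \<odot>\<^bsub>sec (quot_presheaf (DP p) F) W\<^esub> res (quot_presheaf (DP p) F) Tp W (F Tp +>\<^bsub>sec (DP p) Tp\<^esub> \<delta> p j)) ?S"
 using V' y c sumeq[of "%j. co p j V \<phi>"] by (intro exI[of _ V] exI[of _ "%j. co p j V \<phi>"]) auto
qed

lemma quot_dual_eq: "quot_dual X A B KI = Q.D"
 by (simp add: quot_dual_def)

lemma Delta_rank:
 "locally_free_rank X (sub_presheaf (piece (quot_dual X A B KI) (- p)) (Delta X A m (quot_dual X A B KI) (- p))) (int (card (Jm m p)))"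
 unfolding quot_dual_eq QD_piece
 using is_basis_on_locally_free_rank[OF sub_presheaf_module_presheaf[OF X DP E_sub[OF Delta_eq]] finite_Jm E_basis[OF Delta_eq]] .

lemma QD_quot_piece: "piece (gr_quot Q.D N) (- p) = quot_presheaf (DP p) (N (- p))"
 unfolding gr_quot_def[of Q.D N] QD_piece[symmetric] by simp

lemma Delta_quotient_rank:
 "locally_free_rank X (piece (gr_quot (quot_dual X A B KI) (Delta X A m (quot_dual X A B KI))) (- p)) (int (card (J p - Jm m p)))"
 unfolding quot_dual_eq QD_quot_piece
 using is_basis_on_locally_free_rank[OF quot_presheaf_module[OF X DP E_sub[OF Delta_eq]] _ E_quotient_basis[OF Delta_eq]] finite_J
 by simp

text \<open>In degree \<open>- p\<close> the submodule of products with \<open>A\<^sub>+\<close> is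
  \<open>E (p + 1)\<close>, so the contractions that survive are those of level at most
  \<open>p\<close>.\<close>

lemma socle_rank:
 "locally_free_rank X (piece (gr_quot (quot_dual X A B KI) (Aplus_times X A (quot_dual X A B KI))) (- p)) (int (card (J p - Jm (p + 1) p)))"
 unfolding quot_dual_eq QD_quot_piece
 using is_basis_on_locally_free_rank[OF quot_presheaf_module[OF X DP E_sub[OF Aplus_eq]] _ E_quotient_basis[OF Aplus_eq]] finite_J
 by simp

lemma finite_lf_quotient:
 assumes "finite {p. J p ~= {}}"
 shows "is_finite_lf_quotient X A B KI"
 unfolding is_finite_lf_quotient_def
proof (intro conjI allI)
 show "is_graded_submodule X A B KI" by (rule Ker_graded_submodule) simp
 show "locally_free_finite X (piece (gr_quot B KI) p)" for p
 unfolding gr_quot_piece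
 using locally_free_rank_imp_finite[OF is_basis_on_locally_free_rank[OF Qp finite_J quotient_basis]] .
 have "carrier (sec (Qp p) U) = {\<zero>\<^bsub>sec (Qp p) U\<^esub>}" if p: "J p = {}" and U: "opn X U" for p U
 proof -
 obtain m where m: "ALL i:I. m \<le> lev i" using low_level by blast
 have "s : KI p U" if "s : (csec B p U)" for s
 using ker[OF U that, of m] p Km_low[OF m] by simp
 then show ?thesis using cls_zero_iff[OF U] presheafD(1)[OF Qp U]
 by (auto simp: Qs U) (metis (no_types, lifting) abelian_monoid.zero_closed abelian_group_def image_eqI module.axioms(2) presheafD(7)[OF M U])
 qed
 then have "{p. EX U. opn X U & (csec (gr_quot B KI) p U) ~= {\<zero>\<^bsub>gsec (gr_quot B KI) p U\<^esub>}} \<subseteq> {p. J p ~= {}}"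
 unfolding gr_quot_piece by blast
 then show "finite {p. EX U. opn X U & (csec (gr_quot B KI) p U) ~= {\<zero>\<^bsub>gsec (gr_quot B KI) p U\<^esub>}}"
 using assms finite_subset by blast
qed

text \<open>Rank and socle conditions have become cardinalities that mention only \<open>J\<close>
  and the levels, hence the same numbers over the point and over a neighbourhood. Flatness follows
  because the quotient by \<open>Delta\<close> is locally free as well.\<close>

theorem HLambda_socle:
 assumes "finite {p. J p ~= {}}" and h: "!!m p. h m p = int (card (Jm m p))" and t: "!!p. t p = int (card (J p - Jm (p + 1) p))"
 shows "KI : HLambda X A B h" and "has_socle_type X A B KI t"
proof -
 show "has_socle_type X A B KI t" unfolding has_socle_type_def Let_def t using socle_rank by blast
 have "flat_over X (piece (gr_quot Q.D (Delta X A m Q.D)) (- p))" for m p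
 proof (rule locally_free_finite_imp_flat[OF X])
 show "locally_free_finite X (piece (gr_quot Q.D (Delta X A m Q.D)) (- p))"
 using locally_free_rank_imp_finite[OF Delta_quotient_rank] unfolding quot_dual_eq .
 show "module_presheaf X (piece (gr_quot Q.D (Delta X A m Q.D)) (- p))"
 unfolding QD_quot_piece using quot_presheaf_module[OF X DP E_sub[OF Delta_eq]] by simp
 qed
 then show "KI : HLambda X A B h"
 unfolding HLambda_def Let_def using finite_lf_quotient[OF assms(1)] Delta_rank by (auto simp: h quot_dual_eq)
qed

end

section \<open>The fibre at a point\<close>

lemma unit_set_cases: "(U :: unit set) = {} \<or> U = UNIV"
 by auto

text \<open>A family of open sets of the point either contains the whole space or covers only the
  empty set, over which zero is the only section.\<close>

lemma point_presheaf_is_sheaf: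
 assumes z: "\<zero>\<^bsub>M\<^esub> : carrier M"
 shows "is_sheaf (discrete_topology UNIV) (point_presheaf M)"
proof -
 have U: "\<Union>\<U> = UNIV ==> UNIV : \<U>" for \<U> :: "unit set set"
 using unit_set_cases by (metis Union_iff UNIV_I empty_iff)
 have ne: "(UNIV :: unit set) ~= {}" by simp
 have sep: "s = t" if "s : carrier (sec (point_presheaf M) (\<Union>\<U>))" "t : carrier (sec (point_presheaf M) (\<Union>\<U>))"
 "ALL U:\<U>. res (point_presheaf M) (\<Union>\<U>) U s = res (point_presheaf M) (\<Union>\<U>) U t" for \<U> s t
 proof (cases "\<Union>\<U> = {}")
 case True
 then show ?thesis using that(1,2) by (simp only: True) (simp add: point_presheaf_def)
 next
 case False
 then have "\<Union>\<U> = UNIV" using unit_set_cases by blast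
 then show ?thesis using bspec[OF that(3) U] ne by (simp add: point_presheaf_def)
 qed
 have glue: "EX t:carrier (sec (point_presheaf M) (\<Union>\<U>)). ALL U:\<U>. res (point_presheaf M) (\<Union>\<U>) U t = s U"
 if s: "ALL U:\<U>. s U : carrier (sec (point_presheaf M) U)" for \<U> s
 proof (cases "UNIV : \<U>")
 case True
 then have e: "\<Union>\<U> = UNIV" by auto
 have "res (point_presheaf M) UNIV U (s UNIV) = s U" if "U : \<U>" for U
 using s that unit_set_cases[of U] True by (auto simp: point_presheaf_def)
 then show ?thesis unfolding e using s True by (intro bexI[of _ "s UNIV"]) auto
 next
 case False
 then have all: "U = {}" if "U : \<U>" for U using unit_set_cases[of U] that by auto
 then have e: "\<Union>\<U> = {}" by auto
 have "s U = \<zero>\<^bsub>M\<^esub>" if "U : \<U>" for U using s that all[OF that] by (auto simp: point_presheaf_def)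
 then show ?thesis unfolding e using all by (intro bexI[of _ "\<zero>\<^bsub>M\<^esub>"]) (auto simp: point_presheaf_def)
 qed
 show ?thesis
 unfolding is_sheaf_def
 proof (intro conjI allI impI ballI)
 fix U V :: "unit set"
 show "res (point_presheaf M) U V : carrier (sec (point_presheaf M) U) \<rightarrow> carrier (sec (point_presheaf M) V)"
 if "openin (discrete_topology UNIV) U & openin (discrete_topology UNIV) V & V \<subseteq> U"
 using z that unit_set_cases[of U] unit_set_cases[of V] by (auto simp: point_presheaf_def)
 show "res (point_presheaf M) U U s = s" if "s : carrier (sec (point_presheaf M) U)" for s
 using that by (auto simp: point_presheaf_def split: if_splits)
 next
 fix U V W :: "unit set" and s
 assume "openin (discrete_topology UNIV) U & openin (discrete_topology UNIV) V & openin (discrete_topology UNIV) W & W \<subseteq> V & V \<subseteq> U"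
 "s : carrier (sec (point_presheaf M) U)"
 then show "res (point_presheaf M) V W (res (point_presheaf M) U V s) = res (point_presheaf M) U W s"
 by (auto simp: point_presheaf_def)
 next
 fix \<U> :: "unit set set" and s t
 assume "s : carrier (sec (point_presheaf M) (\<Union>\<U>))" "t : carrier (sec (point_presheaf M) (\<Union>\<U>))"
 "ALL U:\<U>. res (point_presheaf M) (\<Union>\<U>) U s = res (point_presheaf M) (\<Union>\<U>) U t"
 then show "s = t" by (rule sep)
 next
 fix \<U> :: "unit set set" and s
 assume "(ALL U:\<U>. openin (discrete_topology UNIV) U & s U : carrier (sec (point_presheaf M) U)) &
 (ALL U:\<U>. ALL V:\<U>. res (point_presheaf M) U (U \<inter> V) (s U) = res (point_presheaf M) V (U \<inter> V) (s V))"
 then show "EX t:carrier (sec (point_presheaf M) (\<Union>\<U>)). ALL U:\<U>. res (point_presheaf M) (\<Union>\<U>) U t = s U"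
 by (intro glue) blast
 qed
qed

lemma Spec_field_simps [simp]:
 "openin (pts (Spec_field K)) U"
 "topspace (pts (Spec_field K)) = UNIV"
 "Osec (Spec_field K) UNIV = K"
 "Osec (Spec_field K) {} = K\<lparr>carrier := {\<zero>\<^bsub>K\<^esub>}, one := \<zero>\<^bsub>K\<^esub>\<rparr>"
 "res (str (Spec_field K)) U V r = (if V = {} then \<zero>\<^bsub>K\<^esub> else r)"
 by (simp_all add: Spec_field_def point_presheaf_def)

lemma point_presheaf_simps [simp]:
 "sec (point_presheaf M) UNIV = M"
 "sec (point_presheaf M) {} = M\<lparr>carrier := {\<zero>\<^bsub>M\<^esub>}, one := \<zero>\<^bsub>M\<^esub>\<rparr>"
 "res (point_presheaf M) U V s = (if V = {} then \<zero>\<^bsub>M\<^esub> else s)"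
 by (simp_all add: point_presheaf_def)

lemma zero_ring_cring: "cring K ==> cring (K\<lparr>carrier := {\<zero>\<^bsub>K\<^esub>}, one := \<zero>\<^bsub>K\<^esub>\<rparr>)"
proof -
 assume "cring K"
 then interpret cring K .
 show ?thesis by (intro cringI abelian_groupI Group.comm_monoidI) auto
qed

lemma Spec_field_ringed_space:
 assumes K: "cring K"
 shows "is_ringed_space (Spec_field K)"
proof -
 interpret cring K by fact
 have "cring (Osec (Spec_field K) U)" for U :: "unit set"
 using unit_set_cases[of U] K zero_ring_cring[OF K] by auto
 moreover have "res (str (Spec_field K)) U V : ring_hom (Osec (Spec_field K) U) (Osec (Spec_field K) V)" if "V \<subseteq> U" for U V :: "unit set"
 using unit_set_cases[of U] unit_set_cases[of V] that by (auto intro!: ring_hom_memI)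
 moreover have "is_sheaf (pts (Spec_field K)) (str (Spec_field K))"
 using point_presheaf_is_sheaf[of K] by (simp add: Spec_field_def)
 ultimately show ?thesis unfolding is_ringed_space_def by blast
qed

lemma point_presheaf_module_presheaf:
 assumes M: "module K M"
 shows "module_presheaf (Spec_field K) (point_presheaf M)"
proof -
 interpret module K M by fact
 have z: "module (K\<lparr>carrier := {\<zero>\<^bsub>K\<^esub>}, one := \<zero>\<^bsub>K\<^esub>\<rparr>) (M\<lparr>carrier := {\<zero>\<^bsub>M\<^esub>}, one := \<zero>\<^bsub>M\<^esub>\<rparr>)"
 by (intro moduleI abelian_groupI zero_ring_cring R.is_cring) auto
 have m: "module (Osec (Spec_field K) U) (sec (point_presheaf M) U)" for U :: "unit set"
 using unit_set_cases[of U] M z by auto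
 show ?thesis
 unfolding module_presheaf_def
 proof (intro conjI allI impI ballI)
 fix U :: "unit set"
 show "module (Osec (Spec_field K) U) (sec (point_presheaf M) U)" by (rule m)
 show "res (point_presheaf M) U U s = s" if "s : carrier (sec (point_presheaf M) U)" for s
 using that by auto
 fix V assume "openin (pts (Spec_field K)) U & openin (pts (Spec_field K)) V & V \<subseteq> U"
 then have V: "V \<subseteq> U" by simp
 fix s assume s: "s : carrier (sec (point_presheaf M) U)"
 show "res (point_presheaf M) U V s : carrier (sec (point_presheaf M) V)"
 using s V unit_set_cases[of U] unit_set_cases[of V] by auto
 show "res (point_presheaf M) U V (s \<oplus>\<^bsub>sec (point_presheaf M) U\<^esub> t) =
 res (point_presheaf M) U V s \<oplus>\<^bsub>sec (point_presheaf M) V\<^esub> res (point_presheaf M) U V t" for t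
 using s V unit_set_cases[of U] unit_set_cases[of V] by auto
 show "res (point_presheaf M) U V (r \<odot>\<^bsub>sec (point_presheaf M) U\<^esub> s) =
 res (str (Spec_field K)) U V r \<odot>\<^bsub>sec (point_presheaf M) V\<^esub> res (point_presheaf M) U V s" for r
 using s V unit_set_cases[of U] unit_set_cases[of V] by auto
 next
 fix U V W :: "unit set" and s
 assume "openin (pts (Spec_field K)) U & openin (pts (Spec_field K)) V & openin (pts (Spec_field K)) W & W \<subseteq> V & V \<subseteq> U"
 then show "res (point_presheaf M) V W (res (point_presheaf M) U V s) = res (point_presheaf M) U W s" by auto
 qed
qed

section \<open>Evaluation of sections at a point of a locally ringed space\<close>

locale local_point =
 fixes X :: "('x, 'r) ringed_space" and x :: 'x
 assumes X: "is_ringed_space X" and x: "x : topspace (pts X)"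
 and loc: "EX! I. maximalideal I (stalk_ring X x)"
begin

abbreviation "R \<equiv> stalk_ring X x"
abbreviation "\<mm> \<equiv> max_ideal R"
abbreviation "K \<equiv> residue_field X x"
abbreviation "nbhd U \<equiv> opn X U & x : U"
abbreviation "Fib P \<equiv> fibre_module X x P"

sublocale R: cring R by (rule stalk_ring_cring[OF X x])

lemma \<mm>: "maximalideal \<mm> R" by (rule max_ideal_maximal[OF loc])

lemma K_field: "field K"
 unfolding residue_field_def by (rule maximalideal.quotient_is_field[OF \<mm> R.is_cring])

sublocale K: field K by (rule K_field)

text \<open>Evaluation at \<open>x\<close>, for functions and for sections of modules: the germ
  followed by its residue class. All passage between neighbourhoods of \<open>x\<close> and the
  fibre goes through these two additive maps.\<close>

definition evO where "evO U r = \<mm> +>\<^bsub>R\<^esub> germ (pts X) (str X) x U r"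
definition ev where "ev P U s = fibre_class X x P (germ (pts X) P x U s)"

lemma O_ps: "is_presheaf (pts X) (str X)" by (rule ringed_space_is_presheaf[OF X])

lemma quot_hom: "(%\<alpha>. \<mm> +>\<^bsub>R\<^esub> \<alpha>) : ring_hom R K"
 unfolding residue_field_def using ideal.rcos_ring_hom[OF maximalideal.axioms(1)[OF \<mm>]] by (simp add: eta_contract_eq)

lemma germ_closed: "nbhd U ==> r : (cO X U) ==> germ (pts X) (str X) x U r : carrier R"
 using germ_in_germs[OF O_ps] by (simp add: stalk_ring_simps(1)[OF X x])

lemma evO:
 assumes U: "nbhd U"
 shows "r : (cO X U) ==> evO U r : carrier K"
 and "r : (cO X U) ==> r' : (cO X U) ==> evO U (r \<oplus>\<^bsub>Osec X U\<^esub> r') = evO U r \<oplus>\<^bsub>K\<^esub> evO U r'"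
 and "r : (cO X U) ==> r' : (cO X U) ==> evO U (r \<otimes>\<^bsub>Osec X U\<^esub> r') = evO U r \<otimes>\<^bsub>K\<^esub> evO U r'"
 and "evO U \<one>\<^bsub>Osec X U\<^esub> = \<one>\<^bsub>K\<^esub>"
 and "evO U \<zero>\<^bsub>Osec X U\<^esub> = \<zero>\<^bsub>K\<^esub>"
 and "r : (cO X U) ==> r' : (cO X U) ==> evO U (r \<ominus>\<^bsub>Osec X U\<^esub> r') = evO U r \<ominus>\<^bsub>K\<^esub> evO U r'"
 and "finite I ==> (!!i. i : I ==> g i : (cO X U)) ==>
 evO U (finsum (Osec X U) g I) = finsum K (%i. evO U (g i)) I"
 and "opn X V ==> x : V ==> V \<subseteq> U ==> r : (cO X U) ==> evO V (res (str X) U V r) = evO U r"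
proof -
 note S = stalk_ring_simps[OF X x]
 show c: "r : (cO X U) ==> evO U r : carrier K" for r
 unfolding evO_def using ring_hom_closed[OF quot_hom germ_closed[OF U]] .
 show a: "r : (cO X U) ==> r' : (cO X U) ==> evO U (r \<oplus>\<^bsub>Osec X U\<^esub> r') = evO U r \<oplus>\<^bsub>K\<^esub> evO U r'" for r r'
 unfolding evO_def using ring_hom_add[OF quot_hom germ_closed[OF U] germ_closed[OF U]] S(4) U by metis
 show "r : (cO X U) ==> r' : (cO X U) ==> evO U (r \<otimes>\<^bsub>Osec X U\<^esub> r') = evO U r \<otimes>\<^bsub>K\<^esub> evO U r'"
 unfolding evO_def using ring_hom_mult[OF quot_hom germ_closed[OF U] germ_closed[OF U]] S(5) U by metis
 show "evO U \<one>\<^bsub>Osec X U\<^esub> = \<one>\<^bsub>K\<^esub>"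
 unfolding evO_def using ring_hom_one[OF quot_hom] S(3) U by metis
 note g = ringedD(11)[OF X conjunct1[OF U]] K.abelian_group_axioms
 show "evO U \<zero>\<^bsub>Osec X U\<^esub> = \<zero>\<^bsub>K\<^esub>" by (rule additive_map_zero[OF g c a])
 show "r : (cO X U) ==> r' : (cO X U) ==> evO U (r \<ominus>\<^bsub>Osec X U\<^esub> r') = evO U r \<ominus>\<^bsub>K\<^esub> evO U r'"
 by (rule additive_map_minus[OF g c a])
 show "finite I ==> (!!i. i : I ==> g i : (cO X U)) ==>
 evO U (finsum (Osec X U) g I) = finsum K (%i. evO U (g i)) I"
 by (rule finsum_additive_map[OF g _ c a])
 show "opn X V ==> x : V ==> V \<subseteq> U ==> r : (cO X U) ==> evO V (res (str X) U V r) = evO U r"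
 unfolding evO_def using germ_res[OF O_ps conjunct1[OF U]] by metis
qed

lemma evO_surj:
 assumes "\<kappa> : carrier K" and W: "nbhd W"
 obtains U r where "nbhd U" "U \<subseteq> W" "r : (cO X U)" "\<kappa> = evO U r"
proof -
 obtain \<alpha> where \<alpha>: "\<alpha> : germs (pts X) (str X) x" "\<kappa> = \<mm> +>\<^bsub>R\<^esub> \<alpha>"
 using assms(1) unfolding residue_field_def FactRing_def A_RCOSETS_defs a_r_coset_defs
 by (auto simp: stalk_ring_simps(1)[OF X x])
 obtain U r where "opn X U" "x : U" "U \<subseteq> W" "r : (cO X U)" "\<alpha> = germ (pts X) (str X) x U r"
 by (rule germs_within[OF O_ps \<alpha>(1) conjunct1[OF W] conjunct2[OF W]])
 then show ?thesis using that \<alpha>(2) by (auto simp: evO_def)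
qed

text \<open>A germ with nonzero residue lies outside the only maximal ideal, so it is a unit of the
  stalk; inverse and relation are then realised on some neighbourhood. Elimination takes its pivots
  from here.\<close>

lemma evO_unit:
 assumes U: "nbhd U" and r: "r : (cO X U)" and nz: "evO U r ~= \<zero>\<^bsub>K\<^esub>"
 obtains W u where "nbhd W" "W \<subseteq> U" "u : (cO X W)" "u \<otimes>\<^bsub>Osec X W\<^esub> res (str X) U W r = \<one>\<^bsub>Osec X W\<^esub>"
proof -
 note S = stalk_ring_simps[OF X x]
 let ?g = "germ (pts X) (str X) x"
 interpret M: maximalideal \<mm> R by (rule \<mm>)
 have "?g U r \<notin> \<mm>"
 proof
 assume "?g U r : \<mm>"
 then have "\<mm> +>\<^bsub>R\<^esub> ?g U r = \<mm>" by (rule M.a_rcos_const)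
 then show False using nz by (simp add: evO_def residue_field_def FactRing_def)
 qed
 then have "?g U r : Units R" using local_ring_unit[OF R.is_cring loc germ_closed[OF U r]] by simp
 then obtain \<beta> where \<beta>: "\<beta> : germs (pts X) (str X) x" "\<beta> \<otimes>\<^bsub>R\<^esub> ?g U r = \<one>\<^bsub>R\<^esub>"
 unfolding Units_def S(1) by auto
 obtain V v where V: "opn X V" "x : V" "V \<subseteq> U" "v : (cO X V)" "\<beta> = ?g V v"
 by (rule germs_within[OF O_ps \<beta>(1) conjunct1[OF U] conjunct2[OF U]])
 interpret O: cring "Osec X V" by (rule ringedD(2)[OF X V(1)])
 have rV: "res (str X) U V r : (cO X V)" using ringedD(3)[OF X conjunct1[OF U] V(1,3) r] .
 have "?g V (v \<otimes>\<^bsub>Osec X V\<^esub> res (str X) U V r) = ?g V \<one>\<^bsub>Osec X V\<^esub>"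
 using \<beta>(2) S(5)[OF V(1,2,4) rV] germ_res[OF O_ps conjunct1[OF U] V(1-3) r] S(3)[OF V(1,2)] V(5) by simp
 then obtain W where W: "opn X W" "x : W" "W \<subseteq> V"
 "res (str X) V W (v \<otimes>\<^bsub>Osec X V\<^esub> res (str X) U V r) = res (str X) V W \<one>\<^bsub>Osec X V\<^esub>"
 using germ_eqE[OF O_ps V(1,2)] V(4) rV by (metis O.m_closed)
 have "res (str X) V W v \<otimes>\<^bsub>Osec X W\<^esub> res (str X) U W r = \<one>\<^bsub>Osec X W\<^esub>"
 using W(4) ringedD(5)[OF X V(1) W(1,3) V(4) rV] ringedD(6)[OF X V(1) W(1,3)]
 ringedD(10)[OF X conjunct1[OF U] V(1) W(1,3) V(3) r] by simp
 then show ?thesis using that[of W "res (str X) V W v"] W V ringedD(3)[OF X V(1) W(1,3) V(4)] by auto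
qed

context
 fixes P :: "('x, 'r, 'm) mod_presheaf"
 assumes P: "module_presheaf X P"
begin

private abbreviation "S \<equiv> stalk_module X P x"
private abbreviation "N \<equiv> max_ideal_times_stalk X x P"

lemma P_ps: "is_presheaf (pts X) P" by (rule module_presheaf_is_presheaf[OF P])

lemma S_mod: "module R S" by (rule stalk_module_module[OF X x P])

text \<open>The whole stalk is one of the submodules intersected, so the intersection is again a
  submodule. Statements about all its members are proved through \<open>N_least\<close>, without
  describing them as sums of products.\<close>

lemma N_submodule: "submodule N R S"
 and N_smult: "r : \<mm> ==> s : carrier S ==> r \<odot>\<^bsub>S\<^esub> s : N"
 and N_least: "submodule L R S ==> (!!r s. r : \<mm> ==> s : carrier S ==> r \<odot>\<^bsub>S\<^esub> s : L) ==> N \<subseteq> L"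
proof -
 interpret S: module R S by (rule S_mod)
 interpret M: maximalideal \<mm> R by (rule \<mm>)
 define F where "F = {L. submodule L R S & (ALL r:\<mm>. ALL s:carrier S. r \<odot>\<^bsub>S\<^esub> s : L)}"
 have N: "N = \<Inter>F" by (simp add: F_def max_ideal_times_stalk_def Let_def)
 have "carrier S : F" using S.carrier_is_submodule M.a_Hcarr by (auto simp: F_def)
 have F: "submodule L R S" if "L : F" for L using that by (simp add: F_def)
 show "submodule N R S"
 unfolding N
 proof (rule S.submoduleI)
 show "\<Inter>F \<subseteq> carrier S" using \<open>carrier S : F\<close> by auto
 show "\<zero>\<^bsub>S\<^esub> : \<Inter>F" using submodule_zero_closed[OF F] by blast
 show "\<ominus>\<^bsub>S\<^esub> a : \<Inter>F" if "a : \<Inter>F" for a using S.submoduleE(3)[OF F] that by blast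
 show "a \<oplus>\<^bsub>S\<^esub> b : \<Inter>F" if "a : \<Inter>F" "b : \<Inter>F" for a b using S.submoduleE(5)[OF F] that by blast
 show "r \<odot>\<^bsub>S\<^esub> a : \<Inter>F" if "r : carrier R" "a : \<Inter>F" for r a using S.submoduleE(4)[OF F] that by blast
 qed
 show "r : \<mm> ==> s : carrier S ==> r \<odot>\<^bsub>S\<^esub> s : N" unfolding N by (auto simp: F_def)
 show "submodule L R S ==> (!!r s. r : \<mm> ==> s : carrier S ==> r \<odot>\<^bsub>S\<^esub> s : L) ==> N \<subseteq> L" unfolding N by (auto simp: F_def)
qed

lemma Fib_quot:
 "carrier (Fib P) = carrier (quot_module S N)" "\<zero>\<^bsub>Fib P\<^esub> = \<zero>\<^bsub>quot_module S N\<^esub>"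
 "y \<oplus>\<^bsub>Fib P\<^esub> z = y \<oplus>\<^bsub>quot_module S N\<^esub> z"
 by (simp_all add: fibre_module_def Let_def quot_module_def)

lemma fibre_class_eq_iff:
 "\<alpha> : carrier S ==> \<beta> : carrier S ==> fibre_class X x P \<alpha> = fibre_class X x P \<beta> \<longleftrightarrow> \<alpha> \<ominus>\<^bsub>S\<^esub> \<beta> : N"
 unfolding fibre_class_def by (rule a_rcoset_eq_iff[OF S_mod N_submodule])

lemma fibre_class_mem:
 "\<alpha> : carrier S ==> \<beta> : fibre_class X x P \<alpha> \<longleftrightarrow> \<beta> : carrier S & fibre_class X x P \<beta> = fibre_class X x P \<alpha>"
 unfolding fibre_class_def by (rule a_rcoset_mem_iff[OF S_mod N_submodule])

lemma residue_mem:
 assumes "\<rho> : carrier R"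
 shows "\<sigma> : \<mm> +>\<^bsub>R\<^esub> \<rho> \<longleftrightarrow> \<sigma> : carrier R & \<sigma> \<ominus>\<^bsub>R\<^esub> \<rho> : \<mm>"
proof -
 interpret M: maximalideal \<mm> R by (rule \<mm>)
 show ?thesis
 using M.a_rcos_module_minus[OF R.ring_axioms assms, of \<sigma>] M.a_elemrcos_carrier[OF assms, of \<sigma>] by blast
qed

lemma Fib_smult:
 assumes \<rho>: "\<rho> : carrier R" and \<alpha>: "\<alpha> : carrier S"
 shows "(\<mm> +>\<^bsub>R\<^esub> \<rho>) \<odot>\<^bsub>Fib P\<^esub> fibre_class X x P \<alpha> = fibre_class X x P (\<rho> \<odot>\<^bsub>S\<^esub> \<alpha>)"
proof -
 interpret S: module R S by (rule S_mod)
 interpret M: maximalideal \<mm> R by (rule \<mm>)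
 \<comment> \<open>The two factors are changed one at a time: changing the scalar by an element of
   \<open>\<mm>\<close>, or the vector by an element of \<open>N\<close>, changes the product by an
   element of \<open>N\<close>.\<close>
 have eq: "fibre_class X x P (\<sigma> \<odot>\<^bsub>S\<^esub> \<beta>) = fibre_class X x P (\<rho> \<odot>\<^bsub>S\<^esub> \<alpha>)"
 if "\<sigma> : \<mm> +>\<^bsub>R\<^esub> \<rho>" "\<beta> : fibre_class X x P \<alpha>" for \<sigma> \<beta>
 proof -
 have \<sigma>: "\<sigma> : carrier R" "\<sigma> \<ominus>\<^bsub>R\<^esub> \<rho> : \<mm>" using residue_mem[OF \<rho>] that(1) by auto
 have \<beta>: "\<beta> : carrier S" "\<beta> \<ominus>\<^bsub>S\<^esub> \<alpha> : N" using fibre_class_mem[OF \<alpha>] fibre_class_eq_iff[OF _ \<alpha>] that(2) by auto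
 have "\<sigma> \<odot>\<^bsub>S\<^esub> \<beta> \<ominus>\<^bsub>S\<^esub> \<rho> \<odot>\<^bsub>S\<^esub> \<alpha> = (\<sigma> \<ominus>\<^bsub>R\<^esub> \<rho>) \<odot>\<^bsub>S\<^esub> \<beta> \<oplus>\<^bsub>S\<^esub> \<rho> \<odot>\<^bsub>S\<^esub> (\<beta> \<ominus>\<^bsub>S\<^esub> \<alpha>)"
 using \<sigma>(1) \<beta>(1) \<rho> \<alpha>
 by (simp add: a_minus_def S.smult_l_distr S.smult_r_distr S.smult_l_minus S.smult_r_minus S.M.a_assoc S.M.r_neg1)
 then have "\<sigma> \<odot>\<^bsub>S\<^esub> \<beta> \<ominus>\<^bsub>S\<^esub> \<rho> \<odot>\<^bsub>S\<^esub> \<alpha> : N"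
 using S.submoduleE(4,5)[OF N_submodule] N_smult[OF \<sigma>(2) \<beta>(1)] \<beta>(2) \<rho> by simp
 then show ?thesis using fibre_class_eq_iff \<sigma> \<beta> \<rho> \<alpha> by simp
 qed
 have ne: "\<rho> : \<mm> +>\<^bsub>R\<^esub> \<rho>" "\<alpha> : fibre_class X x P \<alpha>"
 using residue_mem[OF \<rho>, of \<rho>] \<rho> fibre_class_mem[OF \<alpha>] \<alpha> by (auto simp: a_minus_def R.r_neg)
 have "(\<Union>\<beta>\<in>fibre_class X x P \<alpha>. fibre_class X x P (\<sigma> \<odot>\<^bsub>S\<^esub> \<beta>)) = fibre_class X x P (\<rho> \<odot>\<^bsub>S\<^esub> \<alpha>)" if "\<sigma> : \<mm> +>\<^bsub>R\<^esub> \<rho>" for \<sigma>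
 by (rule UN_constant_eq[OF ne(2)]) (use eq[OF that] in blast)
 then have "(\<Union>\<sigma>\<in>\<mm> +>\<^bsub>R\<^esub> \<rho>. \<Union>\<beta>\<in>fibre_class X x P \<alpha>. fibre_class X x P (\<sigma> \<odot>\<^bsub>S\<^esub> \<beta>)) = fibre_class X x P (\<rho> \<odot>\<^bsub>S\<^esub> \<alpha>)"
 by (intro UN_constant_eq[OF ne(1)]) blast
 then show ?thesis by (simp add: fibre_module_def Let_def)
qed

lemma Fib_carrier: "carrier (Fib P) = fibre_class X x P ` carrier S"
 unfolding Fib_quot quot_module_carrier[OF S_mod N_submodule] fibre_class_def by simp

lemma Fib_module: "module K (Fib P)"
proof -
 interpret S: module R S by (rule S_mod)
 interpret Q: module R "quot_module S N" by (rule quot_module_module[OF S_mod N_submodule])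
 have "abelian_group (Fib P)"
 proof (rule abelian_groupI, unfold Fib_quot)
 show "EX y:carrier (quot_module S N). y \<oplus>\<^bsub>quot_module S N\<^esub> z = \<zero>\<^bsub>quot_module S N\<^esub>" if "z : carrier (quot_module S N)" for z
 using that Q.M.l_neg by (intro bexI[of _ "\<ominus>\<^bsub>quot_module S N\<^esub> z"]) auto
 qed (simp_all add: Q.M.a_ac)
 then interpret F: abelian_group "Fib P" .
 have add: "fibre_class X x P \<alpha> \<oplus>\<^bsub>Fib P\<^esub> fibre_class X x P \<beta> = fibre_class X x P (\<alpha> \<oplus>\<^bsub>S\<^esub> \<beta>)"
 if "\<alpha> : carrier S" "\<beta> : carrier S" for \<alpha> \<beta>
 using quot_module_add[OF S_mod N_submodule that] by (simp add: Fib_quot fibre_class_def)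
 have Kc: "EX \<rho>:carrier R. \<kappa> = \<mm> +>\<^bsub>R\<^esub> \<rho>" if "\<kappa> : carrier K" for \<kappa>
 using that unfolding residue_field_def FactRing_def A_RCOSETS_defs a_r_coset_defs by auto
 note qa = ring_hom_add[OF quot_hom, symmetric] and qm = ring_hom_mult[OF quot_hom, symmetric] and q1 = ring_hom_one[OF quot_hom, symmetric]
 show ?thesis
 proof (rule moduleI)
 show "cring K" "abelian_group (Fib P)" by unfold_locales
 fix a y assume aK: "a : carrier K" and yF: "y : carrier (Fib P)"
 obtain \<rho> where a: "\<rho> : carrier R" "a = \<mm> +>\<^bsub>R\<^esub> \<rho>" using Kc[OF aK] by auto
 obtain \<alpha> where y: "\<alpha> : carrier S" "y = fibre_class X x P \<alpha>" using yF unfolding Fib_carrier by auto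
 show "a \<odot>\<^bsub>Fib P\<^esub> y : carrier (Fib P)" using a y by (auto simp: Fib_smult Fib_carrier)
 {
 fix b assume "b : carrier K"
 then obtain \<sigma> where b: "\<sigma> : carrier R" "b = \<mm> +>\<^bsub>R\<^esub> \<sigma>" using Kc by auto
 show "(a \<oplus>\<^bsub>K\<^esub> b) \<odot>\<^bsub>Fib P\<^esub> y = a \<odot>\<^bsub>Fib P\<^esub> y \<oplus>\<^bsub>Fib P\<^esub> b \<odot>\<^bsub>Fib P\<^esub> y"
  using a b y by (simp add: qa Fib_smult add S.smult_l_distr)
 show "(a \<otimes>\<^bsub>K\<^esub> b) \<odot>\<^bsub>Fib P\<^esub> y = a \<odot>\<^bsub>Fib P\<^esub> (b \<odot>\<^bsub>Fib P\<^esub> y)"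
  using a b y by (simp add: qm Fib_smult S.smult_assoc1)
 }
 fix z assume "z : carrier (Fib P)"
 then obtain \<beta> where z: "\<beta> : carrier S" "z = fibre_class X x P \<beta>" unfolding Fib_carrier by auto
 show "a \<odot>\<^bsub>Fib P\<^esub> (y \<oplus>\<^bsub>Fib P\<^esub> z) = a \<odot>\<^bsub>Fib P\<^esub> y \<oplus>\<^bsub>Fib P\<^esub> a \<odot>\<^bsub>Fib P\<^esub> z"
 using a y z by (simp add: Fib_smult add S.smult_r_distr)
 next
 fix y assume "y : carrier (Fib P)"
 then obtain \<alpha> where y: "\<alpha> : carrier S" "y = fibre_class X x P \<alpha>" unfolding Fib_carrier by auto
 show "\<one>\<^bsub>K\<^esub> \<odot>\<^bsub>Fib P\<^esub> y = y" using y by (simp add: q1 Fib_smult)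
 qed
qed

lemma ev:
 assumes U: "nbhd U"
 shows "s : carrier (sec P U) ==> ev P U s : carrier (Fib P)"
 and "s : carrier (sec P U) ==> s' : carrier (sec P U) ==> ev P U (s \<oplus>\<^bsub>sec P U\<^esub> s') = ev P U s \<oplus>\<^bsub>Fib P\<^esub> ev P U s'"
 and "r : (cO X U) ==> s : carrier (sec P U) ==> ev P U (r \<odot>\<^bsub>sec P U\<^esub> s) = evO U r \<odot>\<^bsub>Fib P\<^esub> ev P U s"
 and "ev P U \<zero>\<^bsub>sec P U\<^esub> = \<zero>\<^bsub>Fib P\<^esub>"
 and "s : carrier (sec P U) ==> s' : carrier (sec P U) ==> ev P U (s \<ominus>\<^bsub>sec P U\<^esub> s') = ev P U s \<ominus>\<^bsub>Fib P\<^esub> ev P U s'"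
 and "finite I ==> (!!i. i : I ==> g i : carrier (sec P U)) ==>
 ev P U (finsum (sec P U) g I) = finsum (Fib P) (%i. ev P U (g i)) I"
 and "opn X V ==> x : V ==> V \<subseteq> U ==> s : carrier (sec P U) ==> ev P V (res P U V s) = ev P U s"
proof -
 interpret F: module K "Fib P" by (rule Fib_module)
 have gc: "germ (pts X) P x U s : carrier S" if "s : carrier (sec P U)" for s
 using germ_in_germs[OF P_ps] U that by (simp add: stalk_module_simps(1)[OF X x P])
 show c: "s : carrier (sec P U) ==> ev P U s : carrier (Fib P)" for s
 using gc by (auto simp: ev_def Fib_carrier)
 show a: "s : carrier (sec P U) ==> s' : carrier (sec P U) ==> ev P U (s \<oplus>\<^bsub>sec P U\<^esub> s') = ev P U s \<oplus>\<^bsub>Fib P\<^esub> ev P U s'" for s s'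
 using quot_module_add[OF S_mod N_submodule gc gc] U stalk_module_simps(3)[OF X x P]
 by (simp add: ev_def Fib_quot fibre_class_def)
 show "r : (cO X U) ==> s : carrier (sec P U) ==> ev P U (r \<odot>\<^bsub>sec P U\<^esub> s) = evO U r \<odot>\<^bsub>Fib P\<^esub> ev P U s"
 using Fib_smult[OF germ_closed[OF U] gc] U stalk_module_simps(4)[OF X x P] by (simp add: ev_def evO_def)
 note g = presheafD(7)[OF P conjunct1[OF U]] F.M.abelian_group_axioms
 show "ev P U \<zero>\<^bsub>sec P U\<^esub> = \<zero>\<^bsub>Fib P\<^esub>" by (rule additive_map_zero[OF g c a])
 show "s : carrier (sec P U) ==> s' : carrier (sec P U) ==> ev P U (s \<ominus>\<^bsub>sec P U\<^esub> s') = ev P U s \<ominus>\<^bsub>Fib P\<^esub> ev P U s'"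
 by (rule additive_map_minus[OF g c a])
 show "finite I ==> (!!i. i : I ==> g i : carrier (sec P U)) ==>
 ev P U (finsum (sec P U) g I) = finsum (Fib P) (%i. ev P U (g i)) I"
 by (rule finsum_additive_map[OF g _ c a])
 show "opn X V ==> x : V ==> V \<subseteq> U ==> s : carrier (sec P U) ==> ev P V (res P U V s) = ev P U s"
 unfolding ev_def using germ_res[OF P_ps conjunct1[OF U]] by metis
qed

lemma ev_surj:
 assumes "y : carrier (Fib P)" and W: "nbhd W"
 obtains U s where "nbhd U" "U \<subseteq> W" "s : carrier (sec P U)" "y = ev P U s"
proof -
 obtain \<alpha> where \<alpha>: "\<alpha> : germs (pts X) P x" "y = fibre_class X x P \<alpha>"
 using assms(1) unfolding Fib_carrier stalk_module_simps(1)[OF X x P] by auto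
 obtain U s where "opn X U" "x : U" "U \<subseteq> W" "s : carrier (sec P U)" "\<alpha> = germ (pts X) P x U s"
 by (rule germs_within[OF P_ps \<alpha>(1) conjunct1[OF W] conjunct2[OF W]])
 then show ?thesis using that \<alpha>(2) by (auto simp: ev_def)
qed

end

end

context local_point
begin

text \<open>The representative exists on every smaller neighbourhood, so that several elements of
  fibres can be represented on a common one.\<close>

lemma ev_near:
 assumes P: "module_presheaf X P" and y: "y : carrier (Fib P)" and W: "nbhd W"
 obtains U where "nbhd U" "U \<subseteq> W" "!!V. nbhd V ==> V \<subseteq> U ==> EX s:carrier (sec P V). y = ev P V s"
proof -
 obtain U s where U: "nbhd U" "U \<subseteq> W" "s : carrier (sec P U)" "y = ev P U s"
 by (rule ev_surj[OF P y W])
 have "EX s:carrier (sec P V). y = ev P V s" if "nbhd V" "V \<subseteq> U" for V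
 using that U ev(7)[OF P U(1) _ _ that(2) U(3)] presheafD(2)[OF P _ _ that(2) U(3)]
 by (intro bexI[of _ "res P U V s"]) auto
 then show ?thesis using that U by blast
qed

lemma top_nbhd: "nbhd (topspace (pts X))"
 using x by simp

text \<open>The values of \<open>\<phi>\<close> on the basis lift to functions near
  \<open>x\<close>; the combination of the coordinate functionals with these functions as
  coefficients is the extension. It induces \<open>\<phi>\<close> at \<open>x\<close> because both
  sides are the same expression in the coordinates.\<close>

lemma lift_functional:
 assumes P: "module_presheaf X P" and U: "nbhd U" and e: "is_local_basis X P U n e"
 and \<phi>: "\<phi> : dual_sections (Spec_field K) (point_presheaf (Fib P)) UNIV"
 obtains W g where "nbhd W" "W \<subseteq> U" "g : dual_sections X P W"
 "!!V s. nbhd V ==> V \<subseteq> W ==> s : carrier (sec P V) ==> evO V (g V s) = \<phi> UNIV (ev P V s)"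
proof -
 have X0: "is_ringed_space (Spec_field K)" by (rule Spec_field_ringed_space[OF K.is_cring])
 have P0: "module_presheaf (Spec_field K) (point_presheaf (Fib P))"
 by (rule point_presheaf_module_presheaf[OF Fib_module[OF P]])
 have \<phi>D: "c : carrier (Fib P) ==> \<phi> UNIV c : carrier K"
 "c : carrier (Fib P) ==> r : carrier K ==> \<phi> UNIV (r \<odot>\<^bsub>Fib P\<^esub> c) = r \<otimes>\<^bsub>K\<^esub> \<phi> UNIV c"
 "finite I ==> (!!i. i : I ==> h i : carrier (Fib P)) ==> \<phi> UNIV (finsum (Fib P) h I) = finsum K (%i. \<phi> UNIV (h i)) I"
 for c r and I :: "nat set" and h
 using dualD(1)[OF X0 P0 \<phi>, of UNIV c] dualD(3)[OF X0 P0 \<phi>, of UNIV r c] dualD(7)[OF X0 P0 \<phi>, of UNIV I h]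
 by simp_all
 have ei: "e i : carrier (sec P U)" if "i < n" for i using e that by (simp add: is_local_basis_def)
 obtain \<gamma> where \<gamma>: "!!l. l < n ==> \<gamma> l : dual_sections X P U"
 and "!!V l i. opn X V ==> V \<subseteq> U ==> l < n ==> i < n ==>
 \<gamma> l V (res P U V (e i)) = (if i = l then \<one>\<^bsub>Osec X V\<^esub> else \<zero>\<^bsub>Osec X V\<^esub>)"
 and span: "!!V s y. opn X V ==> V \<subseteq> U ==> s : carrier (sec P V) ==> y : V ==>
 EX W. opn X W & y : W & W \<subseteq> V &
  res P V W s = finsum (sec P W) (%i. res (str X) V W (\<gamma> i V s) \<odot>\<^bsub>sec P W\<^esub> res P U W (e i)) {..<n}"
 by (rule local_coordinates[OF X P conjunct1[OF U] e]) (rule that)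
 have "EX W v. nbhd W & W \<subseteq> U & v : (cO X W) & \<phi> UNIV (ev P U (e l)) = evO W v" if "l < n" for l
 using evO_surj[OF \<phi>D(1)[OF ev(1)[OF P U ei[OF that]]] U] by metis
 then obtain Wl vl where Wl: "!!l. l < n ==> nbhd (Wl l) & Wl l \<subseteq> U & vl l : (cO X (Wl l)) & \<phi> UNIV (ev P U (e l)) = evO (Wl l) (vl l)"
 by metis
 define W where "W = \<Inter>(insert U (Wl ` {..<n}))"
 have W: "nbhd W" "W \<subseteq> U" "!!l. l < n ==> W \<subseteq> Wl l"
 proof -
 have "opn X W" unfolding W_def by (rule openin_Inter) (use Wl U in auto)
 then show "nbhd W" using Wl U by (auto simp: W_def)
 qed (use Wl in \<open>auto simp: W_def\<close>)
 define v where "v l = res (str X) (Wl l) W (vl l)" for l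
 have v: "v l : (cO X W)" "evO W (v l) = \<phi> UNIV (ev P U (e l))" if "l < n" for l
 using Wl[OF that] W that by (auto simp: v_def ringedD(3)[OF X] evO(8))
 note DW = dual_presheaf_module[OF X P]
 interpret D: module "Osec X W" "sec (dual_presheaf X P) W" by (rule presheafD(1)[OF DW conjunct1[OF W(1)]])
 define g where "g = finsum (sec (dual_presheaf X P) W) (%l. v l \<odot>\<^bsub>sec (dual_presheaf X P) W\<^esub> res (dual_presheaf X P) U W (\<gamma> l)) {..<n}"
 have t: "v l \<odot>\<^bsub>sec (dual_presheaf X P) W\<^esub> res (dual_presheaf X P) U W (\<gamma> l) : dual_sections X P W" if "l < n" for l
 using D.smult_closed[OF v(1)[OF that]] presheafD(2)[OF DW conjunct1[OF U] conjunct1[OF W(1)] W(2)] \<gamma>[OF that] by simp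
 have gc: "g : dual_sections X P W"
 unfolding g_def using D.M.finsum_closed[of "%l. v l \<odot>\<^bsub>sec (dual_presheaf X P) W\<^esub> res (dual_presheaf X P) U W (\<gamma> l)" "{..<n}"] t by auto
 have "evO V (g V s) = \<phi> UNIV (ev P V s)" if V: "nbhd V" "V \<subseteq> W" and s: "s : carrier (sec P V)" for V s
 proof -
 have VU: "V \<subseteq> U" using V W by auto
 have \<gamma>s: "\<gamma> l V s : (cO X V)" if "l < n" for l
 using dualD(1)[OF X P \<gamma>[OF that] _ VU s] V by simp
 have vV: "res (str X) W V (v l) : (cO X V)" "evO V (res (str X) W V (v l)) = evO W (v l)" if "l < n" for l
 using ringedD(3)[OF X _ _ V(2) v(1)[OF that]] evO(8)[OF W(1) _ _ V(2) v(1)[OF that]] V W by auto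
 interpret O: cring "Osec X V" using ringedD(2)[OF X] V by auto
 have "g V s = finsum (Osec X V) (%l. (v l \<odot>\<^bsub>sec (dual_presheaf X P) W\<^esub> res (dual_presheaf X P) U W (\<gamma> l)) V s) {..<n}"
 unfolding g_def using t V s by (intro dual_presheaf_finsum[OF X P conjunct1[OF W(1)]]) auto
 also have "\<dots> = finsum (Osec X V) (%l. res (str X) W V (v l) \<otimes>\<^bsub>Osec X V\<^esub> \<gamma> l V s) {..<n}"
 using V s W vV \<gamma>s by (intro O.add.finprod_cong') (auto simp: dual_presheaf_apply[OF X P])
 also have "evO V \<dots> = finsum K (%l. evO V (res (str X) W V (v l) \<otimes>\<^bsub>Osec X V\<^esub> \<gamma> l V s)) {..<n}"
 using vV \<gamma>s by (intro evO(7)[OF V(1)]) auto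
 also have "\<dots> = finsum K (%l. evO V (\<gamma> l V s) \<otimes>\<^bsub>K\<^esub> \<phi> UNIV (ev P U (e l))) {..<n}"
 using vV \<gamma>s evO(1)[OF V(1)] \<phi>D(1)[OF ev(1)[OF P U ei]]
 by (intro K.add.finprod_cong') (auto simp: evO(3)[OF V(1)] v(2) K.m_comm)
 finally have 1: "evO V (g V s) = finsum K (%l. evO V (\<gamma> l V s) \<otimes>\<^bsub>K\<^esub> \<phi> UNIV (ev P U (e l))) {..<n}" .
 \<comment> \<open>The section is a combination of the basis only near \<open>x\<close>; this
   suffices, as evaluation at \<open>x\<close> is unchanged by restriction.\<close>
 obtain W' where W': "opn X W'" "x : W'" "W' \<subseteq> V"
  "res P V W' s = finsum (sec P W') (%i. res (str X) V W' (\<gamma> i V s) \<odot>\<^bsub>sec P W'\<^esub> res P U W' (e i)) {..<n}"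
 using span[OF conjunct1[OF V(1)] VU s conjunct2[OF V(1)]] by blast
 have nW': "nbhd W'" using W' by simp
 have W'U: "W' \<subseteq> U" using W' VU by auto
 interpret M: module "Osec X W'" "sec P W'" by (rule presheafD(1)[OF P W'(1)])
 interpret F: module K "Fib P" by (rule Fib_module[OF P])
 have c: "res (str X) V W' (\<gamma> i V s) : (cO X W')" "res P U W' (e i) : carrier (sec P W')" if "i < n" for i
 using ringedD(3)[OF X conjunct1[OF V(1)] W'(1,3) \<gamma>s[OF that]] presheafD(2)[OF P conjunct1[OF U] W'(1) W'U ei[OF that]] by auto
 have "ev P V s = ev P W' (res P V W' s)" using ev(7)[OF P V(1) W'(1-3) s] by simp
 also have "\<dots> = finsum (Fib P) (%i. ev P W' (res (str X) V W' (\<gamma> i V s) \<odot>\<^bsub>sec P W'\<^esub> res P U W' (e i))) {..<n}"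
 unfolding W'(4) using c by (intro ev(6)[OF P nW']) auto
 also have "\<phi> UNIV \<dots> = finsum K (%i. \<phi> UNIV (ev P W' (res (str X) V W' (\<gamma> i V s) \<odot>\<^bsub>sec P W'\<^esub> res P U W' (e i)))) {..<n}"
 using c by (intro \<phi>D(3)) (auto intro!: ev(1)[OF P nW'])
 also have "\<dots> = finsum K (%l. evO V (\<gamma> l V s) \<otimes>\<^bsub>K\<^esub> \<phi> UNIV (ev P U (e l))) {..<n}"
 using c \<gamma>s evO(1)[OF V(1)] ev(1)[OF P U ei] \<phi>D(1) V nW' ei
 by (intro K.add.finprod_cong')
  (auto simp: ev(3)[OF P nW'] \<phi>D(2) evO(8)[OF V(1) W'(1-3)] ev(7)[OF P U W'(1,2) W'U])
 finally show ?thesis using 1 by simp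
 qed
 then show ?thesis using that[OF W(1,2) gc] by blast
qed

end

section \<open>The graded action on the fibre\<close>

locale local_system = local_point X x + gs: graded_system X A M
 for X :: "('x, 'r) ringed_space" and x :: 'x and A :: "('x, 'r, 'a) gralg" and M :: "('x, 'r, 'a, 'm) grmod"
begin

abbreviation "SA p \<equiv> stalk_module X (piece A p) x"
abbreviation "SM p \<equiv> stalk_module X (piece M p) x"
definition "sact p q = germ_op (pts X) (piece A p) (piece M q) (piece M (p + q)) x (%U. act M U p q)"

lemma ps: "is_presheaf (pts X) (piece A p)" "is_presheaf (pts X) (piece M p)"
 by (rule module_presheaf_is_presheaf[OF gs.A] module_presheaf_is_presheaf[OF gs.M])+

lemma sact_germ:
 assumes "nbhd U" "a : (csec A p U)" "s : (csec M q U)"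
 shows "sact p q (germ (pts X) (piece A p) x U a) (germ (pts X) (piece M q) x U s) = germ (pts X) (piece M (p + q)) x U (act M U p q a s)"
 unfolding sact_def
 by (rule germ_op_germ[OF ps(1) ps(2) ps(2)]) (use assms gs.act_closed gs.act_res in auto)

lemma stalk_carrier: "carrier (SA p) = germs (pts X) (piece A p) x" "carrier (SM p) = germs (pts X) (piece M p) x"
 by (rule stalk_module_simps(1)[OF X x gs.A] stalk_module_simps(1)[OF X x gs.M])+

lemma sact_props:
 shows "\<alpha> : carrier (SA p) ==> \<beta> : carrier (SM q) ==> sact p q \<alpha> \<beta> : carrier (SM (p + q))"
 and "\<alpha> : carrier (SA p) ==> \<alpha>' : carrier (SA p) ==> \<beta> : carrier (SM q) ==>
 sact p q (\<alpha> \<oplus>\<^bsub>SA p\<^esub> \<alpha>') \<beta> = sact p q \<alpha> \<beta> \<oplus>\<^bsub>SM (p + q)\<^esub> sact p q \<alpha>' \<beta>"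
 and "\<alpha> : carrier (SA p) ==> \<beta> : carrier (SM q) ==> \<beta>' : carrier (SM q) ==>
 sact p q \<alpha> (\<beta> \<oplus>\<^bsub>SM q\<^esub> \<beta>') = sact p q \<alpha> \<beta> \<oplus>\<^bsub>SM (p + q)\<^esub> sact p q \<alpha> \<beta>'"
 and "\<rho> : carrier R ==> \<alpha> : carrier (SA p) ==> \<beta> : carrier (SM q) ==>
 sact p q (\<rho> \<odot>\<^bsub>SA p\<^esub> \<alpha>) \<beta> = \<rho> \<odot>\<^bsub>SM (p + q)\<^esub> sact p q \<alpha> \<beta>"
 and "\<rho> : carrier R ==> \<alpha> : carrier (SA p) ==> \<beta> : carrier (SM q) ==>
 sact p q \<alpha> (\<rho> \<odot>\<^bsub>SM q\<^esub> \<beta>) = \<rho> \<odot>\<^bsub>SM (p + q)\<^esub> sact p q \<alpha> \<beta>"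
proof -
 note sA = stalk_module_simps(3,4)[OF X x gs.A] and sM = stalk_module_simps(3,4)[OF X x gs.M] and sR = stalk_ring_simps(1)[OF X x]
 note cl = module.smult_closed[OF presheafD(1)[OF gs.A]] module.smult_closed[OF presheafD(1)[OF gs.M]]
 abelian_monoid.a_closed[OF abelian_group.axioms(1)[OF presheafD(7)[OF gs.A]]]
 abelian_monoid.a_closed[OF abelian_group.axioms(1)[OF presheafD(7)[OF gs.M]]]
 {
 assume "\<alpha> : carrier (SA p)" "\<beta> : carrier (SM q)"
 then obtain W s t where "opn X W" "x : W" "s : (csec A p W)" "t : (csec M q W)"
 "\<alpha> = germ (pts X) (piece A p) x W s" "\<beta> = germ (pts X) (piece M q) x W t"
 using germs_common[OF ps(1) ps(2)] unfolding stalk_carrier by metis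
 then show "sact p q \<alpha> \<beta> : carrier (SM (p + q))"
 by (auto simp: sact_germ stalk_carrier intro!: germ_in_germs[OF ps(2)] gs.act_closed)
 }
 {
 assume "\<alpha> : carrier (SA p)" "\<alpha>' : carrier (SA p)" "\<beta> : carrier (SM q)"
 then obtain W s s' t where "opn X W" "x : W" "s : (csec A p W)" "s' : (csec A p W)" "t : (csec M q W)"
 "\<alpha> = germ (pts X) (piece A p) x W s" "\<alpha>' = germ (pts X) (piece A p) x W s'" "\<beta> = germ (pts X) (piece M q) x W t"
 using germs_common3[OF ps(1) ps(1) ps(2)] unfolding stalk_carrier by metis
 then show "sact p q (\<alpha> \<oplus>\<^bsub>SA p\<^esub> \<alpha>') \<beta> = sact p q \<alpha> \<beta> \<oplus>\<^bsub>SM (p + q)\<^esub> sact p q \<alpha>' \<beta>"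
 by (simp add: sA sM sact_germ gs.act_closed gs.act_add_left cl)
 }
 {
 assume "\<alpha> : carrier (SA p)" "\<beta> : carrier (SM q)" "\<beta>' : carrier (SM q)"
 then obtain W s t t' where "opn X W" "x : W" "s : (csec A p W)" "t : (csec M q W)" "t' : (csec M q W)"
 "\<alpha> = germ (pts X) (piece A p) x W s" "\<beta> = germ (pts X) (piece M q) x W t" "\<beta>' = germ (pts X) (piece M q) x W t'"
 using germs_common3[OF ps(1) ps(2) ps(2)] unfolding stalk_carrier by metis
 then show "sact p q \<alpha> (\<beta> \<oplus>\<^bsub>SM q\<^esub> \<beta>') = sact p q \<alpha> \<beta> \<oplus>\<^bsub>SM (p + q)\<^esub> sact p q \<alpha> \<beta>'"
 by (simp add: sA sM sact_germ gs.act_closed gs.act_add_right cl)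
 }
 assume "\<rho> : carrier R" "\<alpha> : carrier (SA p)" "\<beta> : carrier (SM q)"
 then obtain W r s t where "opn X W" "x : W" "r : (cO X W)" "s : (csec A p W)" "t : (csec M q W)"
 "\<rho> = germ (pts X) (str X) x W r" "\<alpha> = germ (pts X) (piece A p) x W s" "\<beta> = germ (pts X) (piece M q) x W t"
 using germs_common3[OF O_ps ps(1) ps(2)] unfolding stalk_carrier sR by metis
 then show "sact p q (\<rho> \<odot>\<^bsub>SA p\<^esub> \<alpha>) \<beta> = \<rho> \<odot>\<^bsub>SM (p + q)\<^esub> sact p q \<alpha> \<beta>"
 "sact p q \<alpha> (\<rho> \<odot>\<^bsub>SM q\<^esub> \<beta>) = \<rho> \<odot>\<^bsub>SM (p + q)\<^esub> sact p q \<alpha> \<beta>"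
 by (simp_all add: sA sM sact_germ gs.act_closed gs.act_smult_left gs.act_smult_right cl)
qed

lemma submodule_preimage:
 assumes M1: "module R M1" and M2: "module R M2" and N: "submodule N R M2"
 and h: "!!s. s : carrier M1 ==> h s : carrier M2"
 and add: "!!s t. s : carrier M1 ==> t : carrier M1 ==> h (s \<oplus>\<^bsub>M1\<^esub> t) = h s \<oplus>\<^bsub>M2\<^esub> h t"
 and smult: "!!r s. r : carrier R ==> s : carrier M1 ==> h (r \<odot>\<^bsub>M1\<^esub> s) = r \<odot>\<^bsub>M2\<^esub> h s"
 shows "submodule {s\<in>carrier M1. h s : N} R M1"
proof -
 interpret M1: module R M1 by fact
 interpret M2: module R M2 by fact
 have z: "h \<zero>\<^bsub>M1\<^esub> = \<zero>\<^bsub>M2\<^esub>" by (rule additive_map_zero[OF M1.M.abelian_group_axioms M2.M.abelian_group_axioms h add])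
 show ?thesis
 proof (rule M1.submoduleI)
 fix s assume "s : {s\<in>carrier M1. h s : N}"
 moreover have "h (\<ominus>\<^bsub>M1\<^esub> s) = \<ominus>\<^bsub>M2\<^esub> h s" if "s : carrier M1"
 using additive_map_minus[OF M1.M.abelian_group_axioms M2.M.abelian_group_axioms h add, of "\<zero>\<^bsub>M1\<^esub>" s] that h
 by (simp add: z a_minus_def)
 ultimately show "\<ominus>\<^bsub>M1\<^esub> s : {s\<in>carrier M1. h s : N}" using M2.submoduleE(3)[OF N] by auto
 qed (use M2.submoduleE(4,5)[OF N] submodule_zero_closed[OF N] in \<open>auto simp: z add smult\<close>)
qed

abbreviation "NA p \<equiv> max_ideal_times_stalk X x (piece A p)"
abbreviation "NM p \<equiv> max_ideal_times_stalk X x (piece M p)"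

text \<open>The elements that multiply \<open>\<beta>\<close> into \<open>NM (p + q)\<close> form a
  submodule containing all products with \<open>\<mm>\<close>, and \<open>NA p\<close> is the least
  such submodule.\<close>

lemma sact_left_in:
 assumes \<beta>: "\<beta> : carrier (SM q)"
 shows "\<alpha> : NA p ==> sact p q \<alpha> \<beta> : NM (p + q)"
proof -
 interpret MM: maximalideal \<mm> R by (rule \<mm>)
 have "NA p \<subseteq> {\<alpha>\<in>carrier (SA p). sact p q \<alpha> \<beta> : NM (p + q)}"
 proof (rule N_least[OF gs.A])
 show "submodule {\<alpha>\<in>carrier (SA p). sact p q \<alpha> \<beta> : NM (p + q)} R (SA p)"
 by (rule submodule_preimage[OF S_mod[OF gs.A] S_mod[OF gs.M] N_submodule[OF gs.M]])
  (use \<beta> in \<open>auto simp: sact_props\<close>)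
 show "r \<odot>\<^bsub>SA p\<^esub> s : {\<alpha>\<in>carrier (SA p). sact p q \<alpha> \<beta> : NM (p + q)}" if "r : \<mm>" "s : carrier (SA p)" for r s
 using that \<beta> MM.a_Hcarr[OF that(1)] N_smult[OF gs.M that(1)] module.smult_closed[OF S_mod[OF gs.A]]
 by (auto simp: sact_props)
 qed
 then show "\<alpha> : NA p ==> sact p q \<alpha> \<beta> : NM (p + q)" by blast
qed

lemma sact_right_in:
 assumes \<alpha>: "\<alpha> : carrier (SA p)"
 shows "\<beta> : NM q ==> sact p q \<alpha> \<beta> : NM (p + q)"
proof -
 interpret MM: maximalideal \<mm> R by (rule \<mm>)
 have "NM q \<subseteq> {\<beta>\<in>carrier (SM q). sact p q \<alpha> \<beta> : NM (p + q)}"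
 proof (rule N_least[OF gs.M])
 show "submodule {\<beta>\<in>carrier (SM q). sact p q \<alpha> \<beta> : NM (p + q)} R (SM q)"
 by (rule submodule_preimage[OF S_mod[OF gs.M] S_mod[OF gs.M] N_submodule[OF gs.M]])
  (use \<alpha> in \<open>auto simp: sact_props\<close>)
 show "r \<odot>\<^bsub>SM q\<^esub> s : {\<beta>\<in>carrier (SM q). sact p q \<alpha> \<beta> : NM (p + q)}" if "r : \<mm>" "s : carrier (SM q)" for r s
 using that \<alpha> MM.a_Hcarr[OF that(1)] N_smult[OF gs.M that(1)] module.smult_closed[OF S_mod[OF gs.M]]
 by (auto simp: sact_props)
 qed
 then show "\<beta> : NM q ==> sact p q \<alpha> \<beta> : NM (p + q)" by blast
qed

text \<open>Replacing one factor by another representative changes the product by an element of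
  \<open>NM (p + q)\<close>, by \<open>sact_left_in\<close> and \<open>sact_right_in\<close>. Hence
  the union defining the fibre action is the single class of the product of the given
  sections.\<close>

lemma fibre_act_ev:
 assumes U: "nbhd U" and a: "a : (csec A p U)" and s: "s : (csec M q U)"
 shows "fibre_act X x A M Z p q (ev (piece A p) U a) (ev (piece M q) U s) = ev (piece M (p + q)) U (act M U p q a s)"
proof -
 let ?\<alpha> = "germ (pts X) (piece A p) x U a" and ?\<beta> = "germ (pts X) (piece M q) x U s"
 have \<alpha>: "?\<alpha> : carrier (SA p)" and \<beta>: "?\<beta> : carrier (SM q)"
 using germ_in_germs[OF ps(1)] germ_in_germs[OF ps(2)] U a s by (auto simp: stalk_carrier)
 interpret SA: module R "SA p" by (rule S_mod[OF gs.A])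
 interpret SM: module R "SM q" by (rule S_mod[OF gs.M])
 interpret SMpq: module R "SM (p + q)" by (rule S_mod[OF gs.M])
 have eq: "fibre_class X x (piece M (p + q)) (sact p q \<alpha>' \<beta>') = fibre_class X x (piece M (p + q)) (sact p q ?\<alpha> ?\<beta>)"
 if "\<alpha>' : ev (piece A p) U a" "\<beta>' : ev (piece M q) U s" for \<alpha>' \<beta>'
 proof -
 have \<alpha>': "\<alpha>' : carrier (SA p)" "\<alpha>' \<ominus>\<^bsub>SA p\<^esub> ?\<alpha> : NA p"
 using fibre_class_mem[OF gs.A \<alpha>] fibre_class_eq_iff[OF gs.A _ \<alpha>] that(1) unfolding ev_def by auto
 have \<beta>': "\<beta>' : carrier (SM q)" "\<beta>' \<ominus>\<^bsub>SM q\<^esub> ?\<beta> : NM q"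
 using fibre_class_mem[OF gs.M \<beta>] fibre_class_eq_iff[OF gs.M _ \<beta>] that(2) unfolding ev_def by auto
 have "sact p q \<alpha>' \<beta>' = sact p q (\<alpha>' \<ominus>\<^bsub>SA p\<^esub> ?\<alpha>) \<beta>' \<oplus>\<^bsub>SM (p + q)\<^esub> sact p q ?\<alpha> \<beta>'"
 using sact_props(2)[of "\<alpha>' \<ominus>\<^bsub>SA p\<^esub> ?\<alpha>" p ?\<alpha> \<beta>' q] \<alpha>' \<beta>' \<alpha> by (simp add: SA.M.minus_add_cancel)
 moreover have "sact p q ?\<alpha> \<beta>' = sact p q ?\<alpha> (\<beta>' \<ominus>\<^bsub>SM q\<^esub> ?\<beta>) \<oplus>\<^bsub>SM (p + q)\<^esub> sact p q ?\<alpha> ?\<beta>"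
 using sact_props(3)[of ?\<alpha> p "\<beta>' \<ominus>\<^bsub>SM q\<^esub> ?\<beta>" q ?\<beta>] \<beta>' \<beta> \<alpha> by (simp add: SM.M.minus_add_cancel)
 moreover have n: "sact p q (\<alpha>' \<ominus>\<^bsub>SA p\<^esub> ?\<alpha>) \<beta>' : NM (p + q)" "sact p q ?\<alpha> (\<beta>' \<ominus>\<^bsub>SM q\<^esub> ?\<beta>) : NM (p + q)"
 using sact_left_in[OF \<beta>'(1) \<alpha>'(2)] sact_right_in[OF \<alpha> \<beta>'(2)] by auto
 moreover have c: "sact p q (\<alpha>' \<ominus>\<^bsub>SA p\<^esub> ?\<alpha>) \<beta>' : carrier (SM (p + q))" "sact p q ?\<alpha> (\<beta>' \<ominus>\<^bsub>SM q\<^esub> ?\<beta>) : carrier (SM (p + q))"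
 "sact p q ?\<alpha> ?\<beta> : carrier (SM (p + q))" "sact p q \<alpha>' \<beta>' : carrier (SM (p + q))"
 using \<alpha> \<beta> \<alpha>' \<beta>' by (auto intro!: sact_props)
 ultimately have "sact p q \<alpha>' \<beta>' \<ominus>\<^bsub>SM (p + q)\<^esub> sact p q ?\<alpha> ?\<beta> = sact p q (\<alpha>' \<ominus>\<^bsub>SA p\<^esub> ?\<alpha>) \<beta>' \<oplus>\<^bsub>SM (p + q)\<^esub> sact p q ?\<alpha> (\<beta>' \<ominus>\<^bsub>SM q\<^esub> ?\<beta>)"
 by (simp add: a_minus_def SMpq.M.a_assoc SMpq.M.r_neg)
 then show ?thesis
 using fibre_class_eq_iff[OF gs.M c(4,3)] SMpq.submoduleE(5)[OF N_submodule[OF gs.M] n] by simp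
 qed
 have ne: "?\<alpha> : ev (piece A p) U a" "?\<beta> : ev (piece M q) U s"
 unfolding ev_def using fibre_class_mem[OF gs.A \<alpha>] fibre_class_mem[OF gs.M \<beta>] \<alpha> \<beta> by auto
 let ?c = "fibre_class X x (piece M (p + q)) (sact p q ?\<alpha> ?\<beta>)"
 have "(\<Union>\<beta>'\<in>ev (piece M q) U s. fibre_class X x (piece M (p + q)) (sact p q \<alpha>' \<beta>')) = ?c" if "\<alpha>' : ev (piece A p) U a" for \<alpha>'
 by (rule UN_constant_eq[OF ne(2)]) (use eq[OF that] in blast)
 then have "(\<Union>\<alpha>'\<in>ev (piece A p) U a. \<Union>\<beta>'\<in>ev (piece M q) U s. fibre_class X x (piece M (p + q)) (sact p q \<alpha>' \<beta>')) = ?c"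
 by (intro UN_constant_eq[OF ne(1)]) blast
 then show ?thesis
 using sact_germ[OF U a s] by (simp add: fibre_act_def sact_def ev_def)
qed

end

text \<open>The algebra is also considered as a module over itself. Its record type extends that of
  graded modules by the unit, which \<open>grmod.truncate\<close> forgets, so that the results on
  the action apply to multiplication too.\<close>

locale local_algebra = local_system X x A M + As: local_system X x A "grmod.truncate A"
 for X :: "('x, 'r) ringed_space" and x :: 'x and A :: "('x, 'r, 'a) gralg" and M :: "('x, 'r, 'a, 'm) grmod" +
 assumes unit_res: "opn X V ==> res (piece A 0) (topspace (pts X)) V (unit A (topspace (pts X))) = unit A V"
begin

abbreviation "X0 \<equiv> Spec_field K"
abbreviation "A0 \<equiv> fibre_gralg X x A"
abbreviation "M0 \<equiv> fibre_grmod X x A M"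

lemma fibre_act_A_ev:
 "nbhd U ==> a : (csec A p U) ==> a' : (csec A q U) ==>
 fibre_act X x A A Z p q (ev (piece A p) U a) (ev (piece A q) U a') = ev (piece A (p + q)) U (act A U p q a a')"
 using As.fibre_act_ev[of U a p a' q Z] by (simp add: fibre_act_def grmod.truncate_def)

lemma fibre_simps:
 "piece A0 p = point_presheaf (Fib (piece A p))" "piece M0 p = point_presheaf (Fib (piece M p))"
 "act A0 = fibre_act X x A A" "act M0 = fibre_act X x A M"
 by (simp_all add: fibre_gralg_def fibre_grmod_def)

lemma point_carrierD: "s : carrier (sec (point_presheaf F) U) ==> U = {} & s = \<zero>\<^bsub>F\<^esub> \<or> U = UNIV & s : carrier F"
 using unit_set_cases[of U] by auto

lemma fibre_reps2:
 assumes a: "a : carrier (Fib (piece A p))" and s: "s : carrier (Fib (piece M q))"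
 obtains U a' s' where "nbhd U" "a' : (csec A p U)" "s' : (csec M q U)"
 "a = ev (piece A p) U a'" "s = ev (piece M q) U s'"
proof -
 obtain U where U: "nbhd U" "U \<subseteq> topspace (pts X)" "!!V. nbhd V ==> V \<subseteq> U ==> EX s:(csec A p V). a = ev (piece A p) V s"
 by (rule ev_near[OF gs.A a top_nbhd]) (rule that)
 obtain V where V: "nbhd V" "V \<subseteq> U" "!!W. nbhd W ==> W \<subseteq> V ==> EX s':(csec M q W). s = ev (piece M q) W s'"
 by (rule ev_near[OF gs.M s U(1)]) (rule that)
 obtain s' where "s' : (csec M q V)" "s = ev (piece M q) V s'" using V by blast
 moreover obtain a' where "a' : (csec A p V)" "a = ev (piece A p) V a'" using U(3) V by blast
 ultimately show ?thesis using that V(1) by blast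
qed

lemma zero_in_Fib: "module_presheaf X P ==> \<zero>\<^bsub>Fib P\<^esub> : carrier (Fib P)"
 using module.axioms(2)[OF Fib_module, of P] abelian_group.axioms(1) abelian_monoid.zero_closed by blast

lemma fibre_act_zero:
 "fibre_act X x A M Z p q \<zero>\<^bsub>Fib (piece A p)\<^esub> \<zero>\<^bsub>Fib (piece M q)\<^esub> = \<zero>\<^bsub>Fib (piece M (p + q))\<^esub>"
 "fibre_act X x A A Z p q \<zero>\<^bsub>Fib (piece A p)\<^esub> \<zero>\<^bsub>Fib (piece A q)\<^esub> = \<zero>\<^bsub>Fib (piece A (p + q))\<^esub>"
proof -
 let ?T = "topspace (pts X)"
 have T: "opn X ?T" by simp
 have z: "\<zero>\<^bsub>gsec A p ?T\<^esub> : (csec A p ?T)" "\<zero>\<^bsub>gsec M q ?T\<^esub> : (csec M q ?T)" for p q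
 using presheafD(7)[OF gs.A T] presheafD(7)[OF gs.M T] abelian_group.axioms(1) abelian_monoid.zero_closed by blast+
 show "fibre_act X x A M Z p q \<zero>\<^bsub>Fib (piece A p)\<^esub> \<zero>\<^bsub>Fib (piece M q)\<^esub> = \<zero>\<^bsub>Fib (piece M (p + q))\<^esub>"
 using fibre_act_ev[OF top_nbhd z, where p = p and q = q and Z = Z] gs.act_zero_left[OF T z(2)]
 ev(4)[OF gs.A top_nbhd] ev(4)[OF gs.M top_nbhd] by simp
 have "act A ?T p q \<zero>\<^bsub>gsec A p ?T\<^esub> \<zero>\<^bsub>gsec A q ?T\<^esub> = \<zero>\<^bsub>gsec A (p + q) ?T\<^esub>"
 using As.gs.act_zero_left[OF T, of "\<zero>\<^bsub>gsec A q ?T\<^esub>" q p] z by (simp add: grmod.truncate_def)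
 then show "fibre_act X x A A Z p q \<zero>\<^bsub>Fib (piece A p)\<^esub> \<zero>\<^bsub>Fib (piece A q)\<^esub> = \<zero>\<^bsub>Fib (piece A (p + q))\<^esub>"
 using fibre_act_A_ev[OF top_nbhd z(1) z(1), where p = p and q = q and Z = Z]
 ev(4)[OF gs.A top_nbhd] by simp
qed

lemma fibre_act_closed:
 assumes a: "a : carrier (Fib (piece A p))"
 shows "s : carrier (Fib (piece M q)) ==> fibre_act X x A M Z p q a s : carrier (Fib (piece M (p + q)))"
 and "a' : carrier (Fib (piece A q)) ==> fibre_act X x A A Z p q a a' : carrier (Fib (piece A (p + q)))"
proof -
 assume "s : carrier (Fib (piece M q))"
 from a this obtain U a' s' where "nbhd U" "a' : (csec A p U)" "s' : (csec M q U)"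
 "a = ev (piece A p) U a'" "s = ev (piece M q) U s'" by (rule fibre_reps2)
 then show "fibre_act X x A M Z p q a s : carrier (Fib (piece M (p + q)))"
 by (auto simp: fibre_act_ev intro!: ev(1)[OF gs.M] gs.act_closed)
next
 assume a': "a' : carrier (Fib (piece A q))"
 obtain U where U: "nbhd U" "U \<subseteq> topspace (pts X)" "!!V. nbhd V ==> V \<subseteq> U ==> EX s:(csec A p V). a = ev (piece A p) V s"
 by (rule ev_near[OF gs.A a top_nbhd]) (rule that)
 obtain V where V: "nbhd V" "V \<subseteq> U" "!!W. nbhd W ==> W \<subseteq> V ==> EX s':(csec A q W). a' = ev (piece A q) W s'"
 by (rule ev_near[OF gs.A a' U(1)]) (rule that)
 obtain s where "s : (csec A p V)" "a = ev (piece A p) V s" using U(3) V(1,2) by blast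
 moreover obtain s' where "s' : (csec A q V)" "a' = ev (piece A q) V s'" using V by blast
 ultimately show "fibre_act X x A A Z p q a a' : carrier (Fib (piece A (p + q)))"
 using V(1) by (auto simp: fibre_act_A_ev intro!: ev(1)[OF gs.A] gs.A_act_closed)
qed

lemma unit_fibre: "unit A0 U = (if U = {} then \<zero>\<^bsub>Fib (piece A 0)\<^esub> else ev (piece A 0) (topspace (pts X)) (unit A (topspace (pts X))))"
 by (simp add: fibre_gralg_def ev_def)

text \<open>Each law is verified on representatives over a common neighbourhood of \<open>x\<close>.
  Over the empty set the point presheaf contains only zero, and there the laws reduce to the
  products of zeros computed before.\<close>

lemma fibre_system: "graded_system X0 A0 M0"
proof (unfold_locales, unfold fibre_simps)
 note KX = Spec_field_ringed_space[OF K.is_cring]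
 note cl = module.smult_closed[OF presheafD(1)[OF gs.A]] module.smult_closed[OF presheafD(1)[OF gs.M]]
 abelian_monoid.a_closed[OF abelian_group.axioms(1)[OF presheafD(7)[OF gs.A]]]
 abelian_monoid.a_closed[OF abelian_group.axioms(1)[OF presheafD(7)[OF gs.M]]]
 show "is_ringed_space X0" by (rule KX)
 show "module_presheaf X0 (point_presheaf (Fib (piece A p)))" for p by (rule point_presheaf_module_presheaf[OF Fib_module[OF gs.A]])
 show "module_presheaf X0 (point_presheaf (Fib (piece M p)))" for p by (rule point_presheaf_module_presheaf[OF Fib_module[OF gs.M]])
 fix U :: "unit set"
 have ops: "s \<oplus>\<^bsub>sec (point_presheaf F) U\<^esub> t = s \<oplus>\<^bsub>F\<^esub> t" "r \<odot>\<^bsub>sec (point_presheaf F) U\<^esub> s = r \<odot>\<^bsub>F\<^esub> s"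
 for F :: "('k, 'l) module" and s t r using unit_set_cases[of U] by auto
 have inF: "s : carrier (Fib P)" if "s : carrier (sec (point_presheaf (Fib P)) U)" "module_presheaf X P" for s and P :: "('x, 'r, 'l) mod_presheaf"
 using point_carrierD[OF that(1)] zero_in_Fib[OF that(2)] by auto
 have inK: "r : carrier K" if "r : (cO X0 U)" for r
 using that unit_set_cases[of U] by auto
 have unitc: "unit A (topspace (pts X)) : (csec A 0 (topspace (pts X)))" by (rule gs.unit_closed) simp
 show "unit A0 U : carrier (sec (point_presheaf (Fib (piece A 0))) U)"
 using unit_set_cases[of U] ev(1)[OF gs.A top_nbhd unitc] by (auto simp: unit_fibre)
 show "carrier (sec (point_presheaf (Fib (piece A p))) U) = {\<zero>\<^bsub>sec (point_presheaf (Fib (piece A p))) U\<^esub>}" if p: "p < 0" for p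
 proof -
 have "y = \<zero>\<^bsub>Fib (piece A p)\<^esub>" if y: "y : carrier (Fib (piece A p))" for y
 proof -
 obtain V s where "nbhd V" "V \<subseteq> topspace (pts X)" "s : (csec A p V)" "y = ev (piece A p) V s"
  by (rule ev_surj[OF gs.A y top_nbhd])
 then show ?thesis using gs.A_negative[of V p] p ev(4)[OF gs.A, of V] by auto
 qed
 then show ?thesis using unit_set_cases[of U] zero_in_Fib[OF gs.A] by auto
 qed
 fix p a assume a: "a : carrier (sec (point_presheaf (Fib (piece A p))) U)"
 {
 fix q a' assume a': "a' : carrier (sec (point_presheaf (Fib (piece A q))) U)"
 show "fibre_act X x A A U p q a a' : carrier (sec (point_presheaf (Fib (piece A (p + q)))) U)"
 using point_carrierD[OF a] point_carrierD[OF a'] fibre_act_zero(2) fibre_act_closed(2)[of a p a' q] by auto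
 }
 fix q s assume s: "s : carrier (sec (point_presheaf (Fib (piece M q))) U)"
 show "fibre_act X x A M U p q a s : carrier (sec (point_presheaf (Fib (piece M (p + q)))) U)"
 using point_carrierD[OF a] point_carrierD[OF s] fibre_act_zero(1) fibre_act_closed(1)[of a p s q] by auto
 note aF = inF[OF a gs.A] and sF = inF[OF s gs.M]
 obtain U1 where U1: "nbhd U1" "U1 \<subseteq> topspace (pts X)" "!!V. nbhd V ==> V \<subseteq> U1 ==> EX s:(csec A p V). a = ev (piece A p) V s"
 by (rule ev_near[OF gs.A aF top_nbhd]) (rule that)
 obtain U2 where U2: "nbhd U2" "U2 \<subseteq> U1" "!!V. nbhd V ==> V \<subseteq> U2 ==> EX s':(csec M q V). s = ev (piece M q) V s'"
 by (rule ev_near[OF gs.M sF U1(1)]) (rule that)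
 {
 fix a' assume a': "a' : carrier (sec (point_presheaf (Fib (piece A p))) U)"
 obtain U3 where U3: "nbhd U3" "U3 \<subseteq> U2" "!!V. nbhd V ==> V \<subseteq> U3 ==> EX s':(csec A p V). a' = ev (piece A p) V s'"
 by (rule ev_near[OF gs.A inF[OF a' gs.A] U2(1)]) (rule that)
 obtain a1 a1' s1 where "a1 : (csec A p U3)" "a = ev (piece A p) U3 a1"
 "a1' : (csec A p U3)" "a' = ev (piece A p) U3 a1'" "s1 : (csec M q U3)" "s = ev (piece M q) U3 s1"
 using U1(3)[OF U3(1) order_trans[OF U3(2) U2(2)]] U2(3)[OF U3(1,2)] U3(3)[OF U3(1) order_refl] by blast
 then show "fibre_act X x A M U p q (a \<oplus>\<^bsub>sec (point_presheaf (Fib (piece A p))) U\<^esub> a') s =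
 fibre_act X x A M U p q a s \<oplus>\<^bsub>sec (point_presheaf (Fib (piece M (p + q)))) U\<^esub> fibre_act X x A M U p q a' s"
 using U3(1) by (simp add: ops ev(2)[OF gs.A, symmetric] ev(2)[OF gs.M, symmetric] fibre_act_ev cl gs.act_closed gs.act_add_left)
 }
 {
 fix s' assume s': "s' : carrier (sec (point_presheaf (Fib (piece M q))) U)"
 obtain U3 where U3: "nbhd U3" "U3 \<subseteq> U2" "!!V. nbhd V ==> V \<subseteq> U3 ==> EX t:(csec M q V). s' = ev (piece M q) V t"
 by (rule ev_near[OF gs.M inF[OF s' gs.M] U2(1)]) (rule that)
 obtain a1 s1' s1 where "a1 : (csec A p U3)" "a = ev (piece A p) U3 a1"
 "s1' : (csec M q U3)" "s' = ev (piece M q) U3 s1'" "s1 : (csec M q U3)" "s = ev (piece M q) U3 s1"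
 using U1(3)[OF U3(1) order_trans[OF U3(2) U2(2)]] U2(3)[OF U3(1,2)] U3(3)[OF U3(1) order_refl] by blast
 then show "fibre_act X x A M U p q a (s \<oplus>\<^bsub>sec (point_presheaf (Fib (piece M q))) U\<^esub> s') =
 fibre_act X x A M U p q a s \<oplus>\<^bsub>sec (point_presheaf (Fib (piece M (p + q)))) U\<^esub> fibre_act X x A M U p q a s'"
 using U3(1) by (simp add: ops ev(2)[OF gs.M, symmetric] fibre_act_ev cl gs.act_closed gs.act_add_right)
 }
 {
 fix r assume r: "r : (cO X0 U)"
 obtain U3 r1 where U3: "nbhd U3" "U3 \<subseteq> U2" "r1 : (cO X U3)" "r = evO U3 r1"
 by (rule evO_surj[OF inK[OF r] U2(1)])
 obtain a1 s1 where "a1 : (csec A p U3)" "a = ev (piece A p) U3 a1"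
 "s1 : (csec M q U3)" "s = ev (piece M q) U3 s1"
 using U1(3)[OF U3(1) order_trans[OF U3(2) U2(2)]] U2(3)[OF U3(1,2)] by blast
 then show "fibre_act X x A M U p q (r \<odot>\<^bsub>sec (point_presheaf (Fib (piece A p))) U\<^esub> a) s =
 r \<odot>\<^bsub>sec (point_presheaf (Fib (piece M (p + q)))) U\<^esub> fibre_act X x A M U p q a s"
 "fibre_act X x A M U p q a (r \<odot>\<^bsub>sec (point_presheaf (Fib (piece M q))) U\<^esub> s) =
 r \<odot>\<^bsub>sec (point_presheaf (Fib (piece M (p + q)))) U\<^esub> fibre_act X x A M U p q a s"
 using U3 by (simp_all add: ops ev(3)[OF gs.A, symmetric] ev(3)[OF gs.M, symmetric] fibre_act_ev cl gs.act_closed gs.act_smult_left gs.act_smult_right)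
 }
 {
 fix V assume "V \<subseteq> U"
 then show "res (point_presheaf (Fib (piece M (p + q)))) U V (fibre_act X x A M U p q a s) =
 fibre_act X x A M V p q (res (point_presheaf (Fib (piece A p))) U V a) (res (point_presheaf (Fib (piece M q))) U V s)"
 using fibre_act_zero(1) by (simp add: fibre_act_def)
 }
 {
 fix p' a' assume a': "a' : carrier (sec (point_presheaf (Fib (piece A p'))) U)"
 obtain U3 where U3: "nbhd U3" "U3 \<subseteq> U2" "!!V. nbhd V ==> V \<subseteq> U3 ==> EX s':(csec A p' V). a' = ev (piece A p') V s'"
 by (rule ev_near[OF gs.A inF[OF a' gs.A] U2(1)]) (rule that)
 obtain a1 a1' s1 where "a1 : (csec A p U3)" "a = ev (piece A p) U3 a1"
 "a1' : (csec A p' U3)" "a' = ev (piece A p') U3 a1'" "s1 : (csec M q U3)" "s = ev (piece M q) U3 s1"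
 using U1(3)[OF U3(1) order_trans[OF U3(2) U2(2)]] U2(3)[OF U3(1,2)] U3(3)[OF U3(1) order_refl] by blast
 then show "fibre_act X x A M U (p + p') q (fibre_act X x A A U p p' a a') s = fibre_act X x A M U p (p' + q) a (fibre_act X x A M U p' q a' s)"
 using U3(1) gs.act_assoc[of U3 a1 p a1' p' s1 q]
 by (simp add: fibre_act_ev fibre_act_A_ev gs.A_act_closed gs.act_closed) (simp add: add.assoc)
 }
next
 fix U :: "unit set" and s q assume s: "s : carrier (sec (point_presheaf (Fib (piece M q))) U)"
 show "fibre_act X x A M U 0 q (unit A0 U) s = s"
 proof (cases "U = {}")
 case True
 then show ?thesis using s fibre_act_zero(1)[of U 0 q] by (simp add: unit_fibre)
 next
 case False
 then have U: "U = UNIV" using unit_set_cases by blast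
 then have "s : carrier (Fib (piece M q))" using s by simp
 then obtain V s' where V: "nbhd V" "V \<subseteq> topspace (pts X)" "s' : (csec M q V)" "s = ev (piece M q) V s'"
 by (rule ev_surj[OF gs.M _ top_nbhd])
 have T: "opn X (topspace (pts X))" by simp
 from ev(7)[OF gs.A top_nbhd _ _ V(2) gs.unit_closed[OF T]] V(1)
 have "unit A0 U = ev (piece A 0) V (unit A V)" using U by (simp add: unit_fibre unit_res)
 then show ?thesis using V gs.unit_closed gs.act_unit by (simp add: fibre_act_ev)
 qed
qed

end

section \<open>Lifting a dual basis from the fibre\<close>

text \<open>The effect of a column operation on coefficients: when multiples of the vector
  \<open>b' l0\<close> are split off from all vectors, only the coefficient at \<open>l0\<close>
  changes, to the combination of all \<open>\<delta>\<close> with the old coefficients.\<close>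

lemma (in module) pivot_combination:
 assumes L: "finite L" "l0 : L" and c: "c : L \<rightarrow> carrier R" and \<delta>: "\<delta> : L \<rightarrow> carrier R" and b': "b' : L \<rightarrow> carrier M"
 and b: "!!l. l : L ==> l ~= l0 ==> b l = b' l \<oplus>\<^bsub>M\<^esub> \<delta> l \<odot>\<^bsub>M\<^esub> b' l0" "b l0 = \<delta> l0 \<odot>\<^bsub>M\<^esub> b' l0"
 shows "finsum M (%l. c l \<odot>\<^bsub>M\<^esub> b l) L = finsum M (%l. (if l = l0 then finsum R (%k. c k \<otimes> \<delta> k) L else c l) \<odot>\<^bsub>M\<^esub> b' l) L"
proof -
 let ?t = "finsum R (%k. c k \<otimes> \<delta> k) L"
 let ?z = "%l. if l = l0 then \<zero>\<^bsub>M\<^esub> else c l \<odot>\<^bsub>M\<^esub> b' l"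
 have t: "?t : carrier R" using c \<delta> by (intro R.finsum_closed) auto
 have cl: "!!l. l : L ==> c l : carrier R" "!!l. l : L ==> \<delta> l : carrier R" "!!l. l : L ==> b' l : carrier M" "b' l0 : carrier M"
 using c \<delta> b' L by auto
 have "finsum M (%l. c l \<odot>\<^bsub>M\<^esub> b l) L = finsum M (%l. ?z l \<oplus>\<^bsub>M\<^esub> (c l \<otimes> \<delta> l) \<odot>\<^bsub>M\<^esub> b' l0) L"
 using cl by (intro M.add.finprod_cong') (auto simp: b smult_r_distr smult_assoc1)
 also have "\<dots> = finsum M ?z L \<oplus>\<^bsub>M\<^esub> finsum M (%l. (c l \<otimes> \<delta> l) \<odot>\<^bsub>M\<^esub> b' l0) L"
 using cl by (intro M.finsum_addf) auto
 also have "finsum M (%l. (c l \<otimes> \<delta> l) \<odot>\<^bsub>M\<^esub> b' l0) L = ?t \<odot>\<^bsub>M\<^esub> b' l0"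
 by (rule sym, rule finsum_additive_map[OF R.abelian_group_axioms M.abelian_group_axioms L(1)])
 (use cl in \<open>auto simp: smult_l_distr\<close>)
 also have "\<dots> = finsum M (%l. if l0 = l then ?t \<odot>\<^bsub>M\<^esub> b' l else \<zero>\<^bsub>M\<^esub>) L"
 using cl L t by (intro M.add.finprod_singleton[symmetric]) auto
 also have "finsum M ?z L \<oplus>\<^bsub>M\<^esub> \<dots> = finsum M (%l. ?z l \<oplus>\<^bsub>M\<^esub> (if l0 = l then ?t \<odot>\<^bsub>M\<^esub> b' l else \<zero>\<^bsub>M\<^esub>)) L"
 using cl t by (intro M.finsum_addf[symmetric]) auto
 also have "\<dots> = finsum M (%l. (if l = l0 then ?t else c l) \<odot>\<^bsub>M\<^esub> b' l) L"
 using cl t by (intro M.add.finprod_cong') auto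
 finally show ?thesis .
qed

text \<open>The generating half of a local basis. Column operations preserve it explicitly, while
  the independence used later is supplied by dual functionals.\<close>

definition spanning ::
 "('x, 'r) ringed_space => ('x, 'r, 'm) mod_presheaf => 'x set => 'l set => ('l => 'm) => bool" where
 "spanning X P U L b \<longleftrightarrow> (ALL l:L. b l : carrier (sec P U)) &
 (ALL V s y. opn X V & V \<subseteq> U & s : carrier (sec P V) & y : V -->
 (EX W c. opn X W & y : W & W \<subseteq> V & (ALL l:L. c l : (cO X W)) &
  res P V W s = finsum (sec P W) (%l. c l \<odot>\<^bsub>sec P W\<^esub> res P U W (b l)) L))"

lemma spanningD:
 assumes "spanning X P U L b"
 shows "l : L ==> b l : carrier (sec P U)"
 and "opn X V ==> V \<subseteq> U ==> s : carrier (sec P V) ==> y : V ==>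
 EX W c. opn X W & y : W & W \<subseteq> V & (ALL l:L. c l : (cO X W)) &
  res P V W s = finsum (sec P W) (%l. c l \<odot>\<^bsub>sec P W\<^esub> res P U W (b l)) L"
 using assms unfolding spanning_def by simp_all

lemma local_basis_spanning: "is_local_basis X P U n e ==> spanning X P U {..<n} e"
 unfolding spanning_def is_local_basis_def by (auto simp: Ball_def)

lemma spanning_restrict:
 assumes P: "module_presheaf X P" and U: "opn X U" and V: "opn X V" "V \<subseteq> U"
 and b: "spanning X P U L b"
 shows "spanning X P V L (%l. res P U V (b l))"
 unfolding spanning_def
proof (intro conjI ballI allI impI)
 show "res P U V (b l) : carrier (sec P V)" if "l : L" for l
 by (rule presheafD(2)[OF P U V spanningD(1)[OF b that]])
 fix W s y assume W: "opn X W & W \<subseteq> V & s : carrier (sec P W) & y : W"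
 then obtain W' c where W': "opn X W'" "y : W'" "W' \<subseteq> W" "ALL l:L. c l : (cO X W')"
 "res P W W' s = finsum (sec P W') (%l. c l \<odot>\<^bsub>sec P W'\<^esub> res P U W' (b l)) L"
 using spanningD(2)[OF b, of W s y] V by blast
 interpret module "Osec X W'" "sec P W'" by (rule presheafD(1)[OF P W'(1)])
 have r: "res P V W' (res P U V (b l)) = res P U W' (b l)" "res P U W' (b l) : carrier (sec P W')" if "l : L" for l
 using presheafD(6)[OF P U V(1) W'(1) _ V(2) spanningD(1)[OF b that]]
 presheafD(2)[OF P U W'(1) _ spanningD(1)[OF b that]] W' W V by auto
 have "res P W W' s = finsum (sec P W') (%l. c l \<odot>\<^bsub>sec P W'\<^esub> res P V W' (res P U V (b l))) L"
 unfolding W'(5) using W'(4) r by (intro M.add.finprod_cong') auto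
 then show "EX W' c. opn X W' & y : W' & W' \<subseteq> W & (ALL l:L. c l : (cO X W')) &
 res P W W' s = finsum (sec P W') (%l. c l \<odot>\<^bsub>sec P W'\<^esub> res P V W' (res P U V (b l))) L"
 using W' by blast
qed

section \<open>Elimination near a point\<close>

context local_point
begin

lemma common_nbhd:
 assumes "finite F" and "!!i. i : F ==> EX U. nbhd U & U \<subseteq> W & Q i U" and W: "nbhd W"
 and mono: "!!i U V. nbhd U ==> Q i U ==> U \<subseteq> W ==> nbhd V ==> V \<subseteq> U ==> Q i V"
 obtains U where "nbhd U" "U \<subseteq> W" "!!i. i : F ==> Q i U"
proof -
 obtain U where U: "!!i. i : F ==> nbhd (U i) & U i \<subseteq> W & Q i (U i)" using assms(2) by metis
 have o: "opn X (\<Inter>(insert W (U ` F)))" by (rule openin_Inter) (use assms(1) U W in auto)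
 then have "nbhd (\<Inter>(insert W (U ` F)))" using U W by auto
 moreover have "Q i (\<Inter>(insert W (U ` F)))" if "i : F" for i
 using mono[of "U i" i "\<Inter>(insert W (U ` F))"] U[OF that] that calculation by blast
 ultimately show ?thesis using that by blast
qed

text \<open>A fibre element lifts to a section near \<open>x\<close>, which still closer to
  \<open>x\<close> is a combination of the spanning family; the values of the coefficients at
  \<open>x\<close> are the required scalars.\<close>

lemma spanning_fibre:
 assumes P: "module_presheaf X P" and T: "nbhd T" and L: "finite L" and b: "spanning X P T L b"
 and y: "y : carrier (Fib P)"
 obtains \<kappa> where "!!l. l : L ==> \<kappa> l : carrier K"
 "y = finsum (Fib P) (%l. \<kappa> l \<odot>\<^bsub>Fib P\<^esub> ev P T (b l)) L"
proof -
 obtain V s where V: "nbhd V" "V \<subseteq> T" "s : carrier (sec P V)" "y = ev P V s"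
 by (rule ev_surj[OF P y T])
 obtain W c where W: "opn X W" "x : W" "W \<subseteq> V" "ALL l:L. c l : (cO X W)"
 "res P V W s = finsum (sec P W) (%l. c l \<odot>\<^bsub>sec P W\<^esub> res P T W (b l)) L"
 using spanningD(2)[OF b _ V(2,3), of x] V(1) by blast
 have nW: "nbhd W" and WT: "W \<subseteq> T" using W V by auto
 interpret PW: module "Osec X W" "sec P W" by (rule presheafD(1)[OF P W(1)])
 interpret F: module K "Fib P" by (rule Fib_module[OF P])
 have bl: "b l : carrier (sec P T)" "res P T W (b l) : carrier (sec P W)" if "l : L" for l
 using spanningD(1)[OF b that] presheafD(2)[OF P conjunct1[OF T] W(1) WT] by auto
 have "y = ev P W (res P V W s)" using ev(7)[OF P V(1) W(1-3) V(3)] V(4) by simp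
 also have "\<dots> = finsum (Fib P) (%l. ev P W (c l \<odot>\<^bsub>sec P W\<^esub> res P T W (b l))) L"
 unfolding W(5) using W(4) bl by (intro ev(6)[OF P nW L]) auto
 also have "\<dots> = finsum (Fib P) (%l. evO W (c l) \<odot>\<^bsub>Fib P\<^esub> ev P T (b l)) L"
 using W(4) bl evO(1)[OF nW] ev(1)[OF P T]
 by (intro F.M.add.finprod_cong') (auto simp: ev(3)[OF P nW] ev(7)[OF P T W(1,2) WT])
 finally show ?thesis using that[of "%l. evO W (c l)"] W(4) evO(1)[OF nW] by blast
qed

text \<open>The invariant of the elimination: \<open>J\<close> are the functionals kept so far and
  \<open>\<iota>\<close> assigns to each its pivot vector. Duality with the pivots is exact on
  \<open>U\<close>. The vanishing of a functional off the pivots of its level or higher is recorded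
  only at \<open>x\<close>, since it expresses a dependence, which need not extend.\<close>

definition pivoted where
 "pivoted P L G lev d U J \<iota> b \<longleftrightarrow> J \<subseteq> G & inj_on \<iota> J & \<iota> ` J \<subseteq> L & spanning X P U L b &
 (ALL j:J. ALL l:L. d j U (b l) = (if l = \<iota> j then \<one>\<^bsub>Osec X U\<^esub> else \<zero>\<^bsub>Osec X U\<^esub>)) &
 (ALL g:G. ALL l:L. l \<notin> \<iota> ` {j\<in>J. lev g \<le> lev j} --> evO U (d g U (b l)) = \<zero>\<^bsub>K\<^esub>)"

lemma pivoted_spanning: "pivoted P L G lev d U J \<iota> b ==> spanning X P U L b"
 by (simp add: pivoted_def)

lemma pivoted_restrict:
 assumes P: "module_presheaf X P" and U: "nbhd U" "U \<subseteq> U0" and V: "nbhd V" "V \<subseteq> U"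
 and d: "!!g. g : G ==> d g : dual_sections X P U0"
 and p: "pivoted P L G lev d U J \<iota> b"
 shows "pivoted P L G lev d V J \<iota> (%l. res P U V (b l))"
proof -
 have b: "b l : carrier (sec P U)" if "l : L" for l
 by (rule spanningD(1)[OF pivoted_spanning[OF p] that])
 have dr: "d g V (res P U V (b l)) = res (str X) U V (d g U (b l))" "d g U (b l) : (cO X U)" if "g : G" "l : L" for g l
 using dualD(4)[OF X P d[OF that(1)] conjunct1[OF U(1)] U(2) conjunct1[OF V(1)] V(2) b[OF that(2)]]
 dualD(1)[OF X P d[OF that(1)] conjunct1[OF U(1)] U(2) b[OF that(2)]] by auto
 note r = ringedD(6,7)[OF X conjunct1[OF U(1)] conjunct1[OF V(1)] V(2)]
 show ?thesis
 unfolding pivoted_def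
 proof (intro conjI ballI impI)
 show "J \<subseteq> G" "inj_on \<iota> J" "\<iota> ` J \<subseteq> L" using p by (simp_all add: pivoted_def)
 show "spanning X P V L (%l. res P U V (b l))"
 by (rule spanning_restrict[OF P conjunct1[OF U(1)] conjunct1[OF V(1)] V(2)]) (use p in \<open>simp add: pivoted_def\<close>)
 show "d j V (res P U V (b l)) = (if l = \<iota> j then \<one>\<^bsub>Osec X V\<^esub> else \<zero>\<^bsub>Osec X V\<^esub>)" if "j : J" "l : L" for j l
 proof -
 have "j : G" "d j U (b l) = (if l = \<iota> j then \<one>\<^bsub>Osec X U\<^esub> else \<zero>\<^bsub>Osec X U\<^esub>)" using p that by (auto simp: pivoted_def)
 then show ?thesis using dr(1) that r by simp
 qed
 show "evO V (d g V (res P U V (b l))) = \<zero>\<^bsub>K\<^esub>" if "g : G" "l : L" "l \<notin> \<iota> ` {j\<in>J. lev g \<le> lev j}" for g l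
 proof -
 have "evO U (d g U (b l)) = \<zero>\<^bsub>K\<^esub>" using p that by (simp add: pivoted_def)
 then show ?thesis using evO(8)[OF U(1) conjunct1[OF V(1)] conjunct2[OF V(1)] V(2) dr(2)] dr(1) that by simp
 qed
 qed
qed

text \<open>As \<open>N\<close> has the least level, its new pivot can only be added to the exempted
  vectors of functionals of that same level, and every kept functional has at least the level of
  \<open>N\<close>. So the earlier conditions survive and \<open>N\<close> itself satisfies its
  own.\<close>

lemma pivot_step:
 assumes P: "module_presheaf X P" and L: "finite L" and U: "nbhd U" "U \<subseteq> U0"
 and d: "!!g. g : insert N G ==> d g : dual_sections X P U0"
 and N: "N \<notin> G" "!!g. g : G ==> lev N \<le> (lev g :: int)"
 and p: "pivoted P L G lev d U J \<iota> b"
 and l0: "l0 : L" "l0 \<notin> \<iota> ` J" "d N U (b l0) \<otimes>\<^bsub>Osec X U\<^esub> u = \<one>\<^bsub>Osec X U\<^esub>" and u: "u : (cO X U)"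
 shows "EX \<iota> b. pivoted P L (insert N G) lev d U (insert N J) \<iota> b"
proof -
 interpret O: cring "Osec X U" using ringedD(2)[OF X] U by auto
 interpret PU: module "Osec X U" "sec P U" using presheafD(1)[OF P] U by auto
 have JG: "J \<subseteq> G" and inj: "inj_on \<iota> J" and im: "\<iota> ` J \<subseteq> L" and sp: "spanning X P U L b"
 and dual: "!!j l. j : J ==> l : L ==> d j U (b l) = (if l = \<iota> j then \<one>\<^bsub>Osec X U\<^esub> else \<zero>\<^bsub>Osec X U\<^esub>)"
 and van: "!!g l. g : G ==> l : L ==> l \<notin> \<iota> ` {j\<in>J. lev g \<le> lev j} ==> evO U (d g U (b l)) = \<zero>\<^bsub>K\<^esub>"
 using p by (auto simp: pivoted_def)
 have NJ: "N \<notin> J" using JG N by auto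
 have b: "b l : carrier (sec P U)" if "l : L" for l using spanningD(1)[OF sp that] .
 note dD = dualD[OF X P d conjunct1[OF U(1)] U(2)]
 define \<delta> where "\<delta> l = d N U (b l)" for l
 have \<delta>: "\<delta> l : (cO X U)" if "l : L" for l using dD(1)[of N] b[OF that] by (simp add: \<delta>_def)
 have \<delta>u: "\<delta> l0 \<otimes>\<^bsub>Osec X U\<^esub> u = \<one>\<^bsub>Osec X U\<^esub>" using l0 by (simp add: \<delta>_def)
 \<comment> \<open>Column operations: \<open>b l0\<close> is rescaled so that \<open>N\<close> takes
   the value one on it, and then the value of \<open>N\<close> on every other vector is
   cleared.\<close>
 define b0 where "b0 = u \<odot>\<^bsub>sec P U\<^esub> b l0"
 have b0: "b0 : carrier (sec P U)" using u b l0 by (simp add: b0_def)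
 define b' where "b' l = (if l = l0 then b0 else b l \<ominus>\<^bsub>sec P U\<^esub> \<delta> l \<odot>\<^bsub>sec P U\<^esub> b0)" for l
 have b': "b' l : carrier (sec P U)" if "l : L" for l using b0 b[OF that] \<delta>[OF that] by (auto simp: b'_def)
 have bb': "b l = b' l \<oplus>\<^bsub>sec P U\<^esub> \<delta> l \<odot>\<^bsub>sec P U\<^esub> b' l0" if "l : L" "l ~= l0" for l
 using that b0 b \<delta> by (simp add: b'_def PU.M.minus_add_cancel)
 have bb0: "b l0 = \<delta> l0 \<odot>\<^bsub>sec P U\<^esub> b' l0"
 using \<delta>u \<delta>[OF l0(1)] u b[OF l0(1)] by (simp add: b'_def b0_def PU.smult_assoc1[symmetric])
 have db0: "d g U b0 = u \<otimes>\<^bsub>Osec X U\<^esub> d g U (b l0)" if "g : insert N G" for g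
 using dD(3)[OF that u b[OF l0(1)]] by (simp add: b0_def)
 have db': "d g U (b' l) = d g U (b l) \<ominus>\<^bsub>Osec X U\<^esub> \<delta> l \<otimes>\<^bsub>Osec X U\<^esub> d g U b0" if "g : insert N G" "l : L" "l ~= l0" for g l
 using that dD(6)[OF that(1), of "b l" "\<delta> l \<odot>\<^bsub>sec P U\<^esub> b0"] dD(3)[OF that(1), of "\<delta> l" b0] b[OF that(2)] b0 \<delta>[OF that(2)] by (simp add: b'_def)
 have dc: "d g U (b l) : (cO X U)" "d g U b0 : (cO X U)" if "g : insert N G" "l : L" for g l
 using dD(1)[OF that(1)] b[OF that(2)] b0 by auto
 have dN0: "d N U b0 = \<one>\<^bsub>Osec X U\<^esub>" using db0[of N] \<delta>u u \<delta>[OF l0(1)] by (simp add: \<delta>_def O.m_comm)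
 have dN: "d N U (b' l) = (if l = l0 then \<one>\<^bsub>Osec X U\<^esub> else \<zero>\<^bsub>Osec X U\<^esub>)" if "l : L" for l
 using db'[of N l] dN0 \<delta>[OF that] that by (auto simp: b'_def \<delta>_def[symmetric] a_minus_def O.r_neg)
 define \<iota>' where "\<iota>' = \<iota>(N := l0)"
 have \<iota>'J: "\<iota>' j = \<iota> j" if "j : J" for j using that NJ by (auto simp: \<iota>'_def)
 have inj': "inj_on \<iota>' (insert N J)" and im': "\<iota>' ` insert N J = insert l0 (\<iota> ` J)"
 using inj l0(2) NJ \<iota>'J by (auto simp: \<iota>'_def inj_on_def image_iff)
 show ?thesis
 proof (intro exI)
 show "pivoted P L (insert N G) lev d U (insert N J) \<iota>' b'"
 unfolding pivoted_def
 proof (intro conjI)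
 show "insert N J \<subseteq> insert N G" using JG by auto
 show "inj_on \<iota>' (insert N J)" by (rule inj')
 show "\<iota>' ` insert N J \<subseteq> L" using im im' l0 by auto
 show "ALL j:insert N J. ALL l:L. d j U (b' l) = (if l = \<iota>' j then \<one>\<^bsub>Osec X U\<^esub> else \<zero>\<^bsub>Osec X U\<^esub>)"
 proof (intro ballI)
  fix j l assume jl: "j : insert N J" "l : L"
  show "d j U (b' l) = (if l = \<iota>' j then \<one>\<^bsub>Osec X U\<^esub> else \<zero>\<^bsub>Osec X U\<^esub>)"
  proof (cases "j = N")
  case True
  then show ?thesis using dN jl by (simp add: \<iota>'_def)
  next
  case False
  then have j: "j : J" "j : insert N G" using jl JG by auto
  then have ne: "l0 ~= \<iota> j" using l0(2) by auto
  \<comment> \<open>The functionals kept earlier vanish on the new pivot vector, because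
    \<open>l0\<close> is not one of their pivots; so their duality is untouched.\<close>
  have z: "d j U b0 = \<zero>\<^bsub>Osec X U\<^esub>" using db0[OF j(2)] dual[OF j(1) l0(1)] ne u by simp
  show ?thesis
  proof (cases "l = l0")
   case True
   then show ?thesis using z ne \<iota>'J[OF j(1)] by (simp add: b'_def)
  next
   case False
   then show ?thesis using db'[OF j(2) jl(2)] z \<delta>[OF jl(2)] dual[OF j(1) jl(2)] \<iota>'J[OF j(1)]
   by (auto simp: a_minus_def)
  qed
  qed
 qed
 show "ALL g:insert N G. ALL l:L. l \<notin> \<iota>' ` {j : insert N J. lev g \<le> lev j} --> evO U (d g U (b' l)) = \<zero>\<^bsub>K\<^esub>"
 proof (intro ballI impI)
  fix g l assume gl: "g : insert N G" "l : L" "l \<notin> \<iota>' ` {j : insert N J. lev g \<le> lev j}"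
  show "evO U (d g U (b' l)) = \<zero>\<^bsub>K\<^esub>"
  proof (cases "g = N")
  case True
  have "l0 : \<iota>' ` {j : insert N J. lev g \<le> lev j}" using True by (auto simp: \<iota>'_def)
  then have "l ~= l0" using gl(3) by blast
  then show ?thesis using dN[OF gl(2)] True evO(5)[OF U(1)] by simp
  next
  case False
  then have g: "g : G" using gl by simp
  \<comment> \<open>Exempted indices stay exempted, so \<open>g\<close> already vanished at
    \<open>x\<close> on \<open>b l\<close>. It also vanishes there on \<open>b l0\<close>, hence the
    column operation does not affect its value at \<open>x\<close>.\<close>
  have "\<iota> ` {j\<in>J. lev g \<le> lev j} \<subseteq> \<iota>' ` {j : insert N J. lev g \<le> lev j}" using \<iota>'J by force
  then have 1: "evO U (d g U (b l)) = \<zero>\<^bsub>K\<^esub>" using van[OF g gl(2)] gl(3) by blast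
  have "evO U (d g U (b l0)) = \<zero>\<^bsub>K\<^esub>" using van[OF g l0(1)] l0(2) by blast
  then have 0: "evO U (d g U b0) = \<zero>\<^bsub>K\<^esub>"
   using db0[OF gl(1)] evO(3)[OF U(1) u dc(1)[OF gl(1) l0(1)]] evO(1)[OF U(1) u] by simp
  show ?thesis
  proof (cases "l = l0")
   case True
   then show ?thesis using 0 by (simp add: b'_def)
  next
   case False
   then show ?thesis
   using db'[OF gl(1,2)] 0 1 dc[OF gl(1,2)] \<delta>[OF gl(2)] evO(1)[OF U(1)]
   by (simp add: evO(6)[OF U(1)] evO(3)[OF U(1)] K.minus_eq)
  qed
  qed
 qed
 show "spanning X P U L b'"
  unfolding spanning_def
 proof (intro conjI ballI allI impI)
  show "l : L ==> b' l : carrier (sec P U)" for l by (rule b')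
  fix V s y assume V: "opn X V & V \<subseteq> U & s : carrier (sec P V) & y : V"
  then obtain W c where W: "opn X W" "y : W" "W \<subseteq> V" "ALL l:L. c l : (cO X W)"
  "res P V W s = finsum (sec P W) (%l. c l \<odot>\<^bsub>sec P W\<^esub> res P U W (b l)) L"
  using spanningD(2)[OF sp, of V s y] by blast
  have WU: "W \<subseteq> U" using W V by auto
  interpret PW: module "Osec X W" "sec P W" by (rule presheafD(1)[OF P W(1)])
  note r = presheafD(2,3,4)[OF P conjunct1[OF U(1)] W(1) WU] ringedD(3)[OF X conjunct1[OF U(1)] W(1) WU]
  let ?t = "finsum (Osec X W) (%k. c k \<otimes>\<^bsub>Osec X W\<^esub> res (str X) U W (\<delta> k)) L"
  have "finsum (sec P W) (%l. c l \<odot>\<^bsub>sec P W\<^esub> res P U W (b l)) L =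
  finsum (sec P W) (%l. (if l = l0 then ?t else c l) \<odot>\<^bsub>sec P W\<^esub> res P U W (b' l)) L"
  proof (rule PW.pivot_combination[OF L l0(1)])
  show "c : L \<rightarrow> (cO X W)" "(%k. res (str X) U W (\<delta> k)) : L \<rightarrow> (cO X W)"
   "(%l. res P U W (b' l)) : L \<rightarrow> carrier (sec P W)" using W r b' \<delta> by auto
  show "res P U W (b l) = res P U W (b' l) \<oplus>\<^bsub>sec P W\<^esub> res (str X) U W (\<delta> l) \<odot>\<^bsub>sec P W\<^esub> res P U W (b' l0)"
   if "l : L" "l ~= l0" for l
   using bb'[OF that] b'[OF that(1)] b'[OF l0(1)] \<delta>[OF that(1)] by (simp add: r(2,3))
  show "res P U W (b l0) = res (str X) U W (\<delta> l0) \<odot>\<^bsub>sec P W\<^esub> res P U W (b' l0)"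
   using bb0 b'[OF l0(1)] \<delta>[OF l0(1)] by (simp add: r(3))
  qed
  moreover have "?t : (cO X W)" using W r(4) \<delta> by (intro PW.R.finsum_closed) auto
  ultimately show "EX W c. opn X W & y : W & W \<subseteq> V & (ALL l:L. c l : (cO X W)) &
   res P V W s = finsum (sec P W) (%l. c l \<odot>\<^bsub>sec P W\<^esub> res P U W (b' l)) L"
  using W by (intro exI[of _ W] exI[of _ "%l. if l = l0 then ?t else c l"]) auto
 qed
 qed
 qed
qed

text \<open>
 Elimination in order of decreasing level: a functional is skipped only if, at \<open>x\<close>, it depends on
 those already chosen, all of which have at least its level.
\<close>

lemma pivoted_exists:
 fixes lev :: "'g => int"
 assumes P: "module_presheaf X P" and L: "finite L" and U0: "nbhd U0" and G: "finite G"
 and sp: "spanning X P U0 L e" and d: "!!g. g : G ==> d g : dual_sections X P U0"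
 shows "EX U J \<iota> b. nbhd U & U \<subseteq> U0 & pivoted P L G lev d U J \<iota> b"
 using G d
\<comment> \<open>Ranking by the negated level makes each inserted functional one of least level so
  far.\<close>
proof (induction rule: finite_ranking_induct[where f = "%g. - lev g"])
 case empty
 show ?case using U0 sp by (intro exI[of _ U0] exI[of _ "{}"] exI[of _ e]) (auto simp: pivoted_def)
next
 case (insert N G)
 then obtain U J \<iota> b where U: "nbhd U" "U \<subseteq> U0" and p: "pivoted P L G lev d U J \<iota> b"
 by auto
 have lN: "!!g. g : G ==> lev N \<le> lev g" using insert.hyps(2) by force
 show ?case
 \<comment> \<open>\<open>N\<close> is skipped if at \<open>x\<close> it vanishes on all vectors
   that are not pivots; all kept functionals have at least its level, so this is the condition in
   \<open>pivoted\<close>. Otherwise one of its values is a unit near \<open>x\<close> and provides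
   the next pivot.\<close>
 proof (cases "N : G \<or> (ALL l:L. l \<notin> \<iota> ` J --> evO U (d N U (b l)) = \<zero>\<^bsub>K\<^esub>)")
 case True
 then have "pivoted P L (insert N G) lev d U J \<iota> b"
 proof
 assume "N : G"
 then show ?thesis using p by (simp add: insert_absorb)
 next
 assume *: "ALL l:L. l \<notin> \<iota> ` J --> evO U (d N U (b l)) = \<zero>\<^bsub>K\<^esub>"
 have "{j\<in>J. lev N \<le> lev j} = J" using lN p by (auto simp: pivoted_def)
 then show ?thesis using p * unfolding pivoted_def by auto
 qed
 then show ?thesis using U by blast
 next
 case False
 then obtain l0 where N: "N \<notin> G" and l0: "l0 : L" "l0 \<notin> \<iota> ` J" "evO U (d N U (b l0)) ~= \<zero>\<^bsub>K\<^esub>" by auto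
 have "spanning X P U L b" using p by (simp add: pivoted_def)
 then have bl0: "b l0 : carrier (sec P U)" by (rule spanningD(1)[OF _ l0(1)])
 have dN: "d N : dual_sections X P U0" using insert by simp
 have dc: "d N U (b l0) : (cO X U)" by (rule dualD(1)[OF X P dN conjunct1[OF U(1)] U(2) bl0])
 obtain W u where W: "nbhd W" "W \<subseteq> U" and u: "u : (cO X W)" "u \<otimes>\<^bsub>Osec X W\<^esub> res (str X) U W (d N U (b l0)) = \<one>\<^bsub>Osec X W\<^esub>"
 by (rule evO_unit[OF U(1) dc l0(3)])
 have rc: "res (str X) U W (d N U (b l0)) : (cO X W)"
 by (rule ringedD(3)[OF X conjunct1[OF U(1)] conjunct1[OF W(1)] W(2) dc])
 have dr: "d N W (res P U W (b l0)) = res (str X) U W (d N U (b l0))"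
 by (rule dualD(4)[OF X P dN conjunct1[OF U(1)] U(2) conjunct1[OF W(1)] W(2) bl0])
 have pW: "pivoted P L G lev d W J \<iota> (%l. res P U W (b l))"
 by (rule pivoted_restrict[OF P U W _ p]) (use insert in auto)
 have WU0: "W \<subseteq> U0" using W U by auto
 have "d N W (res P U W (b l0)) \<otimes>\<^bsub>Osec X W\<^esub> u = \<one>\<^bsub>Osec X W\<^esub>"
 using u rc dr cring.cring_simprules(14)[OF ringedD(2)[OF X conjunct1[OF W(1)]], of u] by simp
 then have "EX \<iota> b. pivoted P L (insert N G) lev d W (insert N J) \<iota> b"
 by (intro pivot_step[OF P L W(1) WU0 _ N lN pW l0(1,2) _ u(1)]) (use insert in auto)
 then show ?thesis using W(1) WU0 by blast
 qed
qed

end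

section \<open>Restriction to an open subspace\<close>

context
 fixes X :: "('x, 'r) ringed_space" and T :: "'x set"
 assumes X: "is_ringed_space X" and T: "opn X T"
begin

lemma subspace_simps [simp]:
 "str (open_subspace X T) = str X"
 "openin (pts (open_subspace X T)) U \<longleftrightarrow> opn X U & U \<subseteq> T"
 "topspace (pts (open_subspace X T)) = T"
 using T openin_subset[OF T] by (auto simp: open_subspace_def openin_open_subtopology topspace_subtopology)

lemma open_subspace_ringed_space: "is_ringed_space (open_subspace X T)"
proof -
 have s: "is_sheaf (pts X) (str X)" by (rule ringedD(1)[OF X])
 have "is_sheaf (pts (open_subspace X T)) (str X)"
 using s unfolding is_sheaf_def subspace_simps by (intro conjI) (metis (no_types, lifting))+
 then show ?thesis using X unfolding is_ringed_space_def by simp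
qed

lemma subspace_module:
 assumes P: "module_presheaf X P"
 shows "module_presheaf (open_subspace X T) P"
 unfolding module_presheaf_def subspace_simps
 by (intro conjI allI impI ballI) (auto simp: presheafD(2-6)[OF P] intro: presheafD(1)[OF P])

lemma open_subspace_dual_sections:
 assumes P: "module_presheaf X P" and U: "opn X U" "T \<subseteq> U" and \<phi>: "\<phi> : dual_sections X P U"
 shows "hom_fun (open_subspace X T) P T \<phi> : dual_sections (open_subspace X T) P T"
 by (rule dual_sectionsI[OF subspace_module[OF P]])
 (use U(2) T in \<open>auto intro!: dualD(1-4)[OF X P \<phi>]\<close>)

lemma open_subspace_graded_system:
 assumes "graded_system X A M"
 shows "graded_system (open_subspace X T) A M"
proof -
 interpret gs: graded_system X A M by fact
 show ?thesis
 by unfold_locales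
 (auto simp: open_subspace_ringed_space gs.unit_closed gs.A_negative gs.A_act_closed gs.act_closed gs.act_add_left gs.act_add_right
  gs.act_smult_left gs.act_smult_right gs.act_res gs.act_assoc gs.act_unit intro!: subspace_module gs.A gs.M)
qed

end

lemma graded_system_of_module:
 assumes X: "is_ringed_space X" and A: "is_graded_algebra X A" and M: "is_graded_module X A M"
 shows "graded_system X A M"
proof -
 have AA: "is_graded_module X A A" using A by (simp add: is_graded_algebra_def)
 note U = conjunct2[OF A[unfolded is_graded_algebra_def], rule_format]
 note Mp = conjunct1[OF M[unfolded is_graded_module_def], rule_format]
 note MU = conjunct2[OF M[unfolded is_graded_module_def], rule_format]
 note MA = conjunct1[OF MU, rule_format]
 and MB = conjunct1[OF conjunct2[OF MU], rule_format] and MC = conjunct2[OF conjunct2[OF MU], rule_format]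
 show ?thesis
 proof (unfold_locales, goal_cases)
 case 1 show ?case by (rule X)
 next
 case (2 p) show ?case using AA is_module_sheaf_presheaf(1) by (auto simp: is_graded_module_def)
 next
 case (3 p) show ?case by (rule is_module_sheaf_presheaf(1)[OF Mp])
 next
 case (4 W) then show ?case using U by blast
 next
 case (5 W p) then show ?case using U by blast
 next
 case (6 W a p a' q) then show ?case using conjunct2[OF AA[unfolded is_graded_module_def], rule_format, of W] by blast
 next
 case (7 W a p s q) then show ?case using MA by blast
 next
 case (8 W a p a' s q) then show ?case using MA by blast
 next
 case (9 W a p s q s') then show ?case using MA by blast
 next
 case (10 W r a p s q) then show ?case using MA[OF 10(1,3,4)] by simp
 next
 case (11 W r a p s q) then show ?case using MA[OF 11(1,3,4)] by simp
 next
 case (12 W V a p s q) then show ?case using MA[OF 12(1,4,5)] by simp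
 next
 case (13 W a p a' p' s q) then show ?case by (intro MB)
 next
 case (14 W s q) then show ?case by (intro MC)
 qed
qed

lemma graded_module_truncate: "is_graded_module X A M ==> is_graded_module X A (grmod.truncate M)"
 by (simp add: is_graded_module_def grmod.truncate_def)

text \<open>For fixed \<open>s\<close> the test is linear in the algebra section, and its outcome
  lies in the structure sheaf, where vanishing is local. So finitely many locally spanning algebra
  sections are enough.\<close>

lemma (in dual_generators) KerI_spanning:
 assumes L: "L \<subseteq> I" and U: "opn X U" and s: "s : (csec B p U)"
 and N: "!!i. i : L ==> finite (N i)" and sp: "!!i. i : L ==> spanning X (piece A (lev i - p)) (topspace (pts X)) (N i) (\<alpha> i)"
 and van: "!!i k. i : L ==> k : N i ==>
 f i U (act B U (lev i - p) p (res (piece A (lev i - p)) (topspace (pts X)) U (\<alpha> i k)) s) = \<zero>\<^bsub>Osec X U\<^esub>"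
 shows "s : Ker L p U"
 unfolding Ker_def
proof (intro CollectI conjI allI impI s)
 fix V i a assume "opn X V & V \<subseteq> U & i : L & a : (csec A (lev i - p) V)"
 then have V: "opn X V" "V \<subseteq> U" and i: "i : L" "i : I" and a: "a : (csec A (lev i - p) V)" using L by auto
 let ?T = "topspace (pts X)"
 have sV: "res (piece B p) U V s : (csec B p V)" by (rule presheafD(2)[OF M U V s])
 have T: "opn X ?T" "V \<subseteq> ?T" "U \<subseteq> ?T" using openin_subset V U by auto
 let ?z = "f i V (act B V (lev i - p) p a (res (piece B p) U V s))"
 have zc: "?z : (cO X V)" by (rule fD(1)[OF i(2) V(1) act_lev_closed[OF V(1) a sV]])
 interpret OV: cring "Osec X V" by (rule ringedD(2)[OF X V(1)])
 show "?z = \<zero>\<^bsub>Osec X V\<^esub>"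
 proof (rule is_sheaf_separated[OF ringedD(1)[OF X] V(1) zc])
 fix y assume y: "y : V"
 obtain W c where W: "opn X W" "y : W" "W \<subseteq> V" "ALL k:N i. c k : (cO X W)"
 "res (piece A (lev i - p)) V W a = finsum (gsec A (lev i - p) W) (%k. c k \<odot>\<^bsub>gsec A (lev i - p) W\<^esub> res (piece A (lev i - p)) ?T W (\<alpha> i k)) (N i)"
 using spanningD(2)[OF sp[OF i(1)] V(1) T(2) a y] by blast
 have WU: "W \<subseteq> U" "W \<subseteq> ?T" using W V T by auto
 interpret OW: cring "Osec X W" by (rule ringedD(2)[OF X W(1)])
 interpret AW: module "Osec X W" "gsec A (lev i - p) W" by (rule presheafD(1)[OF A W(1)])
 let ?s = "res (piece B p) U W s"
 have sW: "?s : (csec B p W)" by (rule presheafD(2)[OF M U W(1) WU(1) s])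
 define h where "h a = f i W (act B W (lev i - p) p a ?s)" for a
 note alc = act_lev_closed[OF W(1) _ sW]
 have h: "a : (csec A (lev i - p) W) ==> h a : (cO X W)"
 "a : (csec A (lev i - p) W) ==> a' : (csec A (lev i - p) W) ==>
  h (a \<oplus>\<^bsub>gsec A (lev i - p) W\<^esub> a') = h a \<oplus>\<^bsub>Osec X W\<^esub> h a'"
 "r : (cO X W) ==> a : (csec A (lev i - p) W) ==>
  h (r \<odot>\<^bsub>gsec A (lev i - p) W\<^esub> a) = r \<otimes>\<^bsub>Osec X W\<^esub> h a" for a a' r
 using fD[OF i(2) W(1)] alc act_add_left[OF W(1) _ _ sW, of a "lev i - p" a'] act_smult_left[OF W(1) _ _ sW, of r a "lev i - p"]
 by (simp_all add: h_def)
 have \<alpha>c: "\<alpha> i k : (csec A (lev i - p) ?T)" if "k : N i" for k by (rule spanningD(1)[OF sp[OF i(1)] that])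
 have \<alpha>W: "res (piece A (lev i - p)) ?T W (\<alpha> i k) : (csec A (lev i - p) W)"
 and \<alpha>U: "res (piece A (lev i - p)) ?T U (\<alpha> i k) : (csec A (lev i - p) U)"
 and \<alpha>UW: "res (piece A (lev i - p)) U W (res (piece A (lev i - p)) ?T U (\<alpha> i k)) = res (piece A (lev i - p)) ?T W (\<alpha> i k)"
 if "k : N i" for k
 using presheafD(2)[OF A T(1) _ _ \<alpha>c[OF that]] presheafD(6)[OF A T(1) U W(1) WU(1) T(3) \<alpha>c[OF that]] W(1) U T WU by auto
 have h0: "h (res (piece A (lev i - p)) ?T W (\<alpha> i k)) = \<zero>\<^bsub>Osec X W\<^esub>" if k: "k : N i" for k
 proof -
 let ?t = "act B U (lev i - p) p (res (piece A (lev i - p)) ?T U (\<alpha> i k)) s"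
 have "h (res (piece A (lev i - p)) ?T W (\<alpha> i k)) = f i W (res (piece B (lev i)) U W ?t)"
  using act_res[OF U W(1) WU(1) \<alpha>U[OF k] s] \<alpha>UW[OF k] by (simp add: h_def)
 also have "\<dots> = res (str X) U W (f i U ?t)"
  by (rule fD(4)[OF i(2) U W(1) WU(1) act_lev_closed[OF U \<alpha>U[OF k] s]])
 finally show ?thesis using van[OF i(1) k] ringedD(7)[OF X U W(1) WU(1)] by simp
 qed
 have "res (str X) V W ?z = f i W (res (piece B (lev i)) V W (act B V (lev i - p) p a (res (piece B p) U V s)))"
 by (rule fD(4)[OF i(2) V(1) W(1,3) act_lev_closed[OF V(1) a sV], symmetric])
 also have "\<dots> = h (res (piece A (lev i - p)) V W a)"
 using act_res[OF V(1) W(1,3) a sV] presheafD(6)[OF M U V(1) W(1,3) V(2) s] by (simp add: h_def)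
 also have "\<dots> = finsum (Osec X W) (%k. h (c k \<odot>\<^bsub>gsec A (lev i - p) W\<^esub> res (piece A (lev i - p)) ?T W (\<alpha> i k))) (N i)"
 unfolding W(5) using W(4) \<alpha>W
 by (intro finsum_additive_map[OF AW.M.abelian_group_axioms OW.abelian_group_axioms N[OF i(1)] h(1,2)]) auto
 also have "\<dots> = finsum (Osec X W) (%k. \<zero>\<^bsub>Osec X W\<^esub>) (N i)"
 using W(4) \<alpha>W h0 by (intro OW.add.finprod_cong') (auto simp: h(3))
 finally have "res (str X) V W ?z = \<zero>\<^bsub>Osec X W\<^esub>" by simp
 then show "EX W. opn X W & y : W & W \<subseteq> V & res (str X) V W ?z = res (str X) V W \<zero>\<^bsub>Osec X V\<^esub>"
 using W ringedD(7)[OF X V(1) W(1,3)] by auto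
 qed simp
qed

lemma (in local_point) spanning_point:
 assumes P: "module_presheaf X P" and T: "nbhd T" and L: "finite L" and b: "spanning X P T L b"
 shows "spanning (Spec_field K) (point_presheaf (Fib P)) UNIV L (%l. ev P T (b l))"
 unfolding spanning_def
proof (intro conjI ballI allI impI)
 show "ev P T (b l) : carrier (sec (point_presheaf (Fib P)) UNIV)" if "l : L" for l
 using ev(1)[OF P T spanningD(1)[OF b that]] by simp
 fix V s y assume "openin (pts (Spec_field K)) V & V \<subseteq> UNIV & s : carrier (sec (point_presheaf (Fib P)) V) & y : V"
 then have V: "V = UNIV" and s: "s : carrier (Fib P)" using unit_set_cases[of V] by auto
 obtain \<kappa> where "!!l. l : L ==> \<kappa> l : carrier K" "s = finsum (Fib P) (%l. \<kappa> l \<odot>\<^bsub>Fib P\<^esub> ev P T (b l)) L"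
 by (rule spanning_fibre[OF P T L b s]) (rule that)
 then show "EX W c. openin (pts (Spec_field K)) W & y : W & W \<subseteq> V & (ALL l:L. c l : (cO (Spec_field K) W)) &
 res (point_presheaf (Fib P)) V W s =
  finsum (sec (point_presheaf (Fib P)) W) (%l. c l \<odot>\<^bsub>sec (point_presheaf (Fib P)) W\<^esub> res (point_presheaf (Fib P)) UNIV W (ev P T (b l))) L"
 by (intro exI[of _ UNIV] exI[of _ \<kappa>]) (auto simp: V)
qed

section \<open>Recovering the quotient over the point from its socle\<close>

lemma generated_submodule_least:
 "is_graded_submodule X A M N ==> (!!q V. opn X V ==> G q V \<subseteq> N q V) ==>
 generated_submodule X A M G p U \<subseteq> N p U"
 unfolding generated_submodule_def by blast

text \<open>Each closure property passes to the intersection; the whole module is among the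
  competitors, which keeps the intersection inside the carriers.\<close>

lemma generated_submodule_graded:
 assumes M: "!!p. module_presheaf X (piece M p)"
 and act: "!!U p q a s. opn X U ==> a : (csec A p U) ==> s : (csec M q U) ==>
 act M U p q a s : (csec M (p + q) U)"
 and G: "!!q V. opn X V ==> G q V \<subseteq> (csec M q V)"
 shows "is_graded_submodule X A M (generated_submodule X A M G)"
proof -
 let ?F = "%N. is_graded_submodule X A M N & (ALL q V. opn X V --> G q V \<subseteq> N q V)"
 have mem: "s : generated_submodule X A M G p U \<longleftrightarrow> (ALL N. ?F N --> s : N p U)" for s p U
 unfolding generated_submodule_def by auto
 have "is_graded_submodule X A M (%q V. (csec M q V))"
 by (rule grsubI) (auto intro: module.carrier_is_submodule[OF presheafD(1)[OF M]] presheafD(2)[OF M] act)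
 then have top: "?F (%q V. (csec M q V))" using G by blast
 note D = grsubD
 show ?thesis
 proof (rule grsubI)
 fix U p assume U: "opn X U"
 interpret module "Osec X U" "gsec M p U" by (rule presheafD(1)[OF M U])
 have sub: "submodule (N p U) (Osec X U) (gsec M p U)" if "?F N" for N using D(1)[OF _ U] that by blast
 show "submodule (generated_submodule X A M G p U) (Osec X U) (gsec M p U)"
 proof (rule submoduleI)
 show "generated_submodule X A M G p U \<subseteq> (csec M p U)" using top mem by blast
 show "\<zero>\<^bsub>gsec M p U\<^esub> : generated_submodule X A M G p U"
  unfolding mem using submodule_zero_closed[OF sub] by blast
 show "\<ominus>\<^bsub>gsec M p U\<^esub> s : generated_submodule X A M G p U" if "s : generated_submodule X A M G p U" for s
  using that submoduleE(3)[OF sub] unfolding mem by blast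
 show "s \<oplus>\<^bsub>gsec M p U\<^esub> t : generated_submodule X A M G p U"
  if "s : generated_submodule X A M G p U" "t : generated_submodule X A M G p U" for s t
  using that submoduleE(5)[OF sub] unfolding mem by blast
 show "r \<odot>\<^bsub>gsec M p U\<^esub> s : generated_submodule X A M G p U"
  if "r : (cO X U)" "s : generated_submodule X A M G p U" for r s
  using that submoduleE(4)[OF sub] unfolding mem by blast
 qed
 next
 fix U p V s assume "opn X U" "opn X V" "V \<subseteq> U" "s : generated_submodule X A M G p U"
 then show "res (piece M p) U V s : generated_submodule X A M G p V"
 unfolding mem by (intro allI impI) (rule D(2)[of X A M _ U], blast+)
 next
 fix U p s assume U: "opn X U" "s : (csec M p U)"
 "!!y. y : U ==> EX V. opn X V & y : V & V \<subseteq> U & res (piece M p) U V s : generated_submodule X A M G p V"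
 show "s : generated_submodule X A M G p U"
 unfolding mem
 proof (intro allI impI)
 fix N assume N: "?F N"
 then have "is_graded_submodule X A M N" by blast
 then show "s : N p U"
 proof (rule D(3)[OF _ U(1,2)])
  fix y assume "y : U"
  with U(3) N show "EX V. opn X V & y : V & V \<subseteq> U & res (piece M p) U V s : N p V" unfolding mem by meson
 qed
 qed
 next
 fix U a s p q assume "opn X U" "a : (csec A p U)" "s : generated_submodule X A M G q U"
 then show "act M U p q a s : generated_submodule X A M G (p + q) U"
 unfolding mem by (intro allI impI) (rule D(4)[of X A M], blast+)
 qed
qed

lemma (in graded_system) gr_dual_act_negative:
 assumes U: "opn X U" and p: "p < 0" and a: "a : (csec A p U)" and \<phi>: "\<phi> : (csec D q U)"
 shows "act D U p q a \<phi> = \<zero>\<^bsub>gsec D (p + q) U\<^esub>"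
proof (rule dual_sections_ext[OF X M])
 show "act D U p q a \<phi> : dual_sections X (piece M (- (p + q))) U" "\<zero>\<^bsub>gsec D (p + q) U\<^esub> : dual_sections X (piece M (- (p + q))) U"
 using gr_dual_act_closed[OF U a \<phi>] presheafD(7)[OF D_module_presheaf U, of "p + q"] abelian_group.axioms(1) abelian_monoid.zero_closed
 by (fastforce simp: gr_dual_simps(2))+
 fix V c assume V: "opn X V" "V \<subseteq> U" and c: "c : (csec M (- (p + q)) V)"
 have "res (piece A p) U V a = \<zero>\<^bsub>gsec A p V\<^esub>"
 using presheafD(2)[OF A U V a] A_negative[OF V(1) p] by simp
 then show "act D U p q a \<phi> V c = \<zero>\<^bsub>gsec D (p + q) U\<^esub> V c"
 using gr_dual_act_apply[OF V c, of a \<phi>] act_zero_left[OF V(1) c, of p] dualD(5)[OF X M \<phi>[unfolded gr_dual_simps(2)] V]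
 dual_presheaf_apply(1)[OF X M V c] by (simp add: gr_dual_simps(1))
qed

text \<open>
 Nakayama's lemma over the one-point space: the dual vanishes in low degrees and \<open>A\<^sub>+\<close> raises
 degrees, so lifts of generators of \<open>D / A\<^sub>+ D\<close> generate \<open>D\<close>.
\<close>

lemma (in graded_system) socle_generators:
 fixes n :: "int => nat"
 assumes one: "!!V. opn X V ==> V = {} \<or> V = topspace (pts X)"
 and low: "!!q \<phi>. m < q ==> \<phi> : (csec D (- q) (topspace (pts X))) ==> \<phi> = \<zero>\<^bsub>gsec D (- q) (topspace (pts X))\<^esub>"
 and gen: "!!q \<phi>. \<phi> : (csec D (- q) (topspace (pts X))) ==>
 EX c. (ALL i<n q. c i : (cO X (topspace (pts X)))) &
  \<phi> \<ominus>\<^bsub>gsec D (- q) (topspace (pts X))\<^esub> finsum (gsec D (- q) (topspace (pts X))) (%i. c i \<odot>\<^bsub>gsec D (- q) (topspace (pts X))\<^esub> g q i) {..<n q}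
  : Aplus_times X A D (- q) (topspace (pts X))"
 and N: "is_graded_submodule X A D N" and gN: "!!q i. i < n q ==> g q i : N (- q) (topspace (pts X))"
 and U: "opn X U" and \<phi>: "\<phi> : (csec D q U)"
 shows "\<phi> : N q U"
proof -
 let ?T = "topspace (pts X)"
 have T: "opn X ?T" by simp
 note ND = grsubD[OF N]
 have empty: "\<phi> : N q {}" if "\<phi> : (csec D q {})" for q \<phi> by (rule ND(3)[OF _ that]) auto
 have Nc: "N k V \<subseteq> (csec D k V)" if "opn X V" for k V
 using module.submoduleE(1)[OF presheafD(1)[OF D_module_presheaf that] ND(1)[OF that]] .
 \<comment> \<open>Descending induction on \<open>q\<close>, starting above \<open>m\<close>:
   multiplication by \<open>A\<^sub>+\<close> reaches degree \<open>- q\<close> only from degrees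
   \<open>- q'\<close> with larger \<open>q'\<close>.\<close>
 have ind: "ALL q. m - int k < q --> (csec D (- q) ?T) \<subseteq> N (- q) ?T" for k
 proof (induction k)
 case 0
 then show ?case using low submodule_zero_closed[OF ND(1)[OF T]] by fastforce
 next
 case (Suc k)
 show ?case
 proof (intro allI impI subsetI)
 fix q \<phi> assume q: "m - int (Suc k) < q" and \<phi>: "\<phi> : (csec D (- q) ?T)"
 have IH: "(csec D (- q') V) \<subseteq> N (- q') V" if "q < q'" "opn X V" for q' V
 proof (cases "V = {}")
  case True
  then show ?thesis using empty by auto
 next
  case False
  then have "V = ?T" "m - int k < q'" using one[OF that(2)] that q by auto
  then show ?thesis using Suc by simp
 qed
 \<comment> \<open>\<open>N\<close> in the degree under consideration and everything elsewhere. By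
   the induction hypothesis this is a graded submodule that contains all products with
   \<open>A\<^sub>+\<close>, so in degree \<open>- q\<close> the submodule they generate lies in
   \<open>N\<close>.\<close>
 define P where "P k V = (if k = - q then N k V else (csec D k V))" for k V
 have up: "act D V p r a d : N (p + r) V"
  if "opn X V" "p > 0" "p + r = - q" "a : (csec A p V)" "d : (csec D r V)" for V p r a d
 proof -
  have "(csec D (- (- r)) V) \<subseteq> N (- (- r)) V" by (rule IH) (use that in auto)
  then show ?thesis using ND(4)[OF that(1,4)] that(5) by auto
 qed
 have "is_graded_submodule X A D P"
 proof (rule grsubI)
  fix V p assume "opn X V"
  then show "submodule (P p V) (Osec X V) (gsec D p V)"
  using ND(1) module.carrier_is_submodule[OF presheafD(1)[OF D_module_presheaf]] by (auto simp: P_def)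
 next
  fix V p W s assume "opn X V" "opn X W" "W \<subseteq> V" "s : P p V"
  then show "res (piece D p) V W s : P p W"
  using ND(2) presheafD(2)[OF D_module_presheaf] by (auto simp: P_def split: if_splits)
 next
  fix V p s assume *: "opn X V" "s : (csec D p V)"
  "!!y. y : V ==> EX W. opn X W & y : W & W \<subseteq> V & res (piece D p) V W s : P p W"
  show "s : P p V"
  proof (cases "p = - q")
  case True
  have "s : N p V" by (rule ND(3)[OF *(1,2)]) (use *(3) True in \<open>simp add: P_def\<close>)
  then show ?thesis using True by (simp add: P_def)
  qed (use * in \<open>simp add: P_def\<close>)
 next
  fix V a s p r assume *: "opn X V" "a : (csec A p V)" "s : P r V"
  have s: "s : (csec D r V)" using * Nc by (auto simp: P_def split: if_splits)
  show "act D V p r a s : P (p + r) V"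
  proof (cases "p + r = - q")
  case False
  then show ?thesis using gr_dual_act_closed[OF *(1,2) s] by (simp add: P_def)
  next
  case True
  consider "p < 0" | "p = 0" | "p > 0" by linarith
  then have "act D V p r a s : N (p + r) V"
  proof cases
   case 1
   then show ?thesis using gr_dual_act_negative[OF *(1) _ *(2) s] submodule_zero_closed[OF ND(1)[OF *(1)]] by simp
  next
   case 2
   then show ?thesis using ND(4)[OF *(1,2), of s r] *(3) True by (simp add: P_def)
  next
   case 3
   then show ?thesis using up[OF *(1) _ True *(2) s] by simp
  qed
  then show ?thesis using True by (simp add: P_def)
  qed
 qed
 moreover have "{act D V p r a d | p r a d. p > 0 & p + r = k & a : (csec A p V) & d : (csec D r V)} \<subseteq> P k V"
  if "opn X V" for k V
  using up[OF that] gr_dual_act_closed[OF that] by (auto simp: P_def)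
 ultimately have "Aplus_times X A D (- q) ?T \<subseteq> P (- q) ?T"
  unfolding Aplus_times_def by (rule generated_submodule_least)
 then have sub: "Aplus_times X A D (- q) ?T \<subseteq> N (- q) ?T" by (simp add: P_def)
 obtain c where c: "ALL i<n q. c i : (cO X ?T)"
  "\<phi> \<ominus>\<^bsub>gsec D (- q) ?T\<^esub> finsum (gsec D (- q) ?T) (%i. c i \<odot>\<^bsub>gsec D (- q) ?T\<^esub> g q i) {..<n q} : Aplus_times X A D (- q) ?T"
  using gen[OF \<phi>] by auto
 interpret DT: module "Osec X ?T" "gsec D (- q) ?T" by (rule presheafD(1)[OF D_module_presheaf T])
 let ?s = "finsum (gsec D (- q) ?T) (%i. c i \<odot>\<^bsub>gsec D (- q) ?T\<^esub> g q i) {..<n q}"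
 have s: "?s : N (- q) ?T"
  by (rule submodule_finsum_closed[OF DT.module_axioms ND(1)[OF T]]) (use c gN in \<open>auto intro!: DT.submoduleE(4)[OF ND(1)[OF T]]\<close>)
 have "(\<phi> \<ominus>\<^bsub>gsec D (- q) ?T\<^esub> ?s) \<oplus>\<^bsub>gsec D (- q) ?T\<^esub> ?s = \<phi>"
  using DT.M.minus_add_cancel[OF \<phi>] Nc[OF T] s by blast
 then show "\<phi> : N (- q) ?T"
  using DT.submoduleE(5)[OF ND(1)[OF T] subsetD[OF sub c(2)] s] by simp
 qed
 qed
 show ?thesis
 proof (cases "U = {}")
 case True
 then show ?thesis using empty \<phi> by simp
 next
 case False
 then have "U = ?T" using one[OF U] by blast
 moreover have "m - int (nat (m + q + 1)) < - q" by linarith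
 then have "(csec D (- (- q)) ?T) \<subseteq> N (- (- q)) ?T" using ind by blast
 ultimately show ?thesis using \<phi> by auto
 qed
qed

lemma unit_setI: "() : U ==> U = UNIV"
 using unit_set_cases[of U] by auto

lemma is_local_basis_cong:
 assumes "module_presheaf X P" and U: "opn X U" and e: "is_local_basis X P U n e" and eq: "!!i. i < n ==> e i = e' i"
 shows "is_local_basis X P U n e'"
proof -
 have c: "finsum (sec P V) (%i. c i \<odot>\<^bsub>sec P V\<^esub> res P U V (e i)) {..<n} = finsum (sec P V) (%i. c i \<odot>\<^bsub>sec P V\<^esub> res P U V (e' i)) {..<n}"
 if "opn X V" "V \<subseteq> U" "ALL i<n. c i : (cO X V)" for V c
 proof -
 interpret module "Osec X V" "sec P V" by (rule presheafD(1)[OF assms(1) that(1)])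
 show ?thesis
 using e that eq presheafD(2)[OF assms(1) U that(1,2)]
 by (intro M.add.finprod_cong') (auto simp: is_local_basis_def Pi_iff intro!: smult_closed)
 qed
 have 1: "ALL i<n. c i = \<zero>\<^bsub>Osec X V\<^esub>" if "opn X V" "V \<subseteq> U" "ALL i<n. c i : (cO X V)"
 "finsum (sec P V) (%i. c i \<odot>\<^bsub>sec P V\<^esub> res P U V (e' i)) {..<n} = \<zero>\<^bsub>sec P V\<^esub>" for V c
 using is_local_basisD(1)[OF e that(1-3)] c[OF that(1-3)] that(4) by simp
 have 2: "EX W c. opn X W & y : W & W \<subseteq> V & (ALL i<n. c i : (cO X W)) &
  res P V W s = finsum (sec P W) (%i. c i \<odot>\<^bsub>sec P W\<^esub> res P U W (e' i)) {..<n}"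
 if V: "opn X V" "V \<subseteq> U" "s : carrier (sec P V)" "y : V" for V s y
 proof -
 obtain W d where W: "opn X W" "y : W" "W \<subseteq> V" "ALL i<n. d i : (cO X W)"
 "res P V W s = finsum (sec P W) (%i. d i \<odot>\<^bsub>sec P W\<^esub> res P U W (e i)) {..<n}"
 using is_local_basisD(2)[OF e V] by blast
 have "W \<subseteq> U" using W V by auto
 then show ?thesis using W c[OF W(1) _ W(4)] by auto
 qed
 show ?thesis unfolding is_local_basis_def using e eq 1 2 by (auto simp: is_local_basis_def)
qed

text \<open>A generator is indexed by its degree and its number in a basis of that socle piece, so
  \<open>fst\<close> is the level. \<open>C\<close> lies in the kernel because the functionals come
  from the quotient. Conversely, the functionals on the quotient that vanish on the image of the
  kernel form a submodule containing the lifts, hence all functionals by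
  \<open>socle_generators\<close>; coordinate functionals of the finite free pieces then show that
  this image is zero.\<close>

lemma inverse_system_exists:
 fixes t :: "int => int" and K :: "'k ring"
 assumes gs: "graded_system (Spec_field K) A M" and C: "is_finite_lf_quotient (Spec_field K) A M C"
 and soc: "has_socle_type (Spec_field K) A M C t" and fin: "finite {q. t q ~= 0}"
 and I: "I = Sigma {q. t q ~= 0} (%q. {..<nat (t q)})"
 obtains f where "dual_generators (Spec_field K) A M I fst f"
 "!!p U. C p U = dual_generators.Ker (Spec_field K) A M fst f I p U"
proof -
 let ?X = "Spec_field K"
 let ?U = "UNIV :: unit set"
 interpret gs: graded_system ?X A M by (rule gs)
 have CG: "is_graded_submodule ?X A M C" using C by (simp add: is_finite_lf_quotient_def)
 note CD = gs.graded_submoduleD[OF CG]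
 interpret Q: graded_system ?X A "gr_quot M C" by (rule gs.gr_quot_graded_system(1)[OF CG])
 have Qp: "piece (gr_quot M C) p = quot_presheaf (piece M p) (C p)" for p by (simp add: gr_quot_def)
 let ?Ap = "Aplus_times ?X A Q.D"
 have AG: "is_graded_submodule ?X A Q.D ?Ap"
 unfolding Aplus_times_def
 by (rule generated_submodule_graded[OF Q.D_module_presheaf Q.gr_dual_act_closed]) (auto intro: Q.gr_dual_act_closed[simplified])
 have AS: "submodule_presheaf ?X (piece Q.D k) (?Ap k)" for k
 using grsubD(1,2)[OF AG] unfolding submodule_presheaf_def by blast
 have "EX \<phi>. (ALL i<nat (t q). \<phi> i : (csec Q.D (- q) ?U)) &
 is_local_basis ?X (quot_presheaf (piece Q.D (- q)) (?Ap (- q))) ?U (nat (t q)) (%i. ?Ap (- q) ?U +>\<^bsub>gsec Q.D (- q) ?U\<^esub> \<phi> i)" for q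
 proof -
 let ?P = "quot_presheaf (piece Q.D (- q)) (?Ap (- q))"
 have "locally_free_rank ?X ?P (t q)"
 using soc unfolding has_socle_type_def Let_def quot_dual_def gr_quot_def[of "gr_dual _ _ _"] by simp
 then obtain U e where "() : U" "is_local_basis ?X ?P U (nat (t q)) e"
 unfolding locally_free_rank_def by auto
 then have e: "is_local_basis ?X ?P ?U (nat (t q)) e" using unit_setI by metis
 then have "ALL i<nat (t q). e i : carrier (sec ?P ?U)" unfolding is_local_basis_def by blast
 then have "ALL i<nat (t q). EX \<phi>:(csec Q.D (- q) ?U). e i = ?Ap (- q) ?U +>\<^bsub>gsec Q.D (- q) ?U\<^esub> \<phi>"
 using quot_presheaf_carrier[OF gs.X Q.D_module_presheaf AS, of ?U "- q"] by (simp add: image_iff)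
 then obtain \<phi> where \<phi>: "!!i. i < nat (t q) ==> \<phi> i : (csec Q.D (- q) ?U) & e i = ?Ap (- q) ?U +>\<^bsub>gsec Q.D (- q) ?U\<^esub> \<phi> i"
 by metis
 have "is_local_basis ?X ?P ?U (nat (t q)) (%i. ?Ap (- q) ?U +>\<^bsub>gsec Q.D (- q) ?U\<^esub> \<phi> i)"
 by (rule is_local_basis_cong[OF quot_presheaf_module[OF gs.X Q.D_module_presheaf AS] _ e]) (use \<phi> in auto)
 then show "EX \<phi>. (ALL i<nat (t q). \<phi> i : (csec Q.D (- q) ?U)) &
 is_local_basis ?X ?P ?U (nat (t q)) (%i. ?Ap (- q) ?U +>\<^bsub>gsec Q.D (- q) ?U\<^esub> \<phi> i)" using \<phi> by blast
 qed
 then obtain \<phi> where \<phi>: "!!q i. i < nat (t q) ==> \<phi> q i : (csec Q.D (- q) ?U)"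
 and \<phi>b: "!!q. is_local_basis ?X (quot_presheaf (piece Q.D (- q)) (?Ap (- q))) ?U (nat (t q)) (%i. ?Ap (- q) ?U +>\<^bsub>gsec Q.D (- q) ?U\<^esub> \<phi> q i)"
 by metis
 have \<phi>': "\<phi> q i : dual_sections ?X (quot_presheaf (piece M q) (C q)) ?U" if "i < nat (t q)" for q i
 using \<phi>[OF that] by (simp add: Q.gr_dual_simps(2) Qp)
 define f where "f j = hom_fun ?X (piece M (fst j)) ?U (%V s. \<phi> (fst j) (snd j) V (C (fst j) V +>\<^bsub>gsec M (fst j) V\<^esub> s))" for j
 have I': "snd j < nat (t (fst j))" if "j : I" for j using that by (auto simp: I)
 interpret G: dual_generators ?X A M I fst f
 proof
 show "finite I" using fin by (auto simp: I)
 show "f j : dual_sections ?X (piece M (fst j)) (topspace (pts ?X))" if "j : I" for j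
 unfolding f_def using quot_functional_lift[OF gs.X gs.M CD(1) _ \<phi>'[OF I'[OF that]]] by simp
 qed
 have fap: "f j V s = \<phi> (fst j) (snd j) V (C (fst j) V +>\<^bsub>gsec M (fst j) V\<^esub> s)" if "s : (csec M (fst j) V)" for j V s
 using that by (simp add: f_def)
 have empty: "s : C p {}" if "s : (csec M p {})" for s p by (rule CD(4)[OF _ that]) auto
 have sub1: "C p U \<subseteq> G.Ker I p U" for p U
 proof
 fix s assume s: "s : C p U"
 have sc: "s : (csec M p U)" by (rule CD(3)[OF _ s]) simp
 show "s : G.Ker I p U"
 unfolding G.Ker_def
 proof (intro CollectI conjI allI impI sc)
 fix V j a assume V: "openin (pts ?X) V & V \<subseteq> U & j : I & a : (csec A (fst j - p) V)"
 have O: "openin (pts ?X) W" for W by simp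
 have "res (piece M p) U V s : C p V" by (rule subpresheafD(2)[OF CD(1) O O _ s]) (use V in simp)
 then have "act M V (fst j - p) p a (res (piece M p) U V s) : C (fst j - p + p) V"
  by (intro CD(2)) (use V in simp_all)
 then have m: "act M V (fst j - p) p a (res (piece M p) U V s) : C (fst j) V" by simp
 note mc = CD(3)[OF O m]
 have "C (fst j) V +>\<^bsub>gsec M (fst j) V\<^esub> act M V (fst j - p) p a (res (piece M p) U V s) = \<zero>\<^bsub>sec (quot_presheaf (piece M (fst j)) (C (fst j))) V\<^esub>"
  using quot_presheaf_zero_iff[OF gs.X gs.M CD(1) O mc] m by simp
 then show "f j V (act M V (fst j - p) p a (res (piece M p) U V s)) = \<zero>\<^bsub>Osec ?X V\<^esub>"
  using fap[OF mc] dualD(5)[OF gs.X Q.M[unfolded Qp] \<phi>'[OF I'] O] V by simp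
 qed
 qed
 define L where "L p V = (%s. C p V +>\<^bsub>gsec M p V\<^esub> s) ` G.Ker I p V" for p V
 have KG: "is_graded_submodule ?X A M (G.Ker I)" by (rule G.Ker_graded_submodule) simp
 note KD = gs.graded_submoduleD[OF KG]
 have st: "Q.stable L"
 unfolding Q.stable_def
 proof (intro allI impI conjI ballI)
 fix U assume U: "openin (pts ?X) U"
 show "L p U \<subseteq> (csec (gr_quot M C) p U)" for p
 using KD(3)[OF U] by (auto simp: L_def Qp quot_presheaf_carrier[OF gs.X gs.M CD(1) U])
 show "res (piece (gr_quot M C) p) U V z : L p V" if "openin (pts ?X) V & V \<subseteq> U" "z : L p U" for p V z
 using that KD(3)[OF U] subpresheafD(2)[OF KD(1) U]
 by (auto simp: L_def Qp quot_presheaf_res[OF gs.X gs.M CD(1) U])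
 show "act (gr_quot M C) U p q a z : L (p + q) U" if "a : (csec A p U)" "z : L q U" for p q a z
 using that KD(3)[OF U] KD(2)[OF U] by (auto simp: L_def gs.gr_quot_graded_system(2)[OF CG U])
 qed
 have NG: "is_graded_submodule ?X A Q.D (Q.ann L)" by (rule Q.ann_graded_submodule[OF st])
 have \<phi>N: "\<phi> q i : Q.ann L (- q) ?U" if i: "i < nat (t q)" for q i
 unfolding Q.ann_def
 proof (intro CollectI conjI allI impI ballI \<phi>[OF i])
 fix V c assume "openin (pts ?X) V & V \<subseteq> ?U" "c : L (- (- q)) V"
 then obtain s where s: "s : G.Ker I q V" "c = C q V +>\<^bsub>gsec M q V\<^esub> s" by (auto simp: L_def)
 have j: "(q, i) : I" using i by (auto simp: I)
 have "f (q, i) V s = \<zero>\<^bsub>Osec ?X V\<^esub>" using G.Ker_vanish[OF j j, of V s] s by simp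
 then show "\<phi> q i V c = \<zero>\<^bsub>Osec ?X V\<^esub>" using fap[of s "(q, i)" V] KD(3)[OF _ s(1)] s(2) by simp
 qed
 \<comment> \<open>The finite set of degrees in which the quotient is nonzero; above its maximum the
   dual vanishes. Inserting 0 below covers an empty \<open>F\<close>.\<close>
 define F where "F = {p. EX U. openin (pts ?X) U & (csec (gr_quot M C) p U) ~= {\<zero>\<^bsub>gsec (gr_quot M C) p U\<^esub>}}"
 have finF: "finite F" using C by (simp add: is_finite_lf_quotient_def F_def)
 have all: "\<psi> : Q.ann L q ?U" if \<psi>: "\<psi> : (csec Q.D q ?U)" for q \<psi>
 proof (rule Q.socle_generators[where m = "Max (insert 0 F)" and n = "%q. nat (t q)" and g = \<phi>, OF _ _ _ NG _ _ \<psi>])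
 show "V = {} \<or> V = topspace (pts ?X)" for V using unit_set_cases[of V] by simp
 show "\<phi> q i : Q.ann L (- q) (topspace (pts ?X))" if "i < nat (t q)" for q i using \<phi>N[OF that] by simp
 show "openin (pts ?X) ?U" by simp
 next
 fix q \<psi> assume q: "Max (insert 0 F) < q" and \<psi>: "\<psi> : (csec Q.D (- q) (topspace (pts ?X)))"
 have "q \<notin> F" using q finF Max_ge[of "insert 0 F" q] by auto
 then have z: "(csec (gr_quot M C) q V) = {\<zero>\<^bsub>gsec (gr_quot M C) q V\<^esub>}" for V by (simp add: F_def)
 have \<psi>': "\<psi> : dual_sections ?X (piece (gr_quot M C) q) ?U" using \<psi> by (simp add: Q.gr_dual_simps(2))
 have O: "openin (pts ?X) ?U" by simp
 have zc: "\<zero>\<^bsub>sec (dual_presheaf ?X (piece (gr_quot M C) q)) ?U\<^esub> : dual_sections ?X (piece (gr_quot M C) q) ?U"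
 using abelian_monoid.zero_closed[OF abelian_group.axioms(1)[OF presheafD(7)[OF dual_presheaf_module[OF gs.X Q.M] O]]]
 by simp
 have "\<psi> = \<zero>\<^bsub>sec (dual_presheaf ?X (piece (gr_quot M C) q)) ?U\<^esub>"
 proof (rule dual_sections_ext[OF gs.X Q.M \<psi>' zc])
 fix V c assume V: "openin (pts ?X) V" "V \<subseteq> ?U" and c: "c : (csec (gr_quot M C) q V)"
 then show "\<psi> V c = \<zero>\<^bsub>sec (dual_presheaf ?X (piece (gr_quot M C) q)) ?U\<^esub> V c"
  using z dualD(5)[OF gs.X Q.M \<psi>' V] dual_presheaf_apply(1)[OF gs.X Q.M V c] by simp
 qed
 then show "\<psi> = \<zero>\<^bsub>gsec Q.D (- q) (topspace (pts ?X))\<^esub>" by (simp add: Q.gr_dual_simps(1))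
 next
 fix q \<psi> assume "\<psi> : (csec Q.D (- q) (topspace (pts ?X)))"
 then have \<psi>: "\<psi> : (csec Q.D (- q) ?U)" by simp
 let ?N = "?Ap (- q)" and ?P = "piece Q.D (- q)"
 have O: "openin (pts ?X) ?U" by simp
 note QM = quot_presheaf_module[OF gs.X Q.D_module_presheaf AS]
 interpret DU: module "Osec ?X ?U" "sec ?P ?U" by (rule presheafD(1)[OF Q.D_module_presheaf O])
 interpret QU: module "Osec ?X ?U" "sec (quot_presheaf ?P ?N) ?U" by (rule presheafD(1)[OF QM O])
 have \<psi>c: "?N ?U +>\<^bsub>sec ?P ?U\<^esub> \<psi> : carrier (sec (quot_presheaf ?P ?N) ?U)"
 using \<psi> quot_presheaf_carrier[OF gs.X Q.D_module_presheaf AS O, of "- q"] by blast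
 have \<phi>c: "?N ?U +>\<^bsub>sec ?P ?U\<^esub> \<phi> q i : carrier (sec (quot_presheaf ?P ?N) ?U)" if "i < nat (t q)" for i
 using \<phi>[OF that] quot_presheaf_carrier[OF gs.X Q.D_module_presheaf AS O, of "- q"] by blast
 obtain W c where W: "() : W" "ALL i<nat (t q). c i : (cO ?X W)"
 "res (quot_presheaf ?P ?N) ?U W (?N ?U +>\<^bsub>sec ?P ?U\<^esub> \<psi>) =
  finsum (sec (quot_presheaf ?P ?N) W) (%i. c i \<odot>\<^bsub>sec (quot_presheaf ?P ?N) W\<^esub> res (quot_presheaf ?P ?N) ?U W (?N ?U +>\<^bsub>sec ?P ?U\<^esub> \<phi> q i)) {..<nat (t q)}"
 using is_local_basisD(2)[OF \<phi>b O order_refl \<psi>c, of "()"] by blast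
 note W' = W(2,3)[unfolded unit_setI[OF W(1)]]
 have t: "c i \<odot>\<^bsub>sec ?P ?U\<^esub> \<phi> q i : carrier (sec ?P ?U)" if "i < nat (t q)" for i
 using W'(1) \<phi>[OF that] that by (intro DU.smult_closed) auto
 have "?N ?U +>\<^bsub>sec ?P ?U\<^esub> \<psi> = finsum (sec (quot_presheaf ?P ?N) ?U) (%i. c i \<odot>\<^bsub>sec (quot_presheaf ?P ?N) ?U\<^esub> (?N ?U +>\<^bsub>sec ?P ?U\<^esub> \<phi> q i)) {..<nat (t q)}"
 using W'(2) W'(1) \<phi>c unfolding presheafD(5)[OF QM O \<psi>c]
 by (simp add: presheafD(5)[OF QM O] cong: QU.M.add.finprod_cong)
 also have "\<dots> = finsum (sec (quot_presheaf ?P ?N) ?U) (%i. ?N ?U +>\<^bsub>sec ?P ?U\<^esub> (c i \<odot>\<^bsub>sec ?P ?U\<^esub> \<phi> q i)) {..<nat (t q)}"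
 using W'(1) \<phi> \<phi>c
 by (intro QU.M.add.finprod_cong') (auto simp: quot_presheaf_smult[OF gs.X Q.D_module_presheaf AS O, symmetric] intro!: QU.smult_closed)
 also have "\<dots> = ?N ?U +>\<^bsub>sec ?P ?U\<^esub> finsum (sec ?P ?U) (%i. c i \<odot>\<^bsub>sec ?P ?U\<^esub> \<phi> q i) {..<nat (t q)}"
 by (rule quot_presheaf_finsum[OF gs.X Q.D_module_presheaf AS O]) (use t in auto)
 finally have eq: "?N ?U +>\<^bsub>sec ?P ?U\<^esub> \<psi> = ?N ?U +>\<^bsub>sec ?P ?U\<^esub> finsum (sec ?P ?U) (%i. c i \<odot>\<^bsub>sec ?P ?U\<^esub> \<phi> q i) {..<nat (t q)}" .
 have sc: "finsum (sec ?P ?U) (%i. c i \<odot>\<^bsub>sec ?P ?U\<^esub> \<phi> q i) {..<nat (t q)} : carrier (sec ?P ?U)"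
 using t by (intro DU.M.finsum_closed) auto
 have "\<psi> \<ominus>\<^bsub>sec ?P ?U\<^esub> finsum (sec ?P ?U) (%i. c i \<odot>\<^bsub>sec ?P ?U\<^esub> \<phi> q i) {..<nat (t q)} : ?N ?U"
 using quot_presheaf_eq_iff[OF gs.X Q.D_module_presheaf AS O \<psi> sc] eq by simp
 then show "EX c. (ALL i<nat (t q). c i : (cO ?X (topspace (pts ?X)))) &
  \<psi> \<ominus>\<^bsub>gsec Q.D (- q) (topspace (pts ?X))\<^esub> finsum (gsec Q.D (- q) (topspace (pts ?X))) (%i. c i \<odot>\<^bsub>gsec Q.D (- q) (topspace (pts ?X))\<^esub> \<phi> q i) {..<nat (t q)}
  : ?Ap (- q) (topspace (pts ?X))"
 using W'(1) unfolding Spec_field_simps(2) by blast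
 qed
 have sub2: "G.Ker I p U \<subseteq> C p U" for p U
 proof
 fix s assume s: "s : G.Ker I p U"
 have sc: "s : (csec M p U)" by (rule KD(3)[OF _ s]) simp
 show "s : C p U"
 proof (cases "U = {}")
 case True
 then show ?thesis using empty sc by simp
 next
 case False
 then have U: "U = ?U" using unit_set_cases by blast
 let ?P = "piece (gr_quot M C) p" and ?z = "C p ?U +>\<^bsub>gsec M p ?U\<^esub> s"
 have O: "openin (pts ?X) ?U" by simp
 have zL: "?z : L p ?U" using s U by (auto simp: L_def)
 have zc: "?z : carrier (sec ?P ?U)" using sc U by (auto simp: Qp quot_presheaf_carrier[OF gs.X gs.M CD(1) O])
 have "locally_free_finite ?X ?P" using C by (simp add: is_finite_lf_quotient_def)
 then obtain V n e where "() : V" "is_local_basis ?X ?P V n e" unfolding locally_free_finite_def by auto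
 then have e: "is_local_basis ?X ?P ?U n e" using unit_setI by metis
 obtain \<gamma> where \<gamma>: "!!l. l < n ==> \<gamma> l : dual_sections ?X ?P ?U"
  and "!!V l i. openin (pts ?X) V ==> V \<subseteq> ?U ==> l < n ==> i < n ==>
  \<gamma> l V (res ?P ?U V (e i)) = (if i = l then \<one>\<^bsub>Osec ?X V\<^esub> else \<zero>\<^bsub>Osec ?X V\<^esub>)"
  and span: "!!V s y. openin (pts ?X) V ==> V \<subseteq> ?U ==> s : carrier (sec ?P V) ==> y : V ==>
  EX W. openin (pts ?X) W & y : W & W \<subseteq> V &
   res ?P V W s = finsum (sec ?P W) (%i. res (str ?X) V W (\<gamma> i V s) \<odot>\<^bsub>sec ?P W\<^esub> res ?P ?U W (e i)) {..<n}"
  by (rule local_coordinates[OF gs.X Q.M O e]) (rule that)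
 \<comment> \<open>Coordinate functionals, like all others, annihilate the image of the kernel; the
   class of \<open>s\<close> therefore has coordinates zero.\<close>
 have g0: "\<gamma> l ?U ?z = \<zero>\<^bsub>Osec ?X ?U\<^esub>" if "l < n" for l
 proof -
  have "\<gamma> l : Q.ann L (- p) ?U" by (rule all) (use \<gamma>[OF that] in \<open>simp add: Q.gr_dual_simps(2)\<close>)
  then show ?thesis using zL by (auto simp: Q.ann_def)
 qed
 interpret PU: module "Osec ?X ?U" "sec ?P ?U" by (rule presheafD(1)[OF Q.M O])
 have ei: "e i : carrier (sec ?P ?U)" if "i < n" for i using e that by (simp add: is_local_basis_def)
 obtain W where W: "() : W"
  "res ?P ?U W ?z = finsum (sec ?P W) (%i. res (str ?X) ?U W (\<gamma> i ?U ?z) \<odot>\<^bsub>sec ?P W\<^esub> res ?P ?U W (e i)) {..<n}"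
  using span[OF O order_refl zc UNIV_I, of "()"] by blast
 have "?z = finsum (sec ?P ?U) (%i. res (str ?X) ?U ?U (\<gamma> i ?U ?z) \<odot>\<^bsub>sec ?P ?U\<^esub> res ?P ?U ?U (e i)) {..<n}"
  using W(2)[unfolded unit_setI[OF W(1)]] presheafD(5)[OF Q.M O zc] by simp
 also have "\<dots> = finsum (sec ?P ?U) (%i. \<zero>\<^bsub>sec ?P ?U\<^esub>) {..<n}"
 proof (intro PU.M.add.finprod_cong')
  fix i assume "i : {..<n}"
  then show "res (str ?X) ?U ?U (\<gamma> i ?U ?z) \<odot>\<^bsub>sec ?P ?U\<^esub> res ?P ?U ?U (e i) = \<zero>\<^bsub>sec ?P ?U\<^esub>"
  using g0[of i] presheafD(5)[OF Q.M O ei] ei PU.smult_l_null by simp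
 qed auto
 also have "\<dots> = \<zero>\<^bsub>sec ?P ?U\<^esub>" by simp
 finally have "?z = \<zero>\<^bsub>sec (quot_presheaf (piece M p) (C p)) ?U\<^esub>" unfolding Qp .
 then show ?thesis using quot_presheaf_zero_iff[OF gs.X gs.M CD(1) O] sc U by simp
 qed
 qed
 show ?thesis by (rule that[OF G.dual_generators_axioms]) (use sub1 sub2 in blast)
qed

section \<open>Extending the dual bases to a neighbourhood\<close>

lemma (in dual_generators) KerI_local_zero:
 assumes L: "L \<subseteq> I" and U: "opn X U" and s: "s : (csec B p U)"
 and loc: "!!y. y : U ==> EX V. opn X V & y : V & V \<subseteq> U & res (piece B p) U V s = \<zero>\<^bsub>gsec B p V\<^esub>"
 shows "s : Ker L p U"
proof (rule graded_submoduleD(4)[OF Ker_graded_submodule[OF L] U s])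
 fix y assume "y : U"
 then obtain V where V: "opn X V" "y : V" "V \<subseteq> U" "res (piece B p) U V s = \<zero>\<^bsub>gsec B p V\<^esub>" using loc by blast
 have "\<zero>\<^bsub>gsec B p V\<^esub> : Ker L p V"
 using submodule_zero_closed[OF subpresheafD(1)[OF graded_submoduleD(1)[OF Ker_graded_submodule[OF L]] V(1)]] .
 then show "EX V. opn X V & y : V & V \<subseteq> U & res (piece B p) U V s : Ker L p V" using V by auto
qed

lemma (in graded_system) negative_spanning:
 assumes "p < 0"
 shows "spanning X (piece A p) U {} e"
 unfolding spanning_def
proof (intro conjI ballI allI impI)
 fix V s y assume V: "opn X V & V \<subseteq> U & s : (csec A p V) & y : V"
 then interpret AV: module "Osec X V" "gsec A p V" using presheafD(1)[OF A] by blast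
 show "EX W c. opn X W & y : W & W \<subseteq> V & (ALL l:{}. c l : (cO X W)) &
 res (piece A p) V W s = finsum (gsec A p W) (%l. c l \<odot>\<^bsub>gsec A p W\<^esub> res (piece A p) U W (e l)) {}"
 using V A_negative[OF _ assms, of V] presheafD(5)[OF A, of V s p] by (intro exI[of _ V]) auto
qed simp

context local_algebra
begin

text \<open>Indices of the contractions in degree \<open>p\<close>: a generator of level
  \<open>q\<close> together with an index of a basis of the algebra in degree \<open>q - p\<close>.
  Those of level at least \<open>m\<close> are what \<open>g_fun\<close> counts.\<close>

definition gens where "gens a I p = {g. fst g : I & snd g < nat (a (fst (fst g) - p))}"
 for a :: "int => int" and I :: "(int \<times> nat) set"
text \<open>The algebra section is not restricted to \<open>V\<close>: the values are taken on the
  very open set on which \<open>\<alpha>\<close> lives.\<close>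

definition dd where "dd f \<alpha> p g V s = f (fst g) V (act M V (fst (fst g) - p) p (\<alpha> (fst (fst g) - p) (snd g)) s)"
 for f :: "int \<times> nat => 'x set => 'm => 'r"

lemma finite_gens: "finite I ==> finite (gens a I p)"
 by (rule finite_subset[of _ "Sigma I (%i. {..<nat (a (fst i - p))})"]) (auto simp: gens_def)

text \<open>Finitely many conditions are imposed, each inherited by smaller neighbourhoods: bases of
  the pieces of the algebra and of \<open>M\<close>, extensions of the functionals, and elimination
  in each degree of \<open>P\<close>.\<close>

lemma lift_dual_bases:
 fixes a b :: "int => int" and I :: "(int \<times> nat) set"
 assumes Afree: "!!r. locally_free_rank X (piece A r) (a r)" and Mfree: "!!p. locally_free_rank X (piece M p) (b p)"
 and f0: "!!i. i : I ==> f0 i : dual_sections X0 (piece M0 (fst i)) UNIV" and I: "finite I" and P: "finite P"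
 obtains T f \<alpha> J \<iota> \<beta> where "nbhd T" "!!i. i : I ==> f i : dual_sections X (piece M (fst i)) T"
 "!!i V s. i : I ==> nbhd V ==> V \<subseteq> T ==> s : (csec M (fst i) V) ==>
 evO V (f i V s) = f0 i UNIV (ev (piece M (fst i)) V s)"
 "!!i p. i : I ==> p : P ==> spanning X (piece A (fst i - p)) T {..<nat (a (fst i - p))} (\<alpha> (fst i - p))"
 "!!p. p : P ==> pivoted (piece M p) {..<nat (b p)} (gens a I p) (%g. fst (fst g)) (dd f \<alpha> p) T (J p) (\<iota> p) (\<beta> p)"
proof -
 have bas: "EX U. nbhd U & U \<subseteq> topspace (pts X) & (EX e. is_local_basis X Q U (nat r) e)" if "locally_free_rank X Q r"
 for r and Q :: "('x, 'r, 'l) mod_presheaf"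
 using that x openin_subset unfolding locally_free_rank_def by metis
 have bmono: "EX e. is_local_basis X Q V n e"
 if "module_presheaf X Q" "EX e. is_local_basis X Q U n e" "nbhd U" "nbhd V" "V \<subseteq> U" for U V n and Q :: "('x, 'r, 'l) mod_presheaf"
 using that is_local_basis_restrict by blast
 \<comment> \<open>The degrees of the algebra that occur in contractions to degrees in
   \<open>P\<close>.\<close>
 define Rs where "Rs = (%(i, p). fst i - p) ` (I \<times> P)"
 have finR: "finite Rs" using I P by (simp add: Rs_def)
 obtain U1 where U1: "nbhd U1" "U1 \<subseteq> topspace (pts X)" "!!r. r : Rs ==> EX e. is_local_basis X (piece A r) U1 (nat (a r)) e"
 proof (rule common_nbhd[where F = Rs and W = "topspace (pts X)" and Q = "%r U. EX e. is_local_basis X (piece A r) U (nat (a r)) e"])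
 show "EX U. nbhd U & U \<subseteq> topspace (pts X) & (EX e. is_local_basis X (piece A r) U (nat (a r)) e)" for r by (rule bas[OF Afree])
 show "EX e. is_local_basis X (piece A r) V (nat (a r)) e"
 if "nbhd U" "EX e. is_local_basis X (piece A r) U (nat (a r)) e" "nbhd V" "V \<subseteq> U" for r U V
 by (rule bmono[OF gs.A that(2,1,3,4)])
 qed (rule finR, rule top_nbhd, rule that)
 have "\<exists>U\<subseteq>U1. nbhd U & (EX e. is_local_basis X (piece M p) U (nat (b p)) e)" for p
 proof -
 obtain U where U: "nbhd U" "EX e. is_local_basis X (piece M p) U (nat (b p)) e" using bas[OF Mfree[of p]] by blast
 have "nbhd (U \<inter> U1)" using U U1 by auto
 then show ?thesis using bmono[OF gs.M U(2,1), of "U \<inter> U1"] by blast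
 qed
 then have bM: "EX U. nbhd U & U \<subseteq> U1 & (EX e. is_local_basis X (piece M p) U (nat (b p)) e)" for p by blast
 obtain U2 where U2: "nbhd U2" "U2 \<subseteq> U1" "!!p. p : P \<union> fst ` I ==> EX e. is_local_basis X (piece M p) U2 (nat (b p)) e"
 proof (rule common_nbhd[where F = "P \<union> fst ` I" and W = U1 and Q = "%p U. EX e. is_local_basis X (piece M p) U (nat (b p)) e"])
 show "finite (P \<union> fst ` I)" using P I by simp
 show "EX U. nbhd U & U \<subseteq> U1 & (EX e. is_local_basis X (piece M p) U (nat (b p)) e)" for p by (rule bM)
 show "EX e. is_local_basis X (piece M p) V (nat (b p)) e"
 if "nbhd U" "EX e. is_local_basis X (piece M p) U (nat (b p)) e" "nbhd V" "V \<subseteq> U" for p U V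
 by (rule bmono[OF gs.M that(2,1,3,4)])
 qed (rule U1(1), rule that)
 let ?lift = "%i U. EX g:dual_sections X (piece M (fst i)) U. ALL V s. nbhd V --> V \<subseteq> U --> s : (csec M (fst i) V) -->
 evO V (g V s) = f0 i UNIV (ev (piece M (fst i)) V s)"
 have lift: "EX U. nbhd U & U \<subseteq> U2 & ?lift i U" if i: "i : I" for i
 proof -
 obtain e where e: "is_local_basis X (piece M (fst i)) U2 (nat (b (fst i))) e" using U2(3)[of "fst i"] i by auto
 have f0': "f0 i : dual_sections (Spec_field K) (point_presheaf (Fib (piece M (fst i)))) UNIV" using f0[OF i] unfolding fibre_simps .
 obtain W g where "nbhd W" "W \<subseteq> U2" "g : dual_sections X (piece M (fst i)) W"
 "!!V s. nbhd V ==> V \<subseteq> W ==> s : (csec M (fst i) V) ==> evO V (g V s) = f0 i UNIV (ev (piece M (fst i)) V s)"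
 by (rule lift_functional[OF gs.M U2(1) e f0']) (rule that)
 then show ?thesis by blast
 qed
 have lmono: "?lift i V" if U: "nbhd U" and l: "?lift i U" and V: "nbhd V" "V \<subseteq> U" for i U V
 proof -
 obtain g where g: "g : dual_sections X (piece M (fst i)) U" "!!W s. nbhd W ==> W \<subseteq> U ==> s : (csec M (fst i) W) ==>
 evO W (g W s) = f0 i UNIV (ev (piece M (fst i)) W s)" using l by blast
 have "res (dual_presheaf X (piece M (fst i))) U V g : dual_sections X (piece M (fst i)) V"
 using presheafD(2)[OF dual_presheaf_module[OF X gs.M] conjunct1[OF U] conjunct1[OF V(1)] V(2)] g(1) by simp
 moreover have "res (dual_presheaf X (piece M (fst i))) U V g W s = g W s" if "nbhd W" "W \<subseteq> V" "s : (csec M (fst i) W)" for W s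
 by (rule dual_presheaf_apply(4)[OF X gs.M conjunct1[OF that(1)] that(2,3)])
 ultimately show ?thesis using g(2) V(2) by (intro bexI[of _ "res (dual_presheaf X (piece M (fst i))) U V g"]) auto
 qed
 obtain U3 where U3: "nbhd U3" "U3 \<subseteq> U2" "!!i. i : I ==> ?lift i U3"
 proof (rule common_nbhd[where F = I and W = U2 and Q = ?lift])
 show "EX U. nbhd U & U \<subseteq> U2 & ?lift i U" if "i : I" for i by (rule lift[OF that])
 show "?lift i V" if "nbhd U" "?lift i U" "nbhd V" "V \<subseteq> U" for i U V by (rule lmono[OF that])
 qed (rule I, rule U2(1), rule that)
 then obtain f where f: "!!i. i : I ==> f i : dual_sections X (piece M (fst i)) U3"
 and fev: "!!i V s. i : I ==> nbhd V ==> V \<subseteq> U3 ==> s : (csec M (fst i) V) ==>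
 evO V (f i V s) = f0 i UNIV (ev (piece M (fst i)) V s)" by metis
 have "EX e. is_local_basis X (piece A r) U3 (nat (a r)) e" if "r : Rs" for r
 by (rule bmono[OF gs.A U1(3)[OF that] U1(1) U3(1)]) (use U3 U2 in auto)
 then obtain \<alpha>3 where \<alpha>3: "!!r. r : Rs ==> is_local_basis X (piece A r) U3 (nat (a r)) (\<alpha>3 r)" by metis
 have "EX e. is_local_basis X (piece M p) U3 (nat (b p)) e" if "p : P" for p
 by (rule bmono[OF gs.M U2(3) U2(1) U3(1,2)]) (use that in auto)
 then obtain e3 where e3: "!!p. p : P ==> is_local_basis X (piece M p) U3 (nat (b p)) (e3 p)" by metis
 note o3 = conjunct1[OF U3(1)]
 have RsI: "fst i - p : Rs" if "i : I" "p : P" for i p using that by (force simp: Rs_def)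
 have \<alpha>c: "\<alpha>3 (fst (fst g) - p) (snd g) : (csec A (fst (fst g) - p) U3)" if "p : P" "g : gens a I p" for p g
 using \<alpha>3[OF RsI, of "fst g" p] that by (auto simp: gens_def is_local_basis_def)
 \<comment> \<open>Elimination requires sections of the dual over \<open>U3\<close>, so here the
   algebra section is restricted explicitly. On \<open>T\<close> these functionals agree with
   \<open>dd\<close> on the vectors concerned, once \<open>\<alpha>\<close> is the restricted
   section.\<close>
 define d3 where "d3 p g = hom_fun X (piece M p) U3
 (%V s. f (fst g) V (act M V (fst (fst g) - p) p (res (piece A (fst (fst g) - p)) U3 V (\<alpha>3 (fst (fst g) - p) (snd g))) s))" for p g
 have d3: "d3 p g : dual_sections X (piece M p) U3" if "p : P" "g : gens a I p" for p g
 unfolding d3_def by (rule gs.contract[OF o3 _ \<alpha>c[OF that]]) (use f[of "fst g"] that in \<open>auto simp: gens_def\<close>)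
 let ?piv = "%p U. EX J \<iota> \<beta>. pivoted (piece M p) {..<nat (b p)} (gens a I p) (%g. fst (fst g)) (d3 p) U J \<iota> \<beta>"
 \<comment> \<open>Membership in \<open>P\<close> and inclusion in \<open>U3\<close> are carried
   along because restricting a pivoted family relies on them.\<close>
 have piv: "EX U. nbhd U & U \<subseteq> U3 & (p : P & U \<subseteq> U3 & ?piv p U)" if p: "p : P" for p
 proof -
 have "EX U J \<iota> \<beta>. nbhd U & U \<subseteq> U3 &
 pivoted (piece M p) {..<nat (b p)} (gens a I p) (%g. fst (fst g)) (d3 p) U J \<iota> \<beta>"
 by (rule pivoted_exists[OF gs.M finite_lessThan U3(1) finite_gens[OF I] local_basis_spanning[OF e3[OF p]]], rule d3[OF p])
 then obtain U J \<iota> \<beta> where U: "nbhd U" "U \<subseteq> U3"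
 "pivoted (piece M p) {..<nat (b p)} (gens a I p) (%g. fst (fst g)) (d3 p) U J \<iota> \<beta>"
 by (elim exE) (rule that, auto)
 then have "?piv p U" by (intro exI)
 then show ?thesis using U(1,2) p by (intro exI[of _ U]) simp
 qed
 have pmono: "p : P & V \<subseteq> U3 & ?piv p V" if U: "nbhd U" "p : P & U \<subseteq> U3 & ?piv p U" and V: "nbhd V" "V \<subseteq> U" for p U V
 proof -
 have UP: "p : P" "U \<subseteq> U3" using U(2) by auto
 obtain J \<iota> \<beta> where p: "pivoted (piece M p) {..<nat (b p)} (gens a I p) (%g. fst (fst g)) (d3 p) U J \<iota> \<beta>"
 using U(2) by (elim conjE exE) (rule that)
 have "?piv p V" by (intro exI, rule pivoted_restrict[OF gs.M U(1) UP(2) V _ p], rule d3[OF UP(1)])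
 then show ?thesis using UP V(2) by simp
 qed
 obtain T where T: "nbhd T" "T \<subseteq> U3" "!!p. p : P ==> p : P & T \<subseteq> U3 & ?piv p T"
 proof (rule common_nbhd[where F = P and W = U3 and Q = "%p U. p : P & U \<subseteq> U3 & ?piv p U"])
 show "EX U. nbhd U & U \<subseteq> U3 & (p : P & U \<subseteq> U3 & ?piv p U)" if "p : P" for p by (rule piv[OF that])
 show "p : P & V \<subseteq> U3 & ?piv p V" if "nbhd U" "p : P & U \<subseteq> U3 & ?piv p U" "nbhd V" "V \<subseteq> U" for p U V
 by (rule pmono[OF that])
 qed (rule P, rule U3(1), rule that)
 have "ALL p. EX J \<iota> \<beta>. p : P --> pivoted (piece M p) {..<nat (b p)} (gens a I p) (%g. fst (fst g)) (d3 p) T J \<iota> \<beta>"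
 proof
 fix p
 show "EX J \<iota> \<beta>. p : P --> pivoted (piece M p) {..<nat (b p)} (gens a I p) (%g. fst (fst g)) (d3 p) T J \<iota> \<beta>"
 using T(3)[of p] by (cases "p : P") simp_all
 qed
 then obtain J \<iota> \<beta> where p3: "!!p. p : P ==> pivoted (piece M p) {..<nat (b p)} (gens a I p) (%g. fst (fst g)) (d3 p) T (J p) (\<iota> p) (\<beta> p)"
 by metis
 define \<alpha> where "\<alpha> r k = res (piece A r) U3 T (\<alpha>3 r k)" for r k
 define f' where "f' i = res (dual_presheaf X (piece M (fst i))) U3 T (f i)" for i
 note oT = conjunct1[OF T(1)]
 have f'ap: "f' i V s = f i V s" if "opn X V" "V \<subseteq> T" "s : (csec M (fst i) V)" for i V s
 unfolding f'_def by (rule dual_presheaf_apply(4)[OF X gs.M that])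
 show ?thesis
 proof (rule that[OF T(1)])
 show "f' i : dual_sections X (piece M (fst i)) T" if "i : I" for i
 using presheafD(2)[OF dual_presheaf_module[OF X gs.M] o3 oT T(2)] f[OF that] by (simp add: f'_def)
 show "evO V (f' i V s) = f0 i UNIV (ev (piece M (fst i)) V s)" if "i : I" "nbhd V" "V \<subseteq> T" "s : (csec M (fst i) V)" for i V s
 using fev[OF that(1,2) _ that(4)] f'ap[OF _ that(3,4)] that T(2) by auto
 show "spanning X (piece A (fst i - p)) T {..<nat (a (fst i - p))} (\<alpha> (fst i - p))" if "i : I" "p : P" for i p
 unfolding \<alpha>_def[abs_def] by (rule spanning_restrict[OF gs.A o3 oT T(2) local_basis_spanning[OF \<alpha>3[OF RsI[OF that]]]])
 fix p assume p: "p : P"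
 have \<beta>: "\<beta> p l : (csec M p T)" if "l < nat (b p)" for l
 using spanningD(1)[OF pivoted_spanning[OF p3[OF p]]] that by simp
 have eq: "dd f' \<alpha> p g T (\<beta> p l) = d3 p g T (\<beta> p l)" if g: "g : gens a I p" and l: "l < nat (b p)" for g l
 proof -
 have "\<alpha> (fst (fst g) - p) (snd g) : (csec A (fst (fst g) - p) T)"
  unfolding \<alpha>_def by (rule presheafD(2)[OF gs.A o3 oT T(2) \<alpha>c[OF p g]])
 then have "act M T (fst (fst g) - p) p (\<alpha> (fst (fst g) - p) (snd g)) (\<beta> p l) : (csec M (fst (fst g)) T)"
  using gs.act_closed[OF oT _ \<beta>[OF l], of _ "fst (fst g) - p"] by simp
 then show ?thesis using f'ap[OF oT order_refl] \<beta>[OF l] oT T(2) by (simp add: dd_def d3_def \<alpha>_def)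
 qed
 have "J p \<subseteq> gens a I p" using p3[OF p] by (simp add: pivoted_def)
 then show "pivoted (piece M p) {..<nat (b p)} (gens a I p) (%g. fst (fst g)) (dd f' \<alpha> p) T (J p) (\<iota> p) (\<beta> p)"
 using p3[OF p] eq unfolding pivoted_def by (auto simp: subset_iff)
 qed
qed

end

text \<open>The data produced by lifting, with names fixed. Outside \<open>P\<close> nothing is
  selected: there either all contractions use negative degrees of the algebra or the piece of
  \<open>M\<close> vanishes, so the kernel is everything.\<close>

locale lifted_bases = local_algebra X x A M
 for X :: "('x, 'r) ringed_space" and x :: 'x and A :: "('x, 'r, 'a) gralg" and M :: "('x, 'r, 'a, 'm) grmod" +
 fixes a b :: "int => int" and I :: "(int \<times> nat) set" and f0 and P :: "int set" and T :: "'x set" and f and \<alpha> :: "int => nat => 'a"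
 and J :: "int => ((int \<times> nat) \<times> nat) set" and \<iota> :: "int => (int \<times> nat) \<times> nat => nat" and \<beta> :: "int => nat => 'm"
 assumes Mfree: "locally_free_rank X (piece M p) (b p)"
 and I: "finite I" and f0: "i : I ==> f0 i : dual_sections (Spec_field (residue_field X x)) (piece (fibre_grmod X x A M) (fst i)) UNIV"
 and P: "p \<notin> P ==> (ALL i:I. fst i < p) \<or> b p = 0"
 and T: "opn X T & x : T"
 and f: "i : I ==> f i : dual_sections X (piece M (fst i)) T"
 and fev: "i : I ==> opn X V & x : V ==> V \<subseteq> T ==> s : (csec M (fst i) V) ==>
 local_point.evO X x V (f i V s) = f0 i UNIV (local_point.ev X x (piece M (fst i)) V s)"
 and \<alpha>: "i : I ==> p : P ==> spanning X (piece A (fst i - p)) T {..<nat (a (fst i - p))} (\<alpha> (fst i - p))"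
 and J: "p : P ==> local_point.pivoted X x (piece M p) {..<nat (b p)} (local_algebra.gens a I p) (%g. fst (fst g))
 (local_algebra.dd M f \<alpha> p) T (J p) (\<iota> p) (\<beta> p)"
 and J_out: "p \<notin> P ==> J p = {}"
begin

abbreviation "G \<equiv> gens a I"
abbreviation "XT \<equiv> open_subspace X T"
definition "fT i = hom_fun XT (piece M (fst i)) T (f i)"
definition "\<alpha>\<alpha> p j = \<alpha> (fst (fst j) - p) (snd j)"
definition "\<beta>\<beta> p j = \<beta> p (\<iota> p j)"

lemma oT: "opn X T" using T by simp

sublocale sT: graded_system XT A M
 by (rule open_subspace_graded_system[OF X oT gs.graded_system_axioms])

sublocale s0: graded_system X0 A0 M0
 by (rule fibre_system)

sublocale gT: dual_generators XT A M I fst fT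
proof
 show "fT i : dual_sections XT (piece M (fst i)) (topspace (pts XT))" if "i : I" for i
 using open_subspace_dual_sections[OF X oT gs.M oT order_refl f[OF that]] by (simp add: fT_def subspace_simps[OF X oT])
qed (rule I)

sublocale g0: dual_generators X0 A0 M0 I fst f0
 by unfold_locales (use f0 I in simp_all)

lemma fT: "opn X V ==> V \<subseteq> T ==> s : (csec M (fst i) V) ==> fT i V s = f i V s"
 by (simp add: fT_def hom_fun_def subspace_simps[OF X oT])

lemma JG: "J p \<subseteq> G p"
 using J[of p] J_out[of p] by (cases "p : P") (auto simp: pivoted_def)

lemma JP: "j : J p ==> p : P" using J_out by blast

lemma GI: "g : G p ==> fst g : I" by (simp add: gens_def)

lemma finite_J: "finite (J p)" using finite_subset[OF JG finite_gens[OF I]] .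

lemma \<alpha>\<alpha>: "p : P ==> g : G p ==> \<alpha>\<alpha> p g : (csec A (fst (fst g) - p) T)"
 using spanningD(1)[OF \<alpha>, of "fst g" p "snd g"] by (auto simp: \<alpha>\<alpha>_def gens_def)

lemma \<beta>c: "p : P ==> l < nat (b p) ==> \<beta> p l : (csec M p T)"
 using spanningD(1)[OF pivoted_spanning[OF J]] by simp

lemma \<iota>: "j : J p ==> \<iota> p j < nat (b p)"
 using J[OF JP[of j p]] by (auto simp: pivoted_def)

lemma \<iota>_inj: "inj_on (\<iota> p) (J p)"
 using J[of p] J_out[of p] by (cases "p : P") (auto simp: pivoted_def)

lemma f_act_eq:
 assumes p: "p : P" and g: "g : G p" and l: "l < nat (b p)"
 shows "dd f \<alpha> p g T (\<beta> p l) = fT (fst g) T (act M T (fst (fst g) - p) p (\<alpha>\<alpha> p g) (\<beta> p l))"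
 using fT[OF oT order_refl gs.act_closed[OF oT \<alpha>\<alpha>[OF p g] \<beta>c[OF p l], simplified]] by (simp add: dd_def \<alpha>\<alpha>_def)

lemma dual_T:
 assumes j: "j : J p" and l: "l < nat (b p)"
 shows "fT (fst j) T (act M T (fst (fst j) - p) p (\<alpha>\<alpha> p j) (\<beta> p l)) = (if l = \<iota> p j then \<one>\<^bsub>Osec X T\<^esub> else \<zero>\<^bsub>Osec X T\<^esub>)"
 using J[OF JP[OF j]] f_act_eq[OF JP[OF j] subsetD[OF JG j] l] j l by (simp add: pivoted_def)

text \<open>Evaluation at \<open>x\<close> commutes with the action and turns \<open>f\<close> into
  \<open>f0\<close>, so the values at \<open>x\<close> of the lifted contractions are those of the
  contractions on the fibre.\<close>

lemma value_0:
 assumes p: "p : P" and g: "g : G p" and l: "l < nat (b p)"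
 shows "f0 (fst g) UNIV (act M0 UNIV (fst (fst g) - p) p (ev (piece A (fst (fst g) - p)) T (\<alpha>\<alpha> p g)) (ev (piece M p) T (\<beta> p l)))
 = evO T (dd f \<alpha> p g T (\<beta> p l))"
 using fibre_act_ev[OF T \<alpha>\<alpha>[OF p g] \<beta>c[OF p l]] fev[OF GI[OF g] T order_refl gs.act_closed[OF oT \<alpha>\<alpha>[OF p g] \<beta>c[OF p l], simplified]]
 by (simp add: fibre_simps dd_def \<alpha>\<alpha>_def)

lemma value_0_dual:
 assumes j: "j : J p" and l: "l < nat (b p)"
 shows "f0 (fst j) UNIV (act M0 UNIV (fst (fst j) - p) p (ev (piece A (fst (fst j) - p)) T (\<alpha>\<alpha> p j)) (ev (piece M p) T (\<beta> p l)))
 = (if l = \<iota> p j then \<one>\<^bsub>K\<^esub> else \<zero>\<^bsub>K\<^esub>)"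
 using value_0[OF JP[OF j] subsetD[OF JG j] l] J[OF JP[OF j]] j l evO(4,5)[OF T] by (simp add: pivoted_def)

end

context dual_bases
begin

lemma Delta_presheaf:
 "module_presheaf X (sub_presheaf (piece (quot_dual X A B KI) (- p)) (Delta X A m (quot_dual X A B KI) (- p)))"
 unfolding quot_dual_eq QD_piece by (rule sub_presheaf_module_presheaf[OF X DP E_sub[OF Delta_eq]])

lemma socle_presheaf:
 "module_presheaf X (piece (gr_quot (quot_dual X A B KI) (Aplus_times X A (quot_dual X A B KI))) (- p))"
 unfolding quot_dual_eq QD_quot_piece by (rule quot_presheaf_module[OF X DP E_sub[OF Aplus_eq]])

end

text \<open>Two bases over a field have equal length; nonnegativity, which is part of
  \<open>locally_free_rank\<close>, recovers the integers from their images under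
  \<open>nat\<close>.\<close>

lemma point_rank_unique:
 assumes K: "field K" and P: "module_presheaf (Spec_field K) P"
 and r: "locally_free_rank (Spec_field K) P r" and r': "locally_free_rank (Spec_field K) P r'"
 shows "r = r'"
proof -
 have X: "is_ringed_space (Spec_field K)" by (rule Spec_field_ringed_space) (use K in \<open>simp add: field.axioms(1) domain.axioms(1) field_def domain_def\<close>)
 have ex: "EX e. is_local_basis (Spec_field K) P UNIV (nat r) e" if lf: "locally_free_rank (Spec_field K) P r" for r
 proof -
 obtain U e where "() : U" "is_local_basis (Spec_field K) P U (nat r) e" using lf unfolding locally_free_rank_def by auto
 then show ?thesis using unit_setI by metis
 qed
 have le: "nat r' \<le> nat r" if r: "locally_free_rank (Spec_field K) P r" and r': "locally_free_rank (Spec_field K) P r'" for r r'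
 proof -
 obtain e e' where e: "is_local_basis (Spec_field K) P UNIV (nat r) e" "is_local_basis (Spec_field K) P UNIV (nat r') e'"
 using ex[OF r] ex[OF r'] by blast
 show ?thesis by (rule single_point_basis_card_le[OF X P _ _ _ _ e, of "()"]) (use K unit_setI in auto)
 qed
 have "nat r = nat r'" using le[OF r r'] le[OF r' r] by simp
 moreover have "0 \<le> r" "0 \<le> r'" using r r' unfolding locally_free_rank_def by blast+
 ultimately show ?thesis by (simp only: eq_nat_nat_iff)
qed

section \<open>Kernels on the fibre and on the neighbourhood\<close>

context lifted_bases
begin

text \<open>Above all levels a contraction would use a negative degree of the algebra, for which the
  empty family is spanning; where \<open>b p\<close> is zero, sections are locally zero. Either way
  there is nothing to test.\<close>

lemma outside_T:
 assumes p: "p \<notin> P" and L: "L \<subseteq> I" and U: "openin (pts XT) U" and s: "s : (csec M p U)"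
 shows "s : gT.Ker L p U"
 using P[OF p]
proof
 assume *: "ALL i:I. fst i < p"
 show ?thesis
 proof (rule gT.KerI_spanning[OF L U s, where N = "%_. {}" and \<alpha> = undefined])
 show "spanning XT (piece A (fst i - p)) (topspace (pts XT)) {} (undefined i)" if "i : L" for i
 by (rule sT.negative_spanning) (use * that L in auto)
 qed auto
next
 assume b: "b p = 0"
 have U': "opn X U" "U \<subseteq> T" using U by (simp_all add: subspace_simps[OF X oT])
 show ?thesis
 proof (rule gT.KerI_local_zero[OF L U s])
 fix y assume y: "y : U"
 then have "y : topspace (pts X)" using openin_subset[OF U'(1)] by auto
 then obtain W e where W: "opn X W" "y : W" "is_local_basis X (piece M p) W 0 e"
 using Mfree[of p] b unfolding locally_free_rank_def by auto
 have V: "opn X (U \<inter> W)" "U \<inter> W \<subseteq> W" "U \<inter> W \<subseteq> U" "y : U \<inter> W" using U' W y by auto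
 obtain W' c where W': "opn X W'" "y : W'" "W' \<subseteq> U \<inter> W"
 "res (piece M p) (U \<inter> W) W' (res (piece M p) U (U \<inter> W) s) =
  finsum (gsec M p W') (%i. c i \<odot>\<^bsub>gsec M p W'\<^esub> res (piece M p) W W' (e i)) {..<0}"
 using is_local_basisD(2)[OF W(3) V(1,2) presheafD(2)[OF gs.M U'(1) V(1,3) s] V(4)] by blast
 interpret MW: module "Osec X W'" "gsec M p W'" by (rule presheafD(1)[OF gs.M W'(1)])
 have "res (piece M p) U W' s = \<zero>\<^bsub>gsec M p W'\<^esub>"
 using W'(4) presheafD(6)[OF gs.M U'(1) V(1) W'(1,3) V(3) s] by simp
 then show "EX V. openin (pts XT) V & y : V & V \<subseteq> U & res (piece M p) U V s = \<zero>\<^bsub>gsec M p V\<^esub>"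
 using W' U' by (intro exI[of _ W']) (auto simp: subspace_simps[OF X oT])
 qed
qed

lemma outside_0:
 assumes p: "p \<notin> P" and L: "L \<subseteq> I" and s: "s : (csec M0 p U)"
 shows "s : g0.Ker L p U"
proof -
 have U: "openin (pts X0) U" by simp
 show ?thesis using P[OF p]
 proof
 assume *: "ALL i:I. fst i < p"
 show ?thesis
 proof (rule g0.KerI_spanning[OF L U s, where N = "%_. {}" and \<alpha> = undefined])
 show "spanning X0 (piece A0 (fst i - p)) (topspace (pts X0)) {} (undefined i)" if "i : L" for i
  by (rule s0.negative_spanning) (use * that L in auto)
 qed auto
 next
 assume b: "b p = 0"
 show ?thesis
 proof (rule g0.KerI_local_zero[OF L U s])
 fix y assume y: "y : U"
 then have U: "U = UNIV" by (intro unit_setI) auto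
 then have s': "s : carrier (Fib (piece M p))" using s by (simp add: fibre_simps)
 obtain W e where W: "nbhd W" "is_local_basis X (piece M p) W 0 e"
  using Mfree[of p] b x unfolding locally_free_rank_def by auto
 have sp: "spanning X (piece M p) W {..<0::nat} e" by (rule local_basis_spanning[OF W(2)])
 interpret F: module K "Fib (piece M p)" by (rule Fib_module[OF gs.M])
 obtain \<kappa> where "!!l. l : {..<0::nat} ==> \<kappa> l : carrier K"
  "s = finsum (Fib (piece M p)) (%l. \<kappa> l \<odot>\<^bsub>Fib (piece M p)\<^esub> ev (piece M p) W (e l)) {..<0}"
  by (rule spanning_fibre[OF gs.M W(1) finite_lessThan sp s']) (rule that)
 then have "s = \<zero>\<^bsub>Fib (piece M p)\<^esub>" by simp
 then show "EX V. openin (pts X0) V & y : V & V \<subseteq> U & res (piece M0 p) U V s = \<zero>\<^bsub>gsec M0 p V\<^esub>"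
  using U y by (intro exI[of _ UNIV]) (auto simp: fibre_simps)
 qed
 qed
qed

abbreviation "\<alpha>0 p j \<equiv> ev (piece A (fst (fst j) - p)) T (\<alpha>\<alpha> p j)"
abbreviation "\<beta>0 p j \<equiv> ev (piece M p) T (\<beta>\<beta> p j)"

lemma \<alpha>0: "p : P ==> g : G p ==> \<alpha>0 p g : (csec A0 (fst (fst g) - p) UNIV)"
 using ev(1)[OF gs.A T \<alpha>\<alpha>] by (simp add: fibre_simps)

text \<open>Contraction by a fixed algebra element is itself a functional on the fibre, hence
  linear.\<close>

lemma value_0_combination:
 assumes p: "p : P" and g: "g : G p" and \<kappa>: "!!l. l < nat (b p) ==> \<kappa> l : carrier K"
 and s: "s = finsum (Fib (piece M p)) (%l. \<kappa> l \<odot>\<^bsub>Fib (piece M p)\<^esub> ev (piece M p) T (\<beta> p l)) {..<nat (b p)}"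
 shows "f0 (fst g) UNIV (act M0 UNIV (fst (fst g) - p) p (\<alpha>0 p g) s) =
 finsum K (%l. \<kappa> l \<otimes>\<^bsub>K\<^esub> evO T (dd f \<alpha> p g T (\<beta> p l))) {..<nat (b p)}"
proof -
 let ?k = "fst (fst g) - p"
 define \<phi> where "\<phi> = hom_fun X0 (piece M0 p) UNIV (%V c. f0 (fst g) V (act M0 V ?k p (res (piece A0 ?k) UNIV V (\<alpha>0 p g)) c))"
 have O: "openin (pts X0) UNIV" by simp
 have \<phi>: "\<phi> : dual_sections X0 (piece M0 p) UNIV"
 unfolding \<phi>_def by (rule s0.contract[OF O _ \<alpha>0[OF p g]]) (use f0[OF GI[OF g]] in simp)
 have ap: "\<phi> UNIV c = f0 (fst g) UNIV (act M0 UNIV ?k p (\<alpha>0 p g) c)" if "c : carrier (Fib (piece M p))" for c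
 using that by (simp add: \<phi>_def fibre_simps)
 interpret F: module K "Fib (piece M p)" by (rule Fib_module[OF gs.M])
 have bc: "ev (piece M p) T (\<beta> p l) : carrier (Fib (piece M p))" if "l < nat (b p)" for l
 by (rule ev(1)[OF gs.M T \<beta>c[OF p that]])
 note \<phi>D = dualD[OF s0.X s0.M \<phi> O order_refl, unfolded fibre_simps Spec_field_simps point_presheaf_simps]
 have sc: "s : carrier (Fib (piece M p))" unfolding s using \<kappa> bc by (intro F.M.finsum_closed) auto
 have "\<phi> UNIV s = finsum K (%l. \<phi> UNIV (\<kappa> l \<odot>\<^bsub>Fib (piece M p)\<^esub> ev (piece M p) T (\<beta> p l))) {..<nat (b p)}"
 unfolding s by (rule \<phi>D(7)) (use \<kappa> bc in auto)
 also have "\<dots> = finsum K (%l. \<kappa> l \<otimes>\<^bsub>K\<^esub> evO T (dd f \<alpha> p g T (\<beta> p l))) {..<nat (b p)}"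
 proof (rule K.add.finprod_cong')
 have dc: "evO T (dd f \<alpha> p g T (\<beta> p l)) : carrier K" if "l < nat (b p)" for l
 using value_0[OF p g that] ap[OF bc[OF that]] \<phi>D(1)[OF bc[OF that]] by simp
 then show "(%l. \<kappa> l \<otimes>\<^bsub>K\<^esub> evO T (dd f \<alpha> p g T (\<beta> p l))) : {..<nat (b p)} \<rightarrow> carrier K" using \<kappa> by auto
 show "\<phi> UNIV (\<kappa> l \<odot>\<^bsub>Fib (piece M p)\<^esub> ev (piece M p) T (\<beta> p l)) = \<kappa> l \<otimes>\<^bsub>K\<^esub> evO T (dd f \<alpha> p g T (\<beta> p l))"
 if "l : {..<nat (b p)}" for l
 using \<phi>D(3)[OF \<kappa> bc] ap[OF bc] value_0[OF p g] that by simp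
 qed simp
 finally show ?thesis using ap[OF sc] by simp
qed

text \<open>Over the point, vanishing at \<open>x\<close> is vanishing. If the selected contractions
  of level at least \<open>m\<close> kill \<open>s\<close>, its coefficients at their pivots are
  zero; any other contraction of such a level vanishes on the vectors that remain, by
  \<open>pivoted\<close>.\<close>

lemma ker_0:
 assumes s: "s : (csec M0 p V)"
 and van: "!!j. j : J p ==> m \<le> fst (fst j) ==>
 f0 (fst j) V (act M0 V (fst (fst j) - p) p (res (piece A0 (fst (fst j) - p)) (topspace (pts X0)) V (\<alpha>0 p j)) s) = \<zero>\<^bsub>Osec X0 V\<^esub>"
 shows "s : g0.Ker {i\<in>I. m \<le> fst i} p V"
proof -
 have L: "{i\<in>I. m \<le> fst i} \<subseteq> I" and O: "openin (pts X0) V" by auto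
 consider "p \<notin> P" | "V = {}" | "p : P" "V = UNIV" using unit_set_cases[of V] by blast
 then show ?thesis
 proof cases
 case 1
 then show ?thesis by (rule outside_0[OF _ L s])
 next
 case 2
 show ?thesis by (rule g0.KerI_local_zero[OF L O s]) (use 2 in simp)
 next
 case 3
 note p = 3(1) and V = 3(2)
 have s': "s : carrier (Fib (piece M p))" using s V by (simp add: fibre_simps)
 obtain \<kappa> where \<kappa>: "!!l. l : {..<nat (b p)} ==> \<kappa> l : carrier K"
 and s_eq: "s = finsum (Fib (piece M p)) (%l. \<kappa> l \<odot>\<^bsub>Fib (piece M p)\<^esub> ev (piece M p) T (\<beta> p l)) {..<nat (b p)}"
 by (rule spanning_fibre[OF gs.M T finite_lessThan pivoted_spanning[OF J[OF p]] s']) (rule that)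
 have val: "f0 (fst g) UNIV (act M0 UNIV (fst (fst g) - p) p (\<alpha>0 p g) s) =
 finsum K (%l. \<kappa> l \<otimes>\<^bsub>K\<^esub> evO T (dd f \<alpha> p g T (\<beta> p l))) {..<nat (b p)}" if "g : G p" for g
 by (rule value_0_combination[OF p that _ s_eq]) (use \<kappa> in simp)
 \<comment> \<open>By duality the value of a selected contraction on \<open>s\<close> is the
   coefficient at its pivot.\<close>
 have \<kappa>0: "\<kappa> (\<iota> p j) = \<zero>\<^bsub>K\<^esub>" if j: "j : J p" "m \<le> fst (fst j)" for j
 proof -
 have "\<zero>\<^bsub>K\<^esub> = finsum K (%l. \<kappa> l \<otimes>\<^bsub>K\<^esub> evO T (dd f \<alpha> p j T (\<beta> p l))) {..<nat (b p)}"
  using van[OF j] val[OF subsetD[OF JG j(1)]] V by (simp add: fibre_simps)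
 also have "\<dots> = finsum K (%l. \<kappa> l \<otimes>\<^bsub>K\<^esub> (if l = \<iota> p j then \<one>\<^bsub>K\<^esub> else \<zero>\<^bsub>K\<^esub>)) {..<nat (b p)}"
 proof (intro K.add.finprod_cong')
  show "\<kappa> l \<otimes>\<^bsub>K\<^esub> evO T (dd f \<alpha> p j T (\<beta> p l)) = \<kappa> l \<otimes>\<^bsub>K\<^esub> (if l = \<iota> p j then \<one>\<^bsub>K\<^esub> else \<zero>\<^bsub>K\<^esub>)" if "l : {..<nat (b p)}" for l
  using value_0[OF p subsetD[OF JG j(1)], of l] value_0_dual[OF j(1), of l] that by simp
 qed (use \<kappa> in auto)
 also have "\<dots> = \<kappa> (\<iota> p j)" using \<iota>[OF j(1)] \<kappa> by (intro K.finsum_indicator) auto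
 finally show ?thesis by simp
 qed
 show ?thesis
 proof (rule g0.KerI_spanning[OF L O s, where N = "%i. {..<nat (a (fst i - p))}" and \<alpha> = "%i k. ev (piece A (fst i - p)) T (\<alpha> (fst i - p) k)"])
 show "spanning X0 (piece A0 (fst i - p)) (topspace (pts X0)) {..<nat (a (fst i - p))} (%k. ev (piece A (fst i - p)) T (\<alpha> (fst i - p) k))"
  if "i : {i\<in>I. m \<le> fst i}" for i
  using spanning_point[OF gs.A T finite_lessThan \<alpha>[OF _ p, of i]] that by (simp add: fibre_simps)
 fix i k assume i: "i : {i\<in>I. m \<le> fst i}" and k: "k : {..<nat (a (fst i - p))}"
 define g where "g = (i, k)"
 have g: "g : G p" and lev: "m \<le> fst (fst g)" using i k by (auto simp: g_def gens_def)
 \<comment> \<open>Either \<open>l\<close> is the pivot of a selected contraction whose level is at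
   least that of \<open>g\<close>, and then its coefficient is zero, or \<open>g\<close> vanishes at
   \<open>x\<close> on the vector with index \<open>l\<close>.\<close>
 have gz: "\<kappa> l \<otimes>\<^bsub>K\<^esub> evO T (dd f \<alpha> p g T (\<beta> p l)) = \<zero>\<^bsub>K\<^esub>" if l: "l < nat (b p)" for l
 proof (cases "l : \<iota> p ` {j\<in>J p. fst (fst g) \<le> fst (fst j)}")
  case True
  then have "\<kappa> l = \<zero>\<^bsub>K\<^esub>" using \<kappa>0 lev by force
  moreover have "f0 (fst g) UNIV (act M0 UNIV (fst (fst g) - p) p (\<alpha>0 p g) (ev (piece M p) T (\<beta> p l))) : carrier K"
  using g0.fD(1)[OF GI[OF g], of UNIV] s0.act_closed[of UNIV, OF _ \<alpha>0[OF p g], of "ev (piece M p) T (\<beta> p l)" p]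
   ev(1)[OF gs.M T \<beta>c[OF p l]] by (simp add: fibre_simps)
  ultimately show ?thesis using value_0[OF p g l] by simp
 next
  case False
  have "ALL g:G p. ALL l:{..<nat (b p)}. l \<notin> \<iota> p ` {j\<in>J p. fst (fst g) \<le> fst (fst j)} --> evO T (dd f \<alpha> p g T (\<beta> p l)) = \<zero>\<^bsub>K\<^esub>"
  using J[OF p] by (simp add: pivoted_def)
  then have "evO T (dd f \<alpha> p g T (\<beta> p l)) = \<zero>\<^bsub>K\<^esub>" using False g l by blast
  then show ?thesis using \<kappa> l by simp
 qed
 have "finsum K (%l. \<kappa> l \<otimes>\<^bsub>K\<^esub> evO T (dd f \<alpha> p g T (\<beta> p l))) {..<nat (b p)} = finsum K (%l. \<zero>\<^bsub>K\<^esub>) {..<nat (b p)}"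
  using gz by (intro K.add.finprod_cong') auto
 then show "f0 i V (act M0 V (fst i - p) p (res (piece A0 (fst i - p)) (topspace (pts X0)) V (ev (piece A (fst i - p)) T (\<alpha> (fst i - p) k))) s) = \<zero>\<^bsub>Osec X0 V\<^esub>"
  using val[OF g] V by (simp add: fibre_simps g_def \<alpha>\<alpha>_def)
 qed simp
 qed
qed

lemma base_0: "dual_bases X0 A0 M0 I fst f0 J (%_. fst) \<alpha>0 \<beta>0"
proof (rule dual_bases.intro[OF g0.dual_generators_axioms], rule dual_bases_axioms.intro)
 show "finite (J p)" for p by (rule finite_J)
 show "fst j : I" if "j : J p" for j p using GI JG that by blast
 show "\<alpha>0 p j : (csec A0 (fst (fst j) - p) (topspace (pts X0)))" if "j : J p" for j p
 using \<alpha>0[OF JP[OF that] subsetD[OF JG that]] by simp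
 show "\<beta>0 p j : (csec M0 p (topspace (pts X0)))" if "j : J p" for j p
 using ev(1)[OF gs.M T \<beta>c[OF JP[OF that] \<iota>[OF that]]] by (simp add: \<beta>\<beta>_def fibre_simps)
 show "f0 (fst j) (topspace (pts X0)) (act M0 (topspace (pts X0)) (fst (fst j) - p) p (\<alpha>0 p j) (\<beta>0 p k)) =
 (if j = k then \<one>\<^bsub>Osec X0 (topspace (pts X0))\<^esub> else \<zero>\<^bsub>Osec X0 (topspace (pts X0))\<^esub>)" if "j : J p" "k : J p" for j k p
 using value_0_dual[OF that(1) \<iota>[OF that(2)]] inj_onD[OF \<iota>_inj, of p k j] that by (auto simp: \<beta>\<beta>_def)
qed (rule ker_0)

text \<open>On \<open>T\<close> a skipped contraction is controlled only at \<open>x\<close>, so the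
  argument for the fibre does not carry over. \<open>H\<close> offers two substitutes: no
  contraction of level at least \<open>m\<close> was skipped, or the pivots of that level exhaust
  the spanning family, in which case the kernel is zero.\<close>

lemma base_T:
 assumes H: "!!p m. p : P ==> {..<nat (b p)} = \<iota> p ` {j\<in>J p. m \<le> fst (fst j)} \<or> {g\<in>G p. m \<le> fst (fst g)} \<subseteq> J p"
 shows "dual_bases XT A M I fst fT J (%_. fst) \<alpha>\<alpha> \<beta>\<beta>"
proof (rule dual_bases.intro[OF gT.dual_generators_axioms], rule dual_bases_axioms.intro, unfold subspace_simps[OF X oT])
 show "finite (J p)" for p by (rule finite_J)
 show "fst j : I" if "j : J p" for j p using GI JG that by blast
 show "\<alpha>\<alpha> p j : (csec A (fst (fst j) - p) T)" if "j : J p" for j p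
 by (rule \<alpha>\<alpha>[OF JP[OF that] subsetD[OF JG that]])
 show "\<beta>\<beta> p j : (csec M p T)" if "j : J p" for j p
 unfolding \<beta>\<beta>_def by (rule \<beta>c[OF JP[OF that] \<iota>[OF that]])
 show "fT (fst j) T (act M T (fst (fst j) - p) p (\<alpha>\<alpha> p j) (\<beta>\<beta> p k)) =
 (if j = k then \<one>\<^bsub>Osec X T\<^esub> else \<zero>\<^bsub>Osec X T\<^esub>)" if "j : J p" "k : J p" for j k p
 using dual_T[OF that(1) \<iota>[OF that(2)]] inj_onD[OF \<iota>_inj, of p k j] that by (auto simp: \<beta>\<beta>_def)
next
 fix V s p m assume V: "opn X V & V \<subseteq> T" and s: "s : (csec M p V)"
 and van: "!!j. j : J p ==> m \<le> fst (fst j) ==>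
 fT (fst j) V (act M V (fst (fst j) - p) p (res (piece A (fst (fst j) - p)) T V (\<alpha>\<alpha> p j)) s) = \<zero>\<^bsub>Osec X V\<^esub>"
 have L: "{i\<in>I. m \<le> fst i} \<subseteq> I" and O: "openin (pts XT) V" and OT: "openin (pts XT) T" "topspace (pts XT) = T" "str XT = str X"
 using V oT by (auto simp: subspace_simps[OF X oT])
 show "s : gT.Ker {i\<in>I. m \<le> fst i} p V"
 proof (cases "p : P")
 case False
 then show ?thesis by (rule outside_T[OF _ L O s])
 next
 case p: True
 show ?thesis using H[OF p, of m]
 proof
 \<comment> \<open>Nothing of level at least \<open>m\<close> was skipped, so the hypothesis already
   tests \<open>s\<close> with every such generator against a spanning family of the
   algebra.\<close>
 assume G: "{g\<in>G p. m \<le> fst (fst g)} \<subseteq> J p"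
 show ?thesis
 proof (rule gT.KerI_spanning[OF L O s, where N = "%i. {..<nat (a (fst i - p))}" and \<alpha> = "%i. \<alpha> (fst i - p)"])
  show "spanning XT (piece A (fst i - p)) (topspace (pts XT)) {..<nat (a (fst i - p))} (\<alpha> (fst i - p))"
  if "i : {i\<in>I. m \<le> fst i}" for i
  proof -
  have "i : I" using that by simp
  note sp = \<alpha>[OF this p]
  show ?thesis
   unfolding spanning_def OT
  proof (intro conjI ballI allI impI)
   show "\<alpha> (fst i - p) l : (csec A (fst i - p) T)" if "l : {..<nat (a (fst i - p))}" for l
   by (rule spanningD(1)[OF sp that])
   fix V s y assume V: "openin (pts XT) V & V \<subseteq> T & s : (csec A (fst i - p) V) & y : V"
   then have V': "opn X V" "V \<subseteq> T" and V'': "s : (csec A (fst i - p) V)" "y : V"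
   by (auto simp: subspace_simps[OF X oT])
   obtain W c where W: "opn X W" "y : W" "W \<subseteq> V" "ALL l:{..<nat (a (fst i - p))}. c l : (cO X W)"
   "res (piece A (fst i - p)) V W s = finsum (gsec A (fst i - p) W) (%l. c l \<odot>\<^bsub>gsec A (fst i - p) W\<^esub> res (piece A (fst i - p)) T W (\<alpha> (fst i - p) l)) {..<nat (a (fst i - p))}"
   using spanningD(2)[OF sp V' V''] by (elim exE conjE) (rule that)
   moreover have "openin (pts XT) W" using W V' by (auto simp: subspace_simps[OF X oT])
   ultimately show "EX W c. openin (pts XT) W & y : W & W \<subseteq> V & (ALL l:{..<nat (a (fst i - p))}. c l : (cO X W)) &
   res (piece A (fst i - p)) V W s = finsum (gsec A (fst i - p) W) (%l. c l \<odot>\<^bsub>gsec A (fst i - p) W\<^esub> res (piece A (fst i - p)) T W (\<alpha> (fst i - p) l)) {..<nat (a (fst i - p))}"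
   by (intro exI[of _ W] exI[of _ c] conjI)
  qed
  qed
  fix i k assume ik: "i : {i\<in>I. m \<le> fst i}" "k : {..<nat (a (fst i - p))}"
  have "(i, k) : {g\<in>G p. m \<le> fst (fst g)}" using ik by (auto simp: gens_def)
  then have "(i, k) : J p" using G by (rule subsetD[rotated])
  then show "fT i V (act M V (fst i - p) p (res (piece A (fst i - p)) (topspace (pts XT)) V (\<alpha> (fst i - p) k)) s) = \<zero>\<^bsub>Osec XT V\<^esub>"
  using van[of "(i, k)"] ik OT by (simp add: \<alpha>\<alpha>_def)
 qed simp
 next
 \<comment> \<open>Each vector of the spanning family is the pivot of a selected contraction of
   level at least \<open>m\<close>. Duality forces every coefficient of a local expansion of
   \<open>s\<close> to vanish, so \<open>s\<close> is locally zero.\<close>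
 assume full: "{..<nat (b p)} = \<iota> p ` {j\<in>J p. m \<le> fst (fst j)}"
 show ?thesis
 proof (rule gT.KerI_local_zero[OF L O s])
  fix y assume y: "y : V"
  obtain W c where W: "opn X W" "y : W" "W \<subseteq> V" and c: "ALL l:{..<nat (b p)}. c l : (cO X W)"
  and sW: "res (piece M p) V W s = finsum (gsec M p W) (%l. c l \<odot>\<^bsub>gsec M p W\<^esub> res (piece M p) T W (\<beta> p l)) {..<nat (b p)}"
  using spanningD(2)[OF pivoted_spanning[OF J[OF p]] conjunct1[OF V] conjunct2[OF V] s y] by (elim exE conjE) (rule that)
  have WT: "W \<subseteq> T" "openin (pts XT) W" using W V by (auto simp: subspace_simps[OF X oT])
  interpret MW: module "Osec X W" "gsec M p W" by (rule presheafD(1)[OF gs.M W(1)])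
  have \<beta>W: "res (piece M p) T W (\<beta> p l) : (csec M p W)" if "l < nat (b p)" for l
  by (rule presheafD(2)[OF gs.M oT W(1) WT(1) \<beta>c[OF p that]])
  have c0: "c l = \<zero>\<^bsub>Osec X W\<^esub>" if l: "l < nat (b p)" for l
  proof -
  obtain j where j: "j : J p" "m \<le> fst (fst j)" "l = \<iota> p j" using full l by blast
  let ?k = "fst (fst j) - p"
  define \<phi> where "\<phi> = hom_fun XT (piece M p) T (%V c. fT (fst j) V (act M V ?k p (res (piece A ?k) T V (\<alpha>\<alpha> p j)) c))"
  have fj: "fT (fst j) : dual_sections XT (piece M (?k + p)) T"
   using gT.f[OF GI[OF subsetD[OF JG j(1)]]] OT by simp
  have aj: "\<alpha>\<alpha> p j : (csec A ?k T)" by (rule \<alpha>\<alpha>[OF p subsetD[OF JG j(1)]])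
  have \<phi>: "\<phi> : dual_sections XT (piece M p) T" unfolding \<phi>_def by (rule sT.contract[OF OT(1) fj aj])
  note \<phi>D = dualD[OF sT.X sT.M \<phi>, unfolded OT]
  have \<phi>T: "\<phi> T (\<beta> p l') = (if l' = l then \<one>\<^bsub>Osec X T\<^esub> else \<zero>\<^bsub>Osec X T\<^esub>)" if "l' < nat (b p)" for l'
   using dual_T[OF j(1) that] OT \<beta>c[OF p that] presheafD(5)[OF gs.A oT aj] j(3) by (simp add: \<phi>_def)
  have \<phi>\<beta>: "\<phi> W (res (piece M p) T W (\<beta> p l')) = (if l' = l then \<one>\<^bsub>Osec X W\<^esub> else \<zero>\<^bsub>Osec X W\<^esub>)" if "l' < nat (b p)" for l'
   using \<phi>D(4)[OF OT(1) order_refl WT(2,1) \<beta>c[OF p that]] \<phi>T[OF that] ringedD(6,7)[OF X oT W(1) WT(1)] by simp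
  have "\<phi> V s = \<zero>\<^bsub>Osec X V\<^esub>" using van[OF j(1,2)] O V s by (simp add: \<phi>_def)
  then have "\<zero>\<^bsub>Osec X W\<^esub> = \<phi> W (res (piece M p) V W s)"
   using \<phi>D(4)[OF O _ WT(2) W(3) s] V ringedD(7)[OF X conjunct1[OF V] W(1,3)] by simp
  also have "\<dots> = finsum (Osec X W) (%l. \<phi> W (c l \<odot>\<^bsub>gsec M p W\<^esub> res (piece M p) T W (\<beta> p l))) {..<nat (b p)}"
   unfolding sW by (rule \<phi>D(7)[OF WT(2,1)]) (use c \<beta>W in auto)
  also have "\<dots> = finsum (Osec X W) (%l'. c l' \<otimes>\<^bsub>Osec X W\<^esub> (if l' = l then \<one>\<^bsub>Osec X W\<^esub> else \<zero>\<^bsub>Osec X W\<^esub>)) {..<nat (b p)}"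
   using c \<beta>W by (intro MW.R.add.finprod_cong') (auto simp: \<phi>D(3)[OF WT(2,1)] \<phi>\<beta>)
  also have "\<dots> = c l" using c l by (intro MW.R.finsum_indicator) auto
  finally show ?thesis by simp
  qed
  have "res (piece M p) V W s = finsum (gsec M p W) (%l. \<zero>\<^bsub>gsec M p W\<^esub>) {..<nat (b p)}"
  unfolding sW using c0 \<beta>W by (intro MW.M.add.finprod_cong') auto
  then show "EX W. openin (pts XT) W & y : W & W \<subseteq> V & res (piece M p) V W s = \<zero>\<^bsub>gsec M p W\<^esub>"
  using W WT by auto
 qed
 qed
 qed
qed

text \<open>A test element of the fibre algebra is the value of a section on a smaller
  neighbourhood, where the vanishing over \<open>T\<close> applies.\<close>

lemma ev_Ker:
 assumes V: "nbhd V" "V \<subseteq> T" and s: "s : gT.Ker I p V"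
 shows "ev (piece M p) V s : g0.Ker I p UNIV"
 unfolding g0.Ker_def
proof (intro CollectI conjI allI impI)
 have sc: "s : (csec M p V)" using s by (simp add: gT.Ker_def)
 then show "ev (piece M p) V s : (csec M0 p UNIV)" using ev(1)[OF gs.M V(1)] by (simp add: fibre_simps)
 fix V' i a assume *: "openin (pts X0) V' & V' \<subseteq> UNIV & i : I & a : (csec A0 (fst i - p) V')"
 have c0: "res (piece M0 p) UNIV V' (ev (piece M p) V s) : (csec M0 p V')"
 using ev(1)[OF gs.M V(1) sc] presheafD(2)[OF s0.M, of UNIV V'] by (simp add: fibre_simps)
 show "f0 i V' (act M0 V' (fst i - p) p a (res (piece M0 p) UNIV V' (ev (piece M p) V s))) = \<zero>\<^bsub>Osec X0 V'\<^esub>"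
 proof (cases "V' = {}")
 case True
 have "f0 i V' (act M0 V' (fst i - p) p a (res (piece M0 p) UNIV V' (ev (piece M p) V s))) : (cO X0 V')"
 by (rule g0.fD(1)) (use * c0 g0.act_lev_closed[of V' a i p] in auto)
 then show ?thesis using True by simp
 next
 case False
 then have V': "V' = UNIV" using unit_set_cases by blast
 then have a: "a : carrier (Fib (piece A (fst i - p)))" using * by (simp add: fibre_simps)
 obtain W a' where W: "nbhd W" "W \<subseteq> V" "a' : (csec A (fst i - p) W)" "a = ev (piece A (fst i - p)) W a'"
 by (rule ev_surj[OF gs.A a V(1)])
 have WT: "W \<subseteq> T" "openin (pts XT) W" using W V by (auto simp: subspace_simps[OF X oT])
 have sW: "res (piece M p) V W s : (csec M p W)" "ev (piece M p) W (res (piece M p) V W s) = ev (piece M p) V s"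
 using presheafD(2)[OF gs.M _ _ W(2) sc] ev(7)[OF gs.M V(1) _ _ W(2) sc] V W by auto
 have ac: "act M W (fst i - p) p a' (res (piece M p) V W s) : (csec M (fst i) W)"
 using gs.act_closed[OF conjunct1[OF W(1)] W(3) sW(1)] by simp
 have "fT i W (act M W (fst i - p) p a' (res (piece M p) V W s)) = \<zero>\<^bsub>Osec XT W\<^esub>"
 by (rule gT.KerD[OF s WT(2) W(2) _ W(3)]) (use * in simp)
 then have "f i W (act M W (fst i - p) p a' (res (piece M p) V W s)) = \<zero>\<^bsub>Osec X W\<^esub>"
 using fT[OF conjunct1[OF W(1)] WT(1) ac] by (simp add: subspace_simps[OF X oT])
 then have "f0 i UNIV (ev (piece M (fst i)) W (act M W (fst i - p) p a' (res (piece M p) V W s))) = \<zero>\<^bsub>K\<^esub>"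
 using fev[OF _ W(1) WT(1) ac] * evO(5)[OF W(1)] by simp
 then show ?thesis using fibre_act_ev[OF W(1,3) sW(1), of UNIV] W(4) sW(2) V' by (simp add: fibre_simps)
 qed
qed

text \<open>A lift \<open>s\<close> of an element of the fibre kernel need not lie in the kernel
  over \<open>T\<close>. Subtracting its projection onto the dual vectors moves it there, and the
  class at \<open>x\<close> does not change, because the coefficients of the projection vanish at
  \<open>x\<close>.\<close>

lemma fibre_quotient_Ker:
 assumes H: "!!p m. p : P ==> {..<nat (b p)} = \<iota> p ` {j\<in>J p. m \<le> fst (fst j)} \<or> {g\<in>G p. m \<le> fst (fst g)} \<subseteq> J p"
 shows "fibre_quotient X x T M (gT.Ker I) p U = g0.Ker I p U"
proof (cases "U = {}")
 case True
 have K0: "submodule (g0.Ker I p {}) (Osec X0 {}) (gsec M0 p {})"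
 by (rule grsubD(1)[OF g0.Ker_graded_submodule]) auto
 have "g0.Ker I p {} \<subseteq> {\<zero>\<^bsub>Fib (piece M p)\<^esub>}" by (auto simp: g0.Ker_def fibre_simps)
 then show ?thesis using True submodule_zero_closed[OF K0] by (auto simp: fibre_quotient_def fibre_simps)
next
 case False
 then have U: "U = UNIV" using unit_set_cases by blast
 interpret D: dual_bases XT A M I fst fT J "%_. fst" \<alpha>\<alpha> \<beta>\<beta> by (rule base_T[OF H])
 have "c : fibre_quotient X x T M (gT.Ker I) p UNIV" if c: "c : g0.Ker I p UNIV" for c
 proof -
 have cc: "c : carrier (Fib (piece M p))" using c by (simp add: g0.Ker_def fibre_simps)
 obtain V s where V: "nbhd V" "V \<subseteq> T" and s: "s : (csec M p V)" "c = ev (piece M p) V s"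
 by (rule ev_surj[OF gs.M cc T])
 have O: "openin (pts XT) V" using V by (simp add: subspace_simps[OF X oT])
 obtain m where m: "ALL i:I. m \<le> fst i" using D.low_level by blast
 let ?S = "finsum (gsec M p V) (%j. D.d p j V s \<odot>\<^bsub>gsec M p V\<^esub> D.bV p j V) (D.Jm m p)"
 have sK: "s \<ominus>\<^bsub>gsec M p V\<^esub> ?S : gT.Ker I p V" using D.decompose(1)[OF O s(1), of m] D.Km_low[OF m] by simp
 have d0: "evO V (D.d p j V s) = \<zero>\<^bsub>K\<^esub>" "D.d p j V s : (cO X V)" "D.bV p j V : (csec M p V)" if j: "j : D.Jm m p" for j
 proof -
 have j: "j : J p" using j by (simp add: D.Jm_def)
 show "D.d p j V s : (cO X V)" "D.bV p j V : (csec M p V)"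
  using D.dD(1)[OF j O s(1)] D.bV(1)[OF O j] by (simp_all add: subspace_simps[OF X oT])
 let ?k = "fst (fst j) - p"
 note aT = \<alpha>\<alpha>[OF JP[OF j] subsetD[OF JG j]]
 have aV: "res (piece A ?k) T V (\<alpha>\<alpha> p j) : (csec A ?k V)" "ev (piece A ?k) V (res (piece A ?k) T V (\<alpha>\<alpha> p j)) = \<alpha>0 p j"
  using presheafD(2)[OF gs.A oT conjunct1[OF V(1)] V(2) aT] ev(7)[OF gs.A T conjunct1[OF V(1)] conjunct2[OF V(1)] V(2) aT] by auto
 have ac: "act M V ?k p (res (piece A ?k) T V (\<alpha>\<alpha> p j)) s : (csec M (fst (fst j)) V)"
  using gs.act_closed[OF conjunct1[OF V(1)] aV(1) s(1)] by simp
 have "evO V (D.d p j V s) = f0 (fst j) UNIV (ev (piece M (fst (fst j))) V (act M V ?k p (res (piece A ?k) T V (\<alpha>\<alpha> p j)) s))"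
  using fev[OF GI[OF subsetD[OF JG j]] V ac] fT[OF conjunct1[OF V(1)] V(2) ac]
  by (simp add: D.d_def subspace_simps[OF X oT])
 also have "\<dots> = f0 (fst j) UNIV (act M0 UNIV ?k p (\<alpha>0 p j) c)"
  using fibre_act_ev[OF V(1) aV(1) s(1), of UNIV] aV(2) s(2) by (simp add: fibre_simps)
 also have "\<dots> = \<zero>\<^bsub>K\<^esub>"
  using g0.KerD[OF c _ order_refl GI[OF subsetD[OF JG j]] \<alpha>0[OF JP[OF j] subsetD[OF JG j]]] by (simp add: fibre_simps)
 finally show "evO V (D.d p j V s) = \<zero>\<^bsub>K\<^esub>" .
 qed
 interpret MV: module "Osec X V" "gsec M p V" using presheafD(1)[OF gs.M] V by blast
 interpret F: module K "Fib (piece M p)" by (rule Fib_module[OF gs.M])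
 have bF: "ev (piece M p) V (D.bV p j V) : carrier (Fib (piece M p))" if "j : D.Jm m p" for j by (rule ev(1)[OF gs.M V(1) d0(3)[OF that]])
 have "ev (piece M p) V ?S = finsum (Fib (piece M p)) (%j. ev (piece M p) V (D.d p j V s \<odot>\<^bsub>gsec M p V\<^esub> D.bV p j V)) (D.Jm m p)"
 by (rule ev(6)[OF gs.M V(1) D.finite_Jm]) (use d0 in auto)
 also have "\<dots> = finsum (Fib (piece M p)) (%j. \<zero>\<^bsub>Fib (piece M p)\<^esub>) (D.Jm m p)"
 using d0 bF F.smult_l_null by (intro F.M.add.finprod_cong') (auto simp: ev(3)[OF gs.M V(1)])
 finally have "ev (piece M p) V (s \<ominus>\<^bsub>gsec M p V\<^esub> ?S) = c"
 using ev(5)[OF gs.M V(1) s(1) D.decompose(2)[OF O s(1)]] s(2) cc by (simp add: a_minus_def)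
 then show ?thesis
 using sK V unfolding fibre_quotient_def ev_def by (auto intro!: exI[of _ V] exI[of _ "s \<ominus>\<^bsub>gsec M p V\<^esub> ?S"])
 qed
 moreover have "c : g0.Ker I p UNIV" if "c : fibre_quotient X x T M (gT.Ker I) p UNIV" for c
 using that ev_Ker unfolding fibre_quotient_def ev_def by auto
 ultimately show ?thesis unfolding U by blast
qed

end

text \<open>Group the contractions of level at least \<open>m\<close> by the degree \<open>q\<close>
  of the generator; degrees with \<open>t q\<close> zero contribute nothing to the sum in
  \<open>g_fun\<close>.\<close>

lemma g_fun_eq_card:
 fixes a t :: "int => int"
 assumes fin: "finite {q. t q ~= 0}" and t: "!!q. t q \<ge> 0" and a: "!!q. a q \<ge> 0" and I: "I = Sigma {q. t q ~= 0} (%q. {..<nat (t q)})"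
 shows "g_fun a t m p = int (card {g. (fst g : I & snd g < nat (a (fst (fst g) - p))) & m \<le> fst (fst g)})"
proof -
 let ?Q = "{q. t q ~= 0 & m \<le> q}"
 have finQ: "finite ?Q" by (rule finite_subset[OF _ fin]) auto
 have "{g. (fst g : I & snd g < nat (a (fst (fst g) - p))) & m \<le> fst (fst g)} =
 Sigma (Sigma ?Q (%q. {..<nat (t q)})) (%i. {..<nat (a (fst i - p))})" unfolding I by auto
 then have "card {g. (fst g : I & snd g < nat (a (fst (fst g) - p))) & m \<le> fst (fst g)} =
 (\<Sum>i\<in>Sigma ?Q (%q. {..<nat (t q)}). nat (a (fst i - p)))"
 using finQ by (simp add: card_SigmaI)
 also have "\<dots> = (\<Sum>q\<in>?Q. \<Sum>k<nat (t q). nat (a (q - p)))"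
 using finQ by (subst sum.Sigma) (auto simp: case_prod_beta)
 finally have "int (card {g. (fst g : I & snd g < nat (a (fst (fst g) - p))) & m \<le> fst (fst g)}) = (\<Sum>q\<in>?Q. t q * a (q - p))"
 using t a by simp
 also have "\<dots> = (\<Sum>q = m..Max {q. t q ~= 0}. t q * a (q - p))"
 using fin by (intro sum.mono_neutral_left) auto
 finally show ?thesis by (simp add: g_fun_def)
qed

theorem mainTheorem17:
  fixes S :: "('x, 'r) ringed_space"
    and A :: "('x, 'r, 'a) gralg"
    and B :: "('x, 'r, 'a, 'b) grmod"
    and a b t :: "int \<Rightarrow> int"
    and x :: 'x
    and C :: "int \<Rightarrow> unit set \<Rightarrow> ('x set \<times> 'b) set set set"
  assumes "is_noetherian_scheme S"
    and "topspace (pts S) \<noteq> {}"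
    and "is_graded_algebra S A"
    and "fg_algebra S A"
    and "\<And>p. locally_free_rank S (piece A p) (a p)"
    and "is_graded_module S A B"
    and "locally_fg_module S A B"
    and "\<And>p. locally_free_rank S (piece B p) (b p)"
    and "{p. b p \<noteq> 0} \<noteq> {}"
    and "bdd_below {p. b p \<noteq> 0}"
    and "Inf {p. b p \<noteq> 0} = 0"
    and "finite {p. t p \<noteq> 0}"
    and "{p. t p \<noteq> 0} \<noteq> {}"
    and "\<And>p. t p \<ge> 0"
    and "x \<in> topspace (pts S)"
    and "C \<in> HLambda (Spec_field (residue_field S x)) (fibre_gralg S x A) (fibre_grmod S x A B)
               (hI a b t)"
    and "has_socle_type (Spec_field (residue_field S x)) (fibre_gralg S x A) (fibre_grmod S x A B)
               C t"
  shows "\<exists>T. openin (pts S) T \<and> x \<in> T \<and>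
           (\<exists>C'\<in>HLambda (open_subspace S T) A B (hI a b t).
              has_socle_type (open_subspace S T) A B C' t \<and>
              fibre_quotient S x T B C' = C)"
proof -
 let ?X0 = "Spec_field (residue_field S x)" and ?A0 = "fibre_gralg S x A" and ?B0 = "fibre_grmod S x A B"
 define Q where "Q = {q. t q ~= 0}"
 define I where "I = Sigma Q (%q. {..<nat (t q)})"
 \<comment> \<open>Above the largest socle degree contractions would use negative degrees of the
   algebra; below 0 the pieces of the module have rank zero by the normalisation of
   \<open>b\<close>.\<close>
 define P where "P = {0..Max Q}"
 have finQ: "finite Q" using assms(12) by (simp add: Q_def)
 have X: "is_ringed_space S" and loc: "EX! J. maximalideal J (stalk_ring S x)"
 using conjunct1[OF conjunct1[OF assms(1)[unfolded is_noetherian_scheme_def], unfolded is_scheme_def], unfolded is_locally_ringed_space_def] assms(15)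
 by simp_all
 have AA: "is_graded_module S A (grmod.truncate A)"
 by (rule graded_module_truncate[OF conjunct1[OF assms(3)[unfolded is_graded_algebra_def]]])
 have lp: "local_point S x" by (rule local_point.intro[OF X assms(15) loc])
 have LA: "local_algebra S x A B"
 proof (intro local_algebra.intro local_system.intro local_algebra_axioms.intro lp)
 show "graded_system S A B" by (rule graded_system_of_module[OF X assms(3,6)])
 show "graded_system S A (grmod.truncate A)" by (rule graded_system_of_module[OF X assms(3) AA])
 show "res (piece A 0) (topspace (pts S)) V (unit A (topspace (pts S))) = unit A V" if "openin (pts S) V" for V
 proof -
 note U = conjunct2[OF assms(3)[unfolded is_graded_algebra_def], rule_format, OF openin_topspace]
 show ?thesis by (rule conjunct1[OF conjunct2[OF U], rule_format]) (use that openin_subset[OF that] in simp)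
 qed
 qed
 interpret LA: local_algebra S x A B by (rule LA)
 have fin: "is_finite_lf_quotient ?X0 ?A0 ?B0 C" using assms(16) by (simp add: HLambda_def)
 obtain f0 where f0: "dual_generators ?X0 ?A0 ?B0 I fst f0" and C: "!!p U. C p U = dual_generators.Ker ?X0 ?A0 ?B0 fst f0 I p U"
 by (rule inverse_system_exists[OF LA.fibre_system fin assms(17,12) I_def[unfolded Q_def]]) (rule that)
 have f0d: "f0 i : dual_sections ?X0 (piece ?B0 (fst i)) UNIV" if "i : I" for i
 using dual_generators.f[OF f0 that] by simp
 have finI: "finite I" and finP: "finite P" using finQ by (auto simp: I_def P_def)
 obtain T f \<alpha> J0 \<iota> \<beta> where T: "openin (pts S) T & x : T" and f: "!!i. i : I ==> f i : dual_sections S (piece B (fst i)) T"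
 and fev: "!!i V s. i : I ==> openin (pts S) V & x : V ==> V \<subseteq> T ==> s : (csec B (fst i) V) ==>
 LA.evO V (f i V s) = f0 i UNIV (LA.ev (piece B (fst i)) V s)"
 and \<alpha>: "!!i p. i : I ==> p : P ==> spanning S (piece A (fst i - p)) T {..<nat (a (fst i - p))} (\<alpha> (fst i - p))"
 and J0: "!!p. p : P ==> LA.pivoted (piece B p) {..<nat (b p)} (LA.gens a I p) (%g. fst (fst g)) (LA.dd f \<alpha> p) T (J0 p) (\<iota> p) (\<beta> p)"
 by (rule LA.lift_dual_bases[OF assms(5,8) f0d finI finP]) (assumption, rule that)
 \<comment> \<open>Lifting leaves \<open>J0\<close> unspecified outside \<open>P\<close>; the empty
   set there gives the right cardinalities in every degree.\<close>
 define J where "J p = (if p : P then J0 p else {})" for p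
 have out: "(ALL i:I. fst i < p) \<or> b p = 0" if "p \<notin> P" for p
 proof (cases "p < 0")
 case True
 then have "b p = 0" using cInf_lower[of p "{p. b p ~= 0}"] assms(10,11) by fastforce
 then show ?thesis by simp
 next
 case False
 then have "Max Q < p" using that by (simp add: P_def)
 then have "ALL i:I. fst i < p" using Max_ge[OF finQ] by (fastforce simp: I_def)
 then show ?thesis by simp
 qed
 interpret lb: lifted_bases S x A B a b I f0 P T f \<alpha> J \<iota> \<beta>
 proof (rule lifted_bases.intro[OF LA], rule lifted_bases_axioms.intro)
 show "LA.pivoted (piece B p) {..<nat (b p)} (LA.gens a I p) (%g. fst (fst g)) (LA.dd f \<alpha> p) T (J p) (\<iota> p) (\<beta> p)" if "p : P" for p
 using J0[OF that] that by (simp add: J_def)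
 qed (fact assms(8) finI T | rule f0d out f fev \<alpha> | simp add: J_def)+
 \<comment> \<open>The dual basis over the point, together with uniqueness of rank over a field,
   converts the ranks prescribed for \<open>C\<close> into cardinalities of subsets of
   \<open>J p\<close>.\<close>
 interpret Z: dual_bases ?X0 ?A0 ?B0 I fst f0 J "%_. fst" lb.\<alpha>0 lb.\<beta>0 by (rule lb.base_0)
 have CK: "C = lb.g0.Ker I" using C by (intro ext)
 have h: "hI a b t m p = int (card {j\<in>J p. m \<le> fst (fst j)})" for m p
 proof -
 have "locally_free_rank ?X0 (sub_presheaf (piece (quot_dual ?X0 ?A0 ?B0 C) (- p)) (Delta ?X0 ?A0 m (quot_dual ?X0 ?A0 ?B0 C) (- p))) (hI a b t m p)"
 using assms(16) by (simp add: HLambda_def Let_def)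
 then show ?thesis unfolding CK Z.Jm_def[symmetric] by (rule point_rank_unique[OF LA.K_field Z.Delta_presheaf _ Z.Delta_rank])
 qed
 have tp: "t p = int (card (J p - {j\<in>J p. p + 1 \<le> fst (fst j)}))" for p
 proof -
 have "locally_free_rank ?X0 (piece (gr_quot (quot_dual ?X0 ?A0 ?B0 C) (Aplus_times ?X0 ?A0 (quot_dual ?X0 ?A0 ?B0 C))) (- p)) (t p)"
 using assms(17) by (simp add: has_socle_type_def Let_def)
 then show ?thesis unfolding CK Z.Jm_def[symmetric] by (rule point_rank_unique[OF LA.K_field Z.socle_presheaf _ Z.socle_rank])
 qed
 have H: "{..<nat (b p)} = \<iota> p ` {j\<in>J p. m \<le> fst (fst j)} \<or> {g\<in>LA.gens a I p. m \<le> fst (fst g)} \<subseteq> J p" for p m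
 proof -
 let ?J = "{j\<in>J p. m \<le> fst (fst j)}" and ?G = "{g\<in>LA.gens a I p. m \<le> fst (fst g)}"
 have a0: "a q \<ge> 0" and b0: "b q \<ge> 0" for q using assms(5)[of q] assms(8)[of q] by (auto simp: locally_free_rank_def)
 have g: "g_fun a t m p = int (card ?G)"
 using g_fun_eq_card[OF assms(12,14) a0 I_def[unfolded Q_def]] by (simp add: LA.gens_def)
 have JG: "?J \<subseteq> ?G" and finG: "finite ?G" using lb.JG LA.finite_gens[OF finI] by auto
 have im: "\<iota> p ` ?J \<subseteq> {..<nat (b p)}" using lb.\<iota> by auto
 have ci: "card (\<iota> p ` ?J) = card ?J" by (rule card_image[OF inj_on_subset[OF lb.\<iota>_inj]]) auto
 \<comment> \<open>The number of selected contractions of level at least \<open>m\<close> is the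
   minimum of the number of all such contractions and \<open>b p\<close>. So one of two inclusions
   of finite sets is an equality: of the selected in all contractions, or of their pivots in the
   index set of the basis.\<close>
 consider "card ?J = card ?G" | "card ?J = nat (b p)"
 using h[of m p] g b0[of p] unfolding hI_def min_def by (auto split: if_splits)
 then show ?thesis
 proof cases
 case 1
 then show ?thesis using card_subset_eq[OF finG JG] by auto
 next
 case 2
 then show ?thesis using card_subset_eq[OF finite_lessThan im] ci by simp
 qed
 qed
 \<comment> \<open>The same \<open>J\<close> now serves over \<open>T\<close>, so the cardinalities
   found over the point become the ranks there.\<close>
 interpret D: dual_bases "open_subspace S T" A B I fst lb.fT J "%_. fst" lb.\<alpha>\<alpha> lb.\<beta>\<beta> by (rule lb.base_T[OF H])
 have finJ: "finite {p. J p ~= {}}" by (rule finite_subset[OF _ finP]) (auto simp: J_def)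
 have "lb.gT.Ker I : HLambda (open_subspace S T) A B (hI a b t)" "has_socle_type (open_subspace S T) A B (lb.gT.Ker I) t"
 by (rule D.HLambda_socle[OF finJ]; use h tp in \<open>simp add: D.Jm_def\<close>)+
 moreover have "fibre_quotient S x T B (lb.gT.Ker I) = C"
 unfolding CK using lb.fibre_quotient_Ker[OF H] by (intro ext)
 ultimately show ?thesis using T by blast
qed

end
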